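(* Let $\kappa\in(-1,1)$ and let the unit disk $M$ be equipped with the metric $g_\kappa$, with volume form $dVol_\kappa$. Denote by $\widehat{Z^\kappa_{n,k}}$ and $\widehat{\psi^\kappa_{n,k}}$ the normalizations of $Z^\kappa_{n,k}$ and $\psi^\kappa_{n,k}$ in $L^2(M,w_\kappa\,dVol_\kappa)$ and $L^2(\partial_+SM,d\Sigma^2)$ respectively. Then given any $f\in w_\kappa L^2(M,w_\kappa\,dVol_\kappa)$, admitting a unique expansion $$f=w_\kappa\sum_{n\ge0}\sum_{k=0}^nf_{n,k}\widehat{Z^\kappa_{n,k}},\qquad f_{n,k}:=\left(f,\widehat{Z^\kappa_{n,k}}\right)_{L^2(M,dVol_\kappa)},\qquad\sum_{n,k}|f_{n,k}|^2<\infty,$$ we have $$I_0f=\sum_{n\ge0}\sum_{k=0}^n\sigma^\kappa_{n,k}\,f_{n,k}\,\widehat{\psi^\kappa_{n,k}},\qquad\sigma^\kappa_{n,k}:=\frac{1}{\sqrt{1-\kappa}}\frac{2\sqrt\pi}{\sqrt{n+1}}.$$ In particular, the Singular Value Decomposition of $I_0w_\kappa\colon L^2(M,w_\kappa\,dVol_\kappa)\to L^2(\partial_+SM,d\Sigma^2)$, $h\mapsto I_0(w_\kappa h)$, is $\left(\widehat{Z^\kappa_{n,k}},\widehat{\psi^\kappa_{n,k}},\sigma^\kappa_{n,k}\right)_{n\ge0,\,0\le k\le n}$.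
   Context: Setting. $M=\{z\in\mathbb{C}:|z|\le1\}$ with metric $g_\kappa(z)=(1+\kappa|z|^2)^{-2}|dz|^2$ (constant curvature $4\kappa$); $dVol_\kappa=(1+\kappa\rho^2)^{-2}\rho\,d\rho\,d\omega$ at $z=\rho e^{i\omega}$. The boundary of the unit circle bundle $SM$ is parameterized by fan-beam coordinates $(\beta,\alpha)$: base point $e^{i\beta}$, unit vector $(1+\kappa)e^{i(\beta+\pi+\alpha)}$. The inward boundary is $\partial_+SM=\{\alpha\in[-\pi/2,\pi/2]\}$, with measure $d\Sigma^2=(1+\kappa)^{-1}d\beta\,d\alpha$. X-ray transform: $I_0f(x,v)=\int_0^{\tau(x,v)}f(\gamma_{x,v}(t))\,dt$, $(x,v)\in\partial_+SM$, where $\gamma_{x,v}$ is the unit-speed $g_\kappa$-geodesic with $\gamma_{x,v}(0)=x$, $\dot\gamma_{x,v}(0)=v$ and $\tau(x,v)$ its first exit time; $I_0$ is regarded as a bounded operator $L^2(M,dVol_\kappa)\to L^2(\partial_+SM,d\Sigma^2)$. Weight: $w_\kappa(z)=\frac{1+\kappa|z|^2}{1-\kappa|z|^2}$, and $w_\kappa L^2(M,w_\kappa\,dVol_\kappa)=\{w_\kappa h:h\in L^2(M,w_\kappa\,dVol_\kappa)\}$. Functions on $\partial_+SM$: $\mathfrak{s}_\kappa(\alpha)=\tan^{-1}\left(\frac{1-\kappa}{1+\kappa}\tan\alpha\right)$ (with $\mathfrak{s}_\kappa(\pm\pi/2)=\pm\pi/2$), and for $n\ge0$, $k\in\mathbb{Z}$,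 $$\psi^\kappa_{n,k}(\beta,\alpha)=\frac{(-1)^n}{4\pi}\sqrt{\mathfrak{s}_\kappa'(\alpha)}\,e^{i(n-2k)(\beta+\mathfrak{s}_\kappa(\alpha))}\left(e^{i(n+1)\mathfrak{s}_\kappa(\alpha)}+(-1)^ne^{-i(n+1)\mathfrak{s}_\kappa(\alpha)}\right).$$ Functions on $M$: for $n\ge0$, $0\le k\le n$, the Zernike polynomials (in the convention of Kazantsev–Bukhgeym) are $$Z_{n,k}(\rho e^{i\omega})=\frac{(-1)^n}{2\pi}\int_0^{2\pi}e^{i(n-2k)\theta}W_n(\rho\sin(\theta-\omega))\,d\theta,$$ where $W_0(t)=1$, $W_1(t)=2it$, $W_{n+1}(t)=2itW_n(t)+W_{n-1}(t)$ (so $W_n=i^nU_n$ with $U_n$ the Chebyshev polynomial of the second kind). Then $$Z^\kappa_{n,k}(z)=\sqrt{\frac{1-\kappa}{1+\kappa}}\,\frac{1+\kappa|z|^2}{1-\kappa|z|^2}\,Z_{n,k}\left(\frac{1-\kappa}{1-\kappa|z|^2}z\right).$$ A Singular Value Decomposition $(x_j,y_j,\sigma_j)_j$ of a bounded operator $A$ between Hilbert spaces means: $(x_j)$ is an orthonormal basis of $(\ker A)^\perp$, $(y_j)$ is an orthonormal family in the target, $\sigma_j>0$, and $Ax_j=\sigma_jy_j$. *)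

theory Defs
  imports "HOL-Analysis.Analysis"
begin

section \<open>Square-integrable functions\<close>

text \<open>Elements of $L^2(M)$ are represented by measurable functions; two functions represent the
  same element iff they agree almost everywhere, so equalities between elements are
  stated with \<open>AE\<close>. In \<open>L2_norm\<close> and \<open>L2_inner\<close> the Bochner integral is only meaningful on
  \<open>L2_space M\<close>.\<close>

definition L2_space :: "'a measure \<Rightarrow> ('a \<Rightarrow> complex) set" where
  "L2_space M = {f \<in> borel_measurable M. integrable M (\<lambda>x. (cmod (f x))\<^sup>2)}"

definition L2_norm :: "'a measure \<Rightarrow> ('a \<Rightarrow> complex) \<Rightarrow> real" where
  "L2_norm M f = sqrt (\<integral>x. (cmod (f x))\<^sup>2 \<partial>M)"

definition L2_inner :: "'a measure \<Rightarrow> ('a \<Rightarrow> complex) \<Rightarrow> ('a \<Rightarrow> complex) \<Rightarrow> complex" where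
  "L2_inner M f g = (\<integral>x. f x * cnj (g x) \<partial>M)"

definition L2_normalize :: "'a measure \<Rightarrow> ('a \<Rightarrow> complex) \<Rightarrow> 'a \<Rightarrow> complex" where
  "L2_normalize M f x = f x / complex_of_real (L2_norm M f)"

text \<open>Unordered (net) convergence of a series in the $L^2$ norm.\<close>

definition L2_has_sum ::
    "'a measure \<Rightarrow> ('j \<Rightarrow> 'a \<Rightarrow> complex) \<Rightarrow> 'j set \<Rightarrow> ('a \<Rightarrow> complex) \<Rightarrow> bool" where
  "L2_has_sum M u J f \<longleftrightarrow>
     (\<forall>j\<in>J. u j \<in> L2_space M) \<and> f \<in> L2_space M \<and>
     ((\<lambda>F. L2_norm M (\<lambda>x. f x - (\<Sum>j\<in>F. u j x))) \<longlongrightarrow> 0) (finite_subsets_at_top J)"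

definition L2_orthonormal :: "'a measure \<Rightarrow> 'j set \<Rightarrow> ('j \<Rightarrow> 'a \<Rightarrow> complex) \<Rightarrow> bool" where
  "L2_orthonormal M J x \<longleftrightarrow>
     (\<forall>j\<in>J. x j \<in> L2_space M) \<and>
     (\<forall>i\<in>J. \<forall>j\<in>J. L2_inner M (x i) (x j) = (if i = j then 1 else 0))"

definition L2_orthonormal_basis ::
    "'a measure \<Rightarrow> ('a \<Rightarrow> complex) set \<Rightarrow> 'j set \<Rightarrow> ('j \<Rightarrow> 'a \<Rightarrow> complex) \<Rightarrow> bool" where
  "L2_orthonormal_basis M V J x \<longleftrightarrow>
     L2_orthonormal M J x \<and> (\<forall>j\<in>J. x j \<in> V) \<and>
     (\<forall>f\<in>V. \<forall>e>0. \<exists>F c. finite F \<and> F \<subseteq> J \<and>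
        L2_norm M (\<lambda>z. f z - (\<Sum>j\<in>F. c j * x j z)) < e)"

definition L2_orthogonal_complement :: "'a measure \<Rightarrow> ('a \<Rightarrow> complex) set \<Rightarrow> ('a \<Rightarrow> complex) set" where
  "L2_orthogonal_complement M V = {g \<in> L2_space M. \<forall>f\<in>V. L2_inner M g f = 0}"

text \<open>Linearity up to null sets together with boundedness also implies that \<open>A\<close> respects
  almost-everywhere equality, so \<open>A\<close> induces a bounded operator between the $L^2$ spaces.\<close>

definition L2_bounded_operator ::
    "'a measure \<Rightarrow> 'b measure \<Rightarrow> (('a \<Rightarrow> complex) \<Rightarrow> 'b \<Rightarrow> complex) \<Rightarrow> bool" where
  "L2_bounded_operator M N A \<longleftrightarrow>
     (\<forall>f\<in>L2_space M. A f \<in> L2_space N) \<and>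
     (\<forall>f\<in>L2_space M. \<forall>g\<in>L2_space M. \<forall>a b.
        AE y in N. A (\<lambda>x. a * f x + b * g x) y = a * A f y + b * A g y) \<and>
     (\<exists>C. \<forall>f\<in>L2_space M. L2_norm N (A f) \<le> C * L2_norm M f)"

definition L2_kernel ::
    "'a measure \<Rightarrow> 'b measure \<Rightarrow> (('a \<Rightarrow> complex) \<Rightarrow> 'b \<Rightarrow> complex) \<Rightarrow> ('a \<Rightarrow> complex) set" where
  "L2_kernel M N A = {f \<in> L2_space M. AE y in N. A f y = 0}"

definition singular_value_decomposition ::
    "'a measure \<Rightarrow> 'b measure \<Rightarrow> (('a \<Rightarrow> complex) \<Rightarrow> 'b \<Rightarrow> complex) \<Rightarrow> 'j set \<Rightarrow>
     ('j \<Rightarrow> 'a \<Rightarrow> complex) \<Rightarrow> ('j \<Rightarrow> 'b \<Rightarrow> complex) \<Rightarrow> ('j \<Rightarrow> real) \<Rightarrow> bool" where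
  "singular_value_decomposition M N A J x y \<sigma> \<longleftrightarrow>
     L2_bounded_operator M N A \<and>
     L2_orthonormal_basis M (L2_orthogonal_complement M (L2_kernel M N A)) J x \<and>
     L2_orthonormal N J y \<and>
     (\<forall>j\<in>J. \<sigma> j > 0) \<and>
     (\<forall>j\<in>J. AE p in N. A (x j) p = complex_of_real (\<sigma> j) * y j p)"


section \<open>Geodesics of a Riemannian metric\<close>

text \<open>A metric is given by its bilinear forms \<open>g x u v\<close>. The first definition is the Christoffel
  symbol of the first kind, contracted with constant vector fields \<open>u\<close>, \<open>v\<close>, \<open>w\<close>; the
  geodesic equation below is the usual one with its index lowered by \<open>g\<close>.\<close>

definition christoffel ::
    "('a::real_normed_vector \<Rightarrow> 'a \<Rightarrow> 'a \<Rightarrow> real) \<Rightarrow> 'a \<Rightarrow> 'a \<Rightarrow> 'a \<Rightarrow> 'a \<Rightarrow> real" where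
  "christoffel g x u v w =
     (frechet_derivative (\<lambda>y. g y v w) (at x) u
      + frechet_derivative (\<lambda>y. g y u w) (at x) v
      - frechet_derivative (\<lambda>y. g y u v) (at x) w) / 2"

text \<open>\<open>\<gamma>\<close> is a unit-speed \<open>g\<close>-geodesic on \<open>[0,T]\<close> inside the region \<open>D\<close> with
  initial point \<open>x\<close> and initial velocity \<open>v\<close>; \<open>p\<close> and \<open>q\<close> are its velocity and acceleration.\<close>

definition unit_speed_geodesic ::
    "('a::real_normed_vector \<Rightarrow> 'a \<Rightarrow> 'a \<Rightarrow> real) \<Rightarrow> 'a set \<Rightarrow> 'a \<Rightarrow> 'a \<Rightarrow> real \<Rightarrow> (real \<Rightarrow> 'a) \<Rightarrow> bool"
  where
  "unit_speed_geodesic g D x v T \<gamma> \<longleftrightarrow>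
     (\<exists>p q. \<gamma> 0 = x \<and> p 0 = v \<and>
        (\<forall>t\<in>{0..T}. \<gamma> t \<in> D \<and>
           (\<gamma> has_vector_derivative p t) (at t within {0..T}) \<and>
           (p has_vector_derivative q t) (at t within {0..T}) \<and>
           g (\<gamma> t) (p t) (p t) = 1 \<and>
           (\<forall>w. g (\<gamma> t) (q t) w + christoffel g (\<gamma> t) (p t) (p t) w = 0)))"

text \<open>The first exit time from \<open>D\<close> is the largest time up to which the geodesic stays in \<open>D\<close>
  (it is \<open>0\<close> for a geodesic that leaves \<open>D\<close> immediately).\<close>

definition exit_time ::
    "('a::real_normed_vector \<Rightarrow> 'a \<Rightarrow> 'a \<Rightarrow> real) \<Rightarrow> 'a set \<Rightarrow> 'a \<times> 'a \<Rightarrow> real" where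
  "exit_time g D = (\<lambda>(x, v). Sup {T. 0 \<le> T \<and> (\<exists>\<gamma>. unit_speed_geodesic g D x v T \<gamma>)})"

definition geodesic ::
    "('a::real_normed_vector \<Rightarrow> 'a \<Rightarrow> 'a \<Rightarrow> real) \<Rightarrow> 'a set \<Rightarrow> 'a \<times> 'a \<Rightarrow> real \<Rightarrow> 'a" where
  "geodesic g D = (\<lambda>(x, v). SOME \<gamma>. unit_speed_geodesic g D x v (exit_time g D (x, v)) \<gamma>)"


section \<open>The disk of constant curvature and its X-ray transform\<close>

definition metric :: "real \<Rightarrow> complex \<Rightarrow> complex \<Rightarrow> complex \<Rightarrow> real" where
  "metric \<kappa> z u v = (u \<bullet> v) / (1 + \<kappa> * (cmod z)\<^sup>2)\<^sup>2"

definition vol :: "real \<Rightarrow> complex measure" where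
  "vol \<kappa> = density (restrict_space lborel (cball 0 1)) (\<lambda>z. ennreal (1 / (1 + \<kappa> * (cmod z)\<^sup>2)\<^sup>2))"

definition weight :: "real \<Rightarrow> complex \<Rightarrow> real" where
  "weight \<kappa> z = (1 + \<kappa> * (cmod z)\<^sup>2) / (1 - \<kappa> * (cmod z)\<^sup>2)"

definition weighted_vol :: "real \<Rightarrow> complex measure" where
  "weighted_vol \<kappa> = density (vol \<kappa>) (\<lambda>z. ennreal (weight \<kappa> z))"

text \<open>The space $w_\kappa L^2(M, w_\kappa\,dVol_\kappa)$.\<close>

definition weighted_L2 :: "real \<Rightarrow> (complex \<Rightarrow> complex) set" where
  "weighted_L2 \<kappa> =
     {f. \<exists>h\<in>L2_space (weighted_vol \<kappa>). \<forall>z\<in>cball 0 1. f z = complex_of_real (weight \<kappa> z) * h z}"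

definition xray :: "real \<Rightarrow> (complex \<Rightarrow> complex) \<Rightarrow> complex \<times> complex \<Rightarrow> complex" where
  "xray \<kappa> f xv =
     (LINT t:{0..exit_time (metric \<kappa>) (cball 0 1) xv}|lborel.
        f (geodesic (metric \<kappa>) (cball 0 1) xv t))"

text \<open>Fan-beam coordinates \<open>(\<beta>, \<alpha>)\<close> on the inward boundary; the circle of base points is
  represented by the fundamental domain \<open>[0, 2\<pi>)\<close>.\<close>

definition fan_beam :: "real \<Rightarrow> real \<times> real \<Rightarrow> complex \<times> complex" where
  "fan_beam \<kappa> = (\<lambda>(\<beta>, \<alpha>). (cis \<beta>, complex_of_real (1 + \<kappa>) * cis (\<beta> + pi + \<alpha>)))"

definition boundary_measure :: "real \<Rightarrow> (real \<times> real) measure" where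
  "boundary_measure \<kappa> =
     density (restrict_space lborel ({0..<2 * pi} \<times> {- pi / 2..pi / 2})) (\<lambda>_. ennreal (1 / (1 + \<kappa>)))"

definition I0 :: "real \<Rightarrow> (complex \<Rightarrow> complex) \<Rightarrow> real \<times> real \<Rightarrow> complex" where
  "I0 \<kappa> f = (\<lambda>p. xray \<kappa> f (fan_beam \<kappa> p))"


section \<open>Singular functions and singular values\<close>

definition scat :: "real \<Rightarrow> real \<Rightarrow> real" where
  "scat \<kappa> \<alpha> = (if \<bar>\<alpha>\<bar> = pi / 2 then \<alpha> else arctan ((1 - \<kappa>) / (1 + \<kappa>) * tan \<alpha>))"

text \<open>The derivative is one-sided at \<open>\<plusminus>\<pi>/2\<close>, since the formula for \<open>scat\<close> jumps there.\<close>

definition scat_deriv :: "real \<Rightarrow> real \<Rightarrow> real" where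
  "scat_deriv \<kappa> \<alpha> = vector_derivative (scat \<kappa>) (at \<alpha> within {- pi / 2..pi / 2})"

definition psi :: "real \<Rightarrow> nat \<Rightarrow> int \<Rightarrow> real \<times> real \<Rightarrow> complex" where
  "psi \<kappa> n k = (\<lambda>(\<beta>, \<alpha>).
     (-1) ^ n / complex_of_real (4 * pi) * complex_of_real (sqrt (scat_deriv \<kappa> \<alpha>))
     * cis (real_of_int (int n - 2 * k) * (\<beta> + scat \<kappa> \<alpha>))
     * (cis (real (n + 1) * scat \<kappa> \<alpha>) + (-1) ^ n * cis (- (real (n + 1) * scat \<kappa> \<alpha>))))"

fun W :: "nat \<Rightarrow> real \<Rightarrow> complex" where
  "W 0 t = 1"
| "W (Suc 0) t = 2 * \<i> * complex_of_real t"
| "W (Suc (Suc n)) t = 2 * \<i> * complex_of_real t * W (Suc n) t + W n t"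

definition zernike :: "nat \<Rightarrow> nat \<Rightarrow> complex \<Rightarrow> complex" where
  "zernike n k z = (-1) ^ n / complex_of_real (2 * pi) *
     (LINT \<theta>:{0..2 * pi}|lborel.
        cis (real_of_int (int n - 2 * int k) * \<theta>) * W n (cmod z * sin (\<theta> - Arg z)))"

definition zernike_curv :: "real \<Rightarrow> nat \<Rightarrow> nat \<Rightarrow> complex \<Rightarrow> complex" where
  "zernike_curv \<kappa> n k z =
     complex_of_real (sqrt ((1 - \<kappa>) / (1 + \<kappa>)))
     * complex_of_real ((1 + \<kappa> * (cmod z)\<^sup>2) / (1 - \<kappa> * (cmod z)\<^sup>2))
     * zernike n k (complex_of_real ((1 - \<kappa>) / (1 - \<kappa> * (cmod z)\<^sup>2)) * z)"

definition index_set :: "(nat \<times> nat) set" where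
  "index_set = {(n, k). k \<le> n}"

definition Z_hat :: "real \<Rightarrow> nat \<times> nat \<Rightarrow> complex \<Rightarrow> complex" where
  "Z_hat \<kappa> = (\<lambda>(n, k). L2_normalize (weighted_vol \<kappa>) (zernike_curv \<kappa> n k))"

definition psi_hat :: "real \<Rightarrow> nat \<times> nat \<Rightarrow> real \<times> real \<Rightarrow> complex" where
  "psi_hat \<kappa> = (\<lambda>(n, k). L2_normalize (boundary_measure \<kappa>) (psi \<kappa> n (int k)))"

definition sing_val :: "real \<Rightarrow> nat \<times> nat \<Rightarrow> real" where
  "sing_val \<kappa> = (\<lambda>(n, k). 1 / sqrt (1 - \<kappa>) * (2 * sqrt pi / sqrt (real n + 1)))"

text \<open>The coefficients $f_{n,k}$: the inner product is the one of $L^2(M, dVol_\kappa)$, without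
  the weight.\<close>

definition coefficient :: "real \<Rightarrow> (complex \<Rightarrow> complex) \<Rightarrow> nat \<times> nat \<Rightarrow> complex" where
  "coefficient \<kappa> f j = L2_inner (vol \<kappa>) f (Z_hat \<kappa> j)"

text \<open>$f = w_\kappa \sum_{n,k} c_{n,k} \widehat{Z^\kappa_{n,k}}$ with the series converging in
  $L^2(M, w_\kappa\,dVol_\kappa)$.\<close>

definition has_expansion :: "real \<Rightarrow> (complex \<Rightarrow> complex) \<Rightarrow> (nat \<times> nat \<Rightarrow> complex) \<Rightarrow> bool" where
  "has_expansion \<kappa> f c \<longleftrightarrow>
     (\<exists>h. L2_has_sum (weighted_vol \<kappa>) (\<lambda>j z. c j * Z_hat \<kappa> j z) index_set h \<and>
          (AE z in vol \<kappa>. f z = complex_of_real (weight \<kappa> z) * h z))"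

end

(* The map Phi(z) = (1-kappa) z / (1 - kappa |z|^2) sends geodesics of the curved disk to straight
   chords, and along a geodesic the squared weight times arclength is a constant multiple of
   Euclidean arclength. Hence I_0 composed with multiplication by the weight is conjugate to the
   Euclidean X-ray transform of the disk. There the Zernike polynomials are averages of the ridge
   functions W_n, whose integrals over chords are elementary; this gives the images of the Zernike
   polynomials, and, integrating over parallel chords, their orthogonality. Completeness follows
   from the Stone-Weierstrass theorem, and the singular value expansion from the boundedness of the
   transform together with the fact that it maps a complete orthonormal system to an orthogonal one. *)

theory Submission
  imports Defs
begin

section \<open>Singular systems in L2\<close>

text \<open>The transform is defined through a chosen geodesic and a supremum of times, so it can be
  computed only once geodesics are known to be unique and one of them has been continued past the
  boundary. Uniqueness comes from coordinates in which the nonlinear equation becomes linear with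
  constant coefficients. The weight fits twice. Its square times the weighted volume is the pullback
  of Euclidean area under Phi, up to the factor (1-kappa)^-2, so dividing by the weight and
  transporting by Phi is a multiple of an isometry. Along a geodesic, one weight comes from the
  operator and one from this division, and their product is the speed of the chord parameter. An L2
  function need not be integrable along every geodesic, so linearity holds only almost everywhere.
  Boundedness rests on one coincidence: Cauchy-Schwarz on a chord costs its length 2 cos s, and cos
  s is also the density in the area formula for chords. The area formulas are proved for nonnegative
  functions, so that they also yield integrability. Positive singular values on a complete system
  leave only null functions in the kernel, hence its orthogonal complement is the whole
  space.\<close>

lemma borel_measurable_cnj [measurable (raw)]:
  "f \<in> borel_measurable M \<Longrightarrow> (\<lambda>x. cnj (f x)) \<in> borel_measurable M"
proof -
  assume f: "f \<in> borel_measurable M"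
  have "cnj \<in> borel_measurable borel"
    by (rule borel_measurable_continuous_onI[OF continuous_on_cnj[OF continuous_on_id]])
  then show ?thesis by (rule measurable_compose[OF f])
qed

lemma L2_space_0 [simp]: "(\<lambda>_. 0) \<in> L2_space M"
  by (simp add: L2_space_def)

lemma L2_space_add:
  assumes f: "f \<in> L2_space M" and g: "g \<in> L2_space M"
  shows "(\<lambda>x. f x + g x) \<in> L2_space M"
proof -
  have [measurable]: "f \<in> borel_measurable M" "g \<in> borel_measurable M"
    using assms by (auto simp: L2_space_def)
  have "integrable M (\<lambda>x. (cmod (f x + g x))\<^sup>2)"
  proof (rule Bochner_Integration.integrable_bound)
    show "integrable M (\<lambda>x. 2 * (cmod (f x))\<^sup>2 + 2 * (cmod (g x))\<^sup>2)"
      using assms by (auto simp: L2_space_def)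
    have "(cmod (f x + g x))\<^sup>2 \<le> 2 * (cmod (f x))\<^sup>2 + 2 * (cmod (g x))\<^sup>2" for x
    proof -
      have "(cmod (f x + g x))\<^sup>2 \<le> (cmod (f x) + cmod (g x))\<^sup>2"
        by (intro power_mono norm_triangle_ineq) auto
      also have "\<dots> \<le> 2 * (cmod (f x))\<^sup>2 + 2 * (cmod (g x))\<^sup>2"
        using sum_squares_bound[of "cmod (f x)" "cmod (g x)"] by (simp add: power2_sum)
      finally show ?thesis .
    qed
    then show "AE x in M. norm ((cmod (f x + g x))\<^sup>2) \<le> norm (2 * (cmod (f x))\<^sup>2 + 2 * (cmod (g x))\<^sup>2)"
      by auto
  qed auto
  then show ?thesis by (simp add: L2_space_def)
qed

lemma L2_space_scale:
  assumes f: "f \<in> L2_space M"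
  shows "(\<lambda>x. c * f x) \<in> L2_space M"
  using assms by (auto simp: L2_space_def norm_mult power_mult_distrib)

lemma L2_space_diff:
  assumes f: "f \<in> L2_space M" and g: "g \<in> L2_space M"
  shows "(\<lambda>x. f x - g x) \<in> L2_space M"
  using L2_space_add[OF f L2_space_scale[OF g, of "-1"]] by simp

lemma L2_space_sum:
  assumes "\<And>j. j \<in> F \<Longrightarrow> u j \<in> L2_space M"
  shows "(\<lambda>x. \<Sum>j\<in>F. u j x) \<in> L2_space M"
  using assms by (induction F rule: infinite_finite_induct) (auto intro: L2_space_add)

lemma L2_space_lincomb:
  assumes "\<And>j. j \<in> F \<Longrightarrow> x j \<in> L2_space M"
  shows "(\<lambda>z. \<Sum>j\<in>F. c j * x j z) \<in> L2_space M"
  by (intro L2_space_sum L2_space_scale assms)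

lemma L2_integrable_mult:
  assumes f: "f \<in> L2_space M" and g: "g \<in> L2_space M"
  shows "integrable M (\<lambda>x. f x * cnj (g x))"
proof (rule Bochner_Integration.integrable_bound)
  have [measurable]: "f \<in> borel_measurable M" "g \<in> borel_measurable M"
    using assms by (auto simp: L2_space_def)
  show "(\<lambda>x. f x * cnj (g x)) \<in> borel_measurable M" by measurable
  show "integrable M (\<lambda>x. (cmod (f x))\<^sup>2 + (cmod (g x))\<^sup>2)"
    using assms by (auto simp: L2_space_def)
  have "cmod (f x) * cmod (g x) \<le> (cmod (f x))\<^sup>2 + (cmod (g x))\<^sup>2" for x
    using sum_squares_bound[of "cmod (f x)" "cmod (g x)"]
      mult_nonneg_nonneg[OF norm_ge_zero norm_ge_zero, of "f x" "g x"] by linarith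
  then show "AE x in M. norm (f x * cnj (g x)) \<le> norm ((cmod (f x))\<^sup>2 + (cmod (g x))\<^sup>2)"
    by (auto simp: norm_mult)
qed

lemma L2_norm_nonneg [simp]: "L2_norm M f \<ge> 0"
  by (simp add: L2_norm_def)

lemma L2_norm_sq: "(L2_norm M f)\<^sup>2 = (\<integral>x. (cmod (f x))\<^sup>2 \<partial>M)"
  by (simp add: L2_norm_def)

lemma L2_inner_self: "L2_inner M f f = complex_of_real ((L2_norm M f)\<^sup>2)"
  unfolding L2_norm_sq L2_inner_def
  by (simp only: complex_norm_square[symmetric] integral_complex_of_real)

lemma L2_norm_cong_AE:
  assumes "f \<in> borel_measurable M" "g \<in> borel_measurable M" "AE x in M. f x = g x"
  shows "L2_norm M f = L2_norm M g"
  unfolding L2_norm_def using assms by (auto intro!: arg_cong[of _ _ sqrt] integral_cong_AE)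

lemma L2_inner_cong_AE:
  assumes "f \<in> borel_measurable M" "g \<in> borel_measurable M" "h \<in> borel_measurable M"
    and "AE x in M. f x = g x"
  shows "L2_inner M f h = L2_inner M g h"
  unfolding L2_inner_def
proof (rule integral_cong_AE)
  note [measurable] = assms(1-3)
  show "(\<lambda>x. f x * cnj (h x)) \<in> borel_measurable M" "(\<lambda>x. g x * cnj (h x)) \<in> borel_measurable M"
    by measurable
  show "AE x in M. f x * cnj (h x) = g x * cnj (h x)" using assms(4) by auto
qed

lemma L2_inner_scale_left: "L2_inner M (\<lambda>x. c * f x) h = c * L2_inner M f h"
  by (simp add: L2_inner_def mult.assoc)

lemma L2_inner_cnj: "L2_inner M g f = cnj (L2_inner M f g)"
  unfolding L2_inner_def by (subst Bochner_Integration.integral_cnj[symmetric]) (simp add: mult.commute)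

lemma L2_inner_sum_left:
  assumes "\<And>j. j \<in> F \<Longrightarrow> u j \<in> L2_space M" "h \<in> L2_space M"
  shows "L2_inner M (\<lambda>x. \<Sum>j\<in>F. u j x) h = (\<Sum>j\<in>F. L2_inner M (u j) h)"
  using L2_integrable_mult[OF assms(1) assms(2)]
  by (simp add: L2_inner_def sum_distrib_right)

lemma L2_norm_add_sq:
  assumes f: "f \<in> L2_space M" and g: "g \<in> L2_space M"
  shows "(L2_norm M (\<lambda>x. f x + g x))\<^sup>2 =
    (L2_norm M f)\<^sup>2 + 2 * Re (L2_inner M f g) + (L2_norm M g)\<^sup>2"
proof -
  have "(cmod (f x + g x))\<^sup>2 = (cmod (f x))\<^sup>2 + 2 * Re (f x * cnj (g x)) + (cmod (g x))\<^sup>2" for x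
    unfolding cmod_power2 by (simp add: power2_eq_square algebra_simps)
  then have "(L2_norm M (\<lambda>x. f x + g x))\<^sup>2 =
      (\<integral>x. (cmod (f x))\<^sup>2 + 2 * Re (f x * cnj (g x)) + (cmod (g x))\<^sup>2 \<partial>M)"
    unfolding L2_norm_sq by presburger
  also have "\<dots> = (\<integral>x. (cmod (f x))\<^sup>2 \<partial>M) + 2 * (\<integral>x. Re (f x * cnj (g x)) \<partial>M) + (\<integral>x. (cmod (g x))\<^sup>2 \<partial>M)"
    using f g integrable_Re[OF L2_integrable_mult[OF f g]]
    by (simp del: times_complex.sel add: L2_space_def)
  finally show ?thesis
    using L2_integrable_mult[OF f g] by (simp del: times_complex.sel add: L2_norm_sq L2_inner_def)
qed

section \<open>Orthonormal systems: residuals, Bessel inequality, expansions\<close>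

lemma orthonormal_lincomb_inner:
  assumes on: "L2_orthonormal M J x" and F: "finite F" "F \<subseteq> J" and j: "j \<in> J"
  shows "L2_inner M (\<lambda>z. \<Sum>i\<in>F. c i * x i z) (x j) = (if j \<in> F then c j else 0)"
proof -
  have "L2_inner M (\<lambda>z. \<Sum>i\<in>F. c i * x i z) (x j) = (\<Sum>i\<in>F. c i * (if i = j then 1 else 0))"
    using on F j
    by (subst L2_inner_sum_left)
       (auto simp: L2_inner_scale_left L2_orthonormal_def subset_eq intro!: L2_space_scale sum.cong)
  then show ?thesis using F by (simp add: if_distrib cong: if_cong)
qed

lemma orthonormal_lincomb_norm:
  assumes on: "L2_orthonormal M J x" and F: "finite F" "F \<subseteq> J"
  shows "(L2_norm M (\<lambda>z. \<Sum>i\<in>F. c i * x i z))\<^sup>2 = (\<Sum>i\<in>F. (cmod (c i))\<^sup>2)"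
proof -
  have xs: "x j \<in> L2_space M" if "j \<in> F" for j using on F that by (auto simp: L2_orthonormal_def)
  let ?S = "\<lambda>z. \<Sum>i\<in>F. c i * x i z"
  have S: "?S \<in> L2_space M" by (rule L2_space_lincomb[OF xs])
  have "complex_of_real ((L2_norm M ?S)\<^sup>2) = (\<Sum>i\<in>F. c i * L2_inner M (x i) ?S)"
    unfolding L2_inner_self[symmetric]
    by (subst L2_inner_sum_left) (auto simp: L2_inner_scale_left intro!: S L2_space_scale xs)
  also have "\<dots> = (\<Sum>i\<in>F. c i * cnj (c i))"
    by (intro sum.cong refl, subst L2_inner_cnj, subst orthonormal_lincomb_inner[OF on F]) (use F in auto)
  also have "\<dots> = complex_of_real (\<Sum>i\<in>F. (cmod (c i))\<^sup>2)"
    by (simp only: of_real_sum complex_norm_square)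
  finally show ?thesis by (simp only: of_real_eq_iff)
qed

text \<open>Completing the square. It is kept for arbitrary coefficients \<open>c\<close>, because
  Bessel's inequality, the optimality of Fourier coefficients and their uniqueness are all read off
  from it.\<close>

lemma orthonormal_residual_norm:
  assumes on: "L2_orthonormal M J x" and F: "finite F" "F \<subseteq> J" and f: "f \<in> L2_space M"
  shows "(L2_norm M (\<lambda>z. f z - (\<Sum>i\<in>F. c i * x i z)))\<^sup>2 =
     (L2_norm M f)\<^sup>2 - (\<Sum>i\<in>F. (cmod (L2_inner M f (x i)))\<^sup>2)
       + (\<Sum>i\<in>F. (cmod (c i - L2_inner M f (x i)))\<^sup>2)"
proof -
  have xs: "x j \<in> L2_space M" if "j \<in> F" for j using on F that by (auto simp: L2_orthonormal_def)
  let ?S = "\<lambda>z. \<Sum>i\<in>F. (- c i) * x i z"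
  have S: "?S \<in> L2_space M" by (rule L2_space_lincomb[OF xs])
  have "L2_inner M f ?S = cnj (\<Sum>i\<in>F. (- c i) * L2_inner M (x i) f)"
    by (subst L2_inner_cnj, subst L2_inner_sum_left)
       (auto simp only: L2_inner_scale_left intro!: f L2_space_scale xs)
  also have "\<dots> = - (\<Sum>i\<in>F. cnj (c i) * L2_inner M f (x i))"
    by (simp add: sum_negf L2_inner_cnj[of M f "x i" for i])
  finally have in1: "L2_inner M f ?S = - (\<Sum>i\<in>F. cnj (c i) * L2_inner M f (x i))" .
  have "(L2_norm M (\<lambda>z. f z - (\<Sum>i\<in>F. c i * x i z)))\<^sup>2 = (L2_norm M (\<lambda>z. f z + ?S z))\<^sup>2"
    by (simp add: sum_negf)
  also have "\<dots> = (L2_norm M f)\<^sup>2 + 2 * Re (L2_inner M f ?S) + (\<Sum>i\<in>F. (cmod (- c i))\<^sup>2)"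
    by (simp only: L2_norm_add_sq[OF f S] orthonormal_lincomb_norm[OF on F])
  also have "\<dots> = (L2_norm M f)\<^sup>2 + (\<Sum>i\<in>F. (cmod (c i))\<^sup>2 - 2 * Re (cnj (c i) * L2_inner M f (x i)))"
    by (simp only: in1) (simp add: sum_distrib_left sum_subtractf)
  also have "(\<Sum>i\<in>F. (cmod (c i))\<^sup>2 - 2 * Re (cnj (c i) * L2_inner M f (x i))) =
      (\<Sum>i\<in>F. (cmod (c i - L2_inner M f (x i)))\<^sup>2 - (cmod (L2_inner M f (x i)))\<^sup>2)"
    unfolding cmod_power2 by (intro sum.cong refl) (simp add: power2_eq_square algebra_simps)
  finally show ?thesis by (simp add: sum_subtractf)
qed

lemma bessel_inequality:
  assumes on: "L2_orthonormal M J x" and F: "finite F" "F \<subseteq> J" and f: "f \<in> L2_space M"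
  shows "(\<Sum>i\<in>F. (cmod (L2_inner M f (x i)))\<^sup>2) \<le> (L2_norm M f)\<^sup>2"
proof -
  have "0 \<le> (L2_norm M (\<lambda>z. f z - (\<Sum>i\<in>F. L2_inner M f (x i) * x i z)))\<^sup>2" by simp
  also note orthonormal_residual_norm[OF on F f, of "\<lambda>i. L2_inner M f (x i)"]
  finally show ?thesis by simp
qed

lemma L2_norm_eq_0_AE:
  assumes f: "f \<in> L2_space M" and "L2_norm M f = 0"
  shows "AE x in M. f x = 0"
proof -
  have "(\<integral>x. (cmod (f x))\<^sup>2 \<partial>M) = 0" using assms by (simp add: L2_norm_def)
  then have "AE x in M. (cmod (f x))\<^sup>2 = 0"
    using f by (subst (asm) integral_nonneg_eq_0_iff_AE) (auto simp: L2_space_def)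
  then show ?thesis by simp
qed

text \<open>By Bessel, the squared residual over any finite set containing \<open>j\<close> is at
  least the squared modulus of \<open>c j\<close> minus the Fourier coefficient. This lower bound is
  independent of the finite set and survives in the limit.\<close>

lemma L2_has_sum_coeff_unique:
  assumes on: "L2_orthonormal M J x" and s: "L2_has_sum M (\<lambda>j z. c j * x j z) J f" and j: "j \<in> J"
  shows "c j = L2_inner M f (x j)"
proof -
  have f: "f \<in> L2_space M"
    and lim: "((\<lambda>F. L2_norm M (\<lambda>z. f z - (\<Sum>j\<in>F. c j * x j z))) \<longlongrightarrow> 0) (finite_subsets_at_top J)"
    using s by (auto simp: L2_has_sum_def)
  define d where "d = cmod (c j - L2_inner M f (x j))"
  have ev: "\<forall>\<^sub>F F in finite_subsets_at_top J. d \<le> L2_norm M (\<lambda>z. f z - (\<Sum>j\<in>F. c j * x j z))"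
    unfolding eventually_finite_subsets_at_top
  proof (intro exI[of _ "{j}"] conjI allI impI)
    fix F assume F: "finite F \<and> {j} \<subseteq> F \<and> F \<subseteq> J"
    have "(\<Sum>i\<in>F. (cmod (L2_inner M f (x i)))\<^sup>2) \<le> (L2_norm M f)\<^sup>2"
      using F by (intro bessel_inequality[OF on _ _ f]) auto
    moreover have "d\<^sup>2 \<le> (\<Sum>i\<in>F. (cmod (c i - L2_inner M f (x i)))\<^sup>2)"
      unfolding d_def using F by (intro member_le_sum) auto
    ultimately have "d\<^sup>2 \<le> (L2_norm M (\<lambda>z. f z - (\<Sum>i\<in>F. c i * x i z)))\<^sup>2"
      using F by (subst orthonormal_residual_norm[OF on _ _ f]) auto
    then show "d \<le> L2_norm M (\<lambda>z. f z - (\<Sum>i\<in>F. c i * x i z))"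
      by (rule power2_le_imp_le) simp
  qed (use j in auto)
  have "d \<le> 0"
    by (rule tendsto_lowerbound[OF lim ev]) simp
  then show ?thesis by (simp add: d_def)
qed

text \<open>The approximation clause of \<open>L2_orthonormal_basis\<close> for the full space. It
  is separated so that completeness can be proved before the kernel of the operator is
  known.\<close>

definition L2_dense_span :: "'a measure \<Rightarrow> 'j set \<Rightarrow> ('j \<Rightarrow> 'a \<Rightarrow> complex) \<Rightarrow> bool" where
  "L2_dense_span M J x \<longleftrightarrow> (\<forall>f\<in>L2_space M. \<forall>e>0. \<exists>F c. finite F \<and> F \<subseteq> J \<and>
        L2_norm M (\<lambda>z. f z - (\<Sum>j\<in>F. c j * x j z)) < e)"

lemma L2_dense_spanE:
  assumes "L2_dense_span M J x" "f \<in> L2_space M" "e > 0"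
  obtains F c where "finite F" "F \<subseteq> J" "L2_norm M (\<lambda>z. f z - (\<Sum>j\<in>F. c j * x j z)) < e"
proof -
  have "\<forall>e>0. \<exists>F c. finite F \<and> F \<subseteq> J \<and> L2_norm M (\<lambda>z. f z - (\<Sum>j\<in>F. c j * x j z)) < e"
    using assms(1,2) unfolding L2_dense_span_def by (rule bspec)
  then have "\<exists>F c. finite F \<and> F \<subseteq> J \<and> L2_norm M (\<lambda>z. f z - (\<Sum>j\<in>F. c j * x j z)) < e"
    using assms(3) by simp
  then show thesis by (elim exE conjE) (rule that)
qed

text \<open>Density supplies one good finite combination. Fourier coefficients minimise the
  residual, so every larger finite set does at least as well, which is exactly net
  convergence.\<close>

lemma orthonormal_expansion:
  assumes on: "L2_orthonormal M J x" and ds: "L2_dense_span M J x" and f: "f \<in> L2_space M"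
  shows "L2_has_sum M (\<lambda>j z. L2_inner M f (x j) * x j z) J f"
  unfolding L2_has_sum_def
proof (intro conjI ballI f)
  fix j assume "j \<in> J"
  then show "(\<lambda>z. L2_inner M f (x j) * x j z) \<in> L2_space M"
    using on by (intro L2_space_scale) (simp add: L2_orthonormal_def)
next
  let ?S = "\<lambda>F. L2_norm M (\<lambda>z. f z - (\<Sum>j\<in>F. L2_inner M f (x j) * x j z))"
  show "(?S \<longlongrightarrow> 0) (finite_subsets_at_top J)"
  proof (rule tendstoI)
    fix e :: real assume "e > 0"
    obtain F c where F: "finite F" "F \<subseteq> J"
      and less: "L2_norm M (\<lambda>z. f z - (\<Sum>j\<in>F. c j * x j z)) < e"
      by (rule L2_dense_spanE[OF ds f \<open>e > 0\<close>])
    show "\<forall>\<^sub>F G in finite_subsets_at_top J. dist (?S G) 0 < e"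
      unfolding eventually_finite_subsets_at_top
    proof (intro exI[of _ F] conjI allI impI F)
      fix G assume G: "finite G \<and> F \<subseteq> G \<and> G \<subseteq> J"
      \<comment> \<open>Padding by zero turns the approximation on \<open>F\<close> into a
        competitor on \<open>G\<close>.\<close>
      let ?c = "\<lambda>j. if j \<in> F then c j else 0"
      have eq: "(\<Sum>j\<in>G. ?c j * x j z) = (\<Sum>j\<in>F. c j * x j z)" for z
        using G by (intro sum.mono_neutral_cong_right) auto
      have "(?S G)\<^sup>2 \<le> (L2_norm M (\<lambda>z. f z - (\<Sum>j\<in>G. ?c j * x j z)))\<^sup>2"
        using G orthonormal_residual_norm[OF on _ _ f, of G "\<lambda>j. L2_inner M f (x j)"]
          orthonormal_residual_norm[OF on _ _ f, of G ?c]
        by (simp add: sum_nonneg)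
      then have "?S G \<le> L2_norm M (\<lambda>z. f z - (\<Sum>j\<in>F. c j * x j z))"
        unfolding eq by (rule power2_le_imp_le) simp
      with less show "dist (?S G) 0 < e" by simp
    qed
  qed
qed

lemma bessel_summable:
  assumes on: "L2_orthonormal M J x" and f: "f \<in> L2_space M"
  shows "(\<lambda>j. (cmod (L2_inner M f (x j)))\<^sup>2) summable_on J"
proof (rule nonneg_bdd_above_summable_on)
  show "bdd_above (sum (\<lambda>j. (cmod (L2_inner M f (x j)))\<^sup>2) ` {F. F \<subseteq> J \<and> finite F})"
  proof (rule bdd_aboveI2)
    fix F assume F: "F \<in> {F. F \<subseteq> J \<and> finite F}"
    then show "(\<Sum>i\<in>F. (cmod (L2_inner M f (x i)))\<^sup>2) \<le> (L2_norm M f)\<^sup>2"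
      by (intro bessel_inequality[OF on _ _ f]) auto
  qed
qed auto

lemma L2_bounded_operatorD:
  assumes "L2_bounded_operator M N A"
  shows "f \<in> L2_space M \<Longrightarrow> A f \<in> L2_space N"
    and "f \<in> L2_space M \<Longrightarrow> g \<in> L2_space M \<Longrightarrow>
      AE y in N. A (\<lambda>x. a * f x + b * g x) y = a * A f y + b * A g y"
    and "\<exists>C. \<forall>f\<in>L2_space M. L2_norm N (A f) \<le> C * L2_norm M f"
  using assms unfolding L2_bounded_operator_def by simp_all

text \<open>Linearity is available for two terms and off a null set that depends on them. Finite
  induction collects finitely many such null sets.\<close>

lemma bounded_operator_lincomb:
  assumes A: "L2_bounded_operator M N A"
    and x: "\<And>j. j \<in> F \<Longrightarrow> x j \<in> L2_space M" and F: "finite F" and f: "f \<in> L2_space M"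
  shows "AE y in N. A (\<lambda>z. f z - (\<Sum>j\<in>F. c j * x j z)) y = A f y - (\<Sum>j\<in>F. c j * A (x j) y)"
  using F x
proof (induction F)
  case empty
  then show ?case by simp
next
  case (insert i F)
  let ?g = "\<lambda>z. f z - (\<Sum>j\<in>F. c j * x j z)"
  have g: "?g \<in> L2_space M"
    by (intro L2_space_diff f L2_space_lincomb) (use insert in auto)
  have "AE y in N. A (\<lambda>z. 1 * ?g z + (- c i) * x i z) y = 1 * A ?g y + (- c i) * A (x i) y"
    by (rule L2_bounded_operatorD(2)[OF A g]) (simp add: insert.prems)
  moreover have "(\<lambda>z. 1 * ?g z + (- c i) * x i z) = (\<lambda>z. f z - (\<Sum>j\<in>insert i F. c j * x j z))"
    using insert.hyps by (auto simp: algebra_simps)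
  ultimately have "AE y in N. A (\<lambda>z. f z - (\<Sum>j\<in>insert i F. c j * x j z)) y = A ?g y - c i * A (x i) y"
    by simp
  moreover have "AE y in N. A ?g y = A f y - (\<Sum>j\<in>F. c j * A (x j) y)"
    using insert by auto
  ultimately show ?case
    by eventually_elim (use insert.hyps in \<open>simp add: algebra_simps\<close>)
qed

locale singular_system =
  fixes M :: "'a measure" and N :: "'b measure" and A :: "('a \<Rightarrow> complex) \<Rightarrow> 'b \<Rightarrow> complex"
    and J :: "'j set" and x y and \<sigma> :: "'j \<Rightarrow> real"
  assumes bounded: "L2_bounded_operator M N A"
    and on_x: "L2_orthonormal M J x" and dense_x: "L2_dense_span M J x"
    and on_y: "L2_orthonormal N J y"
    and pos: "\<And>j. j \<in> J \<Longrightarrow> \<sigma> j > 0"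
    and sing: "\<And>j. j \<in> J \<Longrightarrow> AE p in N. A (x j) p = complex_of_real (\<sigma> j) * y j p"
begin

text \<open>The operator maps the residual of the expansion of \<open>f\<close> to the residual of
  the image series almost everywhere, so the bound \<open>C\<close> carries convergence from
  \<open>M\<close> to \<open>N\<close>.\<close>

lemma image_expansion:
  assumes f: "f \<in> L2_space M"
  shows "L2_has_sum N (\<lambda>j p. complex_of_real (\<sigma> j) * L2_inner M f (x j) * y j p) J (A f)"
  unfolding L2_has_sum_def
proof (intro conjI ballI)
  fix j assume "j \<in> J"
  then show "(\<lambda>p. complex_of_real (\<sigma> j) * L2_inner M f (x j) * y j p) \<in> L2_space N"
    using on_y by (intro L2_space_scale) (simp add: L2_orthonormal_def)
next
  have AL2: "A g \<in> L2_space N" if "g \<in> L2_space M" for g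
    using that by (rule L2_bounded_operatorD(1)[OF bounded])
  show "A f \<in> L2_space N" by (rule AL2[OF f])
  let ?S = "\<lambda>F. L2_norm M (\<lambda>z. f z - (\<Sum>j\<in>F. L2_inner M f (x j) * x j z))"
  let ?T = "\<lambda>F. L2_norm N (\<lambda>p. A f p - (\<Sum>j\<in>F. complex_of_real (\<sigma> j) * L2_inner M f (x j) * y j p))"
  obtain C where C: "\<And>g. g \<in> L2_space M \<Longrightarrow> L2_norm N (A g) \<le> C * L2_norm M g"
    using L2_bounded_operatorD(3)[OF bounded] by blast
  have S0: "(?S \<longlongrightarrow> 0) (finite_subsets_at_top J)"
    using orthonormal_expansion[OF on_x dense_x f] by (simp add: L2_has_sum_def)
  have bound: "\<forall>\<^sub>F F in finite_subsets_at_top J. norm (?T F) \<le> norm (?S F) * C"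
  proof (rule eventually_finite_subsets_at_top_weakI)
    fix F assume "finite F" "F \<subseteq> J"
    then have F: "finite F \<and> F \<subseteq> J" by blast
    then have xF: "x j \<in> L2_space M" and yF: "y j \<in> L2_space N" if "j \<in> F" for j
      using on_x on_y that by (auto simp: L2_orthonormal_def)
    let ?g = "\<lambda>z. f z - (\<Sum>j\<in>F. L2_inner M f (x j) * x j z)"
    have g: "?g \<in> L2_space M"
      by (intro L2_space_diff f L2_space_lincomb xF)
    have sF: "AE p in N. \<forall>j\<in>F. A (x j) p = complex_of_real (\<sigma> j) * y j p"
      using F sing by (intro AE_finite_allI) auto
    have lin: "AE p in N. A ?g p = A f p - (\<Sum>j\<in>F. L2_inner M f (x j) * A (x j) p)"
      by (rule bounded_operator_lincomb[OF bounded]) (use F xF f in simp_all)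
    \<comment> \<open>The singular relation replaces each image \<open>A (x j)\<close> by its
      multiple of \<open>y j\<close>, off a finite union of null sets.\<close>
    from sF lin
    have "AE p in N. A ?g p = A f p - (\<Sum>j\<in>F. complex_of_real (\<sigma> j) * L2_inner M f (x j) * y j p)"
      by eventually_elim (simp add: mult_ac)
    then have "L2_norm N (A ?g) = ?T F"
      using AL2[OF g] L2_space_diff[OF AL2[OF f] L2_space_lincomb[of F y N "\<lambda>j. complex_of_real (\<sigma> j) * L2_inner M f (x j)", OF yF]]
      by (intro L2_norm_cong_AE) (simp_all add: L2_space_def)
    then show "norm (?T F) \<le> norm (?S F) * C" using C[OF g] by (simp add: mult.commute)
  qed
  show "(?T \<longlongrightarrow> 0) (finite_subsets_at_top J)"
    by (rule tendsto_0_le[OF S0 bound])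
qed

text \<open>The coefficients of the zero image are the products of \<open>\<sigma> j\<close> with
  the coefficients of \<open>f\<close>. Since \<open>\<sigma> j\<close> is positive, all
  coefficients of \<open>f\<close> vanish, and then no combination of the \<open>x j\<close>
  approximates \<open>f\<close> better than 0 does. Density forces norm zero.\<close>

lemma kernel_null:
  assumes "f \<in> L2_kernel M N A"
  shows "AE z in M. f z = 0"
proof -
  have f: "f \<in> L2_space M" and 0: "AE p in N. A f p = 0"
    using assms by (auto simp: L2_kernel_def)
  have Af: "A f \<in> L2_space N" using f by (rule L2_bounded_operatorD(1)[OF bounded])
  have coeff: "L2_inner M f (x j) = 0" if j: "j \<in> J" for j
  proof -
    have "complex_of_real (\<sigma> j) * L2_inner M f (x j) = L2_inner N (A f) (y j)"
      by (rule L2_has_sum_coeff_unique[OF on_y image_expansion[OF f] j])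
    also have "\<dots> = L2_inner N (\<lambda>_. 0) (y j)"
      using Af on_y j 0 by (intro L2_inner_cong_AE) (auto simp: L2_space_def L2_orthonormal_def)
    also have "\<dots> = 0" by (simp add: L2_inner_def)
    finally show ?thesis using pos[OF j] by auto
  qed
  have small: "L2_norm M f < e" if "e > 0" for e
  proof -
    obtain F c where F: "finite F" "F \<subseteq> J"
      and less: "L2_norm M (\<lambda>z. f z - (\<Sum>j\<in>F. c j * x j z)) < e"
      by (rule L2_dense_spanE[OF dense_x f \<open>e > 0\<close>])
    have "(L2_norm M f)\<^sup>2 \<le> (L2_norm M (\<lambda>z. f z - (\<Sum>j\<in>F. c j * x j z)))\<^sup>2"
      using F coeff by (subst orthonormal_residual_norm[OF on_x F f])
        (auto intro!: sum_nonneg simp: subset_eq)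
    then have "L2_norm M f \<le> L2_norm M (\<lambda>z. f z - (\<Sum>j\<in>F. c j * x j z))"
      by (rule power2_le_imp_le) simp
    with less show "L2_norm M f < e" by simp
  qed
  have "L2_norm M f = 0"
    using small[of "L2_norm M f"] L2_norm_nonneg[of M f] by linarith
  then show ?thesis by (rule L2_norm_eq_0_AE[OF f])
qed

text \<open>Null functions are orthogonal to everything. Hence the basis of the orthogonal
  complement of the kernel demanded by the decomposition is a basis of the whole space.\<close>

lemma kernel_complement: "L2_orthogonal_complement M (L2_kernel M N A) = L2_space M"
proof -
  have "L2_inner M g f = 0" if "g \<in> L2_space M" "f \<in> L2_kernel M N A" for f g
  proof -
    have "L2_inner M f g = L2_inner M (\<lambda>_. 0) g"
      using kernel_null[OF that(2)] that by (intro L2_inner_cong_AE) (simp_all add: L2_space_def L2_kernel_def)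
    then show ?thesis by (subst L2_inner_cnj) (simp add: L2_inner_def)
  qed
  then show ?thesis by (auto simp: L2_orthogonal_complement_def)
qed

lemma svd: "singular_value_decomposition M N A J x y \<sigma>"
  unfolding singular_value_decomposition_def L2_orthonormal_basis_def kernel_complement
proof (intro conjI ballI)
  show "x j \<in> L2_space M" if "j \<in> J" for j
    using on_x that by (auto simp: L2_orthonormal_def)
  show "\<forall>e>0. \<exists>F c. finite F \<and> F \<subseteq> J \<and> L2_norm M (\<lambda>z. f z - (\<Sum>j\<in>F. c j * x j z)) < e"
    if "f \<in> L2_space M" for f
    using dense_x that unfolding L2_dense_span_def by (rule bspec)
qed (fact bounded on_x on_y | erule pos sing)+

end

section \<open>Geodesics\<close>

lemma metric_has_derivative:
  fixes x :: complex
  assumes "1 + \<kappa> * (cmod x)\<^sup>2 > 0"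
  shows "((\<lambda>y. metric \<kappa> y u v) has_derivative
     (\<lambda>h. - 4 * \<kappa> * (u \<bullet> v) * (x \<bullet> h) / (1 + \<kappa> * (cmod x)\<^sup>2) ^ 3)) (at x)"
proof -
  define N where "N = 1 + \<kappa> * (x \<bullet> x)"
  have N: "N > 0" using assms by (simp add: N_def power2_norm_eq_inner)
  have 1: "((\<lambda>s. (u \<bullet> v) / s\<^sup>2) has_real_derivative (- 2 * (u \<bullet> v) / N ^ 3)) (at N)"
    using N by (auto intro!: derivative_eq_intros simp: field_simps power2_eq_square power3_eq_cube)
  have 2: "((\<lambda>y. 1 + \<kappa> * (y \<bullet> y)) has_derivative (\<lambda>h. 2 * \<kappa> * (x \<bullet> h))) (at x)"
    by (auto intro!: derivative_eq_intros ext simp: inner_commute algebra_simps)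
  have "((\<lambda>y. (u \<bullet> v) / (1 + \<kappa> * (y \<bullet> y))\<^sup>2) has_derivative
     (\<lambda>h. 2 * \<kappa> * (x \<bullet> h) * (- 2 * (u \<bullet> v) / N ^ 3))) (at x)"
    by (rule DERIV_compose_FDERIV[where g = "\<lambda>y. 1 + \<kappa> * (y \<bullet> y)" and f = "\<lambda>s. (u \<bullet> v) / s\<^sup>2"])
       (use 1 2 in \<open>simp_all add: N_def\<close>)
  then show ?thesis by (simp add: metric_def[abs_def] N_def power2_norm_eq_inner mult_ac)
qed

text \<open>After multiplication by the cube of the conformal factor, the lowered equation reads A .
  w = 0 for all w. The Christoffel terms collapse because 2 (x . p) p - |p|^2 x is the complex
  number conj(x) p^2.\<close>

lemma geodesic_equation_iff:
  assumes N: "1 + \<kappa> * (cmod x)\<^sup>2 > 0"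
  shows "(\<forall>w. metric \<kappa> x q w + christoffel (metric \<kappa>) x p p w = 0) \<longleftrightarrow>
    q = 2 * complex_of_real \<kappa> * cnj x * p\<^sup>2 / complex_of_real (1 + \<kappa> * (cmod x)\<^sup>2)"
    (is "?L \<longleftrightarrow> ?R")
proof -
  let ?N = "1 + \<kappa> * (cmod x)\<^sup>2"
  define A where "A = complex_of_real ?N * q - 2 * complex_of_real \<kappa> * cnj x * p\<^sup>2"
  have fd: "frechet_derivative (\<lambda>y. metric \<kappa> y u v) (at x) h =
      - 4 * \<kappa> * (u \<bullet> v) * (x \<bullet> h) / ?N ^ 3" for u v h
    using frechet_derivative_at[OF metric_has_derivative[OF N]] by metis
  have "metric \<kappa> x q w + christoffel (metric \<kappa>) x p p w = (A \<bullet> w) / ?N ^ 3" for w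
  proof -
    have "metric \<kappa> x q w + christoffel (metric \<kappa>) x p p w
      = (?N * (q \<bullet> w) - 4 * \<kappa> * (p \<bullet> w) * (x \<bullet> p) + 2 * \<kappa> * (p \<bullet> p) * (x \<bullet> w)) / ?N ^ 3"
    proof -
      obtain n where n: "n = ?N" "n > 0" using N by blast
      have "(q \<bullet> w) / n\<^sup>2 = ?N * (q \<bullet> w) / n ^ 3"
        using n by (simp add: power2_eq_square power3_eq_cube)
      then show ?thesis
        unfolding christoffel_def fd unfolding metric_def n(1)[symmetric] using n(2)
        by (simp add: add_divide_distrib diff_divide_distrib)
    qed
    also have "?N * (q \<bullet> w) - 4 * \<kappa> * (p \<bullet> w) * (x \<bullet> p) + 2 * \<kappa> * (p \<bullet> p) * (x \<bullet> w) = A \<bullet> w"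
      by (simp add: A_def inner_complex_def cmod_power2 power2_eq_square algebra_simps)
    finally show ?thesis .
  qed
  then have "?L \<longleftrightarrow> (\<forall>w. A \<bullet> w = 0)" using N by simp
  also have "\<dots> \<longleftrightarrow> A = 0" by (metis inner_eq_zero_iff inner_zero_left)
  also have "\<dots> \<longleftrightarrow> ?R"
  proof -
    have "complex_of_real ?N \<noteq> 0" using N by (simp only: of_real_eq_0_iff)
    then show ?thesis unfolding A_def by (simp only: eq_divide_eq) (simp add: mult.commute)
  qed
  finally show ?thesis .
qed

lemma curvature_factor_pos:
  assumes "-1 < \<kappa>" "\<kappa> < 1" "cmod z \<le> 1"
  shows "1 + \<kappa> * (cmod z)\<^sup>2 > 0" "1 - \<kappa> * (cmod z)\<^sup>2 > 0"
proof -
  have "\<bar>\<kappa> * (cmod z)\<^sup>2\<bar> \<le> \<bar>\<kappa>\<bar> * 1"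
    unfolding abs_mult using assms by (intro mult_left_mono) (auto simp: power_le_one)
  then show "1 + \<kappa> * (cmod z)\<^sup>2 > 0" "1 - \<kappa> * (cmod z)\<^sup>2 > 0" using assms by linarith+
qed

text \<open>The equation in solved complex form. Confinement to the disk is replaced by positivity
  of the conformal factor, so that a solution may be followed beyond the boundary.\<close>

definition geodesic_flow :: "real \<Rightarrow> real \<Rightarrow> (real \<Rightarrow> complex) \<Rightarrow> (real \<Rightarrow> complex) \<Rightarrow> bool" where
  "geodesic_flow \<kappa> T \<gamma> p \<longleftrightarrow> (\<forall>t\<in>{0..T}. 1 + \<kappa> * (cmod (\<gamma> t))\<^sup>2 > 0 \<and>
     (\<gamma> has_vector_derivative p t) (at t within {0..T}) \<and>
     (p has_vector_derivative 2 * complex_of_real \<kappa> * cnj (\<gamma> t) * (p t)\<^sup>2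
         / complex_of_real (1 + \<kappa> * (cmod (\<gamma> t))\<^sup>2)) (at t within {0..T}) \<and>
     cmod (p t) = 1 + \<kappa> * (cmod (\<gamma> t))\<^sup>2)"

lemma unit_speed_geodesic_iff:
  assumes \<kappa>: "-1 < \<kappa>" "\<kappa> < 1"
  shows "unit_speed_geodesic (metric \<kappa>) (cball 0 1) x v T \<gamma> \<longleftrightarrow>
    (\<exists>p. \<gamma> 0 = x \<and> p 0 = v \<and> geodesic_flow \<kappa> T \<gamma> p \<and> (\<forall>t\<in>{0..T}. cmod (\<gamma> t) \<le> 1))"
proof -
  have sp: "metric \<kappa> z u u = 1 \<longleftrightarrow> cmod u = 1 + \<kappa> * (cmod z)\<^sup>2" if "cmod z \<le> 1" for z u
  proof -
    have "metric \<kappa> z u u = 1 \<longleftrightarrow> (cmod u)\<^sup>2 = (1 + \<kappa> * (cmod z)\<^sup>2)\<^sup>2"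
      using curvature_factor_pos[OF \<kappa> that] by (auto simp: metric_def dot_square_norm)
    then show ?thesis using curvature_factor_pos[OF \<kappa> that] by (simp add: power2_eq_iff_nonneg)
  qed
  let ?q = "\<lambda>p t. 2 * complex_of_real \<kappa> * cnj (\<gamma> t) * (p t)\<^sup>2
         / complex_of_real (1 + \<kappa> * (cmod (\<gamma> t))\<^sup>2)"
  show ?thesis (is "?L \<longleftrightarrow> ?R")
  proof
    assume ?L
    then obtain p q where "\<gamma> 0 = x" "p 0 = v" and *: "\<forall>t\<in>{0..T}. \<gamma> t \<in> cball 0 1 \<and>
           (\<gamma> has_vector_derivative p t) (at t within {0..T}) \<and>
           (p has_vector_derivative q t) (at t within {0..T}) \<and>
           metric \<kappa> (\<gamma> t) (p t) (p t) = 1 \<and>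
           (\<forall>w. metric \<kappa> (\<gamma> t) (q t) w + christoffel (metric \<kappa>) (\<gamma> t) (p t) (p t) w = 0)"
      unfolding unit_speed_geodesic_def by blast
    moreover have "geodesic_flow \<kappa> T \<gamma> p"
      unfolding geodesic_flow_def
    proof
      fix t assume "t \<in> {0..T}"
      note t = bspec[OF * this]
      then have le: "cmod (\<gamma> t) \<le> 1" by simp
      note pos = curvature_factor_pos(1)[OF \<kappa> le]
      have "q t = ?q p t"
        using t geodesic_equation_iff[OF pos, of "q t" "p t"] by blast
      from t[unfolded this] sp[OF le] pos
      show "1 + \<kappa> * (cmod (\<gamma> t))\<^sup>2 > 0 \<and> (\<gamma> has_vector_derivative p t) (at t within {0..T}) \<and>
        (p has_vector_derivative ?q p t) (at t within {0..T}) \<and> cmod (p t) = 1 + \<kappa> * (cmod (\<gamma> t))\<^sup>2"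
        by simp
    qed
    ultimately show ?R by auto
  next
    assume ?R
    then obtain p where p: "\<gamma> 0 = x" "p 0 = v" "geodesic_flow \<kappa> T \<gamma> p"
      and le: "\<forall>t\<in>{0..T}. cmod (\<gamma> t) \<le> 1" by blast
    show ?L unfolding unit_speed_geodesic_def
    proof (rule exI[of _ p], rule exI[of _ "?q p"], intro conjI p ballI)
      fix t assume T: "t \<in> {0..T}"
      note t = bspec[OF p(3)[unfolded geodesic_flow_def] T] and le = bspec[OF le T]
      show "\<gamma> t \<in> cball 0 1" "(\<gamma> has_vector_derivative p t) (at t within {0..T})"
        "(p has_vector_derivative ?q p t) (at t within {0..T})" "metric \<kappa> (\<gamma> t) (p t) (p t) = 1"
        using t le sp[of "\<gamma> t" "p t"] by simp_all
      show "\<forall>w. metric \<kappa> (\<gamma> t) (?q p t) w + christoffel (metric \<kappa>) (\<gamma> t) (p t) (p t) w = 0"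
        by (subst geodesic_equation_iff[OF curvature_factor_pos(1)[OF \<kappa>]]) (use le in simp_all)
    qed
  qed
qed

section \<open>Uniqueness of geodesics\<close>

text \<open>With s^2 = c the operator f'' - c f factors: g - s f solves a first-order equation with
  zero initial value, and then so does f. A complex square root covers both signs of the curvature
  at once.\<close>

lemma linear_ode_unique:
  fixes f g :: "real \<Rightarrow> complex"
  assumes f: "\<And>t. t \<in> {0..T} \<Longrightarrow> (f has_vector_derivative g t) (at t within {0..T})"
    and g: "\<And>t. t \<in> {0..T} \<Longrightarrow> (g has_vector_derivative c * f t) (at t within {0..T})"
    and 0: "f 0 = 0" "g 0 = 0" and t: "t \<in> {0..T}"
  shows "f t = 0" "g t = 0"
proof -
  have first_order: "P t = 0" if P: "\<And>t. t \<in> {0..T} \<Longrightarrow> (P has_vector_derivative a * P t) (at t within {0..T})"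
    and "P 0 = 0" and t: "t \<in> {0..T}" for P :: "real \<Rightarrow> complex" and a t
  proof -
    \<comment> \<open>Integrating factor: the product of \<open>P\<close> with this exponential has
      derivative zero.\<close>
    have e: "((\<lambda>t. exp (complex_of_real t * (- a))) has_vector_derivative
       exp (complex_of_real t * (- a)) * (- a)) (at t within {0..T})" for t
    proof -
      have "((\<lambda>t. t *\<^sub>R (- a)) has_vector_derivative (- a)) (at t within {0..T})"
        by (auto intro!: derivative_eq_intros)
      from field_vector_diff_chain_within[OF this DERIV_subset[OF DERIV_exp subset_UNIV]]
      show ?thesis by (simp add: o_def scaleR_conv_of_real mult.commute)
    qed
    have "((\<lambda>t. exp (complex_of_real t * (- a)) * P t) has_vector_derivative 0) (at t within {0..T})"
      if "t \<in> {0..T}" for t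
      using has_vector_derivative_mult[OF e P[OF that]] by (simp add: algebra_simps)
    then have "\<exists>c. \<forall>t\<in>{0..T}. exp (complex_of_real t * (- a)) * P t = c"
      by (intro has_derivative_zero_constant[of "{0..T}", simplified])
         (auto simp: has_vector_derivative_def)
    then obtain c where "\<forall>t\<in>{0..T}. exp (complex_of_real t * (- a)) * P t = c" by blast
    from bspec[OF this, of 0] bspec[OF this, of t] \<open>P 0 = 0\<close> t show "P t = 0" by simp
  qed
  define s where "s = csqrt c"
  have s: "s * s = c" unfolding s_def by (metis power2_csqrt power2_eq_square)
  have P: "g t - s * f t = 0" if "t \<in> {0..T}" for t
  proof (rule first_order[where a = "- s"])
    fix u assume "u \<in> {0..T}"
    from has_vector_derivative_diff[OF g[OF this] bounded_linear.has_vector_derivative[OF bounded_linear_mult_right f[OF this], of s]]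
    show "((\<lambda>t. g t - s * f t) has_vector_derivative - s * (g u - s * f u)) (at u within {0..T})"
      by (simp add: algebra_simps s[symmetric])
  qed (use 0 that in auto)
  show "f t = 0"
  proof (rule first_order[where a = s])
    fix u assume u: "u \<in> {0..T}"
    show "(f has_vector_derivative s * f u) (at u within {0..T})"
      using f[OF u] P[OF u] by simp
  qed (use 0 t in auto)
  then show "g t = 0" using P[OF t] by simp
qed

text \<open>Up to normalisation, the following are the coordinates of the geodesic in the model of the
  surface as a quadric in three-space, where geodesics solve a linear equation. They determine the
  geodesic.\<close>

lemma geodesic_flow_linearized:
  fixes \<kappa> :: real
  defines "k \<equiv> complex_of_real \<kappa>"
  assumes flow: "geodesic_flow \<kappa> T \<gamma> p"
  defines "R \<equiv> \<lambda>t. inverse (1 + k * (\<gamma> t * cnj (\<gamma> t)))"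
  defines "h \<equiv> \<lambda>t. 2 * R t - 1"
    and "m \<equiv> \<lambda>t. (R t)\<^sup>2 * (cnj (\<gamma> t) * p t + \<gamma> t * cnj (p t)) / 2"
    and "X \<equiv> \<lambda>t. \<gamma> t * R t"
    and "V \<equiv> \<lambda>t. (R t)\<^sup>2 * (p t - k * (\<gamma> t)\<^sup>2 * cnj (p t))"
  assumes t: "t \<in> {0..T}"
  shows "(m has_vector_derivative h t) (at t within {0..T})"
    and "(h has_vector_derivative (- 4 * k) * m t) (at t within {0..T})"
    and "(X has_vector_derivative V t) (at t within {0..T})"
    and "(V has_vector_derivative (- 4 * k) * X t) (at t within {0..T})"
proof -
  define N where "N = complex_of_real (1 + \<kappa> * (cmod (\<gamma> t))\<^sup>2)"
  define q where "q = 2 * k * cnj (\<gamma> t) * (p t)\<^sup>2 / N"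
  note fl = bspec[OF flow[unfolded geodesic_flow_def] t]
  then have Npos: "0 < 1 + \<kappa> * (cmod (\<gamma> t))\<^sup>2" and sp: "cmod (p t) = 1 + \<kappa> * (cmod (\<gamma> t))\<^sup>2"
    and g: "(\<gamma> has_vector_derivative p t) (at t within {0..T})"
    and p: "(p has_vector_derivative q) (at t within {0..T})"
    by (simp_all add: q_def k_def N_def)
  have N: "N = 1 + k * (\<gamma> t * cnj (\<gamma> t))"
    by (simp add: N_def k_def complex_norm_square[symmetric])
  have N0: "N \<noteq> 0" using Npos unfolding N_def by (simp only: of_real_eq_0_iff)
  \<comment> \<open>Unit speed enters here. Replacing |p|^2 by the squared conformal factor is what
    makes the coefficients constant.\<close>
  have pp: "p t * cnj (p t) = N\<^sup>2"
    unfolding complex_norm_square[symmetric] sp N_def by simp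
  have RN: "R t = 1 / N" by (simp add: R_def N inverse_eq_divide)
  have g': "((\<lambda>t. cnj (\<gamma> t)) has_vector_derivative cnj (p t)) (at t within {0..T})"
    and p': "((\<lambda>t. cnj (p t)) has_vector_derivative cnj q) (at t within {0..T})"
    using g p by (auto intro: has_vector_derivative_cnj)
  have "((\<lambda>t. 1 + k * (\<gamma> t * cnj (\<gamma> t))) has_vector_derivative
      k * (p t * cnj (\<gamma> t) + \<gamma> t * cnj (p t))) (at t within {0..T})"
    by (auto intro!: derivative_eq_intros g g' simp: algebra_simps)
  moreover have "(inverse has_field_derivative - (inverse N * 1 * inverse N))
      (at (1 + k * (\<gamma> t * cnj (\<gamma> t))) within S)" for S
    using DERIV_subset[OF DERIV_inverse'[OF DERIV_ident N0] subset_UNIV] by (simp add: N)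
  ultimately have "((inverse \<circ> (\<lambda>t. 1 + k * (\<gamma> t * cnj (\<gamma> t)))) has_vector_derivative
      k * (p t * cnj (\<gamma> t) + \<gamma> t * cnj (p t)) * (- (inverse N * 1 * inverse N))) (at t within {0..T})"
    by (rule field_vector_diff_chain_within)
  then have R: "(R has_vector_derivative - k * (p t * cnj (\<gamma> t) + \<gamma> t * cnj (p t)) / N\<^sup>2) (at t within {0..T})"
    by (simp add: o_def R_def power2_eq_square inverse_eq_divide)
  have q': "cnj q = 2 * k * \<gamma> t * (cnj (p t))\<^sup>2 / N"
    by (simp add: q_def k_def N_def)
  show "(h has_vector_derivative (- 4 * k) * m t) (at t within {0..T})"
    unfolding h_def using N0
    by (auto intro!: derivative_eq_intros R simp: m_def RN field_simps)
  show "(X has_vector_derivative V t) (at t within {0..T})"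
    unfolding X_def
    by (rule derivative_eq_intros g R refl)+
       (use N0 in \<open>simp add: V_def RN field_simps power2_eq_square\<close>, simp add: N algebra_simps)
  define d where "d = \<gamma> t * cnj (\<gamma> t)"
  have R2: "((\<lambda>t. (R t)\<^sup>2) has_vector_derivative
     - 2 * k * (p t * cnj (\<gamma> t) + \<gamma> t * cnj (p t)) / N ^ 3) (at t within {0..T})"
    unfolding power2_eq_square
    by (rule derivative_eq_intros R refl)+ (simp add: RN power2_eq_square power3_eq_cube mult.assoc)
  have gp: "((\<lambda>t. cnj (\<gamma> t) * p t + \<gamma> t * cnj (p t)) has_vector_derivative
     cnj (\<gamma> t) * q + cnj q * \<gamma> t + 2 * N\<^sup>2) (at t within {0..T})"
    by (rule derivative_eq_intros g g' p p' refl)+ (simp add: pp[symmetric] algebra_simps)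
  have "(m has_vector_derivative ((1 / N\<^sup>2) * (cnj (\<gamma> t) * q + cnj q * \<gamma> t + 2 * N\<^sup>2)
     + (- 2 * k * (p t * cnj (\<gamma> t) + \<gamma> t * cnj (p t)) / N ^ 3) * (cnj (\<gamma> t) * p t + \<gamma> t * cnj (p t))) / 2)
      (at t within {0..T})"
    unfolding m_def
    by (rule derivative_eq_intros R2 gp refl)+ (simp add: RN power_divide)
  also have "((1 / N\<^sup>2) * (cnj (\<gamma> t) * q + cnj q * \<gamma> t + 2 * N\<^sup>2)
     + (- 2 * k * (p t * cnj (\<gamma> t) + \<gamma> t * cnj (p t)) / N ^ 3) * (cnj (\<gamma> t) * p t + \<gamma> t * cnj (p t))) / 2
    = (1 - 2 * k * d * (p t * cnj (p t)) / N ^ 3)"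
    unfolding q_def q'[unfolded q_def] d_def using N0
    by (simp add: field_simps power2_eq_square power3_eq_cube)
  also have "\<dots> = h t"
    unfolding pp h_def RN using N0 by (simp add: field_simps power2_eq_square power3_eq_cube) (simp add: N d_def)
  finally show "(m has_vector_derivative h t) (at t within {0..T})" .
  have pg: "((\<lambda>t. p t - k * (\<gamma> t)\<^sup>2 * cnj (p t)) has_vector_derivative
     q - k * (2 * \<gamma> t * N\<^sup>2 + (\<gamma> t)\<^sup>2 * cnj q)) (at t within {0..T})"
    unfolding power2_eq_square[of "\<gamma> _"]
    by (rule derivative_eq_intros g g' p p' refl)+ (simp add: pp[symmetric] algebra_simps)
  have "(V has_vector_derivative (1 / N\<^sup>2) * (q - k * (2 * \<gamma> t * N\<^sup>2 + (\<gamma> t)\<^sup>2 * cnj q))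
     + (- 2 * k * (p t * cnj (\<gamma> t) + \<gamma> t * cnj (p t)) / N ^ 3) * (p t - k * (\<gamma> t)\<^sup>2 * cnj (p t)))
      (at t within {0..T})"
    unfolding V_def
    by (rule derivative_eq_intros R2 pg refl)+ (simp add: RN power_divide)
  also have "(1 / N\<^sup>2) * (q - k * (2 * \<gamma> t * N\<^sup>2 + (\<gamma> t)\<^sup>2 * cnj q))
     + (- 2 * k * (p t * cnj (\<gamma> t) + \<gamma> t * cnj (p t)) / N ^ 3) * (p t - k * (\<gamma> t)\<^sup>2 * cnj (p t))
    = - 2 * k * \<gamma> t * (1 + (1 - k * d) * (p t * cnj (p t)) / N ^ 3)"
    unfolding q_def q'[unfolded q_def] d_def using N0
    by (simp add: field_simps power2_eq_square power3_eq_cube)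
  also have "\<dots> = - 4 * k * X t"
    unfolding pp X_def RN using N0 by (simp add: field_simps power2_eq_square power3_eq_cube) (simp add: N d_def algebra_simps)
  finally show "(V has_vector_derivative (- 4 * k) * X t) (at t within {0..T})" by simp
qed

text \<open>The pair (\<open>m\<close>, \<open>h\<close>) satisfies a linear system, and its
  \<open>h\<close> component determines the conformal factor. The pair (\<open>X\<close>,
  \<open>V\<close>) then determines the quotient of the position by that factor, hence the
  position.\<close>

lemma geodesic_flow_unique:
  assumes f1: "geodesic_flow \<kappa> T \<gamma>1 p1" and f2: "geodesic_flow \<kappa> T \<gamma>2 p2"
    and 0: "\<gamma>1 0 = \<gamma>2 0" "p1 0 = p2 0" and t: "t \<in> {0..T}"
  shows "\<gamma>1 t = \<gamma>2 t"
proof -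
  note l1 = geodesic_flow_linearized[OF f1] and l2 = geodesic_flow_linearized[OF f2]
  note h = linear_ode_unique(2)[OF has_vector_derivative_diff[OF l1(1) l2(1)]
      has_vector_derivative_diff[OF l1(2) l2(2), folded right_diff_distrib] _ _ t]
  have N: "1 + complex_of_real \<kappa> * (\<gamma>1 t * cnj (\<gamma>1 t)) = 1 + complex_of_real \<kappa> * (\<gamma>2 t * cnj (\<gamma>2 t))"
    using h 0 by simp
  have N0: "1 + complex_of_real \<kappa> * (\<gamma>2 t * cnj (\<gamma>2 t)) \<noteq> 0"
  proof -
    have "0 < 1 + \<kappa> * (cmod (\<gamma>2 t))\<^sup>2" using f2 t by (simp add: geodesic_flow_def)
    then have "complex_of_real (1 + \<kappa> * (cmod (\<gamma>2 t))\<^sup>2) \<noteq> 0" by (simp only: of_real_eq_0_iff)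
    then show ?thesis by (simp add: complex_norm_square[symmetric])
  qed
  note X = linear_ode_unique(1)[OF has_vector_derivative_diff[OF l1(3) l2(3)]
      has_vector_derivative_diff[OF l1(4) l2(4), folded right_diff_distrib] _ _ t]
  show ?thesis using X 0 N N0 by simp
qed

section \<open>Explicit geodesics in fan-beam coordinates\<close>

lemma tanh_artanh_real:
  assumes "\<bar>x\<bar> < (1::real)"
  shows "tanh (artanh x) = x"
proof -
  have pos: "1 + x > 0" "1 - x > 0" using assms by linarith+
  then have e: "exp (- 2 * artanh x) = (1 - x) / (1 + x)"
    by (simp add: artanh_def exp_minus)
  show ?thesis unfolding tanh_real_altdef e
    using pos by (simp add: field_simps)
qed

text \<open>The solution is a tangent, the identity or a hyperbolic tangent according to the sign of
  kappa. Its inverse function at \<open>y1\<close> gives \<open>T\<close>. For negative kappa the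
  hypothesis places \<open>y1\<close> below the asymptotic value 1/sqrt(-kappa). Derivatives are
  two-sided, also at the end points.\<close>

lemma riccati_solution:
  fixes \<kappa> y1 :: real
  assumes y1: "0 \<le> y1" "1 + \<kappa> * y1\<^sup>2 > 0"
  obtains T Y where "0 \<le> T" "Y 0 = 0" "Y T = y1"
    "\<And>t. t \<in> {0..T} \<Longrightarrow> (Y has_real_derivative 1 + \<kappa> * (Y t)\<^sup>2) (at t)"
    "\<And>s t. 0 \<le> s \<Longrightarrow> s < t \<Longrightarrow> t \<le> T \<Longrightarrow> Y s < Y t"
proof -
  have mono: "Y s < Y t" if "\<And>t. t \<in> {0..T} \<Longrightarrow> (Y has_real_derivative 1 + \<kappa> * (Y t)\<^sup>2) (at t)"
    "\<And>t. t \<in> {0..T} \<Longrightarrow> 1 + \<kappa> * (Y t)\<^sup>2 > 0" "0 \<le> s" "s < t" "t \<le> T" for s t T and Y :: "real \<Rightarrow> real"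
  proof (rule DERIV_pos_imp_increasing[OF that(4)])
    fix x assume "s \<le> x" "x \<le> t"
    then have "x \<in> {0..T}" using that by simp
    with that(1,2) show "\<exists>y. (Y has_real_derivative y) (at x) \<and> 0 < y" by blast
  qed
  consider "\<kappa> > 0" | "\<kappa> = 0" | "\<kappa> < 0" by linarith
  then show thesis
  proof cases
    case 1
    define a where "a = sqrt \<kappa>"
    have a: "a > 0" "a\<^sup>2 = \<kappa>" using 1 by (auto simp: a_def)
    define T where "T = arctan (a * y1) / a"
    define Y where "Y = (\<lambda>t. tan (a * t) / a)"
    have T: "T \<ge> 0" using a y1 by (simp add: T_def)
    have d: "(Y has_real_derivative 1 + \<kappa> * (Y t)\<^sup>2) (at t)" if "t \<in> {0..T}" for t
    proof -
      have "a * t \<le> a * T" using that a by simp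
      also have "\<dots> < pi / 2" using a arctan_ubound[of "a * y1"] by (simp add: T_def)
      finally have less: "a * t < pi / 2" .
      have "0 \<le> a * t" using that a by simp
      then have "- (pi / 2) < a * t" using pi_gt_zero by linarith
      then have "cos (a * t) \<noteq> 0"
        using cos_gt_zero_pi[OF _ less] by linarith
      then show ?thesis unfolding Y_def using a tan_sec[of "a * t"]
        by (auto intro!: derivative_eq_intros simp: power_divide inverse_eq_divide)
    qed
    have p: "1 + \<kappa> * (Y t)\<^sup>2 > 0" for t
    proof -
      have "0 \<le> \<kappa> * (Y t)\<^sup>2" using 1 by simp
      then show ?thesis by linarith
    qed
    have YT: "Y T = y1" using a by (simp add: Y_def T_def tan_arctan)
    show thesis
      by (rule that[of T Y, OF T _ YT d mono[OF d p]]) (auto simp: Y_def)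
  next
    case 2
    show thesis
      by (rule that[of y1 "\<lambda>t. t"]) (use 2 y1 in \<open>auto intro!: derivative_eq_intros\<close>)
  next
    case 3
    define a where "a = sqrt (- \<kappa>)"
    have a: "a > 0" "a\<^sup>2 = - \<kappa>" using 3 by (auto simp: a_def)
    have "(a * y1)\<^sup>2 < 1\<^sup>2" using y1 a by (simp add: power_mult_distrib)
    then have ay: "a * y1 < 1" by (rule power2_less_imp_less) simp
    define T where "T = artanh (a * y1) / a"
    define Y where "Y = (\<lambda>t. tanh (a * t) / a)"
    have ay0: "0 \<le> a * y1" using a y1 by simp
    have T: "T \<ge> 0" using a ay ay0 by (simp add: T_def artanh_def)
    have YT: "Y T = y1" using a ay ay0 by (simp add: Y_def T_def tanh_artanh_real)
    have d: "(Y has_real_derivative 1 + \<kappa> * (Y t)\<^sup>2) (at t)" for t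
      unfolding Y_def using a 3
      by (auto intro!: derivative_eq_intros simp: power_divide)
    have p: "1 + \<kappa> * (Y t)\<^sup>2 > 0" for t
    proof -
      have "(tanh (a * t))\<^sup>2 < 1"
        using tanh_real_bounds[of "a * t"] by (simp add: abs_square_less_1 abs_less_iff)
      moreover have "\<kappa> * (Y t)\<^sup>2 = - (tanh (a * t))\<^sup>2" using a 3 by (simp add: Y_def power_divide)
      ultimately show ?thesis by simp
    qed
    show thesis
      by (rule that[of T Y, OF T _ YT d mono[OF d p]]) (auto simp: Y_def)
  qed
qed

lemma cis_mult_cnj [simp]: "cis a * cnj (cis a) = 1" "cnj (cis a) * cis a = 1"
  by (simp_all add: cis_cnj cis_mult)

context
  fixes \<kappa> \<beta> \<alpha> :: real
  assumes \<kappa>: "-1 < \<kappa>" "\<kappa> < 1" and cos_nonneg: "cos \<alpha> \<ge> 0"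
begin

text \<open>The geodesic issued from the fan-beam point \<open>(\<beta>, \<alpha>)\<close> is the image of a line through \<open>0\<close>
  under an isometry; the parameter \<open>y\<close> as a function of arclength solves \<open>y' = 1 + \<kappa> y\<^sup>2\<close>.\<close>

definition moebius :: "real \<Rightarrow> complex" where
  "moebius y = cis \<beta> * (1 - complex_of_real y * cis \<alpha>) / (1 + complex_of_real (\<kappa> * y) * cis \<alpha>)"

definition moebius_velocity :: "real \<Rightarrow> complex" where
  "moebius_velocity y = - (complex_of_real ((1 + \<kappa>) * (1 + \<kappa> * y\<^sup>2)) * cis \<beta> * cis \<alpha>) /
     (1 + complex_of_real (\<kappa> * y) * cis \<alpha>)\<^sup>2"

lemma norm_den: "(cmod (1 + complex_of_real (\<kappa> * y) * cis \<alpha>))\<^sup>2 = 1 + 2 * \<kappa> * y * cos \<alpha> + \<kappa>\<^sup>2 * y\<^sup>2"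
proof -
  have "(cmod (1 + complex_of_real (\<kappa> * y) * cis \<alpha>))\<^sup>2 = (1 + \<kappa> * y * cos \<alpha>)\<^sup>2 + (\<kappa> * y * sin \<alpha>)\<^sup>2"
    by (simp add: cmod_power2)
  also have "\<dots> = 1 + 2 * \<kappa> * y * cos \<alpha> + \<kappa>\<^sup>2 * y\<^sup>2"
    using sin_cos_squared_add[of \<alpha>] by algebra
  finally show ?thesis .
qed

lemma norm_num: "(cmod (1 - complex_of_real y * cis \<alpha>))\<^sup>2 = 1 - 2 * y * cos \<alpha> + y\<^sup>2"
proof -
  have "(cmod (1 - complex_of_real y * cis \<alpha>))\<^sup>2 = (1 - y * cos \<alpha>)\<^sup>2 + (y * sin \<alpha>)\<^sup>2"
    by (simp add: cmod_power2)
  also have "\<dots> = 1 - 2 * y * cos \<alpha> + y\<^sup>2"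
    using sin_cos_squared_add[of \<alpha>] by algebra
  finally show ?thesis .
qed

text \<open>For negative kappa the expression is at least (1 + kappa y)^2, its value at cos alpha =
  1. This is positive, because |kappa| < 1 improves |kappa| y^2 < 1 to |kappa| y < 1.\<close>

lemma den_pos:
  assumes y: "0 \<le> y" "1 + \<kappa> * y\<^sup>2 > 0"
  shows "1 + 2 * \<kappa> * y * cos \<alpha> + \<kappa>\<^sup>2 * y\<^sup>2 > 0"
proof (cases "\<kappa> \<ge> 0")
  case True
  then have "0 \<le> 2 * \<kappa> * y * cos \<alpha>" "0 \<le> \<kappa>\<^sup>2 * y\<^sup>2"
    using y cos_nonneg by simp_all
  then show ?thesis by linarith
next
  case False
  have "(- \<kappa> * y)\<^sup>2 < 1\<^sup>2"
  proof -
    have "(- \<kappa> * y)\<^sup>2 = (- \<kappa>) * (- \<kappa> * y\<^sup>2)" by (simp add: power2_eq_square)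
    also have "\<dots> \<le> 1 * (- \<kappa> * y\<^sup>2)" using \<kappa> False by (intro mult_right_mono) (auto simp: mult_nonpos_nonneg)
    also have "\<dots> < 1" using y by simp
    finally show ?thesis by simp
  qed
  then have l: "- \<kappa> * y < 1" by (rule power2_less_imp_less) simp
  have "(- \<kappa> * y) * cos \<alpha> \<le> (- \<kappa> * y) * 1"
    using False y by (intro mult_left_mono) (auto simp: mult_nonpos_nonneg)
  then have "(1 + \<kappa> * y)\<^sup>2 \<le> 1 + 2 * \<kappa> * y * cos \<alpha> + \<kappa>\<^sup>2 * y\<^sup>2"
    by (simp add: power2_eq_square algebra_simps)
  moreover have "(1 + \<kappa> * y)\<^sup>2 > 0" using l by simp
  ultimately show ?thesis by linarith
qed

lemma den_nonzero:
  assumes y: "0 \<le> y" "1 + \<kappa> * y\<^sup>2 > 0"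
  shows "1 + complex_of_real (\<kappa> * y) * cis \<alpha> \<noteq> 0"
  using den_pos[OF y] norm_den[of y] by (metis less_irrefl norm_zero power_zero_numeral zero_power2)

lemma norm_moebius:
  "(cmod (moebius y))\<^sup>2 = (1 - 2 * y * cos \<alpha> + y\<^sup>2) / (1 + 2 * \<kappa> * y * cos \<alpha> + \<kappa>\<^sup>2 * y\<^sup>2)"
  by (simp only: moebius_def norm_mult norm_divide norm_cis power_mult_distrib power_divide norm_den norm_num) simp

lemma moebius_factors:
  assumes y: "0 \<le> y" "1 + \<kappa> * y\<^sup>2 > 0"
  shows "1 + \<kappa> * (cmod (moebius y))\<^sup>2 = (1 + \<kappa>) * (1 + \<kappa> * y\<^sup>2) / (1 + 2 * \<kappa> * y * cos \<alpha> + \<kappa>\<^sup>2 * y\<^sup>2)"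
    and "1 - \<kappa> * (cmod (moebius y))\<^sup>2 = (1 - \<kappa> + 4 * \<kappa> * y * cos \<alpha> - \<kappa> * (1 - \<kappa>) * y\<^sup>2) / (1 + 2 * \<kappa> * y * cos \<alpha> + \<kappa>\<^sup>2 * y\<^sup>2)"
  unfolding norm_moebius using den_pos[OF y]
  by (simp_all add: field_simps) (simp_all add: power2_eq_square algebra_simps)

text \<open>The difference of the squared moduli of denominator and numerator factors as (1+kappa) y
  (2 cos alpha - (1-kappa) y). The second root is the parameter at which the geodesic leaves the
  disk.\<close>

lemma norm_moebius_le_1_iff:
  assumes y: "0 \<le> y" "1 + \<kappa> * y\<^sup>2 > 0"
  shows "cmod (moebius y) \<le> 1 \<longleftrightarrow> y \<le> 2 * cos \<alpha> / (1 - \<kappa>)"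
proof -
  have "cmod (moebius y) \<le> 1 \<longleftrightarrow> (cmod (moebius y))\<^sup>2 \<le> 1"
    by (simp add: power2_le_iff_abs_le abs_square_le_1)
  also have "\<dots> \<longleftrightarrow> 1 - 2 * y * cos \<alpha> + y\<^sup>2 \<le> 1 + 2 * \<kappa> * y * cos \<alpha> + \<kappa>\<^sup>2 * y\<^sup>2"
    unfolding norm_moebius using den_pos[OF y] by simp
  also have "\<dots> \<longleftrightarrow> 0 \<le> ((1 + \<kappa>) * y) * (2 * cos \<alpha> - (1 - \<kappa>) * y)"
    by (simp add: power2_eq_square algebra_simps)
  also have "\<dots> \<longleftrightarrow> y \<le> 2 * cos \<alpha> / (1 - \<kappa>)"
  proof (cases "y = 0")
    case True then show ?thesis using cos_nonneg \<kappa> by simp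
  next
    case False
    then have "0 < (1 + \<kappa>) * y" using y \<kappa> by simp
    from mult_le_cancel_left_pos[OF this, of 0 "2 * cos \<alpha> - (1 - \<kappa>) * y"]
    have "0 \<le> ((1 + \<kappa>) * y) * (2 * cos \<alpha> - (1 - \<kappa>) * y) \<longleftrightarrow> y * (1 - \<kappa>) \<le> 2 * cos \<alpha>"
      by (simp only: mult_zero_right) (simp add: mult.commute)
    then show ?thesis using \<kappa> by (simp add: pos_le_divide_eq)
  qed
  finally show ?thesis .
qed

text \<open>Chain rule with y' = 1 + kappa y^2. The second derivative has the geodesic form because
  E^2 times the conjugated numerator 1 - v conj(E) is E (E - v), the factor produced by
  differentiating the velocity.\<close>

lemma moebius_deriv:
  assumes Y: "(Y has_real_derivative 1 + \<kappa> * (Y t)\<^sup>2) (at t within S)"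
    and y: "0 \<le> Y t" "1 + \<kappa> * (Y t)\<^sup>2 > 0"
  shows "((\<lambda>t. moebius (Y t)) has_vector_derivative moebius_velocity (Y t)) (at t within S)"
    and "((\<lambda>t. moebius_velocity (Y t)) has_vector_derivative
      2 * complex_of_real \<kappa> * cnj (moebius (Y t)) * (moebius_velocity (Y t))\<^sup>2
         / complex_of_real (1 + \<kappa> * (cmod (moebius (Y t)))\<^sup>2)) (at t within S)"
proof -
  define k where "k = complex_of_real \<kappa>"
  define E where "E = cis \<alpha>"
  define B where "B = cis \<beta>"
  define v where "v = complex_of_real (Y t)"
  define d where "d = 1 + k * v * E"
  have d0: "d \<noteq> 0" using den_nonzero[OF y] by (simp add: d_def k_def v_def E_def)
  define db where "db = 1 + k * v * cnj E"
  have db: "db = cnj d" by (simp add: d_def db_def k_def v_def)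
  have db0: "db \<noteq> 0" using d0 db by simp
  have EE: "E * cnj E = 1" and BB: "B * cnj B = 1" by (simp_all add: E_def B_def)
  define r where "r = 1 + k * v\<^sup>2"
  have r: "r = complex_of_real (1 + \<kappa> * (Y t)\<^sup>2)" by (simp add: r_def k_def v_def)
  have r0: "r \<noteq> 0" using y unfolding r by (simp only: of_real_eq_0_iff)
  have k0: "1 + k \<noteq> 0"
  proof -
    have "complex_of_real (1 + \<kappa>) \<noteq> 0" using \<kappa> by (simp only: of_real_eq_0_iff)
    then show ?thesis by (simp add: k_def)
  qed
  have Yc: "((\<lambda>t. complex_of_real (Y t)) has_vector_derivative r) (at t within S)"
    using has_vector_derivative_of_real[of Y "1 + \<kappa> * (Y t)\<^sup>2"] Y unfolding r
    by (simp add: has_real_derivative_iff_has_vector_derivative)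
  have D1: "((\<lambda>v. B * (1 - v * E) / (1 + k * v * E)) has_field_derivative
     - ((1 + k) * B * E / d\<^sup>2)) (at v within U)" for U
    using d0 by (auto intro!: derivative_eq_intros simp: d_def[symmetric]) (simp add: field_simps power2_eq_square d_def, simp add: minus_divide_left algebra_simps)
  have D2: "((\<lambda>v. - ((1 + k) * (1 + k * v\<^sup>2) * B * E) / (1 + k * v * E)\<^sup>2) has_field_derivative
     2 * k * (1 + k) * B * E * (E - v) / d ^ 3) (at v within U)" for U
  proof -
    have "((\<lambda>v. - ((1 + k) * (1 + k * v\<^sup>2) * B * E) / (1 + k * v * E)\<^sup>2) has_field_derivative
     (- ((1 + k) * (k * (2 * v)) * B * E) * d\<^sup>2 - (- ((1 + k) * (1 + k * v\<^sup>2) * B * E)) * (2 * d * (k * E))) / (d\<^sup>2 * d\<^sup>2)) (at v within U)"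
      using d0 by (auto intro!: derivative_eq_intros simp: d_def[symmetric]) (simp add: field_simps)
    also have "(- ((1 + k) * (k * (2 * v)) * B * E) * d\<^sup>2 - (- ((1 + k) * (1 + k * v\<^sup>2) * B * E)) * (2 * d * (k * E))) / (d\<^sup>2 * d\<^sup>2)
      = (2 * k * (1 + k) * B * E) * ((1 + k * v\<^sup>2) * E - v * d) / d ^ 3"
      using d0 by (simp add: field_simps power2_eq_square power3_eq_cube)
    also have "(1 + k * v\<^sup>2) * E - v * d = E - v"
      by (simp add: d_def power2_eq_square algebra_simps)
    finally show ?thesis .
  qed
  have P: "moebius_velocity (Y t) = - ((1 + k) * r * B * E) / d\<^sup>2"
    by (simp add: moebius_velocity_def r d_def v_def E_def k_def B_def)
  have M: "moebius (Y t) = B * (1 - v * E) / d"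
    by (simp add: moebius_def d_def v_def E_def k_def B_def)
  show "((\<lambda>t. moebius (Y t)) has_vector_derivative moebius_velocity (Y t)) (at t within S)"
    using field_vector_diff_chain_within[OF Yc D1[unfolded v_def]] unfolding P
    by (simp add: o_def moebius_def[abs_def] E_def k_def B_def mult_ac)
  \<comment> \<open>The conformal factor at the geodesic point, with the squared modulus of the
    denominator split into \<open>d\<close> and its conjugate so that it cancels below.\<close>
  have N: "complex_of_real (1 + \<kappa> * (cmod (moebius (Y t)))\<^sup>2) = (1 + k) * r / (d * db)"
  proof -
    have "complex_of_real (1 + 2 * \<kappa> * Y t * cos \<alpha> + \<kappa>\<^sup>2 * (Y t)\<^sup>2) = d * db"
      unfolding db complex_norm_square[symmetric] norm_den[symmetric]
      by (simp add: d_def k_def v_def E_def)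
    then show ?thesis
      by (simp only: moebius_factors(1)[OF y] of_real_divide of_real_mult r k_def of_real_add of_real_1)
  qed
  have "2 * k * (1 + k) * B * E * (E - v) / d ^ 3 * r =
     2 * k * cnj (moebius (Y t)) * (moebius_velocity (Y t))\<^sup>2 / complex_of_real (1 + \<kappa> * (cmod (moebius (Y t)))\<^sup>2)"
  proof -
    have "cnj (moebius (Y t)) = cnj B * (1 - v * cnj E) / db"
      by (simp add: M db v_def)
    then have "2 * k * cnj (moebius (Y t)) * (moebius_velocity (Y t))\<^sup>2 / complex_of_real (1 + \<kappa> * (cmod (moebius (Y t)))\<^sup>2)
      = 2 * k * (cnj B * (1 - v * cnj E) / db) * (- ((1 + k) * r * B * E) / d\<^sup>2)\<^sup>2 / ((1 + k) * r / (d * db))"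
      by (simp only: N P)
    also have "\<dots> = 2 * k * (1 + k) * r * (B * (B * cnj B)) * (E * (E * (1 - v * cnj E))) / d ^ 3"
    proof -
      have "2 * k * (b * u / db) * (- (c * r * B * E) / d\<^sup>2)\<^sup>2 / (c * r / (d * db))
        = 2 * k * c * r * (B * (B * b)) * (E * (E * u)) / d ^ 3" if "c \<noteq> 0" for b c u
        using d0 db0 r0 that by (simp add: field_simps power2_eq_square power3_eq_cube)
      from this[OF k0] show ?thesis .
    qed
    also have "E * (E * (1 - v * cnj E)) = E * (E - v * (E * cnj E))" by (simp add: algebra_simps)
    finally show ?thesis by (simp add: EE BB mult_ac)
  qed
  then show "((\<lambda>t. moebius_velocity (Y t)) has_vector_derivative
      2 * complex_of_real \<kappa> * cnj (moebius (Y t)) * (moebius_velocity (Y t))\<^sup>2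
         / complex_of_real (1 + \<kappa> * (cmod (moebius (Y t)))\<^sup>2)) (at t within S)"
    using field_vector_diff_chain_within[OF Yc D2[unfolded v_def]]
    by (simp add: o_def moebius_velocity_def[abs_def] E_def k_def B_def v_def mult_ac)
qed

lemma norm_moebius_velocity:
  assumes y: "0 \<le> y" "1 + \<kappa> * y\<^sup>2 > 0"
  shows "cmod (moebius_velocity y) = 1 + \<kappa> * (cmod (moebius y))\<^sup>2"
proof -
  have "0 \<le> (1 + \<kappa>) * (1 + \<kappa> * y\<^sup>2)" using \<kappa> y by simp
  then have "cmod (complex_of_real ((1 + \<kappa>) * (1 + \<kappa> * y\<^sup>2)) * cis \<beta> * cis \<alpha>) = (1 + \<kappa>) * (1 + \<kappa> * y\<^sup>2)"
    by (simp only: norm_mult norm_cis norm_of_real mult_1_right abs_of_nonneg)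
  then show ?thesis
    unfolding moebius_factors(1)[OF y] moebius_velocity_def norm_divide norm_power norm_den norm_minus_cancel
    by simp
qed

end

lemma cos_nonneg_pi_half:
  assumes "\<bar>\<alpha>\<bar> \<le> pi / 2" shows "cos \<alpha> \<ge> 0"
  using assms by (intro cos_ge_zero) linarith+

lemma moebius_flow:
  assumes \<kappa>: "-1 < \<kappa>" "\<kappa> < 1" and c: "cos \<alpha> \<ge> 0"
    and Y: "\<And>t. t \<in> {0..T} \<Longrightarrow> (Y has_real_derivative 1 + \<kappa> * (Y t)\<^sup>2) (at t)"
    and y: "\<And>t. t \<in> {0..T} \<Longrightarrow> 0 \<le> Y t" "\<And>t. t \<in> {0..T} \<Longrightarrow> 1 + \<kappa> * (Y t)\<^sup>2 > 0"
  shows "geodesic_flow \<kappa> T (\<lambda>t. moebius \<kappa> \<beta> \<alpha> (Y t)) (\<lambda>t. moebius_velocity \<kappa> \<beta> \<alpha> (Y t))"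
  unfolding geodesic_flow_def
proof
  fix t assume t: "t \<in> {0..T}"
  have Yt: "(Y has_real_derivative 1 + \<kappa> * (Y t)\<^sup>2) (at t within {0..T})"
    by (rule DERIV_subset[OF Y[OF t] subset_UNIV])
  have "1 + \<kappa> * (cmod (moebius \<kappa> \<beta> \<alpha> (Y t)))\<^sup>2 > 0"
    unfolding moebius_factors(1)[OF \<kappa> c y[OF t]] using den_pos[OF \<kappa> c y[OF t]] \<kappa> y[OF t] by simp
  then show "1 + \<kappa> * (cmod (moebius \<kappa> \<beta> \<alpha> (Y t)))\<^sup>2 > 0 \<and>
     ((\<lambda>t. moebius \<kappa> \<beta> \<alpha> (Y t)) has_vector_derivative moebius_velocity \<kappa> \<beta> \<alpha> (Y t)) (at t within {0..T}) \<and>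
     ((\<lambda>t. moebius_velocity \<kappa> \<beta> \<alpha> (Y t)) has_vector_derivative
        2 * complex_of_real \<kappa> * cnj (moebius \<kappa> \<beta> \<alpha> (Y t)) * (moebius_velocity \<kappa> \<beta> \<alpha> (Y t))\<^sup>2
         / complex_of_real (1 + \<kappa> * (cmod (moebius \<kappa> \<beta> \<alpha> (Y t)))\<^sup>2)) (at t within {0..T}) \<and>
     cmod (moebius_velocity \<kappa> \<beta> \<alpha> (Y t)) = 1 + \<kappa> * (cmod (moebius \<kappa> \<beta> \<alpha> (Y t)))\<^sup>2"
    using moebius_deriv[OF \<kappa> c Yt y[OF t]] norm_moebius_velocity[OF \<kappa> c y[OF t]] by simp
qed

text \<open>Uniqueness identifies every unit-speed geodesic with the explicit one. The supremum
  defining the exit time is therefore attained at the time \<open>\<tau>\<close> at which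
  \<open>Y\<close> reaches the exit parameter, and the chosen geodesic agrees with the explicit one
  up to that time.\<close>

lemma xray_moebius:
  assumes \<kappa>: "-1 < \<kappa>" "\<kappa> < 1" and \<alpha>: "\<bar>\<alpha>\<bar> \<le> pi / 2"
  obtains \<tau> Y where "0 \<le> \<tau>" "Y 0 = 0" "Y \<tau> = 2 * cos \<alpha> / (1 - \<kappa>)"
    "\<And>t. t \<in> {0..\<tau>} \<Longrightarrow> (Y has_real_derivative 1 + \<kappa> * (Y t)\<^sup>2) (at t)"
    "\<And>t. t \<in> {0..\<tau>} \<Longrightarrow> 0 \<le> Y t" "\<And>t. t \<in> {0..\<tau>} \<Longrightarrow> Y t \<le> 2 * cos \<alpha> / (1 - \<kappa>)"
    "\<And>t. t \<in> {0..\<tau>} \<Longrightarrow> 1 + \<kappa> * (Y t)\<^sup>2 > 0"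
    "\<And>f. xray \<kappa> f (fan_beam \<kappa> (\<beta>, \<alpha>)) = (LINT t:{0..\<tau>}|lborel. f (moebius \<kappa> \<beta> \<alpha> (Y t)))"
proof -
  note c = cos_nonneg_pi_half[OF \<alpha>]
  define ys where "ys = 2 * cos \<alpha> / (1 - \<kappa>)"
  have ys0: "ys \<ge> 0" using c \<kappa> by (simp add: ys_def)
  have ys1: "1 + \<kappa> * ys\<^sup>2 > 0"
  proof (cases "\<kappa> \<ge> 0")
    case True
    then have "0 \<le> \<kappa> * ys\<^sup>2" by simp
    then show ?thesis by linarith
  next
    case False
    \<comment> \<open>The worst case is cos alpha = 1, where the difference (1-kappa)^2 + 4 kappa
      equals (1+kappa)^2.\<close>
    have "- 4 * \<kappa> * (cos \<alpha>)\<^sup>2 \<le> - 4 * \<kappa> * 1"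
      using False c by (intro mult_left_mono) (auto intro: power_le_one)
    also have "\<dots> < (1 - \<kappa>)\<^sup>2"
    proof -
      have "0 < (1 + \<kappa>)\<^sup>2" using \<kappa> by simp
      then show ?thesis by (simp add: power2_eq_square algebra_simps)
    qed
    finally show ?thesis using \<kappa> by (simp add: ys_def power_divide field_simps)
  qed
  \<comment> \<open>A little room beyond the exit parameter: the explicit geodesic must visibly
    leave the disk for the maximality of the exit time to be provable.\<close>
  obtain y1 where y1: "ys < y1" "1 + \<kappa> * y1\<^sup>2 > 0"
  proof -
    have "((\<lambda>y. 1 + \<kappa> * y\<^sup>2) \<longlongrightarrow> 1 + \<kappa> * ys\<^sup>2) (at_right ys)"
      by (intro tendsto_intros)
    from order_tendstoD(1)[OF this ys1] eventually_at_right_less[of ys]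
    have "\<forall>\<^sub>F y in at_right ys. ys < y \<and> 0 < 1 + \<kappa> * y\<^sup>2"
      by eventually_elim simp
    then have "\<exists>y. ys < y \<and> 0 < 1 + \<kappa> * y\<^sup>2"
      by (rule eventually_happens'[rotated]) simp
    then show thesis using that by blast
  qed
  obtain T Y where T: "0 \<le> T" and Y0: "Y 0 = 0" and YT: "Y T = y1"
    and Yd: "\<And>t. t \<in> {0..T} \<Longrightarrow> (Y has_real_derivative 1 + \<kappa> * (Y t)\<^sup>2) (at t)"
    and Ym: "\<And>s t. 0 \<le> s \<Longrightarrow> s < t \<Longrightarrow> t \<le> T \<Longrightarrow> Y s < Y t"
    by (rule riccati_solution[of y1 \<kappa>]) (use y1 ys0 in auto)
  have mono: "Y s \<le> Y t" if "0 \<le> s" "s \<le> t" "t \<le> T" for s t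
    using Ym[of s t] that by (cases "s = t") auto
  have "\<exists>x\<ge>0. x \<le> T \<and> Y x = ys"
    using T Y0 YT ys0 y1 Yd DERIV_isCont by (intro IVT) auto
  then obtain \<tau> where \<tau>: "0 \<le> \<tau>" "\<tau> \<le> T" "Y \<tau> = ys" by blast
  have pos: "1 + \<kappa> * (Y t)\<^sup>2 > 0" if "t \<in> {0..T}" for t
  proof (cases "\<kappa> \<ge> 0")
    case True
    then have "0 \<le> \<kappa> * (Y t)\<^sup>2" by simp
    then show ?thesis by linarith
  next
    case False
    have "0 \<le> Y t" "Y t \<le> y1" using mono[of 0 t] mono[of t T] that Y0 YT by auto
    then have "(Y t)\<^sup>2 \<le> y1\<^sup>2" by (intro power_mono)
    then have "\<kappa> * y1\<^sup>2 \<le> \<kappa> * (Y t)\<^sup>2" using False by (intro mult_left_mono_neg) auto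
    then show ?thesis using y1 by linarith
  qed
  have nn: "0 \<le> Y t" if "t \<in> {0..T}" for t using mono[of 0 t] that Y0 by simp
  let ?x = "cis \<beta>" and ?v = "complex_of_real (1 + \<kappa>) * cis (\<beta> + pi + \<alpha>)"
  let ?G = "\<lambda>t. moebius \<kappa> \<beta> \<alpha> (Y t)" and ?P = "\<lambda>t. moebius_velocity \<kappa> \<beta> \<alpha> (Y t)"
  have flow: "geodesic_flow \<kappa> S ?G ?P" if "S \<le> T" for S
    by (rule moebius_flow[OF \<kappa> c]) (use that nn pos Yd in auto)
  have init: "?G 0 = ?x" "?P 0 = ?v"
  proof -
    show "?G 0 = ?x" by (simp add: Y0 moebius_def[OF \<kappa> c])
    have "cis (\<beta> + pi + \<alpha>) = - (cis \<beta> * cis \<alpha>)"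
      by (simp add: cis_mult[symmetric])
    then show "?P 0 = ?v" by (simp add: Y0 moebius_velocity_def[OF \<kappa> c] mult_ac)
  qed
  \<comment> \<open>This makes the result independent of the choice hidden in
    \<open>geodesic\<close>.\<close>
  have same: "\<gamma> t = ?G t" if us: "unit_speed_geodesic (metric \<kappa>) (cball 0 1) ?x ?v S \<gamma>" "S \<le> T" "t \<in> {0..S}" for \<gamma> S t
  proof -
    obtain p where "\<gamma> 0 = ?x" "p 0 = ?v" "geodesic_flow \<kappa> S \<gamma> p"
      using us unfolding unit_speed_geodesic_iff[OF \<kappa>] by blast
    then show ?thesis
      using geodesic_flow_unique[OF _ flow[OF that(2)] _ _ that(3)] init by simp
  qed
  have geo: "unit_speed_geodesic (metric \<kappa>) (cball 0 1) ?x ?v \<tau> ?G"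
    unfolding unit_speed_geodesic_iff[OF \<kappa>]
  proof (intro exI[of _ ?P] conjI init flow \<tau> ballI)
    fix t assume t: "t \<in> {0..\<tau>}"
    then have tT: "t \<in> {0..T}" using \<tau> by simp
    show "cmod (?G t) \<le> 1"
      using norm_moebius_le_1_iff[OF \<kappa> c nn[OF tT] pos[OF tT]] mono[of t \<tau>] t \<tau> by (simp add: ys_def)
  qed
  have max: "S \<le> \<tau>" if us: "0 \<le> S" "unit_speed_geodesic (metric \<kappa>) (cball 0 1) ?x ?v S \<gamma>" for S \<gamma>
  proof (rule ccontr)
    assume "\<not> S \<le> \<tau>"
    then have S: "\<tau> < S" by simp
    \<comment> \<open>The explicit geodesic is known only up to \<open>T\<close>, so the competitor
      is cut there. Since \<open>Y\<close> takes the value \<open>y1\<close> > \<open>ys\<close> at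
      \<open>T\<close>, the cut time still lies beyond \<open>\<tau>\<close>.\<close>
    define S' where "S' = min S T"
    have "\<tau> \<noteq> T" using \<tau> YT y1 by auto
    then have S': "\<tau> < S'" "S' \<le> S" "S' \<le> T" using S \<tau> by (auto simp: S'_def)
    obtain p where p: "\<gamma> 0 = ?x" "p 0 = ?v" "geodesic_flow \<kappa> S \<gamma> p" "\<forall>t\<in>{0..S}. cmod (\<gamma> t) \<le> 1"
      using us(2) unfolding unit_speed_geodesic_iff[OF \<kappa>] by blast
    have sub: "{0..S'} \<subseteq> {0..S}" using S' by auto
    have "geodesic_flow \<kappa> S' \<gamma> p"
      unfolding geodesic_flow_def
    proof
      fix t assume "t \<in> {0..S'}"
      with sub have "t \<in> {0..S}" by blast
      from bspec[OF p(3)[unfolded geodesic_flow_def] this]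
      show "1 + \<kappa> * (cmod (\<gamma> t))\<^sup>2 > 0 \<and>
         (\<gamma> has_vector_derivative p t) (at t within {0..S'}) \<and>
         (p has_vector_derivative 2 * complex_of_real \<kappa> * cnj (\<gamma> t) * (p t)\<^sup>2
             / complex_of_real (1 + \<kappa> * (cmod (\<gamma> t))\<^sup>2)) (at t within {0..S'}) \<and>
         cmod (p t) = 1 + \<kappa> * (cmod (\<gamma> t))\<^sup>2"
        using has_vector_derivative_within_subset[OF _ sub] by blast
    qed
    then have "unit_speed_geodesic (metric \<kappa>) (cball 0 1) ?x ?v S' \<gamma>"
      unfolding unit_speed_geodesic_iff[OF \<kappa>] using p sub by blast
    then have "\<gamma> S' = ?G S'" by (rule same) (use S' \<tau> in auto)
    moreover have "cmod (\<gamma> S') \<le> 1" using p(4) S' \<tau> by auto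
    ultimately have "cmod (?G S') \<le> 1" by simp
    moreover have S'T: "S' \<in> {0..T}" using S' \<tau> by simp
    ultimately have "Y S' \<le> ys"
      using norm_moebius_le_1_iff[OF \<kappa> c nn[OF S'T] pos[OF S'T]] by (simp add: ys_def)
    \<comment> \<open>Strict monotonicity of \<open>Y\<close> contradicts staying in the disk after
      the exit parameter.\<close>
    moreover have "ys < Y S'" using Ym[of \<tau> S'] \<tau> S' by simp
    ultimately show False by simp
  qed
  have ex: "exit_time (metric \<kappa>) (cball 0 1) (?x, ?v) = \<tau>"
    unfolding exit_time_def case_prod_conv
    by (rule cSup_eq_maximum) (use \<tau> geo max in auto)
  have gam: "geodesic (metric \<kappa>) (cball 0 1) (?x, ?v) t = ?G t" if "t \<in> {0..\<tau>}" for t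
  proof (rule same[OF _ \<tau>(2) that])
    show "unit_speed_geodesic (metric \<kappa>) (cball 0 1) ?x ?v \<tau> (geodesic (metric \<kappa>) (cball 0 1) (?x, ?v))"
      unfolding geodesic_def case_prod_conv ex by (rule someI[of _ ?G]) (rule geo)
  qed
  show thesis
  proof (rule that[of \<tau> Y, OF \<tau>(1) Y0])
    show "xray \<kappa> f (fan_beam \<kappa> (\<beta>, \<alpha>)) = (LINT t:{0..\<tau>}|lborel. f (?G t))" for f
      unfolding xray_def fan_beam_def case_prod_conv ex
      by (rule set_lebesgue_integral_cong) (use gam in auto)
  qed (use \<tau> Yd nn pos mono[of _ \<tau>] in \<open>auto simp: ys_def\<close>)
qed

text \<open>Derived from an equality of measures: the density \<open>g'\<close> on [a, b] pushes
  forward under \<open>g\<close> to Lebesgue measure on the image interval. Bochner integrals then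
  transform for every Borel integrand, integrable or not, as is required along exceptional
  geodesics.\<close>

lemma set_integral_substitution:
  fixes f :: "real \<Rightarrow> complex"
  assumes f: "f \<in> borel_measurable borel"
    and g: "\<And>x. x \<in> {a..b} \<Longrightarrow> (g has_real_derivative g' x) (at x)"
    and g': "continuous_on {a..b} g'" "\<And>x. x \<in> {a..b} \<Longrightarrow> g' x \<ge> 0" and ab: "a \<le> b"
  shows "(LINT x:{g a..g b}|lborel. f x) = (LINT x:{a..b}|lborel. complex_of_real (g' x) * f (g x))"
\<comment> \<open>The degenerate interval belongs to tangential directions, whose geodesics have
  length zero.\<close>
proof (cases "a = b")
  case True
  have "(LINT x:{c..c}|lborel. h x) = 0" for c :: real and h :: "real \<Rightarrow> complex"
    unfolding set_lebesgue_integral_def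
  proof (rule integral_eq_zero_AE)
    show "AE x in lborel. indicat_real {c..c} x *\<^sub>R h x = 0"
      using AE_lborel_singleton[of c] by eventually_elim (simp add: indicator_def)
  qed
  then show ?thesis using True by simp
next
  case False
  with ab have ab: "a < b" by simp
  \<comment> \<open>Clamping to [a, b] extends \<open>g\<close> and \<open>g'\<close> to continuous,
    hence measurable, functions on the line without changing them on the interval.\<close>
  define cl where "cl = (\<lambda>x. max a (min b x))"
  define G where "G = (\<lambda>x. g (cl x))"
  define G' where "G' = (\<lambda>x. g' (cl x))"
  have cl: "cl x \<in> {a..b}" "x \<in> {a..b} \<Longrightarrow> cl x = x" for x using ab by (auto simp: cl_def)
  have clc: "continuous_on UNIV cl" unfolding cl_def by (intro continuous_intros)
  have gc: "continuous_on {a..b} g"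
    using g DERIV_isCont by (intro continuous_at_imp_continuous_on) blast
  have "continuous_on UNIV G" unfolding G_def
    by (rule continuous_on_compose2[OF gc clc]) (use cl in auto)
  then have [measurable]: "G \<in> borel_measurable borel" by (rule borel_measurable_continuous_onI)
  have "continuous_on UNIV G'" unfolding G'_def
    by (rule continuous_on_compose2[OF g'(1) clc]) (use cl in auto)
  then have [measurable]: "G' \<in> borel_measurable borel" by (rule borel_measurable_continuous_onI)
  have G'0: "G' x \<ge> 0" for x using g'(2) cl(1) by (simp add: G'_def)
  let ?L = "density lborel (\<lambda>x. ennreal (indicator {g a..g b} x))"
  let ?R = "density lborel (\<lambda>x. ennreal (G' x * indicator {a..b} x))"
  have eq: "distr ?R lborel G = ?L"
  proof (rule measure_eqI)
    fix A :: "real set" assume "A \<in> sets (distr ?R lborel G)"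
    then have [measurable]: "A \<in> sets borel" by simp
    have "emeasure (distr ?R lborel G) A = (\<integral>\<^sup>+x. ennreal (G' x * indicator {a..b} x) * indicator (G -` A) x \<partial>lborel)"
    proof -
      have "G -` A \<in> sets borel" using measurable_sets[of G borel borel A] by simp
      then show ?thesis by (simp add: emeasure_distr emeasure_density)
    qed
    also have "\<dots> = (\<integral>\<^sup>+x. indicator A (g x) * ennreal (g' x) * indicator {a..b} x \<partial>lborel)"
      by (intro nn_integral_cong) (auto simp: indicator_def cl G_def G'_def)
    also have "\<dots> = (\<integral>\<^sup>+x. indicator A x * indicator {g a..g b} x \<partial>lborel)"
      by (rule nn_integral_substitution_aux[symmetric, OF _ _ g g' ab]) auto
    also have "\<dots> = emeasure ?L A"
      by (simp add: emeasure_density mult.commute ennreal_indicator)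
    finally show "emeasure (distr ?R lborel G) A = emeasure ?L A" .
  qed simp
  have "(LINT x:{g a..g b}|lborel. f x) = (\<integral>x. f x \<partial>?L)"
    unfolding set_lebesgue_integral_def using f by (subst integral_density) auto
  also have "\<dots> = (\<integral>x. f (G x) \<partial>?R)"
    unfolding eq[symmetric] using f by (subst integral_distr) auto
  also have "\<dots> = (\<integral>x. (G' x * indicator {a..b} x) *\<^sub>R f (G x) \<partial>lborel)"
  proof (rule integral_density)
    show "(\<lambda>x. f (G x)) \<in> borel_measurable lborel"
      using measurable_compose[of G borel borel f] f by simp
  qed (use G'0 in auto)
  also have "\<dots> = (LINT x:{a..b}|lborel. complex_of_real (g' x) * f (g x))"
    unfolding set_lebesgue_integral_def
    by (intro Bochner_Integration.integral_cong refl)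
       (auto simp: indicator_def cl G_def G'_def scaleR_conv_of_real)
  finally show ?thesis .
qed

section \<open>Straightening geodesics into chords\<close>

definition proj :: "real \<Rightarrow> complex \<Rightarrow> complex" where
  "proj \<kappa> z = complex_of_real ((1 - \<kappa>) / (1 - \<kappa> * (cmod z)\<^sup>2)) * z"

text \<open>For given rho = |proj z| the radius r solves kappa rho r^2 + (1-kappa) r - rho = 0. The
  root is written in rationalised form, so that kappa = 0 and z = 0 need no separate
  treatment.\<close>

definition unproj :: "real \<Rightarrow> complex \<Rightarrow> complex" where
  "unproj \<kappa> z = complex_of_real (2 / (1 - \<kappa> + sqrt ((1 - \<kappa>)\<^sup>2 + 4 * \<kappa> * (cmod z)\<^sup>2))) * z"

text \<open>The function \<open>H\<close> with \<open>h = weight \<kappa> \<cdot> (H \<circ> proj \<kappa>)\<close> on the disk; \<open>unproj \<kappa>\<close> is the inverse of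
  \<open>proj \<kappa>\<close> only there.\<close>

definition flatten :: "real \<Rightarrow> (complex \<Rightarrow> complex) \<Rightarrow> complex \<Rightarrow> complex" where
  "flatten \<kappa> h z = (if cmod z \<le> 1 \<and> cmod (unproj \<kappa> z) \<le> 1
     then h (unproj \<kappa> z) / complex_of_real (weight \<kappa> (unproj \<kappa> z)) else 0)"

text \<open>The point at Euclidean distance \<open>r\<close> from the boundary point with angle
  \<open>\<beta>\<close>, in the direction making angle \<open>s\<close> with the inward normal. The
  chord ends at r = 2 cos s.\<close>

definition chord :: "real \<Rightarrow> real \<Rightarrow> real \<Rightarrow> complex" where
  "chord \<beta> s r = cis \<beta> * (1 - complex_of_real r * cis s)"

lemma weight_pos:
  assumes "-1 < \<kappa>" "\<kappa> < 1" "cmod z \<le> 1"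
  shows "weight \<kappa> z > 0"
  using curvature_factor_pos[OF assms] by (simp add: weight_def)

text \<open>The inequality (1-kappa) |z| <= 1 - kappa |z|^2 is the nonnegativity of (1 - |z|)(1 +
  kappa |z|).\<close>

lemma norm_proj_le_1:
  assumes \<kappa>: "-1 < \<kappa>" "\<kappa> < 1" and z: "cmod z \<le> 1"
  shows "cmod (proj \<kappa> z) \<le> 1"
proof -
  note p = curvature_factor_pos(2)[OF \<kappa> z]
  have "0 \<le> (1 - cmod z) * (1 + \<kappa> * cmod z)"
  proof (rule mult_nonneg_nonneg)
    have "\<bar>\<kappa> * cmod z\<bar> \<le> 1 * 1" unfolding abs_mult by (intro mult_mono) (use \<kappa> z in auto)
    then show "0 \<le> 1 + \<kappa> * cmod z" by linarith
  qed (use z in simp)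
  then have "(1 - \<kappa>) * cmod z \<le> 1 - \<kappa> * (cmod z)\<^sup>2"
    by (simp add: power2_eq_square algebra_simps)
  moreover have "cmod (proj \<kappa> z) = (1 - \<kappa>) * cmod z / (1 - \<kappa> * (cmod z)\<^sup>2)"
    unfolding proj_def norm_mult norm_of_real using p \<kappa> by simp
  ultimately show ?thesis using p by simp
qed

text \<open>The discriminant is a perfect square on the image, since (1 - kappa |z|^2)^2 + 4 kappa
  |z|^2 = (1 + kappa |z|^2)^2.\<close>

lemma unproj_proj:
  assumes \<kappa>: "-1 < \<kappa>" "\<kappa> < 1" and z: "cmod z \<le> 1"
  shows "unproj \<kappa> (proj \<kappa> z) = z"
proof -
  define q where "q = 1 - \<kappa> * (cmod z)\<^sup>2"
  have q: "q > 0" "1 + \<kappa> * (cmod z)\<^sup>2 > 0" using curvature_factor_pos[OF \<kappa> z] by (auto simp: q_def)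
  have pz: "proj \<kappa> z = complex_of_real ((1 - \<kappa>) / q) * z" by (simp add: proj_def q_def)
  have "cmod (proj \<kappa> z) = (1 - \<kappa>) / q * cmod z"
    unfolding pz norm_mult norm_of_real using q \<kappa> by simp
  then have "(cmod (proj \<kappa> z))\<^sup>2 = (1 - \<kappa>)\<^sup>2 / q\<^sup>2 * (cmod z)\<^sup>2"
    by (simp add: power_mult_distrib power_divide)
  then have "(1 - \<kappa>)\<^sup>2 + 4 * \<kappa> * (cmod (proj \<kappa> z))\<^sup>2 = (1 - \<kappa>)\<^sup>2 * (q\<^sup>2 + 4 * \<kappa> * (cmod z)\<^sup>2) / q\<^sup>2"
    using q by (simp add: distrib_left add_divide_distrib)
  also have "q\<^sup>2 + 4 * \<kappa> * (cmod z)\<^sup>2 = (1 + \<kappa> * (cmod z)\<^sup>2)\<^sup>2"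
    by (simp add: q_def power2_eq_square algebra_simps)
  also have "(1 - \<kappa>)\<^sup>2 * (1 + \<kappa> * (cmod z)\<^sup>2)\<^sup>2 / q\<^sup>2 = ((1 - \<kappa>) * (1 + \<kappa> * (cmod z)\<^sup>2) / q)\<^sup>2"
    by (simp add: power_mult_distrib power_divide)
  finally have "sqrt ((1 - \<kappa>)\<^sup>2 + 4 * \<kappa> * (cmod (proj \<kappa> z))\<^sup>2) = (1 - \<kappa>) * (1 + \<kappa> * (cmod z)\<^sup>2) / q"
    using q \<kappa> by simp
  moreover have "1 - \<kappa> + (1 - \<kappa>) * (1 + \<kappa> * (cmod z)\<^sup>2) / q = 2 * (1 - \<kappa>) / q"
  proof -
    have "1 - \<kappa> + (1 - \<kappa>) * (1 + \<kappa> * (cmod z)\<^sup>2) / q = (1 - \<kappa>) * (q + (1 + \<kappa> * (cmod z)\<^sup>2)) / q"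
      using q by (simp add: field_simps)
    also have "q + (1 + \<kappa> * (cmod z)\<^sup>2) = 2" by (simp add: q_def)
    finally show ?thesis by simp
  qed
  ultimately have "unproj \<kappa> (proj \<kappa> z) = complex_of_real (2 / (2 * (1 - \<kappa>) / q)) * proj \<kappa> z"
    unfolding unproj_def by simp
  also have "\<dots> = complex_of_real (2 / (2 * (1 - \<kappa>) / q) * ((1 - \<kappa>) / q)) * z"
    by (simp only: pz of_real_mult mult.assoc)
  also have "2 / (2 * (1 - \<kappa>) / q) * ((1 - \<kappa>) / q) = 1" using q \<kappa> by simp
  finally show ?thesis by simp
qed

lemma flatten_proj:
  assumes \<kappa>: "-1 < \<kappa>" "\<kappa> < 1" and z: "cmod z \<le> 1"
  shows "flatten \<kappa> h (proj \<kappa> z) = h z / complex_of_real (weight \<kappa> z)"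
  using norm_proj_le_1[OF assms] z by (simp add: flatten_def unproj_proj[OF assms])

lemma flatten_measurable:
  assumes h: "h \<in> borel_measurable (restrict_space borel (cball 0 1))"
  shows "flatten \<kappa> h \<in> borel_measurable borel"
proof -
  define h' where "h' = (\<lambda>z. if cmod z \<le> 1 then h z else 0)"
  have "(\<lambda>z. indicator (cball 0 1) z *\<^sub>R h z) \<in> borel_measurable borel"
    using h by (subst (asm) borel_measurable_restrict_space_iff) auto
  also have "(\<lambda>z. indicator (cball 0 1) z *\<^sub>R h z) = h'"
    by (auto simp: h'_def indicator_def)
  finally have [measurable]: "h' \<in> borel_measurable borel" .
  have [measurable]: "unproj \<kappa> \<in> borel_measurable borel" "weight \<kappa> \<in> borel_measurable borel"
    unfolding unproj_def[abs_def] weight_def[abs_def] by measurable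
  have "flatten \<kappa> h = (\<lambda>z. if cmod z \<le> 1 \<and> cmod (unproj \<kappa> z) \<le> 1
     then h' (unproj \<kappa> z) / complex_of_real (weight \<kappa> (unproj \<kappa> z)) else 0)"
    by (auto simp: flatten_def h'_def)
  also have "\<dots> \<in> borel_measurable borel" by measurable
  finally show ?thesis .
qed

text \<open>The modulus of (1+kappa) cos alpha + i (1-kappa) sin alpha, whose argument is the
  scattering angle \<open>scat\<close>.\<close>

definition chord_factor :: "real \<Rightarrow> real \<Rightarrow> real" where
  "chord_factor \<kappa> \<alpha> = sqrt ((1 + \<kappa>)\<^sup>2 * (cos \<alpha>)\<^sup>2 + (1 - \<kappa>)\<^sup>2 * (sin \<alpha>)\<^sup>2)"

lemma chord_factor_sq:
  "(chord_factor \<kappa> \<alpha>)\<^sup>2 = (1 + \<kappa>)\<^sup>2 * (cos \<alpha>)\<^sup>2 + (1 - \<kappa>)\<^sup>2 * (sin \<alpha>)\<^sup>2"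
  by (simp add: chord_factor_def)

lemma chord_factor_pos:
  assumes \<kappa>: "-1 < \<kappa>" "\<kappa> < 1"
  shows "chord_factor \<kappa> \<alpha> > 0"
proof -
  have "0 < (1 + \<kappa>)\<^sup>2 * (cos \<alpha>)\<^sup>2 + (1 - \<kappa>)\<^sup>2 * (sin \<alpha>)\<^sup>2"
  proof (cases "cos \<alpha> = 0")
    case True
    then have "(sin \<alpha>)\<^sup>2 = 1" using sin_cos_squared_add[of \<alpha>] by simp
    then show ?thesis using True \<kappa> by simp
  next
    case False
    then show ?thesis using \<kappa> by (intro add_pos_nonneg mult_pos_pos) auto
  qed
  then show ?thesis by (simp add: chord_factor_def)
qed

lemma scat_trig:
  assumes \<kappa>: "-1 < \<kappa>" "\<kappa> < 1" and \<alpha>: "\<bar>\<alpha>\<bar> \<le> pi / 2"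
  shows "cos (scat \<kappa> \<alpha>) = (1 + \<kappa>) * cos \<alpha> / chord_factor \<kappa> \<alpha>"
    and "sin (scat \<kappa> \<alpha>) = (1 - \<kappa>) * sin \<alpha> / chord_factor \<kappa> \<alpha>"
    and "\<bar>scat \<kappa> \<alpha>\<bar> \<le> pi / 2"
proof -
  have "cos (scat \<kappa> \<alpha>) = (1 + \<kappa>) * cos \<alpha> / chord_factor \<kappa> \<alpha> \<and>
    sin (scat \<kappa> \<alpha>) = (1 - \<kappa>) * sin \<alpha> / chord_factor \<kappa> \<alpha> \<and> \<bar>scat \<kappa> \<alpha>\<bar> \<le> pi / 2"
  proof (cases "\<bar>\<alpha>\<bar> = pi / 2")
    case True
    then have c: "cos \<alpha> = 0" by (metis abs_if cos_minus cos_pi_half)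
    then have "(sin \<alpha>)\<^sup>2 = 1" using sin_cos_squared_add[of \<alpha>] by simp
    then have "chord_factor \<kappa> \<alpha> = 1 - \<kappa>" using \<kappa> c by (simp add: chord_factor_def)
    then show ?thesis using True c \<kappa> by (simp add: scat_def)
  next
    case False
    then have "\<bar>\<alpha>\<bar> < pi / 2" using \<alpha> by simp
    then have c: "cos \<alpha> > 0" by (intro cos_gt_zero_pi) linarith+
    define x where "x = (1 - \<kappa>) / (1 + \<kappa>) * tan \<alpha>"
    have s: "scat \<kappa> \<alpha> = arctan x" using False by (simp add: scat_def x_def)
    have "x = (1 - \<kappa>) * sin \<alpha> / ((1 + \<kappa>) * cos \<alpha>)" by (simp add: x_def tan_def)
    note x = this
    have "1 + x\<^sup>2 = (chord_factor \<kappa> \<alpha> / ((1 + \<kappa>) * cos \<alpha>))\<^sup>2"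
      unfolding power_divide chord_factor_sq power_mult_distrib x using \<kappa> c
      by (simp add: add_divide_distrib power_divide power_mult_distrib)
    then have sq: "sqrt (1 + x\<^sup>2) = chord_factor \<kappa> \<alpha> / ((1 + \<kappa>) * cos \<alpha>)"
      using \<kappa> c chord_factor_pos[OF \<kappa>, of \<alpha>] by simp
    show ?thesis
      unfolding s cos_arctan sin_arctan sq
    proof (intro conjI)
      have A: "(1 + \<kappa>) * cos \<alpha> \<noteq> 0" using \<kappa> c by simp
      then have "b / A' / (D' / A') = b / D'" if "A' = (1 + \<kappa>) * cos \<alpha>" for A' b D' :: real
        using that by simp
      then show "x / (chord_factor \<kappa> \<alpha> / ((1 + \<kappa>) * cos \<alpha>)) = (1 - \<kappa>) * sin \<alpha> / chord_factor \<kappa> \<alpha>"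
        unfolding x by blast
      show "\<bar>arctan x\<bar> \<le> pi / 2" using arctan_lbound[of x] arctan_ubound[of x] by linarith
    qed simp
  qed
  then show "cos (scat \<kappa> \<alpha>) = (1 + \<kappa>) * cos \<alpha> / chord_factor \<kappa> \<alpha>"
    "sin (scat \<kappa> \<alpha>) = (1 - \<kappa>) * sin \<alpha> / chord_factor \<kappa> \<alpha>" "\<bar>scat \<kappa> \<alpha>\<bar> \<le> pi / 2" by auto
qed

text \<open>Expanding the fraction by the conjugate denominator turns the numerator into Q -
  (1+kappa) y D e^{is}, with D the chord factor and s the scattering angle. Dividing by the real
  number Q leaves a point of the Euclidean chord with angle s.\<close>

lemma proj_moebius:
  assumes \<kappa>: "-1 < \<kappa>" "\<kappa> < 1" and \<alpha>: "\<bar>\<alpha>\<bar> \<le> pi / 2"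
    and y: "0 \<le> y" "1 + \<kappa> * y\<^sup>2 > 0" "cmod (moebius \<kappa> \<beta> \<alpha> y) \<le> 1"
  defines "Q \<equiv> 1 - \<kappa> + 4 * \<kappa> * y * cos \<alpha> - \<kappa> * (1 - \<kappa>) * y\<^sup>2"
  shows "Q > 0"
    and "weight \<kappa> (moebius \<kappa> \<beta> \<alpha> y) = (1 + \<kappa>) * (1 + \<kappa> * y\<^sup>2) / Q"
    and "proj \<kappa> (moebius \<kappa> \<beta> \<alpha> y) = chord \<beta> (scat \<kappa> \<alpha>) ((1 + \<kappa>) * chord_factor \<kappa> \<alpha> * y / Q)"
proof -
  note c = cos_nonneg_pi_half[OF \<alpha>]
  let ?M = "moebius \<kappa> \<beta> \<alpha> y"
  define n where "n = 1 + 2 * \<kappa> * y * cos \<alpha> + \<kappa>\<^sup>2 * y\<^sup>2"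
  have n: "n > 0" unfolding n_def by (rule den_pos[OF \<kappa> c y(1,2)])
  have f: "1 + \<kappa> * (cmod ?M)\<^sup>2 = (1 + \<kappa>) * (1 + \<kappa> * y\<^sup>2) / n" "1 - \<kappa> * (cmod ?M)\<^sup>2 = Q / n"
    using moebius_factors[OF \<kappa> c y(1,2)] by (simp_all add: n_def Q_def)
  show Q: "Q > 0"
    using curvature_factor_pos(2)[OF \<kappa> y(3)] n unfolding f(2) by (simp add: zero_less_divide_iff)
  show "weight \<kappa> ?M = (1 + \<kappa>) * (1 + \<kappa> * y\<^sup>2) / Q"
    unfolding weight_def f using n by simp
  define d where "d = 1 + complex_of_real (\<kappa> * y) * cis \<alpha>"
  have d0: "d \<noteq> 0" unfolding d_def by (rule den_nonzero[OF \<kappa> c y(1,2)])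
  have dd: "complex_of_real n = d * cnj d"
    unfolding complex_norm_square[symmetric] n_def d_def norm_den[OF \<kappa> c, symmetric] by simp
  have M: "?M = cis \<beta> * (1 - complex_of_real y * cis \<alpha>) / d"
    by (simp add: moebius_def[OF \<kappa> c] d_def)
  have "proj \<kappa> ?M = complex_of_real (1 - \<kappa>) * complex_of_real n / complex_of_real Q * ?M"
    unfolding proj_def f(2) by simp
  also have "\<dots> = cis \<beta> * (complex_of_real (1 - \<kappa>) * (1 - complex_of_real y * cis \<alpha>) * cnj d) / complex_of_real Q"
    unfolding M dd using d0 by (simp add: mult_ac)
  also have "complex_of_real (1 - \<kappa>) * (1 - complex_of_real y * cis \<alpha>) * cnj d =
     complex_of_real Q - complex_of_real ((1 + \<kappa>) * y) * Complex ((1 + \<kappa>) * cos \<alpha>) ((1 - \<kappa>) * sin \<alpha>)"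
  proof (rule complex_eqI)
    have "(1 - \<kappa>) * ((1 - y * cos \<alpha>) * (1 + \<kappa> * y * cos \<alpha>) - y * sin \<alpha> * (\<kappa> * y * sin \<alpha>)) =
      1 - \<kappa> + 4 * \<kappa> * y * cos \<alpha> - \<kappa> * (1 - \<kappa>) * y\<^sup>2 - (1 + \<kappa>) * y * ((1 + \<kappa>) * cos \<alpha>)"
      using sin_cos_squared_add[of \<alpha>] by algebra
    then show "Re (complex_of_real (1 - \<kappa>) * (1 - complex_of_real y * cis \<alpha>) * cnj d) =
      Re (complex_of_real Q - complex_of_real ((1 + \<kappa>) * y) * Complex ((1 + \<kappa>) * cos \<alpha>) ((1 - \<kappa>) * sin \<alpha>))"
      by (simp add: d_def Q_def algebra_simps)
    show "Im (complex_of_real (1 - \<kappa>) * (1 - complex_of_real y * cis \<alpha>) * cnj d) =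
      Im (complex_of_real Q - complex_of_real ((1 + \<kappa>) * y) * Complex ((1 + \<kappa>) * cos \<alpha>) ((1 - \<kappa>) * sin \<alpha>))"
      by (simp add: d_def Q_def algebra_simps)
  qed
  also have "Complex ((1 + \<kappa>) * cos \<alpha>) ((1 - \<kappa>) * sin \<alpha>) = complex_of_real (chord_factor \<kappa> \<alpha>) * cis (scat \<kappa> \<alpha>)"
    using chord_factor_pos[OF \<kappa>, of \<alpha>]
    by (simp add: complex_eq_iff scat_trig[OF \<kappa> \<alpha>])
  finally show "proj \<kappa> ?M = chord \<beta> (scat \<kappa> \<alpha>) ((1 + \<kappa>) * chord_factor \<kappa> \<alpha> * y / Q)"
    using Q by (simp add: chord_def diff_divide_distrib algebra_simps)
qed

text \<open>The chord parameter has derivative (1-kappa) D / (1+kappa) times the squared weight with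
  respect to arclength. \<open>flatten\<close> removes one weight from \<open>h\<close>, so exactly
  the integrand weight times \<open>h\<close> remains after substitution.\<close>

lemma I0_flatten:
  assumes \<kappa>: "-1 < \<kappa>" "\<kappa> < 1" and \<alpha>: "\<bar>\<alpha>\<bar> \<le> pi / 2"
    and h: "h \<in> borel_measurable (restrict_space borel (cball 0 1))"
  shows "I0 \<kappa> (\<lambda>z. complex_of_real (weight \<kappa> z) * h z) (\<beta>, \<alpha>) =
    complex_of_real ((1 + \<kappa>) / ((1 - \<kappa>) * chord_factor \<kappa> \<alpha>)) *
      (LINT r:{0..2 * cos (scat \<kappa> \<alpha>)}|lborel. flatten \<kappa> h (chord \<beta> (scat \<kappa> \<alpha>) r))"
proof -
  note c = cos_nonneg_pi_half[OF \<alpha>] and D = chord_factor_pos[OF \<kappa>, of \<alpha>]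
  let ?D = "chord_factor \<kappa> \<alpha>" and ?s = "scat \<kappa> \<alpha>"
  obtain \<tau> Y where \<tau>: "0 \<le> \<tau>" and Y0: "Y 0 = 0" and Y\<tau>: "Y \<tau> = 2 * cos \<alpha> / (1 - \<kappa>)"
    and Yd: "\<And>t. t \<in> {0..\<tau>} \<Longrightarrow> (Y has_real_derivative 1 + \<kappa> * (Y t)\<^sup>2) (at t)"
    and nn: "\<And>t. t \<in> {0..\<tau>} \<Longrightarrow> 0 \<le> Y t" and le: "\<And>t. t \<in> {0..\<tau>} \<Longrightarrow> Y t \<le> 2 * cos \<alpha> / (1 - \<kappa>)"
    and pos: "\<And>t. t \<in> {0..\<tau>} \<Longrightarrow> 1 + \<kappa> * (Y t)\<^sup>2 > 0"
    and x: "\<And>f. xray \<kappa> f (fan_beam \<kappa> (\<beta>, \<alpha>)) = (LINT t:{0..\<tau>}|lborel. f (moebius \<kappa> \<beta> \<alpha> (Y t)))"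
    by (rule xray_moebius[OF \<kappa> \<alpha>]) blast
  let ?M = "\<lambda>t. moebius \<kappa> \<beta> \<alpha> (Y t)"
  have M1: "cmod (?M t) \<le> 1" if "t \<in> {0..\<tau>}" for t
    using norm_moebius_le_1_iff[OF \<kappa> c nn[OF that] pos[OF that]] le[OF that] by simp
  define Q where "Q = (\<lambda>y. 1 - \<kappa> + 4 * \<kappa> * y * cos \<alpha> - \<kappa> * (1 - \<kappa>) * y\<^sup>2)"
  have pm: "Q (Y t) > 0" "weight \<kappa> (?M t) = (1 + \<kappa>) * (1 + \<kappa> * (Y t)\<^sup>2) / Q (Y t)"
    "proj \<kappa> (?M t) = chord \<beta> ?s ((1 + \<kappa>) * ?D * Y t / Q (Y t))" if t: "t \<in> {0..\<tau>}" for t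
    unfolding Q_def using proj_moebius[OF \<kappa> \<alpha> nn[OF t] pos[OF t] M1[OF t]] .
  define g where "g = (\<lambda>t. (1 + \<kappa>) * ?D * Y t / Q (Y t))"
  \<comment> \<open>The squared factor is the weight at the geodesic point, in terms of
    \<open>Y\<close>.\<close>
  define g' where "g' = (\<lambda>t. (1 - \<kappa>) * ?D / (1 + \<kappa>) * ((1 + \<kappa>) * (1 + \<kappa> * (Y t)\<^sup>2) / Q (Y t))\<^sup>2)"
  have Yc: "continuous_on {0..\<tau>} Y"
    using Yd DERIV_isCont by (intro continuous_at_imp_continuous_on) blast
  note Qpos = pm(1)
  have Qc: "continuous_on {0..\<tau>} (\<lambda>t. Q (Y t))"
    unfolding Q_def by (intro continuous_intros Yc)
  have g0: "g 0 = 0" by (simp add: g_def Y0)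
  \<comment> \<open>At the exit (1-kappa) Q is the squared chord factor, which turns the exit
    parameter into the Euclidean chord length.\<close>
  have g\<tau>: "g \<tau> = 2 * cos ?s"
  proof -
    have e: "(1 - \<kappa>) * Y \<tau> = 2 * cos \<alpha>" using \<kappa> by (simp add: Y\<tau>)
    have "(1 - \<kappa>) * Q (Y \<tau>) = (1 - \<kappa>)\<^sup>2 + 4 * \<kappa> * ((1 - \<kappa>) * Y \<tau>) * cos \<alpha> - \<kappa> * ((1 - \<kappa>) * Y \<tau>)\<^sup>2"
      unfolding Q_def by (simp add: power2_eq_square algebra_simps)
    also have "\<dots> = (1 - \<kappa>)\<^sup>2 + 4 * \<kappa> * (cos \<alpha>)\<^sup>2"
      unfolding e by (simp add: power2_eq_square)
    also have "\<dots> = ?D\<^sup>2"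
      unfolding chord_factor_sq using sin_cos_squared_add[of \<alpha>] by algebra
    finally have "Q (Y \<tau>) = ?D\<^sup>2 / (1 - \<kappa>)" using \<kappa> by (simp add: field_simps)
    then show ?thesis unfolding g_def scat_trig(1)[OF \<kappa> \<alpha>] using D \<kappa>
      by (simp add: Y\<tau> power2_eq_square)
  qed
  have gd: "(g has_real_derivative g' t) (at t)" if t: "t \<in> {0..\<tau>}" for t
  proof -
    let ?y = "Y t" and ?r = "1 + \<kappa> * (Y t)\<^sup>2"
    have "(g has_real_derivative ((1 + \<kappa>) * ?D * ?r * Q ?y - (1 + \<kappa>) * ?D * ?y * (4 * \<kappa> * cos \<alpha> * ?r - 2 * \<kappa> * (1 - \<kappa>) * ?y * ?r)) / (Q ?y)\<^sup>2) (at t)"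
      unfolding g_def Q_def
      by (rule derivative_eq_intros Yd[OF t] refl)+
         (use Qpos[OF t] in \<open>simp_all add: Q_def power2_eq_square algebra_simps\<close>)
    also have "(1 + \<kappa>) * ?D * ?r * Q ?y - (1 + \<kappa>) * ?D * ?y * (4 * \<kappa> * cos \<alpha> * ?r - 2 * \<kappa> * (1 - \<kappa>) * ?y * ?r)
      = (1 + \<kappa>) * ?D * ?r * ((1 - \<kappa>) * ?r)"
      by (simp add: Q_def power2_eq_square algebra_simps)
    also have "\<dots> / (Q ?y)\<^sup>2 = g' t"
      using \<kappa> Qpos[OF t] by (simp add: g'_def power2_eq_square)
    finally show ?thesis .
  qed
  have "(LINT r:{g 0..g \<tau>}|lborel. flatten \<kappa> h (chord \<beta> ?s r)) =
      (LINT t:{0..\<tau>}|lborel. complex_of_real (g' t) * flatten \<kappa> h (chord \<beta> ?s (g t)))"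
  proof (rule set_integral_substitution[OF _ gd])
    have "(\<lambda>r. chord \<beta> ?s r) \<in> borel_measurable borel"
      unfolding chord_def by measurable
    then show "(\<lambda>r. flatten \<kappa> h (chord \<beta> ?s r)) \<in> borel_measurable borel"
      using flatten_measurable[OF h] by (rule measurable_compose)
    show "continuous_on {0..\<tau>} g'"
      unfolding g'_def using Qpos by (intro continuous_intros Yc Qc) force
    show "0 \<le> g' t" for t using \<kappa> D by (simp add: g'_def)
  qed (use \<tau> in auto)
  also have "\<dots> = (LINT t:{0..\<tau>}|lborel. complex_of_real ((1 - \<kappa>) * ?D / (1 + \<kappa>)) *
       (complex_of_real (weight \<kappa> (?M t)) * h (?M t)))"
  proof (rule set_lebesgue_integral_cong)
    show "\<forall>t. t \<in> {0..\<tau>} \<longrightarrow> complex_of_real (g' t) * flatten \<kappa> h (chord \<beta> ?s (g t)) =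
      complex_of_real ((1 - \<kappa>) * ?D / (1 + \<kappa>)) * (complex_of_real (weight \<kappa> (?M t)) * h (?M t))"
    proof (intro allI impI)
      fix t assume t: "t \<in> {0..\<tau>}"
      have w: "weight \<kappa> (?M t) > 0" by (rule weight_pos[OF \<kappa> M1[OF t]])
      have "flatten \<kappa> h (chord \<beta> ?s (g t)) = h (?M t) / complex_of_real (weight \<kappa> (?M t))"
        unfolding g_def using pm(3)[OF t] flatten_proj[OF \<kappa> M1[OF t]] by simp
      moreover have "g' t = (1 - \<kappa>) * ?D / (1 + \<kappa>) * (weight \<kappa> (?M t))\<^sup>2"
        unfolding g'_def pm(2)[OF t] ..
      ultimately show "complex_of_real (g' t) * flatten \<kappa> h (chord \<beta> ?s (g t)) =
      complex_of_real ((1 - \<kappa>) * ?D / (1 + \<kappa>)) * (complex_of_real (weight \<kappa> (?M t)) * h (?M t))"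
        using w by (simp add: power2_eq_square)
    qed
  qed simp
  also have "\<dots> = complex_of_real ((1 - \<kappa>) * ?D / (1 + \<kappa>)) * I0 \<kappa> (\<lambda>z. complex_of_real (weight \<kappa> z) * h z) (\<beta>, \<alpha>)"
    unfolding I0_def x by (rule set_integral_mult_right)
  finally have *: "(LINT r:{0..2 * cos ?s}|lborel. flatten \<kappa> h (chord \<beta> ?s r)) =
     complex_of_real ((1 - \<kappa>) * ?D / (1 + \<kappa>)) * I0 \<kappa> (\<lambda>z. complex_of_real (weight \<kappa> z) * h z) (\<beta>, \<alpha>)"
    by (simp only: g0 g\<tau>)
  have "complex_of_real ((1 + \<kappa>) / ((1 - \<kappa>) * ?D)) * complex_of_real ((1 - \<kappa>) * ?D / (1 + \<kappa>)) = 1"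
    unfolding of_real_mult[symmetric] using \<kappa> D by simp
  then show ?thesis unfolding * mult.assoc[symmetric] by simp
qed

section \<open>Integration over the disk\<close>

text \<open>Lebesgue measure is determined by its values on boxes, and a box in the complex plane
  pulls back to a product of intervals.\<close>

lemma lborel_complex_distr:
  "distr (lborel \<Otimes>\<^sub>M lborel) borel (\<lambda>(x, y). Complex x y) = lborel"
proof (rule lborel_eqI[symmetric])
  have m [measurable]: "(\<lambda>(x, y). Complex x y) \<in> borel_measurable (lborel \<Otimes>\<^sub>M lborel)"
  proof -
    have "(\<lambda>p::real\<times>real. Complex (fst p) (snd p)) \<in> borel_measurable borel"
      by (intro borel_measurable_continuous_onI continuous_on_Complex continuous_on_fst continuous_on_snd continuous_on_id)
    then show ?thesis by (simp add: lborel_prod case_prod_unfold)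
  qed
  fix l u :: complex assume le: "\<And>b. b \<in> Basis \<Longrightarrow> l \<bullet> b \<le> u \<bullet> b"
  from le[of 1] le[of \<i>] have lu: "Re l \<le> Re u" "Im l \<le> Im u" by (auto simp: Basis_complex_def)
  have "(\<lambda>(x, y). Complex x y) -` box l u = {Re l<..<Re u} \<times> {Im l<..<Im u}"
    by (auto simp: box_def Basis_complex_def)
  then have "emeasure (distr (lborel \<Otimes>\<^sub>M lborel) borel (\<lambda>(x, y). Complex x y)) (box l u)
    = emeasure (lborel \<Otimes>\<^sub>M lborel) ({Re l<..<Re u} \<times> {Im l<..<Im u})"
    by (subst emeasure_distr) (auto simp: space_pair_measure)
  also have "\<dots> = ennreal ((Re u - Re l) * (Im u - Im l))"
    using lu by (subst lborel.emeasure_pair_measure_Times) (auto simp: ennreal_mult)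
  also have "(Re u - Re l) * (Im u - Im l) = (\<Prod>b\<in>Basis. (u - l) \<bullet> b)"
    by (simp add: Basis_complex_def complex_eq_iff)
  finally show "emeasure (distr (lborel \<Otimes>\<^sub>M lborel) borel (\<lambda>(x, y). Complex x y)) (box l u) = (\<Prod>b\<in>Basis. (u - l) \<bullet> b)" .
qed simp

lemma borel_measurable_Complex [measurable (raw)]:
  assumes f: "f \<in> borel_measurable M" and g: "g \<in> borel_measurable M"
  shows "(\<lambda>x. Complex (f x) (g x)) \<in> borel_measurable M"
proof -
  have "(\<lambda>x. complex_of_real (f x) + \<i> * complex_of_real (g x)) \<in> borel_measurable M"
    using f g by measurable
  then show ?thesis by (simp add: Complex_eq)
qed

lemma nn_integral_complex:
  fixes F :: "complex \<Rightarrow> ennreal"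
  assumes [measurable]: "F \<in> borel_measurable borel"
  shows "(\<integral>\<^sup>+z. F z \<partial>lborel) = (\<integral>\<^sup>+x. \<integral>\<^sup>+y. F (Complex x y) \<partial>lborel \<partial>lborel)"
    and "(\<integral>\<^sup>+z. F z \<partial>lborel) = (\<integral>\<^sup>+y. \<integral>\<^sup>+x. F (Complex x y) \<partial>lborel \<partial>lborel)"
proof -
  have m: "(\<lambda>(x, y). Complex x y) \<in> borel_measurable (lborel \<Otimes>\<^sub>M lborel)"
    unfolding case_prod_unfold by measurable
  have "(\<integral>\<^sup>+z. F z \<partial>lborel) = (\<integral>\<^sup>+p. F (case p of (x, y) \<Rightarrow> Complex x y) \<partial>(lborel \<Otimes>\<^sub>M lborel))"
    by (subst lborel_complex_distr[symmetric], subst nn_integral_distr[OF m]) simp_all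
  also have "\<dots> = (\<integral>\<^sup>+x. \<integral>\<^sup>+y. F (Complex x y) \<partial>lborel \<partial>lborel)"
    by (subst lborel.nn_integral_fst[symmetric]) (simp_all add: case_prod_unfold)
  finally show 1: "(\<integral>\<^sup>+z. F z \<partial>lborel) = (\<integral>\<^sup>+x. \<integral>\<^sup>+y. F (Complex x y) \<partial>lborel \<partial>lborel)" .
  show "(\<integral>\<^sup>+z. F z \<partial>lborel) = (\<integral>\<^sup>+y. \<integral>\<^sup>+x. F (Complex x y) \<partial>lborel \<partial>lborel)"
    unfolding 1 by (rule lborel_pair.Fubini') (simp add: case_prod_unfold)
qed

lemma nn_integral_shift:
  fixes f :: "real \<Rightarrow> ennreal"
  assumes "f \<in> borel_measurable borel"
  shows "(\<integral>\<^sup>+x. f (x + t) \<partial>lborel) = (\<integral>\<^sup>+x. f x \<partial>lborel)"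
  using nn_integral_real_affine[OF assms, of 1 t] by (simp add: add.commute)

lemma nn_integral_reflect:
  fixes f :: "real \<Rightarrow> ennreal"
  assumes "f \<in> borel_measurable borel"
  shows "(\<integral>\<^sup>+x. f (t - x) \<partial>lborel) = (\<integral>\<^sup>+x. f x \<partial>lborel)"
  using nn_integral_real_affine[OF assms, of "-1" t] by simp

text \<open>A rotation other than \<open>\<plusminus>1\<close> is a product of three shears, each of which preserves
  Lebesgue measure by translation invariance in one variable.\<close>

lemma nn_integral_rotate:
  fixes F :: "complex \<Rightarrow> ennreal"
  assumes F: "F \<in> borel_measurable borel" and c: "cmod c = 1"
  shows "(\<integral>\<^sup>+z. F (c * z) \<partial>lborel) = (\<integral>\<^sup>+z. F z \<partial>lborel)"
proof -
  have shear_x: "(\<integral>\<^sup>+z. F (Complex (Re z + t * Im z) (Im z)) \<partial>lborel) = (\<integral>\<^sup>+z. F z \<partial>lborel)"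
    if [measurable]: "F \<in> borel_measurable borel" for F :: "complex \<Rightarrow> ennreal" and t
    by (subst (1 2) nn_integral_complex(2)) (simp_all, intro nn_integral_cong nn_integral_shift, measurable)
  have shear_y: "(\<integral>\<^sup>+z. F (Complex (Re z) (Im z + t * Re z)) \<partial>lborel) = (\<integral>\<^sup>+z. F z \<partial>lborel)"
    if [measurable]: "F \<in> borel_measurable borel" for F :: "complex \<Rightarrow> ennreal" and t
    by (subst (1 2) nn_integral_complex(1)) (simp_all, intro nn_integral_cong nn_integral_shift, measurable)
  have rot: "(\<integral>\<^sup>+z. F (c * z) \<partial>lborel) = (\<integral>\<^sup>+z. F z \<partial>lborel)"
    if [measurable]: "F \<in> borel_measurable borel" and c: "cmod c = 1" "Im c \<noteq> 0" for F :: "complex \<Rightarrow> ennreal" and c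
  proof -
    define a b where "a = Re c" and "b = Im c"
    have ab: "a * a + b * b = 1" "b \<noteq> 0"
      using c cmod_power2[of c] by (auto simp: a_def b_def power2_eq_square)
    \<comment> \<open>For c = e^{i phi} this is -tan(phi/2), the slope of the outer two shears; the
      middle shear has slope sin phi.\<close>
    define t where "t = (a - 1) / b"
    define F1 where "F1 = (\<lambda>z. F (Complex (Re z + t * Im z) (Im z)))"
    define F2 where "F2 = (\<lambda>z. F1 (Complex (Re z) (Im z + b * Re z)))"
    have [measurable]: "F1 \<in> borel_measurable borel" "F2 \<in> borel_measurable borel"
      unfolding F1_def F2_def by measurable
    have "F (c * z) = F2 (Complex (Re z + t * Im z) (Im z))" for z
    proof -
      have bt: "b * t = a - 1" using ab by (simp add: t_def)
      have tb: "t * (1 + a) = - b" using ab by (simp add: t_def field_simps)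
      have "a * Re z - b * Im z = Re z + t * Im z + t * (Im z + b * (Re z + t * Im z))"
      proof -
        have "Re z + t * Im z + t * (Im z + b * (Re z + t * Im z)) = (1 + b * t) * Re z + t * (1 + (1 + b * t)) * Im z"
          by (simp add: algebra_simps)
        also have "\<dots> = a * Re z - b * Im z" using tb by (simp add: bt)
        finally show ?thesis ..
      qed
      moreover have "a * Im z + b * Re z = Im z + b * (Re z + t * Im z)"
      proof -
        have "Im z + b * (Re z + t * Im z) = (1 + b * t) * Im z + b * Re z" by (simp add: algebra_simps)
        then show ?thesis by (simp add: bt)
      qed
      ultimately have "c * z = Complex (Re z + t * Im z + t * (Im z + b * (Re z + t * Im z))) (Im z + b * (Re z + t * Im z))"
        by (simp add: complex_eq_iff a_def[symmetric] b_def[symmetric])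
      then show ?thesis by (simp add: F2_def F1_def)
    qed
    then have "(\<integral>\<^sup>+z. F (c * z) \<partial>lborel) = (\<integral>\<^sup>+z. F2 z \<partial>lborel)"
      using shear_x[of F2 t] by simp
    also have "\<dots> = (\<integral>\<^sup>+z. F1 z \<partial>lborel)" unfolding F2_def by (rule shear_y) measurable
    also have "\<dots> = (\<integral>\<^sup>+z. F z \<partial>lborel)" unfolding F1_def by (rule shear_x) measurable
    finally show ?thesis .
  qed
  show ?thesis
  proof (cases "Im c = 0")
    case False
    then show ?thesis by (rule rot[OF F c])
  next
    case True
    have F': "(\<lambda>z. F (\<i> * z)) \<in> borel_measurable borel" using F by measurable
    \<comment> \<open>The half turn has no shear decomposition of this kind and is taken as two
      quarter turns.\<close>
    from True c have "c = 1 \<or> c = \<i> * \<i>"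
      by (auto simp: complex_eq_iff cmod_def)
    moreover have "(\<integral>\<^sup>+z. F (\<i> * (\<i> * z)) \<partial>lborel) = (\<integral>\<^sup>+z. F z \<partial>lborel)"
      using rot[OF F', of \<i>] rot[OF F, of \<i>] by simp
    ultimately show ?thesis by (auto simp only: mult.assoc mult_1_left)
  qed
qed

text \<open>By periodicity, the part of the shifted period beyond 2 pi is moved back to the
  start.\<close>

lemma nn_integral_circle_shift:
  fixes G :: "complex \<Rightarrow> ennreal"
  assumes [measurable]: "G \<in> borel_measurable borel" and c: "cmod c = 1"
  shows "(\<integral>\<^sup>+\<beta>. G (cis \<beta> * c) * indicator {0..<2 * pi} \<beta> \<partial>lborel) = (\<integral>\<^sup>+\<beta>. G (cis \<beta>) * indicator {0..<2 * pi} \<beta> \<partial>lborel)"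
proof -
  define t where "t = Arg2pi c"
  have t: "0 \<le> t" "t < 2 * pi" "c = cis t"
    using Arg2pi_ge_0[of c] Arg2pi_lt_2pi[of c] Arg2pi_eq[of c] c by (simp_all add: t_def cis_conv_exp)
  define g where "g = (\<lambda>\<beta>. G (cis \<beta>))"
  have [measurable]: "g \<in> borel_measurable borel"
    unfolding g_def
    by (rule measurable_compose[of cis borel borel G])
       (auto intro!: borel_measurable_continuous_onI continuous_intros)
  have per: "g (x + 2 * pi) = g x" for x
    by (simp add: g_def cis_mult[symmetric])
  have "(\<integral>\<^sup>+\<beta>. G (cis \<beta> * c) * indicator {0..<2 * pi} \<beta> \<partial>lborel)
    = (\<integral>\<^sup>+\<beta>. g (\<beta> + t) * indicator {t..<2 * pi + t} (\<beta> + t) \<partial>lborel)"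
    by (intro nn_integral_cong) (auto simp: g_def t cis_mult indicator_def)
  also have "\<dots> = (\<integral>\<^sup>+\<beta>. g \<beta> * indicator {t..<2 * pi + t} \<beta> \<partial>lborel)"
    by (rule nn_integral_shift[of "\<lambda>\<beta>. g \<beta> * indicator {t..<2 * pi + t} \<beta>"]) measurable
  also have "\<dots> = (\<integral>\<^sup>+\<beta>. g \<beta> * indicator {t..<2 * pi} \<beta> + g \<beta> * indicator {2 * pi..<2 * pi + t} \<beta> \<partial>lborel)"
    by (intro nn_integral_cong) (use t in \<open>auto simp: indicator_def\<close>)
  also have "\<dots> = (\<integral>\<^sup>+\<beta>. g \<beta> * indicator {t..<2 * pi} \<beta> \<partial>lborel) + (\<integral>\<^sup>+\<beta>. g \<beta> * indicator {2 * pi..<2 * pi + t} \<beta> \<partial>lborel)"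
    by (rule nn_integral_add) measurable
  also have "(\<integral>\<^sup>+\<beta>. g \<beta> * indicator {2 * pi..<2 * pi + t} \<beta> \<partial>lborel) =
      (\<integral>\<^sup>+\<beta>. g (\<beta> + 2 * pi) * indicator {2 * pi..<2 * pi + t} (\<beta> + 2 * pi) \<partial>lborel)"
    by (rule nn_integral_shift[symmetric, of "\<lambda>\<beta>. g \<beta> * indicator {2 * pi..<2 * pi + t} \<beta>"]) measurable
  also have "\<dots> = (\<integral>\<^sup>+\<beta>. g \<beta> * indicator {0..<t} \<beta> \<partial>lborel)"
    by (intro nn_integral_cong) (auto simp: per indicator_def)
  also have "(\<integral>\<^sup>+\<beta>. g \<beta> * indicator {t..<2 * pi} \<beta> \<partial>lborel) + (\<integral>\<^sup>+\<beta>. g \<beta> * indicator {0..<t} \<beta> \<partial>lborel)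
    = (\<integral>\<^sup>+\<beta>. g \<beta> * indicator {t..<2 * pi} \<beta> + g \<beta> * indicator {0..<t} \<beta> \<partial>lborel)"
    by (rule nn_integral_add[symmetric]) measurable
  also have "\<dots> = (\<integral>\<^sup>+\<beta>. g \<beta> * indicator {0..<2 * pi} \<beta> \<partial>lborel)"
    by (intro nn_integral_cong) (use t in \<open>auto simp: indicator_def\<close>)
  finally show ?thesis by (simp add: g_def)
qed

text \<open>Two measures on the line agree once they agree, finitely, on all upper half-lines. The
  sign of the modulus is reversed so that these half-lines correspond to disks, whose areas are
  finite, rather than to their complements.\<close>

lemma nn_integral_radial:
  fixes \<phi> :: "real \<Rightarrow> ennreal"
  assumes [measurable]: "\<phi> \<in> borel_measurable borel"
  shows "(\<integral>\<^sup>+z. \<phi> (cmod z) \<partial>(lborel :: complex measure)) = (\<integral>\<^sup>+r. ennreal (2 * pi * r) * \<phi> r * indicator {0..} r \<partial>lborel)"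
proof -
  let ?M = "distr lborel borel (\<lambda>z::complex. - cmod z)"
  let ?N = "density lborel (\<lambda>r. ennreal (- 2 * pi * r) * indicator {..0} r)"
  have M: "emeasure ?M {x<..} = ennreal (if x < 0 then pi * x\<^sup>2 else 0)" for x
  proof -
    have "(\<lambda>z::complex. - cmod z) -` {x<..} = ball 0 (- x)" by (auto simp: dist_norm)
    then have "emeasure ?M {x<..} = emeasure lborel (ball (0::complex) (- x))"
      by (subst emeasure_distr) auto
    then show ?thesis
      by (cases "x < 0") (simp_all add: emeasure_ball unit_ball_vol_2 ball_empty)
  qed
  have N: "emeasure ?N {x<..} = ennreal (if x < 0 then pi * x\<^sup>2 else 0)" for x
  proof (cases "x < 0")
    case True
    have "emeasure ?N {x<..} = (\<integral>\<^sup>+r. ennreal (- 2 * pi * r) * indicator {..0} r * indicator {x<..} r \<partial>lborel)"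
      by (subst emeasure_density) auto
    also have "\<dots> = (\<integral>\<^sup>+r. ennreal (- 2 * pi * r) * indicator {x..0} r \<partial>lborel)"
      by (intro nn_integral_cong_AE, use AE_lborel_singleton[of x] in eventually_elim)
         (auto simp: indicator_def)
    also have "\<dots> = ennreal (- pi * 0\<^sup>2 - (- pi * x\<^sup>2))"
      by (intro nn_integral_FTC_Icc)
         (use True in \<open>auto intro!: derivative_eq_intros simp: mult_nonneg_nonpos\<close>)
    finally show ?thesis using True by simp
  next
    case False
    have "emeasure ?N {x<..} = (\<integral>\<^sup>+r. ennreal (- 2 * pi * r) * indicator {..0} r * indicator {x<..} r \<partial>lborel)"
      by (subst emeasure_density) auto
    also have "\<dots> = (\<integral>\<^sup>+r. 0 \<partial>(lborel :: real measure))"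
      by (intro nn_integral_cong) (use False in \<open>auto simp: indicator_def\<close>)
    finally show ?thesis using False by simp
  qed
  have eq: "?M = ?N"
  proof (rule measure_eqI_lessThan)
    show "emeasure ?M {x<..} < \<infinity>" for x unfolding M by simp
    show "emeasure ?M {x<..} = emeasure ?N {x<..}" for x unfolding M N ..
  qed simp_all
  have "(\<integral>\<^sup>+z. \<phi> (cmod z) \<partial>(lborel :: complex measure)) = (\<integral>\<^sup>+r. \<phi> (- r) \<partial>?M)"
    by (subst nn_integral_distr) auto
  also have "\<dots> = (\<integral>\<^sup>+r. ennreal (- 2 * pi * r) * indicator {..0} r * \<phi> (- r) \<partial>lborel)"
    unfolding eq by (subst nn_integral_density) auto
  also have "\<dots> = (\<integral>\<^sup>+r. ennreal (- 2 * pi * (0 - r)) * indicator {..0} (0 - r) * \<phi> (- (0 - r)) \<partial>lborel)"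
    by (rule nn_integral_reflect[symmetric, of "\<lambda>r. ennreal (- 2 * pi * r) * indicator {..0} r * \<phi> (- r)"]) measurable
  also have "\<dots> = (\<integral>\<^sup>+r. ennreal (2 * pi * r) * \<phi> r * indicator {0..} r \<partial>lborel)"
    by (intro nn_integral_cong) (auto simp: indicator_def)
  finally show ?thesis .
qed

definition circle_integral :: "(complex \<Rightarrow> ennreal) \<Rightarrow> real \<Rightarrow> ennreal" where
  "circle_integral F r = (\<integral>\<^sup>+\<theta>. F (cis \<theta> * complex_of_real r) * indicator {0..<2 * pi} \<theta> \<partial>lborel)"

lemma borel_measurable_cis [measurable]: "cis \<in> borel_measurable borel"
  by (auto intro!: borel_measurable_continuous_onI continuous_intros)

lemma circle_integral_measurable [measurable]:
  assumes [measurable]: "F \<in> borel_measurable borel"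
  shows "circle_integral F \<in> borel_measurable borel"
  unfolding circle_integral_def[abs_def] by measurable

lemma circle_integral_cmod:
  assumes [measurable]: "F \<in> borel_measurable borel"
  shows "(\<integral>\<^sup>+\<theta>. F (cis \<theta> * z) * indicator {0..<2 * pi} \<theta> \<partial>lborel) = circle_integral F (cmod z)"
proof (cases "z = 0")
  case True
  then show ?thesis by (simp add: circle_integral_def)
next
  case False
  define c where "c = z / complex_of_real (cmod z)"
  have c: "cmod c = 1" and z: "z = c * complex_of_real (cmod z)" using False by (auto simp: c_def norm_divide)
  have "(\<integral>\<^sup>+\<theta>. F (cis \<theta> * z) * indicator {0..<2 * pi} \<theta> \<partial>lborel) =
     (\<integral>\<^sup>+\<theta>. F (cis \<theta> * c * complex_of_real (cmod z)) * indicator {0..<2 * pi} \<theta> \<partial>lborel)"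
    using z by (simp add: mult.assoc)
  also have "\<dots> = circle_integral F (cmod z)"
    unfolding circle_integral_def
    by (rule nn_integral_circle_shift[of "\<lambda>w. F (w * complex_of_real (cmod z))", OF _ c]) measurable
  finally show ?thesis .
qed

text \<open>Rotation invariance makes the inner plane integral independent of the angle, and Fubini
  exchanges the two.\<close>

lemma nn_integral_circle_average:
  assumes [measurable]: "F \<in> borel_measurable borel"
  shows "ennreal (2 * pi) * (\<integral>\<^sup>+z. F z \<partial>lborel) = (\<integral>\<^sup>+z. circle_integral F (cmod z) \<partial>(lborel :: complex measure))"
proof -
  have "(\<integral>\<^sup>+z. circle_integral F (cmod z) \<partial>(lborel :: complex measure)) =
    (\<integral>\<^sup>+z. \<integral>\<^sup>+\<theta>. F (cis \<theta> * z) * indicator {0..<2 * pi} \<theta> \<partial>lborel \<partial>lborel)"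
    by (simp add: circle_integral_cmod)
  also have "\<dots> = (\<integral>\<^sup>+\<theta>. \<integral>\<^sup>+z. F (cis \<theta> * z) * indicator {0..<2 * pi} \<theta> \<partial>lborel \<partial>lborel)"
    by (rule lborel_pair.Fubini') measurable
  also have "\<dots> = (\<integral>\<^sup>+\<theta>. (\<integral>\<^sup>+z. F z \<partial>lborel) * indicator {0..<2 * pi} \<theta> \<partial>lborel)"
    by (intro nn_integral_cong) (simp add: nn_integral_multc nn_integral_rotate)
  also have "\<dots> = (\<integral>\<^sup>+z. F z \<partial>lborel) * emeasure lborel {0..<2 * pi}"
    by (simp add: nn_integral_cmult)
  finally show ?thesis by (simp add: mult.commute)
qed

lemma nn_integral_polar:
  assumes [measurable]: "F \<in> borel_measurable borel"
  shows "ennreal (2 * pi) * (\<integral>\<^sup>+z. F z \<partial>lborel) = (\<integral>\<^sup>+r. ennreal (2 * pi * r) * circle_integral F r * indicator {0..} r \<partial>lborel)"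
  unfolding nn_integral_circle_average[OF assms] by (rule nn_integral_radial) measurable

section \<open>Change of variables under the straightening map\<close>

definition proj_jacobian :: "real \<Rightarrow> complex \<Rightarrow> real" where
  "proj_jacobian \<kappa> z = (1 - \<kappa>)\<^sup>2 * (1 + \<kappa> * (cmod z)\<^sup>2) / (1 - \<kappa> * (cmod z)\<^sup>2) ^ 3"

lemma proj_measurable [measurable]: "proj \<kappa> \<in> borel_measurable borel"
  unfolding proj_def[abs_def] by measurable

lemma proj_jacobian_measurable [measurable]: "proj_jacobian \<kappa> \<in> borel_measurable borel"
  unfolding proj_jacobian_def[abs_def] by measurable

lemma proj_jacobian_pos:
  assumes \<kappa>: "-1 < \<kappa>" "\<kappa> < 1" and z: "cmod z \<le> 1"
  shows "proj_jacobian \<kappa> z > 0"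
  using curvature_factor_pos[OF \<kappa> z] \<kappa> by (simp add: proj_jacobian_def)

text \<open>The map is radial with profile \<open>\<phi>\<close>, so in polar coordinates it acts
  only on the radius, and the claim is the substitution r -> phi(r). Accordingly
  \<open>proj_jacobian\<close> is phi(r) phi'(r) / r. The common factor 2 pi is cancelled at the
  end.\<close>

lemma nn_integral_proj:
  assumes \<kappa>: "-1 < \<kappa>" "\<kappa> < 1" and [measurable]: "F \<in> borel_measurable borel"
  shows "(\<integral>\<^sup>+z. F (proj \<kappa> z) * (ennreal (proj_jacobian \<kappa> z) * indicator (cball 0 1) z) \<partial>lborel) =
    (\<integral>\<^sup>+z. F z * indicator (cball 0 1) z \<partial>lborel)"
proof -
  have [measurable]: "cball (0::complex) 1 \<in> sets borel" by simp
  define \<phi> where "\<phi> = (\<lambda>r::real. (1 - \<kappa>) / (1 - \<kappa> * r\<^sup>2) * r)"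
  define \<phi>' where "\<phi>' = (\<lambda>r::real. (1 - \<kappa>) * (1 + \<kappa> * r\<^sup>2) / (1 - \<kappa> * r\<^sup>2)\<^sup>2)"
  have p: "1 - \<kappa> * r\<^sup>2 > 0" "1 + \<kappa> * r\<^sup>2 > 0" if "r \<in> {0..1}" for r
    using curvature_factor_pos[OF \<kappa>, of "complex_of_real r"] that by simp_all
  let ?A = "circle_integral F"
  let ?F1 = "\<lambda>z. F (proj \<kappa> z) * (ennreal (proj_jacobian \<kappa> z) * indicator (cball 0 1) z)"
  let ?F2 = "\<lambda>z. F z * indicator (cball 0 1) z"
  have A1: "circle_integral ?F1 r = ennreal (proj_jacobian \<kappa> (complex_of_real r)) * ?A (\<phi> r) * indicator {0..1} r"
    if "r \<ge> 0" for r
  proof -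
    have "circle_integral ?F1 r = (\<integral>\<^sup>+\<theta>. ennreal (proj_jacobian \<kappa> (complex_of_real r)) * indicator {0..1} r *
       (F (cis \<theta> * complex_of_real (\<phi> r)) * indicator {0..<2 * pi} \<theta>) \<partial>lborel)"
      unfolding circle_integral_def
    proof (intro nn_integral_cong)
      fix \<theta> :: real
      have "proj \<kappa> (cis \<theta> * complex_of_real r) = cis \<theta> * complex_of_real (\<phi> r)"
        using that by (simp add: proj_def \<phi>_def norm_mult)
      moreover have "proj_jacobian \<kappa> (cis \<theta> * complex_of_real r) = proj_jacobian \<kappa> (complex_of_real r)"
        by (simp add: proj_jacobian_def norm_mult)
      moreover have "indicator (cball 0 1) (cis \<theta> * complex_of_real r) = (indicator {0..1} r :: ennreal)"
        using that by (simp add: indicator_def norm_mult)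
      ultimately show "?F1 (cis \<theta> * complex_of_real r) * indicator {0..<2 * pi} \<theta> =
         ennreal (proj_jacobian \<kappa> (complex_of_real r)) * indicator {0..1} r *
         (F (cis \<theta> * complex_of_real (\<phi> r)) * indicator {0..<2 * pi} \<theta>)"
        by (simp add: mult_ac)
    qed
    also have "\<dots> = ennreal (proj_jacobian \<kappa> (complex_of_real r)) * indicator {0..1} r * ?A (\<phi> r)"
      unfolding circle_integral_def by (rule nn_integral_cmult) measurable
    finally show ?thesis by (simp add: mult_ac)
  qed
  have A2: "circle_integral ?F2 r = ?A r * indicator {0..1} r" if "r \<ge> 0" for r
  proof -
    have "circle_integral ?F2 r = (\<integral>\<^sup>+\<theta>. (F (cis \<theta> * complex_of_real r) * indicator {0..<2 * pi} \<theta>) * indicator {0..1} r \<partial>lborel)"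
      unfolding circle_integral_def
      by (intro nn_integral_cong) (use that in \<open>auto simp: indicator_def norm_mult\<close>)
    also have "\<dots> = ?A r * indicator {0..1} r"
      unfolding circle_integral_def by (rule nn_integral_multc) measurable
    finally show ?thesis .
  qed
  have d: "(\<phi> has_real_derivative \<phi>' r) (at r)" if "r \<in> {0..1}" for r
  proof -
    have "(\<phi> has_real_derivative ((1 - \<kappa>) * (1 - \<kappa> * r\<^sup>2) + (1 - \<kappa>) * r * (2 * r * \<kappa>)) / (1 - \<kappa> * r\<^sup>2)\<^sup>2) (at r)"
      unfolding \<phi>_def using p[OF that]
      by (auto intro!: derivative_eq_intros simp: power2_eq_square)
    also have "((1 - \<kappa>) * (1 - \<kappa> * r\<^sup>2) + (1 - \<kappa>) * r * (2 * r * \<kappa>)) / (1 - \<kappa> * r\<^sup>2)\<^sup>2 = \<phi>' r"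
      unfolding \<phi>'_def
      by (rule arg_cong[of _ _ "\<lambda>x. x / _"]) (simp add: power2_eq_square algebra_simps)
    finally show ?thesis .
  qed
  have "ennreal (2 * pi) * (\<integral>\<^sup>+z. ?F1 z \<partial>lborel) = (\<integral>\<^sup>+r. ennreal (2 * pi * r) * circle_integral ?F1 r * indicator {0..} r \<partial>lborel)"
    by (rule nn_integral_polar) measurable
  also have "\<dots> = (\<integral>\<^sup>+r. ennreal (2 * pi * \<phi> r) * ?A (\<phi> r) * ennreal (\<phi>' r) * indicator {0..1} r \<partial>lborel)"
  proof (intro nn_integral_cong)
    fix r :: real
    show "ennreal (2 * pi * r) * circle_integral ?F1 r * indicator {0..} r =
      ennreal (2 * pi * \<phi> r) * ?A (\<phi> r) * ennreal (\<phi>' r) * indicator {0..1} r"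
    proof (cases "r \<in> {0..1}")
      case True
      have "r * proj_jacobian \<kappa> (complex_of_real r) = \<phi> r * \<phi>' r"
        using True by (simp add: proj_jacobian_def \<phi>_def \<phi>'_def power2_eq_square power3_eq_cube mult_ac)
      then have e: "ennreal (2 * pi * r) * ennreal (proj_jacobian \<kappa> (complex_of_real r)) = ennreal (2 * pi * \<phi> r) * ennreal (\<phi>' r)"
        using True p[OF True] \<kappa>
        by (simp add: ennreal_mult'[symmetric] \<phi>_def \<phi>'_def mult.assoc)
      have "r \<ge> 0" using True by simp
      from A1[OF this] have "ennreal (2 * pi * r) * circle_integral ?F1 r * indicator {0..} r =
          (ennreal (2 * pi * r) * ennreal (proj_jacobian \<kappa> (complex_of_real r))) * ?A (\<phi> r)"
        using True by (simp only:) (simp add: mult.assoc)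
      also have "\<dots> = ennreal (2 * pi * \<phi> r) * ?A (\<phi> r) * ennreal (\<phi>' r) * indicator {0..1} r"
        unfolding e using True by (simp add: mult_ac)
      finally show ?thesis .
    next
      case False
      show ?thesis
      proof (cases "r \<ge> 0")
        case True
        from A1[OF this] False show ?thesis by simp
      qed (use False in simp)
    qed
  qed
  also have "\<dots> = (\<integral>\<^sup>+r. ennreal (2 * pi * r) * ?A r * indicator {\<phi> 0..\<phi> 1} r \<partial>lborel)"
  proof (rule nn_integral_substitution_aux[symmetric, OF _ _ d])
    show "continuous_on {0..1} \<phi>'"
      unfolding \<phi>'_def using p by (intro continuous_intros) force
    show "\<phi>' r \<ge> 0" if "r \<in> {0..1}" for r using p[OF that] \<kappa> by (simp add: \<phi>'_def)
  qed (auto, measurable)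
  also have "\<dots> = (\<integral>\<^sup>+r. ennreal (2 * pi * r) * circle_integral ?F2 r * indicator {0..} r \<partial>lborel)"
  proof (intro nn_integral_cong)
    fix r :: real
    show "ennreal (2 * pi * r) * ?A r * indicator {\<phi> 0..\<phi> 1} r =
      ennreal (2 * pi * r) * circle_integral ?F2 r * indicator {0..} r"
    proof (cases "r \<ge> 0")
      case True
      from A2[OF this] show ?thesis using True \<kappa> by (simp add: \<phi>_def indicator_def)
    qed (simp add: \<phi>_def)
  qed
  also have "\<dots> = ennreal (2 * pi) * (\<integral>\<^sup>+z. ?F2 z \<partial>lborel)"
    by (rule nn_integral_polar[symmetric]) measurable
  finally show ?thesis
    by (subst (asm) ennreal_mult_cancel_left) auto
qed

section \<open>Disintegration of the disk into chords\<close>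

definition chord_weight :: "real \<Rightarrow> real \<Rightarrow> real" where
  "chord_weight s r = cos s * indicator {- pi / 2..pi / 2} s * indicator {0..2 * cos s} r"

lemma chord_weight_measurable [measurable (raw)]:
  assumes [measurable]: "f \<in> borel_measurable M" "g \<in> borel_measurable M"
  shows "(\<lambda>x. chord_weight (f x) (g x)) \<in> borel_measurable M"
proof -
  have "(\<lambda>x. chord_weight (f x) (g x)) = (\<lambda>x. if - pi / 2 \<le> f x \<and> f x \<le> pi / 2 \<and> 0 \<le> g x \<and> g x \<le> 2 * cos (f x) then cos (f x) else 0)"
    by (auto simp: chord_weight_def indicator_def)
  also have "\<dots> \<in> borel_measurable M" by measurable
  finally show ?thesis .
qed

lemma chord_weight_nonneg [simp]: "chord_weight s r \<ge> 0"
proof (cases "s \<in> {- pi / 2..pi / 2}")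
  case True
  then have "cos s \<ge> 0" by (intro cos_ge_zero) auto
  then show ?thesis by (simp add: chord_weight_def)
qed (simp add: chord_weight_def)

text \<open>Horizontal slicing at height -sin s, with cos s - r as horizontal coordinate. The
  density cos s in \<open>chord_weight\<close> is the derivative of the height up to sign, and its
  indicators encode the half circle of angles and the chord length.\<close>

lemma nn_integral_chords:
  fixes F :: "complex \<Rightarrow> ennreal"
  assumes [measurable]: "F \<in> borel_measurable borel"
  shows "(\<integral>\<^sup>+z. F z * indicator (cball 0 1) z \<partial>lborel) =
    (\<integral>\<^sup>+s. \<integral>\<^sup>+r. F (cis (- s) - complex_of_real r) * ennreal (chord_weight s r) \<partial>lborel \<partial>lborel)"
proof -
  have [measurable]: "cball (0::complex) 1 \<in> sets borel" by simp
  define g where "g = (\<lambda>v. \<integral>\<^sup>+u. F (Complex u v) * indicator (cball 0 1) (Complex u v) \<partial>lborel)"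
  have [measurable]: "g \<in> borel_measurable borel" unfolding g_def by measurable
  have "(\<integral>\<^sup>+z. F z * indicator (cball 0 1) z \<partial>lborel) = (\<integral>\<^sup>+v. g v \<partial>lborel)"
    unfolding g_def by (rule nn_integral_complex(2)) measurable
  also have "\<dots> = (\<integral>\<^sup>+v. g v * indicator {sin (- (pi / 2))..sin (pi / 2)} v \<partial>lborel)"
  proof (intro nn_integral_cong)
    fix v :: real
    show "g v = g v * indicator {sin (- (pi / 2))..sin (pi / 2)} v"
    proof (cases "\<bar>v\<bar> \<le> 1")
      case True
      then show ?thesis by (auto simp: indicator_def)
    next
      case False
      have "Complex u v \<notin> cball 0 1" for u
        using abs_Im_le_cmod[of "Complex u v"] False by auto
      then have "g v = (\<integral>\<^sup>+u. 0 \<partial>(lborel :: real measure))"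
        unfolding g_def by (intro nn_integral_cong) (simp add: indicator_def)
      then show ?thesis by simp
    qed
  qed
  also have "\<dots> = (\<integral>\<^sup>+s. g (sin s) * ennreal (cos s) * indicator {- (pi / 2)..pi / 2} s \<partial>lborel)"
    by (rule nn_integral_substitution_aux)
       (auto intro!: derivative_eq_intros continuous_intros cos_ge_zero)
  also have "\<dots> = (\<integral>\<^sup>+s. g (sin (0 - s)) * ennreal (cos (0 - s)) * indicator {- (pi / 2)..pi / 2} (0 - s) \<partial>lborel)"
    by (rule nn_integral_reflect[symmetric, of "\<lambda>s. g (sin s) * ennreal (cos s) * indicator {- (pi / 2)..pi / 2} s"]) measurable
  also have "\<dots> = (\<integral>\<^sup>+s. \<integral>\<^sup>+r. F (cis (- s) - complex_of_real r) * ennreal (chord_weight s r) \<partial>lborel \<partial>lborel)"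
  proof (intro nn_integral_cong)
    fix s :: real
    show "g (sin (0 - s)) * ennreal (cos (0 - s)) * indicator {- (pi / 2)..pi / 2} (0 - s) =
       (\<integral>\<^sup>+r. F (cis (- s) - complex_of_real r) * ennreal (chord_weight s r) \<partial>lborel)"
    proof (cases "s \<in> {- (pi / 2)..pi / 2}")
      case True
      then have c: "cos s \<ge> 0" by (intro cos_ge_zero) auto
      have ind: "indicator (cball 0 1) (Complex u (- sin s)) = (indicator {- cos s..cos s} u :: ennreal)" for u
      proof -
        have "cmod (Complex u (- sin s)) \<le> 1 \<longleftrightarrow> u\<^sup>2 + (sin s)\<^sup>2 \<le> 1" by (simp add: cmod_def)
        also have "\<dots> \<longleftrightarrow> u\<^sup>2 \<le> (cos s)\<^sup>2" using sin_cos_squared_add[of s] by linarith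
        also have "\<dots> \<longleftrightarrow> \<bar>u\<bar> \<le> cos s" using c by (simp add: abs_le_square_iff[symmetric])
        finally show ?thesis by (auto simp: indicator_def abs_le_iff)
      qed
      have "g (- sin s) = (\<integral>\<^sup>+u. F (Complex u (- sin s)) * indicator {- cos s..cos s} u \<partial>lborel)"
        unfolding g_def ind ..
      also have "\<dots> = (\<integral>\<^sup>+r. F (Complex (cos s - r) (- sin s)) * indicator {- cos s..cos s} (cos s - r) \<partial>lborel)"
        by (rule nn_integral_reflect[symmetric, of "\<lambda>u. F (Complex u (- sin s)) * indicator {- cos s..cos s} u"]) measurable
      also have "\<dots> = (\<integral>\<^sup>+r. F (cis (- s) - complex_of_real r) * indicator {0..2 * cos s} r \<partial>lborel)"
      proof (intro nn_integral_cong)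
        fix r :: real
        have "Complex (cos s - r) (- sin s) = cis (- s) - complex_of_real r"
          by (simp add: complex_eq_iff)
        then show "F (Complex (cos s - r) (- sin s)) * indicator {- cos s..cos s} (cos s - r) =
           F (cis (- s) - complex_of_real r) * indicator {0..2 * cos s} r"
          by (auto simp: indicator_def)
      qed
      finally have "g (- sin s) * ennreal (cos s) = (\<integral>\<^sup>+r. F (cis (- s) - complex_of_real r) * indicator {0..2 * cos s} r * ennreal (cos s) \<partial>lborel)"
        by (simp add: nn_integral_multc)
      also have "\<dots> = (\<integral>\<^sup>+r. F (cis (- s) - complex_of_real r) * ennreal (chord_weight s r) \<partial>lborel)"
        using True by (intro nn_integral_cong) (auto simp: chord_weight_def indicator_def)
      finally show ?thesis using True by simp
    qed (auto simp: chord_weight_def)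
  qed
  finally show ?thesis .
qed

lemma circle_integral_cball:
  assumes [measurable]: "F \<in> borel_measurable borel"
  shows "circle_integral (\<lambda>z. F z * indicator (cball 0 1) z) (cmod w) = circle_integral F (cmod w) * indicator (cball 0 1) w"
proof -
  have "circle_integral (\<lambda>z. F z * indicator (cball 0 1) z) (cmod w) =
     (\<integral>\<^sup>+\<theta>. (F (cis \<theta> * complex_of_real (cmod w)) * indicator {0..<2 * pi} \<theta>) * indicator (cball 0 1) w \<partial>lborel)"
    unfolding circle_integral_def
    by (intro nn_integral_cong) (auto simp: indicator_def norm_mult)
  also have "\<dots> = circle_integral F (cmod w) * indicator (cball 0 1) w"
    unfolding circle_integral_def by (rule nn_integral_multc) measurable
  finally show ?thesis .
qed

text \<open>Santalo's formula for the Euclidean disk. Integrating over the base point first leaves a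
  function of the modulus alone, and |1 - r e^{is}| = |e^{-is} - r|, so the fan of chords may be
  replaced by parallel ones.\<close>

lemma nn_integral_fan_beam:
  fixes F :: "complex \<Rightarrow> ennreal"
  assumes [measurable]: "F \<in> borel_measurable borel"
  shows "(\<integral>\<^sup>+\<beta>. (\<integral>\<^sup>+s. \<integral>\<^sup>+r. F (chord \<beta> s r) * ennreal (chord_weight s r) \<partial>lborel \<partial>lborel) * indicator {0..<2 * pi} \<beta> \<partial>lborel)
    = ennreal (2 * pi) * (\<integral>\<^sup>+z. F z * indicator (cball 0 1) z \<partial>lborel)"
proof -
  have [measurable]: "cball (0::complex) 1 \<in> sets borel" by simp
  let ?K = "\<lambda>\<beta> s r. F (chord \<beta> s r) * ennreal (chord_weight s r) * indicator {0..<2 * pi} \<beta>"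
  have [measurable]: "(\<lambda>x. chord (f x) (g x) (h x)) \<in> borel_measurable M"
    if [measurable]: "f \<in> borel_measurable M" "g \<in> borel_measurable M" "h \<in> borel_measurable M" for f g h and M :: "'z measure"
    unfolding chord_def by measurable
  have "(\<integral>\<^sup>+\<beta>. (\<integral>\<^sup>+s. \<integral>\<^sup>+r. F (chord \<beta> s r) * ennreal (chord_weight s r) \<partial>lborel \<partial>lborel) * indicator {0..<2 * pi} \<beta> \<partial>lborel)
     = (\<integral>\<^sup>+\<beta>. \<integral>\<^sup>+s. \<integral>\<^sup>+r. ?K \<beta> s r \<partial>lborel \<partial>lborel \<partial>lborel)"
    by (simp add: nn_integral_multc)
  also have "\<dots> = (\<integral>\<^sup>+s. \<integral>\<^sup>+\<beta>. \<integral>\<^sup>+r. ?K \<beta> s r \<partial>lborel \<partial>lborel \<partial>lborel)"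
    by (rule lborel_pair.Fubini') measurable
  also have "\<dots> = (\<integral>\<^sup>+s. \<integral>\<^sup>+r. \<integral>\<^sup>+\<beta>. ?K \<beta> s r \<partial>lborel \<partial>lborel \<partial>lborel)"
    by (intro nn_integral_cong lborel_pair.Fubini') measurable
  also have "\<dots> = (\<integral>\<^sup>+s. \<integral>\<^sup>+r. circle_integral F (cmod (cis (- s) - complex_of_real r)) * ennreal (chord_weight s r) \<partial>lborel \<partial>lborel)"
  proof (intro nn_integral_cong)
    fix s r :: real
    have "cis (- s) * (1 - complex_of_real r * cis s) = cis (- s) - complex_of_real r"
      by (simp add: algebra_simps cis_mult)
    then have n: "cmod (1 - complex_of_real r * cis s) = cmod (cis (- s) - complex_of_real r)"
      by (metis norm_mult norm_cis mult_1)
    have "(\<integral>\<^sup>+\<beta>. ?K \<beta> s r \<partial>lborel) = (\<integral>\<^sup>+\<beta>. F (cis \<beta> * (1 - complex_of_real r * cis s)) * indicator {0..<2 * pi} \<beta> * ennreal (chord_weight s r) \<partial>lborel)"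
      by (simp add: chord_def mult_ac)
    also have "\<dots> = circle_integral F (cmod (1 - complex_of_real r * cis s)) * ennreal (chord_weight s r)"
      by (simp add: nn_integral_multc circle_integral_cmod)
    finally show "(\<integral>\<^sup>+\<beta>. ?K \<beta> s r \<partial>lborel) = circle_integral F (cmod (cis (- s) - complex_of_real r)) * ennreal (chord_weight s r)"
      unfolding n .
  qed
  also have "\<dots> = (\<integral>\<^sup>+z. circle_integral F (cmod z) * indicator (cball 0 1) z \<partial>(lborel :: complex measure))"
    by (rule nn_integral_chords[symmetric]) measurable
  also have "\<dots> = ennreal (2 * pi) * (\<integral>\<^sup>+z. F z * indicator (cball 0 1) z \<partial>lborel)"
    by (subst nn_integral_circle_average) (simp_all add: circle_integral_cball)
  finally show ?thesis .
qed

text \<open>The complex-valued version, for bounded functions, obtained by pushing a measure on (s,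
  r) forward to the disk. The rotation by \<open>\<theta>\<close> aligns the slices with the level
  lines of Im(e^{i theta} conj z), which equals sin s on the slice with parameter s.\<close>

lemma integral_chords:
  fixes G :: "complex \<Rightarrow> complex"
  assumes [measurable]: "G \<in> borel_measurable borel" and B: "\<And>z. cmod z \<le> 1 \<Longrightarrow> cmod (G z) \<le> B"
  shows "(LINT z:cball 0 1|lborel. G z) =
    (LINT s:{- pi / 2..pi / 2}|lborel. complex_of_real (cos s) *
       (LINT r:{0..2 * cos s}|lborel. G (cis \<theta> * (cis (- s) - complex_of_real r))))"
proof -
  have [measurable]: "cball (0::complex) 1 \<in> sets borel" by simp
  let ?P = "density (lborel \<Otimes>\<^sub>M lborel) (\<lambda>(s, r). ennreal (chord_weight s r))"
  let ?T = "\<lambda>(s, r). cis \<theta> * (cis (- s) - complex_of_real r)"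
  let ?Q = "density lborel (\<lambda>z::complex. ennreal (indicator (cball 0 1) z))"
  have T [measurable]: "?T \<in> borel_measurable (lborel \<Otimes>\<^sub>M lborel)" unfolding case_prod_unfold by measurable
  have eq: "distr ?P borel ?T = ?Q"
  proof (rule measure_eqI)
    fix A assume "A \<in> sets (distr ?P borel ?T)"
    then have [measurable]: "A \<in> sets borel" by simp
    have "emeasure (distr ?P borel ?T) A = (\<integral>\<^sup>+p. indicator A p \<partial>distr ?P borel ?T)"
      by simp
    also have "\<dots> = (\<integral>\<^sup>+p. indicator A (?T p) \<partial>?P)" by (subst nn_integral_distr) (auto simp del: nn_integral_indicator)
    also have "\<dots> = (\<integral>\<^sup>+p. (case p of (s, r) \<Rightarrow> ennreal (chord_weight s r)) * indicator A (?T p) \<partial>(lborel \<Otimes>\<^sub>M lborel))"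
      by (subst nn_integral_density) (auto simp: case_prod_unfold)
    also have "\<dots> = (\<integral>\<^sup>+s. \<integral>\<^sup>+r. indicator A (cis \<theta> * (cis (- s) - complex_of_real r)) * ennreal (chord_weight s r) \<partial>lborel \<partial>lborel)"
      by (subst lborel.nn_integral_fst[symmetric]) (auto simp: case_prod_unfold mult.commute)
    also have "\<dots> = (\<integral>\<^sup>+z. indicator A (cis \<theta> * z) * indicator (cball 0 1) z \<partial>lborel)"
      by (rule nn_integral_chords[symmetric]) measurable
    also have "\<dots> = (\<integral>\<^sup>+z. indicator A (cis \<theta> * z) * indicator (cball 0 1) (cis \<theta> * z) \<partial>lborel)"
      by (intro nn_integral_cong) (auto simp: indicator_def norm_mult)
    also have "\<dots> = (\<integral>\<^sup>+z. indicator A z * indicator (cball 0 1) z \<partial>lborel)"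
      by (rule nn_integral_rotate[of "\<lambda>z. indicator A z * indicator (cball 0 1) z"]) (auto simp: norm_cis)
    also have "\<dots> = emeasure ?Q A"
      by (subst emeasure_density) (auto simp: mult.commute ennreal_indicator)
    finally show "emeasure (distr ?P borel ?T) A = emeasure ?Q A" .
  qed simp
  have mG [measurable]: "(\<lambda>p. G (?T p)) \<in> borel_measurable (lborel \<Otimes>\<^sub>M lborel)" by measurable
  have "integrable ?Q (\<lambda>z. complex_of_real B)"
  proof -
    have "emeasure ?Q (space ?Q) = (\<integral>\<^sup>+z. indicator (cball (0::complex) 1) z \<partial>lborel)"
      by (subst emeasure_density) (auto simp: ennreal_indicator)
    also have "\<dots> < \<infinity>" using emeasure_bounded_finite[OF bounded_cball[of "0::complex" 1]] by simp
    finally have "emeasure ?Q (space ?Q) \<noteq> \<infinity>" by simp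
    then have "finite_measure ?Q" by (rule finite_measureI)
    then show ?thesis by (rule finite_measure.integrable_const)
  qed
  then have "integrable (distr ?P borel ?T) (\<lambda>z. complex_of_real B)" unfolding eq .
  have iG: "integrable ?Q G"
  proof (rule Bochner_Integration.integrable_bound[OF \<open>integrable ?Q (\<lambda>z. complex_of_real B)\<close>])
    have "cmod (G z) \<le> norm (complex_of_real B)" if "cmod z \<le> 1" for z
      using B[OF that] by simp
    then show "AE z in ?Q. cmod (G z) \<le> norm (complex_of_real B)"
      by (subst AE_density) (auto simp: indicator_def)
  qed simp
  then have iT: "integrable (lborel \<Otimes>\<^sub>M lborel) (\<lambda>p. chord_weight (fst p) (snd p) *\<^sub>R G (?T p))"
    unfolding eq[symmetric]
    by (subst (asm) integrable_distr_eq) (simp_all add: integrable_density case_prod_unfold)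
  have "(LINT z:cball 0 1|lborel. G z) = (\<integral>z. G z \<partial>?Q)"
    unfolding set_lebesgue_integral_def by (subst integral_density) auto
  also have "\<dots> = (\<integral>p. G (?T p) \<partial>?P)"
    unfolding eq[symmetric] by (subst integral_distr) auto
  also have "\<dots> = (\<integral>p. chord_weight (fst p) (snd p) *\<^sub>R G (?T p) \<partial>(lborel \<Otimes>\<^sub>M lborel))"
    unfolding case_prod_unfold by (subst integral_density) auto
  also have "\<dots> = (\<integral>s. \<integral>r. chord_weight s r *\<^sub>R G (cis \<theta> * (cis (- s) - complex_of_real r)) \<partial>lborel \<partial>lborel)"
    using lborel_pair.integral_fst'[OF iT] by simp
  also have "\<dots> = (LINT s:{- pi / 2..pi / 2}|lborel. complex_of_real (cos s) *
       (LINT r:{0..2 * cos s}|lborel. G (cis \<theta> * (cis (- s) - complex_of_real r))))"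
    unfolding set_lebesgue_integral_def
  proof (intro Bochner_Integration.integral_cong refl)
    fix s :: real
    have "(\<integral>r. chord_weight s r *\<^sub>R G (cis \<theta> * (cis (- s) - complex_of_real r)) \<partial>lborel) =
      (\<integral>r. (indicator {- pi / 2..pi / 2} s * complex_of_real (cos s)) * (indicat_real {0..2 * cos s} r *\<^sub>R G (cis \<theta> * (cis (- s) - complex_of_real r))) \<partial>lborel)"
      by (intro Bochner_Integration.integral_cong refl) (auto simp: chord_weight_def indicator_def scaleR_conv_of_real)
    also have "\<dots> = (indicator {- pi / 2..pi / 2} s * complex_of_real (cos s)) * (\<integral>r. indicat_real {0..2 * cos s} r *\<^sub>R G (cis \<theta> * (cis (- s) - complex_of_real r)) \<partial>lborel)"
      by (rule integral_mult_right_zero)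
    also have "\<dots> = indicat_real {- pi / 2..pi / 2} s *\<^sub>R (complex_of_real (cos s) * (\<integral>r. indicat_real {0..2 * cos s} r *\<^sub>R G (cis \<theta> * (cis (- s) - complex_of_real r)) \<partial>lborel))"
      by (simp add: indicator_def)
    finally show "(\<integral>r. chord_weight s r *\<^sub>R G (cis \<theta> * (cis (- s) - complex_of_real r)) \<partial>lborel) =
       indicat_real {- pi / 2..pi / 2} s *\<^sub>R (complex_of_real (cos s) * (\<integral>r. indicat_real {0..2 * cos s} r *\<^sub>R G (cis \<theta> * (cis (- s) - complex_of_real r)) \<partial>lborel))" .
  qed
  finally show ?thesis .
qed

section \<open>The weighted volume under the straightening map\<close>

lemma space_weighted_vol [simp]: "space (weighted_vol \<kappa>) = cball 0 1"
  by (simp add: weighted_vol_def vol_def space_restrict_space)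

lemma space_vol [simp]: "space (vol \<kappa>) = cball 0 1"
  by (simp add: vol_def space_restrict_space)

lemma measurable_weighted_vol: "borel_measurable (weighted_vol \<kappa>) = borel_measurable (restrict_space borel (cball 0 1))"
  by (intro measurable_cong_sets) (simp_all add: weighted_vol_def vol_def sets_restrict_space)

lemma measurable_vol: "borel_measurable (vol \<kappa>) = borel_measurable (restrict_space borel (cball 0 1))"
  by (intro measurable_cong_sets) (simp_all add: vol_def sets_restrict_space)

lemma measurable_restrict_lborel:
  "borel_measurable (restrict_space lborel S) = borel_measurable (restrict_space borel S)"
  by (intro measurable_cong_sets) (simp_all add: sets_restrict_space)

lemma weight_measurable [measurable]: "weight \<kappa> \<in> borel_measurable borel"
  unfolding weight_def[abs_def] by measurable

definition vol_density :: "real \<Rightarrow> complex \<Rightarrow> real" where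
  "vol_density \<kappa> z = weight \<kappa> z / (1 + \<kappa> * (cmod z)\<^sup>2)\<^sup>2"

lemma vol_density_measurable [measurable]: "vol_density \<kappa> \<in> borel_measurable borel"
  unfolding vol_density_def[abs_def] by measurable

lemma vol_density_pos:
  assumes "-1 < \<kappa>" "\<kappa> < 1" "cmod z \<le> 1"
  shows "vol_density \<kappa> z > 0"
  using weight_pos[OF assms] curvature_factor_pos[OF assms] by (simp add: vol_density_def)

text \<open>The algebraic identity behind the choice of weight: two powers of it, beyond the one in
  the measure, turn the weighted volume into the Jacobian of the straightening map.\<close>

lemma weight_sq_vol_density:
  assumes "-1 < \<kappa>" "\<kappa> < 1" "cmod z \<le> 1"
  shows "(weight \<kappa> z)\<^sup>2 * vol_density \<kappa> z = proj_jacobian \<kappa> z / (1 - \<kappa>)\<^sup>2"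
proof -
  have "(a / b)\<^sup>2 * ((a / b) / a\<^sup>2) = (c\<^sup>2 * a / b ^ 3) / c\<^sup>2" if "a > 0" "b > 0" "c > 0" for a b c :: real
    using that by (simp add: power2_eq_square power3_eq_cube)
  from this[OF curvature_factor_pos[OF assms], of "1 - \<kappa>"] assms show ?thesis
    by (simp add: weight_def vol_density_def proj_jacobian_def)
qed

lemma weighted_vol_eq:
  assumes \<kappa>: "-1 < \<kappa>" "\<kappa> < 1"
  shows "weighted_vol \<kappa> = density (restrict_space lborel (cball 0 1)) (\<lambda>z. ennreal (vol_density \<kappa> z))"
proof -
  have m: "(\<lambda>z. ennreal (1 / (1 + \<kappa> * (cmod z)\<^sup>2)\<^sup>2)) \<in> borel_measurable (restrict_space lborel (cball 0 1))"
    "(\<lambda>z. ennreal (weight \<kappa> z)) \<in> borel_measurable (restrict_space lborel (cball 0 1))"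
    by (intro measurable_restrict_space1, measurable)+
  have "weighted_vol \<kappa> = density (restrict_space lborel (cball 0 1))
      (\<lambda>z. ennreal (1 / (1 + \<kappa> * (cmod z)\<^sup>2)\<^sup>2) * ennreal (weight \<kappa> z))"
    unfolding weighted_vol_def vol_def by (rule density_density_eq[OF m])
  also have "\<dots> = density (restrict_space lborel (cball 0 1)) (\<lambda>z. ennreal (vol_density \<kappa> z))"
  proof (rule density_cong)
    show "AE z in restrict_space lborel (cball 0 1). ennreal (1 / (1 + \<kappa> * (cmod z)\<^sup>2)\<^sup>2) * ennreal (weight \<kappa> z) = ennreal (vol_density \<kappa> z)"
    proof (rule AE_I2)
      fix z :: complex assume "z \<in> space (restrict_space lborel (cball 0 1))"
      then have "cmod z \<le> 1" by (simp add: space_restrict_space)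
      from weight_pos[OF \<kappa> this]
      show "ennreal (1 / (1 + \<kappa> * (cmod z)\<^sup>2)\<^sup>2) * ennreal (weight \<kappa> z) = ennreal (vol_density \<kappa> z)"
        by (simp add: vol_density_def ennreal_mult'[symmetric])
    qed
  qed (intro measurable_restrict_space1, measurable)+
  finally show ?thesis .
qed

lemma nn_integral_weighted_vol:
  assumes \<kappa>: "-1 < \<kappa>" "\<kappa> < 1" and f: "f \<in> borel_measurable (restrict_space borel (cball 0 1))"
  shows "(\<integral>\<^sup>+z. f z \<partial>weighted_vol \<kappa>) = (\<integral>\<^sup>+z. f z * (ennreal (vol_density \<kappa> z) * indicator (cball 0 1) z) \<partial>lborel)"
proof -
  have "(\<integral>\<^sup>+z. f z \<partial>weighted_vol \<kappa>) = (\<integral>\<^sup>+z. ennreal (vol_density \<kappa> z) * f z \<partial>restrict_space lborel (cball 0 1))"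
    unfolding weighted_vol_eq[OF \<kappa>]
    by (rule nn_integral_density)
       (use f in \<open>auto simp: measurable_restrict_lborel intro!: measurable_restrict_space1\<close>)
  also have "\<dots> = (\<integral>\<^sup>+z. ennreal (vol_density \<kappa> z) * f z * indicator (cball 0 1) z \<partial>lborel)"
    by (subst nn_integral_restrict_space) auto
  finally show ?thesis by (simp add: mult_ac)
qed

lemma integral_weighted_vol:
  fixes f :: "complex \<Rightarrow> complex"
  assumes \<kappa>: "-1 < \<kappa>" "\<kappa> < 1" and f: "f \<in> borel_measurable (restrict_space borel (cball 0 1))"
  shows "(\<integral>z. f z \<partial>weighted_vol \<kappa>) = (LINT z:cball 0 1|lborel. complex_of_real (vol_density \<kappa> z) * f z)"
proof -
  have "(\<integral>z. f z \<partial>weighted_vol \<kappa>) = (\<integral>z. vol_density \<kappa> z *\<^sub>R f z \<partial>restrict_space lborel (cball 0 1))"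
    unfolding weighted_vol_eq[OF \<kappa>]
  proof (rule integral_density)
    show "AE z in restrict_space lborel (cball 0 1). 0 \<le> vol_density \<kappa> z"
      using vol_density_pos[OF \<kappa>] by (intro AE_I2) (auto simp: space_restrict_space less_imp_le)
  qed (use f in \<open>auto simp: measurable_restrict_lborel intro!: measurable_restrict_space1\<close>)
  also have "\<dots> = (LINT z:cball 0 1|lborel. complex_of_real (vol_density \<kappa> z) * f z)"
    unfolding set_lebesgue_integral_def by (subst integral_restrict_space) (auto simp: scaleR_conv_of_real)
  finally show ?thesis .
qed

lemma borel_measurable_restrict: "f \<in> borel_measurable borel \<Longrightarrow> f \<in> borel_measurable (restrict_space borel S)"
  by (rule measurable_restrict_space1)

lemma nn_integral_weighted_vol_proj:
  fixes K :: "complex \<Rightarrow> ennreal"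
  assumes \<kappa>: "-1 < \<kappa>" "\<kappa> < 1" and [measurable]: "K \<in> borel_measurable borel"
  shows "(\<integral>\<^sup>+z. ennreal ((weight \<kappa> z)\<^sup>2) * K (proj \<kappa> z) \<partial>weighted_vol \<kappa>) =
    ennreal (1 / (1 - \<kappa>)\<^sup>2) * (\<integral>\<^sup>+z. K z * indicator (cball 0 1) z \<partial>lborel)"
proof -
  have [measurable]: "cball (0::complex) 1 \<in> sets borel" by simp
  have "(\<integral>\<^sup>+z. ennreal ((weight \<kappa> z)\<^sup>2) * K (proj \<kappa> z) \<partial>weighted_vol \<kappa>) =
    (\<integral>\<^sup>+z. ennreal ((weight \<kappa> z)\<^sup>2) * K (proj \<kappa> z) * (ennreal (vol_density \<kappa> z) * indicator (cball 0 1) z) \<partial>lborel)"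
    by (rule nn_integral_weighted_vol[OF \<kappa>]) (rule borel_measurable_restrict, measurable)
  also have "\<dots> = (\<integral>\<^sup>+z. ennreal (1 / (1 - \<kappa>)\<^sup>2) * (K (proj \<kappa> z) * (ennreal (proj_jacobian \<kappa> z) * indicator (cball 0 1) z)) \<partial>lborel)"
  proof (intro nn_integral_cong)
    fix z :: complex
    show "ennreal ((weight \<kappa> z)\<^sup>2) * K (proj \<kappa> z) * (ennreal (vol_density \<kappa> z) * indicator (cball 0 1) z) =
      ennreal (1 / (1 - \<kappa>)\<^sup>2) * (K (proj \<kappa> z) * (ennreal (proj_jacobian \<kappa> z) * indicator (cball 0 1) z))"
    proof (cases "cmod z \<le> 1")
      case True
      have e: "ennreal ((weight \<kappa> z)\<^sup>2) * ennreal (vol_density \<kappa> z) = ennreal (1 / (1 - \<kappa>)\<^sup>2) * ennreal (proj_jacobian \<kappa> z)"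
        using proj_jacobian_pos[OF \<kappa> True] vol_density_pos[OF \<kappa> True]
        by (simp add: ennreal_mult'[symmetric] weight_sq_vol_density[OF \<kappa> True])
      have "ennreal ((weight \<kappa> z)\<^sup>2) * K (proj \<kappa> z) * (ennreal (vol_density \<kappa> z) * indicator (cball 0 1) z)
        = (ennreal ((weight \<kappa> z)\<^sup>2) * ennreal (vol_density \<kappa> z)) * (K (proj \<kappa> z) * indicator (cball 0 1) z)"
        by (simp only: mult_ac)
      then show ?thesis unfolding e by (simp only: mult_ac)
    qed simp
  qed
  also have "\<dots> = ennreal (1 / (1 - \<kappa>)\<^sup>2) * (\<integral>\<^sup>+z. K (proj \<kappa> z) * (ennreal (proj_jacobian \<kappa> z) * indicator (cball 0 1) z) \<partial>lborel)"
    by (rule nn_integral_cmult) measurable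
  finally show ?thesis using nn_integral_proj[OF \<kappa>, of K] by simp
qed

text \<open>Passing from \<open>k\<close> to \<open>K\<close> is thus (1-kappa) times an isometry
  from the weighted space to L2 of the Euclidean disk. Norms, completeness and boundedness are all
  transported through this identity.\<close>

lemma nn_integral_weighted_vol_norm:
  assumes \<kappa>: "-1 < \<kappa>" "\<kappa> < 1" and K: "K \<in> borel_measurable borel"
    and k: "\<And>z. cmod z \<le> 1 \<Longrightarrow> k z = complex_of_real (weight \<kappa> z) * K (proj \<kappa> z)"
  shows "(\<integral>\<^sup>+z. ennreal ((cmod (k z))\<^sup>2) \<partial>weighted_vol \<kappa>) =
    ennreal (1 / (1 - \<kappa>)\<^sup>2) * (\<integral>\<^sup>+z. ennreal ((cmod (K z))\<^sup>2) * indicator (cball 0 1) z \<partial>lborel)"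
proof -
  have "(\<integral>\<^sup>+z. ennreal ((cmod (k z))\<^sup>2) \<partial>weighted_vol \<kappa>) =
     (\<integral>\<^sup>+z. ennreal ((weight \<kappa> z)\<^sup>2) * ennreal ((cmod (K (proj \<kappa> z)))\<^sup>2) \<partial>weighted_vol \<kappa>)"
    by (intro nn_integral_cong) (simp add: k norm_mult power_mult_distrib ennreal_mult)
  also have "\<dots> = ennreal (1 / (1 - \<kappa>)\<^sup>2) * (\<integral>\<^sup>+z. ennreal ((cmod (K z))\<^sup>2) * indicator (cball 0 1) z \<partial>lborel)"
    using K by (intro nn_integral_weighted_vol_proj[OF \<kappa>]) measurable
  finally show ?thesis .
qed

lemma weighted_vol_measurable_proj:
  assumes \<kappa>: "-1 < \<kappa>" "\<kappa> < 1" and K [measurable]: "K \<in> borel_measurable borel"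
    and k: "\<And>z. cmod z \<le> 1 \<Longrightarrow> k z = complex_of_real (weight \<kappa> z) * K (proj \<kappa> z)"
  shows "k \<in> borel_measurable (weighted_vol \<kappa>)"
proof -
  have "(\<lambda>z. complex_of_real (weight \<kappa> z) * K (proj \<kappa> z)) \<in> borel_measurable (weighted_vol \<kappa>)"
    unfolding measurable_weighted_vol by (rule borel_measurable_restrict) measurable
  then show ?thesis by (rule measurable_cong[THEN iffD1, rotated]) (simp add: k)
qed

lemma L2_space_iff:
  assumes "f \<in> borel_measurable M"
  shows "f \<in> L2_space M \<longleftrightarrow> (\<integral>\<^sup>+x. ennreal ((cmod (f x))\<^sup>2) \<partial>M) < \<infinity>"
  using assms by (simp add: L2_space_def integrable_iff_bounded)

lemma L2_norm_nn:
  assumes "f \<in> L2_space M"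
  shows "(\<integral>\<^sup>+x. ennreal ((cmod (f x))\<^sup>2) \<partial>M) = ennreal ((L2_norm M f)\<^sup>2)"
  unfolding L2_norm_def using assms
  by (simp add: L2_space_def nn_integral_eq_integral)

text \<open>The isometry in polarised form, again through an equality of measures: the Jacobian
  density on the disk pushes forward to Lebesgue measure on the disk.\<close>

lemma integral_weighted_vol_inner:
  fixes K1 K2 :: "complex \<Rightarrow> complex"
  assumes \<kappa>: "-1 < \<kappa>" "\<kappa> < 1" and [measurable]: "K1 \<in> borel_measurable borel" "K2 \<in> borel_measurable borel"
    and k: "\<And>z. cmod z \<le> 1 \<Longrightarrow> k1 z = complex_of_real (weight \<kappa> z) * K1 (proj \<kappa> z)"
      "\<And>z. cmod z \<le> 1 \<Longrightarrow> k2 z = complex_of_real (weight \<kappa> z) * K2 (proj \<kappa> z)"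
  shows "L2_inner (weighted_vol \<kappa>) k1 k2 = complex_of_real (1 / (1 - \<kappa>)\<^sup>2) * (LINT z:cball 0 1|lborel. K1 z * cnj (K2 z))"
proof -
  have [measurable]: "cball (0::complex) 1 \<in> sets borel" by simp
  let ?P = "density lborel (\<lambda>z::complex. ennreal (proj_jacobian \<kappa> z * indicator (cball 0 1) z))"
  let ?Q = "density lborel (\<lambda>z::complex. ennreal (indicator (cball 0 1) z))"
  have Jn: "0 \<le> proj_jacobian \<kappa> z * indicator (cball 0 1) z" for z
    using proj_jacobian_pos[OF \<kappa>, of z] by (auto simp: indicator_def)
  have Je: "ennreal (proj_jacobian \<kappa> z * indicator (cball 0 1) z) = ennreal (proj_jacobian \<kappa> z) * indicator (cball 0 1) z" for z
    by (auto simp: indicator_def)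
  have eq: "distr ?P borel (proj \<kappa>) = ?Q"
  proof (rule measure_eqI)
    fix A assume "A \<in> sets (distr ?P borel (proj \<kappa>))"
    then have [measurable]: "A \<in> sets borel" by simp
    have "emeasure (distr ?P borel (proj \<kappa>)) A = (\<integral>\<^sup>+p. indicator A p \<partial>distr ?P borel (proj \<kappa>))"
      by simp
    also have "\<dots> = (\<integral>\<^sup>+z. indicator A (proj \<kappa> z) \<partial>?P)" by (subst nn_integral_distr) (auto simp del: nn_integral_indicator)
    also have "\<dots> = (\<integral>\<^sup>+z. indicator A (proj \<kappa> z) * (ennreal (proj_jacobian \<kappa> z) * indicator (cball 0 1) z) \<partial>lborel)"
      unfolding Je by (subst nn_integral_density) (auto simp: mult_ac)
    also have "\<dots> = (\<integral>\<^sup>+z. indicator A z * indicator (cball 0 1) z \<partial>lborel)"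
      by (rule nn_integral_proj[OF \<kappa>]) measurable
    also have "\<dots> = emeasure ?Q A"
      by (subst emeasure_density) (auto simp: mult.commute ennreal_indicator)
    finally show "emeasure (distr ?P borel (proj \<kappa>)) A = emeasure ?Q A" .
  qed simp
  let ?K = "\<lambda>z. K1 z * cnj (K2 z)"
  have mK [measurable]: "?K \<in> borel_measurable borel"
    by (intro borel_measurable_times borel_measurable_cnj) measurable
  have "L2_inner (weighted_vol \<kappa>) k1 k2 = (\<integral>z. complex_of_real ((weight \<kappa> z)\<^sup>2) * ?K (proj \<kappa> z) \<partial>weighted_vol \<kappa>)"
    unfolding L2_inner_def
    by (intro Bochner_Integration.integral_cong refl) (simp add: k power2_eq_square)
  also have "\<dots> = (LINT z:cball 0 1|lborel. complex_of_real (vol_density \<kappa> z) * (complex_of_real ((weight \<kappa> z)\<^sup>2) * ?K (proj \<kappa> z)))"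
  proof (rule integral_weighted_vol[OF \<kappa>], rule borel_measurable_restrict)
    have [measurable]: "(\<lambda>z. ?K (proj \<kappa> z)) \<in> borel_measurable borel"
      by (rule measurable_compose[OF proj_measurable mK])
    show "(\<lambda>z. complex_of_real ((weight \<kappa> z)\<^sup>2) * ?K (proj \<kappa> z)) \<in> borel_measurable borel"
      by (intro borel_measurable_times) measurable
  qed
  also have "\<dots> = (LINT z:cball 0 1|lborel. complex_of_real (1 / (1 - \<kappa>)\<^sup>2) * (complex_of_real (proj_jacobian \<kappa> z) * ?K (proj \<kappa> z)))"
  proof (rule set_lebesgue_integral_cong)
    show "\<forall>z. z \<in> cball 0 1 \<longrightarrow> complex_of_real (vol_density \<kappa> z) * (complex_of_real ((weight \<kappa> z)\<^sup>2) * ?K (proj \<kappa> z))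
      = complex_of_real (1 / (1 - \<kappa>)\<^sup>2) * (complex_of_real (proj_jacobian \<kappa> z) * ?K (proj \<kappa> z))"
    proof (intro allI impI)
      fix z :: complex assume "z \<in> cball 0 1"
      then have "vol_density \<kappa> z * (weight \<kappa> z)\<^sup>2 = (1 / (1 - \<kappa>)\<^sup>2) * proj_jacobian \<kappa> z"
        using weight_sq_vol_density[OF \<kappa>, of z] by (simp add: mult.commute)
      then have "complex_of_real (vol_density \<kappa> z) * complex_of_real ((weight \<kappa> z)\<^sup>2) = complex_of_real (1 / (1 - \<kappa>)\<^sup>2) * complex_of_real (proj_jacobian \<kappa> z)"
        by (simp only: of_real_mult[symmetric])
      then show "complex_of_real (vol_density \<kappa> z) * (complex_of_real ((weight \<kappa> z)\<^sup>2) * ?K (proj \<kappa> z))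
      = complex_of_real (1 / (1 - \<kappa>)\<^sup>2) * (complex_of_real (proj_jacobian \<kappa> z) * ?K (proj \<kappa> z))"
        by (simp only: mult.assoc[symmetric])
    qed
  qed simp
  also have "\<dots> = complex_of_real (1 / (1 - \<kappa>)\<^sup>2) * (LINT z:cball 0 1|lborel. complex_of_real (proj_jacobian \<kappa> z) * ?K (proj \<kappa> z))"
    by (rule set_integral_mult_right)
  also have "(LINT z:cball 0 1|lborel. complex_of_real (proj_jacobian \<kappa> z) * ?K (proj \<kappa> z)) = (\<integral>z. (proj_jacobian \<kappa> z * indicator (cball 0 1) z) *\<^sub>R ?K (proj \<kappa> z) \<partial>lborel)"
    unfolding set_lebesgue_integral_def
    by (intro Bochner_Integration.integral_cong refl) (auto simp: indicator_def scaleR_conv_of_real)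
  also have "\<dots> = (\<integral>z. ?K (proj \<kappa> z) \<partial>?P)"
    using measurable_compose[OF proj_measurable mK] Jn by (subst integral_density) auto
  also have "\<dots> = (\<integral>z. ?K z \<partial>?Q)"
    unfolding eq[symmetric] using mK by (subst integral_distr) auto
  also have "\<dots> = (LINT z:cball 0 1|lborel. ?K z)"
    unfolding set_lebesgue_integral_def using mK by (subst integral_density) auto
  finally show ?thesis .
qed

text \<open>Agrees with \<open>scat\<close> on \<open>[-\<pi>/2, \<pi>/2]\<close>, but is smooth on the whole line: the tangent in the
  definition of \<open>scat\<close> is singular at the end points.\<close>

definition scat_ext :: "real \<Rightarrow> real \<Rightarrow> real" where
  "scat_ext \<kappa> \<alpha> = \<alpha> - arctan (\<kappa> * sin (2 * \<alpha>) / (1 + \<kappa> * cos (2 * \<alpha>)))"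

section \<open>The scattering angle as a change of variables\<close>

lemma chord_factor_sq': "(chord_factor \<kappa> \<alpha>)\<^sup>2 = 1 + 2 * \<kappa> * cos (2 * \<alpha>) + \<kappa>\<^sup>2"
  unfolding chord_factor_sq cos_double using sin_cos_squared_add[of \<alpha>] by algebra

text \<open>Since (1+kappa) cos alpha + i (1-kappa) sin alpha = e^{i alpha} (1 + kappa e^{-2 i
  alpha}), its argument is alpha minus the argument of 1 + kappa e^{2 i alpha}; this is the origin
  of \<open>scat_ext\<close>. The derivative is the Poisson kernel (1-kappa^2) / |1 + kappa e^{2 i
  alpha}|^2.\<close>

lemma DERIV_scat_ext:
  assumes \<kappa>: "-1 < \<kappa>" "\<kappa> < 1"
  shows "(scat_ext \<kappa> has_real_derivative (1 - \<kappa>\<^sup>2) / (chord_factor \<kappa> \<alpha>)\<^sup>2) (at \<alpha>)"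
proof -
  define c s where "c = cos (2 * \<alpha>)" and "s = sin (2 * \<alpha>)"
  have cs: "s\<^sup>2 + c\<^sup>2 = 1" unfolding c_def s_def by (rule sin_cos_squared_add)
  have "\<bar>\<kappa> * c\<bar> \<le> \<bar>\<kappa>\<bar> * 1" unfolding abs_mult by (intro mult_left_mono) (auto simp: c_def)
  then have n: "1 + \<kappa> * c > 0" using \<kappa> by linarith
  have D: "(chord_factor \<kappa> \<alpha>)\<^sup>2 > 0" using chord_factor_pos[OF \<kappa>, of \<alpha>] by simp
  have D': "(1 + \<kappa> * c)\<^sup>2 * (1 + (\<kappa> * s / (1 + \<kappa> * c))\<^sup>2) = (chord_factor \<kappa> \<alpha>)\<^sup>2"
  proof -
    have "(1 + \<kappa> * c)\<^sup>2 * (1 + (\<kappa> * s / (1 + \<kappa> * c))\<^sup>2) = (1 + \<kappa> * c)\<^sup>2 + (\<kappa> * s)\<^sup>2"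
      using n by (simp add: power_divide distrib_left)
    also have "\<dots> = 1 + 2 * \<kappa> * c + \<kappa>\<^sup>2" using cs by algebra
    finally show ?thesis unfolding chord_factor_sq' c_def .
  qed
  have "((\<lambda>\<alpha>. \<kappa> * sin (2 * \<alpha>) / (1 + \<kappa> * cos (2 * \<alpha>))) has_real_derivative
     (2 * \<kappa> * (c + \<kappa>)) / (1 + \<kappa> * c)\<^sup>2) (at \<alpha>)"
  proof -
    have "((\<lambda>\<alpha>. \<kappa> * sin (2 * \<alpha>) / (1 + \<kappa> * cos (2 * \<alpha>))) has_real_derivative
     ((\<kappa> * (c * 2)) * (1 + \<kappa> * c) - \<kappa> * s * (\<kappa> * (- s * 2))) / ((1 + \<kappa> * c) * (1 + \<kappa> * c))) (at \<alpha>)"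
      using n by (auto intro!: derivative_eq_intros simp: c_def s_def)
    also have "(\<kappa> * (c * 2)) * (1 + \<kappa> * c) - \<kappa> * s * (\<kappa> * (- s * 2)) = 2 * \<kappa> * (c + \<kappa>)"
      using cs by algebra
    finally show ?thesis by (simp add: power2_eq_square)
  qed
  from DERIV_chain2[OF DERIV_arctan this]
  have "(scat_ext \<kappa> has_real_derivative 1 - inverse (1 + (\<kappa> * s / (1 + \<kappa> * c))\<^sup>2) * (2 * \<kappa> * (c + \<kappa>) / (1 + \<kappa> * c)\<^sup>2)) (at \<alpha>)"
    unfolding scat_ext_def[abs_def] by (intro DERIV_diff DERIV_ident) (simp add: c_def s_def)
  also have "inverse (1 + (\<kappa> * s / (1 + \<kappa> * c))\<^sup>2) * (2 * \<kappa> * (c + \<kappa>) / (1 + \<kappa> * c)\<^sup>2) = 2 * \<kappa> * (c + \<kappa>) / (chord_factor \<kappa> \<alpha>)\<^sup>2"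
    unfolding D'[symmetric] by (simp add: inverse_eq_divide mult.commute)
  also have "1 - 2 * \<kappa> * (c + \<kappa>) / (chord_factor \<kappa> \<alpha>)\<^sup>2 = ((chord_factor \<kappa> \<alpha>)\<^sup>2 - 2 * \<kappa> * (c + \<kappa>)) / (chord_factor \<kappa> \<alpha>)\<^sup>2"
    using D by (simp add: diff_divide_distrib)
  also have "(chord_factor \<kappa> \<alpha>)\<^sup>2 - 2 * \<kappa> * (c + \<kappa>) = 1 - \<kappa>\<^sup>2"
    unfolding chord_factor_sq' c_def by (simp add: power2_eq_square algebra_simps)
  finally show ?thesis .
qed

lemma scat_ext_pi_half [simp]: "scat_ext \<kappa> (pi / 2) = pi / 2" "scat_ext \<kappa> (- pi / 2) = - pi / 2"
  "scat_ext \<kappa> (- (pi / 2)) = - (pi / 2)"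
  by (simp_all add: scat_ext_def)

text \<open>Both sides have the same derivative on the open interval and vanish at 0. The end points
  are compared by value.\<close>

lemma scat_eq_scat_ext:
  assumes \<kappa>: "-1 < \<kappa>" "\<kappa> < 1" and \<alpha>: "\<bar>\<alpha>\<bar> \<le> pi / 2"
  shows "scat \<kappa> \<alpha> = scat_ext \<kappa> \<alpha>"
proof (cases "\<bar>\<alpha>\<bar> = pi / 2")
  case True
  then have "\<alpha> = pi / 2 \<or> \<alpha> = - pi / 2" by linarith
  moreover have "scat \<kappa> (pi / 2) = scat_ext \<kappa> (pi / 2)" "scat \<kappa> (- pi / 2) = scat_ext \<kappa> (- pi / 2)"
    by (simp_all add: scat_def)
  ultimately show ?thesis by metis
next
  case False
  then have lt: "\<bar>\<alpha>\<bar> < pi / 2" using \<alpha> by simp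
  define S where "S = {- pi / 2<..<pi / 2}"
  define f where "f = (\<lambda>x. arctan ((1 - \<kappa>) / (1 + \<kappa>) * tan x) - scat_ext \<kappa> x)"
  have d: "(f has_real_derivative 0) (at x within S)" if "x \<in> S" for x
  proof -
    have c: "cos x > 0" using that by (intro cos_gt_zero_pi) (auto simp: S_def)
    have "((\<lambda>x. arctan ((1 - \<kappa>) / (1 + \<kappa>) * tan x)) has_real_derivative
        inverse (1 + ((1 - \<kappa>) / (1 + \<kappa>) * tan x)\<^sup>2) * ((1 - \<kappa>) / (1 + \<kappa>) * inverse ((cos x)\<^sup>2))) (at x)"
      using c by (intro DERIV_chain2[OF DERIV_arctan] DERIV_cmult DERIV_tan) auto
    also have "inverse (1 + ((1 - \<kappa>) / (1 + \<kappa>) * tan x)\<^sup>2) * ((1 - \<kappa>) / (1 + \<kappa>) * inverse ((cos x)\<^sup>2))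
       = (1 - \<kappa>\<^sup>2) / (chord_factor \<kappa> x)\<^sup>2"
    proof -
      have "inverse (1 + (b / a * (s / c))\<^sup>2) * (b / a * inverse (c\<^sup>2)) = a * b / (a\<^sup>2 * c\<^sup>2 + b\<^sup>2 * s\<^sup>2)"
        if "a > 0" "c > 0" for a b c s :: real
      proof -
        have "1 + (b / a * (s / c))\<^sup>2 = (a\<^sup>2 * c\<^sup>2 + b\<^sup>2 * s\<^sup>2) / (a\<^sup>2 * c\<^sup>2)"
          using that by (simp add: power_divide power_mult_distrib add_divide_distrib)
        then show ?thesis using that by (simp add: inverse_eq_divide power2_eq_square)
      qed
      from this[of "1 + \<kappa>" "cos x" "1 - \<kappa>" "sin x"] c \<kappa>
      have "inverse (1 + ((1 - \<kappa>) / (1 + \<kappa>) * tan x)\<^sup>2) * ((1 - \<kappa>) / (1 + \<kappa>) * inverse ((cos x)\<^sup>2)) =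
         (1 + \<kappa>) * (1 - \<kappa>) / (chord_factor \<kappa> x)\<^sup>2"
        unfolding chord_factor_sq tan_def by simp
      also have "(1 + \<kappa>) * (1 - \<kappa>) = 1 - \<kappa>\<^sup>2" by (simp add: power2_eq_square algebra_simps)
      finally show ?thesis .
    qed
    finally have "(f has_real_derivative 0) (at x)"
      unfolding f_def using DERIV_diff[OF _ DERIV_scat_ext[OF \<kappa>, of x]] by fastforce
    then show ?thesis by (rule DERIV_subset) simp
  qed
  have "\<exists>c. \<forall>x\<in>S. f x = c"
    using d by (intro has_field_derivative_zero_constant) (auto simp: S_def)
  then obtain c where c: "\<forall>x\<in>S. f x = c" by blast
  have "0 \<in> S" "\<alpha> \<in> S" using lt by (auto simp: S_def abs_less_iff)
  then have "f \<alpha> = f 0" using c by simp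
  also have "f 0 = 0" by (simp add: f_def scat_ext_def)
  finally show ?thesis using False by (simp add: f_def scat_def)
qed

lemma scat_deriv_eq:
  assumes \<kappa>: "-1 < \<kappa>" "\<kappa> < 1" and \<alpha>: "\<bar>\<alpha>\<bar> \<le> pi / 2"
  shows "scat_deriv \<kappa> \<alpha> = (1 - \<kappa>\<^sup>2) / (chord_factor \<kappa> \<alpha>)\<^sup>2"
proof -
  have mem: "\<alpha> \<in> {- pi / 2..pi / 2}" using \<alpha> by (auto simp: abs_le_iff)
  have "(scat_ext \<kappa> has_vector_derivative (1 - \<kappa>\<^sup>2) / (chord_factor \<kappa> \<alpha>)\<^sup>2) (at \<alpha> within {- pi / 2..pi / 2})"
    using DERIV_subset[OF DERIV_scat_ext[OF \<kappa>] subset_UNIV]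
    by (simp add: has_real_derivative_iff_has_vector_derivative)
  then have "(scat \<kappa> has_vector_derivative (1 - \<kappa>\<^sup>2) / (chord_factor \<kappa> \<alpha>)\<^sup>2) (at \<alpha> within {- pi / 2..pi / 2})"
  proof (rule has_vector_derivative_transform[OF mem, rotated])
    fix x assume "x \<in> {- pi / 2..pi / 2}"
    then have "\<bar>x\<bar> \<le> pi / 2" by (auto simp: abs_le_iff)
    then show "scat \<kappa> x = scat_ext \<kappa> x" by (rule scat_eq_scat_ext[OF \<kappa>])
  qed
  then show ?thesis
    unfolding scat_deriv_def using vector_derivative_within_cbox[of "- pi / 2" "pi / 2" \<alpha> "scat \<kappa>"] mem
    by simp
qed

lemma scat_ext_continuous:
  assumes \<kappa>: "-1 < \<kappa>" "\<kappa> < 1"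
  shows "continuous_on A (scat_ext \<kappa>)"
  using DERIV_isCont[OF DERIV_scat_ext[OF \<kappa>]] by (intro continuous_at_imp_continuous_on) auto

lemma scat_deriv_continuous:
  assumes \<kappa>: "-1 < \<kappa>" "\<kappa> < 1"
  shows "continuous_on A (\<lambda>\<alpha>. (1 - \<kappa>\<^sup>2) / (chord_factor \<kappa> \<alpha>)\<^sup>2)"
proof -
  have "(1 + \<kappa>)\<^sup>2 * (cos \<alpha>)\<^sup>2 + (1 - \<kappa>)\<^sup>2 * (sin \<alpha>)\<^sup>2 \<noteq> 0" for \<alpha>
    using chord_factor_pos[OF \<kappa>, of \<alpha>] unfolding chord_factor_sq[symmetric] by simp
  then show ?thesis unfolding chord_factor_sq by (intro continuous_intros) auto
qed

lemma scat_deriv_pos: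
  assumes \<kappa>: "-1 < \<kappa>" "\<kappa> < 1"
  shows "(1 - \<kappa>\<^sup>2) / (chord_factor \<kappa> \<alpha>)\<^sup>2 > 0"
proof -
  have "\<kappa>\<^sup>2 < 1" using \<kappa> by (simp add: abs_square_less_1)
  then show ?thesis using chord_factor_pos[OF \<kappa>, of \<alpha>] by simp
qed

lemma nn_integral_scat:
  fixes g :: "real \<Rightarrow> ennreal"
  assumes \<kappa>: "-1 < \<kappa>" "\<kappa> < 1" and g: "g \<in> borel_measurable borel"
  shows "(\<integral>\<^sup>+\<alpha>. g (scat \<kappa> \<alpha>) * ennreal (scat_deriv \<kappa> \<alpha>) * indicator {- pi / 2..pi / 2} \<alpha> \<partial>lborel) =
     (\<integral>\<^sup>+s. g s * indicator {- pi / 2..pi / 2} s \<partial>lborel)"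
proof -
  have "(\<integral>\<^sup>+s. g s * indicator {scat_ext \<kappa> (- pi / 2)..scat_ext \<kappa> (pi / 2)} s \<partial>lborel) =
    (\<integral>\<^sup>+\<alpha>. g (scat_ext \<kappa> \<alpha>) * ennreal ((1 - \<kappa>\<^sup>2) / (chord_factor \<kappa> \<alpha>)\<^sup>2) * indicator {- pi / 2..pi / 2} \<alpha> \<partial>lborel)"
    using scat_deriv_pos[OF \<kappa>]
    by (intro nn_integral_substitution_aux g DERIV_scat_ext[OF \<kappa>] scat_deriv_continuous[OF \<kappa>])
       (auto simp: less_imp_le)
  also have "\<dots> = (\<integral>\<^sup>+\<alpha>. g (scat \<kappa> \<alpha>) * ennreal (scat_deriv \<kappa> \<alpha>) * indicator {- pi / 2..pi / 2} \<alpha> \<partial>lborel)"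
  proof (intro nn_integral_cong)
    fix \<alpha> :: real
    show "g (scat_ext \<kappa> \<alpha>) * ennreal ((1 - \<kappa>\<^sup>2) / (chord_factor \<kappa> \<alpha>)\<^sup>2) * indicator {- pi / 2..pi / 2} \<alpha> =
      g (scat \<kappa> \<alpha>) * ennreal (scat_deriv \<kappa> \<alpha>) * indicator {- pi / 2..pi / 2} \<alpha>"
    proof (cases "\<bar>\<alpha>\<bar> \<le> pi / 2")
      case True
      then show ?thesis by (simp add: scat_eq_scat_ext[OF \<kappa>] scat_deriv_eq[OF \<kappa>])
    next
      case False
      then show ?thesis by (auto simp: indicator_def abs_le_iff)
    qed
  qed
  finally show ?thesis by simp
qed

section \<open>The measure on the inward boundary\<close>

abbreviation fan_domain :: "(real \<times> real) set" where
  "fan_domain \<equiv> {0..<2 * pi} \<times> {- pi / 2..pi / 2}"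

lemma fan_domain_borel [measurable]: "fan_domain \<in> sets borel"
proof -
  have "fan_domain \<in> sets (borel \<Otimes>\<^sub>M borel)" by (intro pair_measureI) auto
  then show ?thesis by (simp only: borel_prod)
qed

lemma space_boundary_measure [simp]: "space (boundary_measure \<kappa>) = fan_domain"
  by (simp add: boundary_measure_def space_restrict_space)

lemma measurable_boundary_measure:
  "borel_measurable (boundary_measure \<kappa>) = borel_measurable (restrict_space borel fan_domain)"
  by (intro measurable_cong_sets) (simp_all add: boundary_measure_def sets_restrict_space)

lemma nn_integral_boundary:
  assumes [measurable]: "f \<in> borel_measurable borel"
  shows "(\<integral>\<^sup>+p. f p \<partial>boundary_measure \<kappa>) = ennreal (1 / (1 + \<kappa>)) *
    (\<integral>\<^sup>+\<beta>. (\<integral>\<^sup>+\<alpha>. f (\<beta>, \<alpha>) * indicator {- pi / 2..pi / 2} \<alpha> \<partial>lborel) * indicator {0..<2 * pi} \<beta> \<partial>lborel)"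
proof -
  have fr: "f \<in> borel_measurable (restrict_space lborel fan_domain)"
    unfolding measurable_restrict_lborel by (rule borel_measurable_restrict) measurable
  have "fan_domain \<inter> space lborel \<in> sets lborel" using fan_domain_borel by simp
  note restr = nn_integral_restrict_space[OF this, of f]
  have "(\<integral>\<^sup>+p. f p \<partial>boundary_measure \<kappa>) = ennreal (1 / (1 + \<kappa>)) * (\<integral>\<^sup>+p. f p * indicator fan_domain p \<partial>lborel)"
    unfolding boundary_measure_def restr[symmetric] using fr
    by (simp add: nn_integral_density nn_integral_cmult)
  also have "(\<integral>\<^sup>+p. f p * indicator fan_domain p \<partial>lborel) = (\<integral>\<^sup>+\<beta>. \<integral>\<^sup>+\<alpha>. f (\<beta>, \<alpha>) * indicator fan_domain (\<beta>, \<alpha>) \<partial>lborel \<partial>lborel)"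
  proof -
    have "(\<lambda>p. f p * indicator fan_domain p) \<in> borel_measurable borel"
      by (intro borel_measurable_times_ennreal borel_measurable_indicator fan_domain_borel) measurable
    then have "(\<lambda>p. f p * indicator fan_domain p) \<in> borel_measurable (lborel \<Otimes>\<^sub>M lborel)"
      by (simp add: lborel_prod)
    from lborel.nn_integral_fst[OF this] show ?thesis by (simp add: lborel_prod)
  qed
  also have "\<dots> = (\<integral>\<^sup>+\<beta>. \<integral>\<^sup>+\<alpha>. (f (\<beta>, \<alpha>) * indicator {- pi / 2..pi / 2} \<alpha>) * indicator {0..<2 * pi} \<beta> \<partial>lborel \<partial>lborel)"
    by (intro nn_integral_cong) (auto simp: indicator_def)
  also have "\<dots> = (\<integral>\<^sup>+\<beta>. (\<integral>\<^sup>+\<alpha>. f (\<beta>, \<alpha>) * indicator {- pi / 2..pi / 2} \<alpha> \<partial>lborel) * indicator {0..<2 * pi} \<beta> \<partial>lborel)"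
    by (intro nn_integral_cong nn_integral_multc) measurable
  finally show ?thesis .
qed

section \<open>Zernike polynomials\<close>

text \<open>\<open>V n = 2 \<i>\<^sup>n T\<^sub>n\<close>, with \<open>T\<^sub>n\<close> the Chebyshev polynomials of the first kind, provides
  antiderivatives of the \<open>W n\<close>.\<close>

fun V :: "nat \<Rightarrow> real \<Rightarrow> complex" where
  "V 0 t = 2"
| "V (Suc 0) t = 2 * \<i> * complex_of_real t"
| "V (Suc (Suc n)) t = 2 * \<i> * complex_of_real t * V (Suc n) t + V n t"

lemma two_step_induct [case_names 0 1 step]:
  assumes "P 0" "P (Suc 0)" "\<And>n. P n \<Longrightarrow> P (Suc n) \<Longrightarrow> P (Suc (Suc n))"
  shows "P (n::nat)"
proof -
  have "P n \<and> P (Suc n)" by (induction n) (auto intro: assms)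
  then show ?thesis ..
qed

lemma V_conv_W: "V (Suc (Suc n)) t = W (Suc (Suc n)) t + W n t"
proof (induction n rule: two_step_induct)
  case (step n)
  show ?case
    unfolding V.simps(3)[of "Suc (Suc n)"] step by (simp add: algebra_simps)
qed (simp_all add: algebra_simps)

text \<open>The classical relation between the derivative of T_{n+1} and (n+1) U_n, by induction
  along the recurrence; \<open>V_conv_W\<close> absorbs the term coming from the derivative of
  t.\<close>

lemma V_has_vector_derivative:
  "(V (Suc n) has_vector_derivative 2 * \<i> * of_nat (n + 1) * W n t) (at t within S)"
proof (induction n rule: two_step_induct)
  case 0
  have V: "V (Suc 0) = (\<lambda>t. 2 * \<i> * complex_of_real t)" by (rule ext) simp
  show ?case unfolding V by (auto intro!: derivative_eq_intros has_vector_derivative_of_real)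
next
  case 1
  have V: "V (Suc (Suc 0)) = (\<lambda>t. 2 * \<i> * complex_of_real t * (2 * \<i> * complex_of_real t) + 2)" by (rule ext) simp
  show ?case unfolding V by (auto intro!: derivative_eq_intros has_vector_derivative_of_real)
next
  case (step n)
  have V: "V (Suc (Suc (Suc n))) = (\<lambda>t. 2 * \<i> * complex_of_real t * V (Suc (Suc n)) t + V (Suc n) t)" by (rule ext) simp
  have t: "((\<lambda>t. 2 * \<i> * complex_of_real t) has_vector_derivative 2 * \<i>) (at t within S)"
    by (auto intro!: derivative_eq_intros has_vector_derivative_of_real)
  have "(V (Suc (Suc (Suc n))) has_vector_derivative
     (2 * \<i> * complex_of_real t * (2 * \<i> * of_nat (Suc n + 1) * W (Suc n) t) + 2 * \<i> * V (Suc (Suc n)) t)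
      + 2 * \<i> * of_nat (n + 1) * W n t) (at t within S)"
    unfolding V by (intro has_vector_derivative_add has_vector_derivative_mult t step)
  also have "(2 * \<i> * complex_of_real t * (2 * \<i> * of_nat (Suc n + 1) * W (Suc n) t) + 2 * \<i> * V (Suc (Suc n)) t)
      + 2 * \<i> * of_nat (n + 1) * W n t =
      2 * \<i> * (of_nat (n + 2) * (2 * \<i> * complex_of_real t * W (Suc n) t) + V (Suc (Suc n)) t + of_nat (n + 1) * W n t)"
    by (simp add: algebra_simps)
  also have "2 * \<i> * complex_of_real t * W (Suc n) t = W (Suc (Suc n)) t - W n t" by simp
  also have "2 * \<i> * (of_nat (n + 2) * (W (Suc (Suc n)) t - W n t) + V (Suc (Suc n)) t + of_nat (n + 1) * W n t)
     = 2 * \<i> * of_nat (Suc (Suc n) + 1) * W (Suc (Suc n)) t"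
    unfolding V_conv_W by (simp del: W.simps V.simps add: algebra_simps)
  finally show ?case .
qed

lemma W_continuous [continuous_intros]:
  assumes "continuous_on S f" shows "continuous_on S (\<lambda>x. W n (f x))"
  by (induction n rule: two_step_induct) (auto intro!: continuous_intros assms)

lemma sin_conv_cis: "2 * \<i> * complex_of_real (sin x) = cis x - cis (- x)"
  by (simp add: complex_eq_iff)

lemma cos_conv_cis: "2 * complex_of_real (cos x) = cis x + cis (- x)"
  by (simp add: complex_eq_iff)

text \<open>The common algebra of the inductions for \<open>V_sin\<close> and \<open>W_sin\<close>:
  \<open>a\<close> and \<open>b\<close> stand for e^{ix} and e^{-ix}, \<open>p\<close> and
  \<open>q\<close> for the exponentials of the lower order, \<open>e\<close> for the sign.\<close>

lemma sin_recurrence: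
  fixes a b :: complex
  assumes "a * b = 1"
  shows "(a - b) * (a * p - e * (b * q)) + (p + e * q) = a * (a * p) + e * (b * (b * q))"
  using assms by algebra

lemma V_sin: "V n (sin x) = cis (real n * x) + (-1) ^ n * cis (- (real n * x))"
proof (induction n rule: two_step_induct)
  case (step n)
  have e: "cis (real (Suc n) * x) = cis x * cis (real n * x)" "cis (real (Suc (Suc n)) * x) = cis x * (cis x * cis (real n * x))"
     "cis (- (real (Suc n) * x)) = cis (- x) * cis (- (real n * x))"
     "cis (- (real (Suc (Suc n)) * x)) = cis (- x) * (cis (- x) * cis (- (real n * x)))"
    unfolding mult.assoc[symmetric] cis_mult by (rule arg_cong[of _ _ cis], simp add: algebra_simps)+
  have i: "cis x * cis (- x) = 1" by (simp add: cis_mult)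
  show ?case
    unfolding V.simps step sin_conv_cis e
    using sin_recurrence[OF i, of "cis (real n * x)" "(-1) ^ n" "cis (- (real n * x))"] by simp
qed (simp_all add: sin_conv_cis)

text \<open>Equals 2 cos((n+1)s) for even \<open>n\<close> and 2i sin((n+1)s) for odd
  \<open>n\<close>. It is the last factor of \<open>psi\<close> at s =
  \<open>scat \<kappa> \<alpha>\<close>.\<close>

definition chord_fun :: "nat \<Rightarrow> real \<Rightarrow> complex" where
  "chord_fun n s = cis (real (n + 1) * s) + (-1) ^ n * cis (- (real (n + 1) * s))"

lemma W_sin: "2 * complex_of_real (cos x) * W n (sin x) = chord_fun n x"
proof (induction n rule: two_step_induct)
  case 0
  then show ?case by (simp add: chord_fun_def cos_conv_cis)
next
  case 1
  have "2 * complex_of_real (cos x) * W (Suc 0) (sin x) = (2 * complex_of_real (cos x)) * (2 * \<i> * complex_of_real (sin x))"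
    by simp
  also have "\<dots> = cis (2 * x) - cis (- (2 * x))"
    unfolding cos_conv_cis sin_conv_cis by (simp add: algebra_simps cis_mult)
  finally show ?case by (simp add: chord_fun_def)
next
  case (step n)
  have e: "cis (real (Suc n + 1) * x) = cis x * cis (real (n + 1) * x)" "cis (real (Suc (Suc n) + 1) * x) = cis x * (cis x * cis (real (n + 1) * x))"
     "cis (- (real (Suc n + 1) * x)) = cis (- x) * cis (- (real (n + 1) * x))"
     "cis (- (real (Suc (Suc n) + 1) * x)) = cis (- x) * (cis (- x) * cis (- (real (n + 1) * x)))"
    unfolding mult.assoc[symmetric] cis_mult by (rule arg_cong[of _ _ cis], simp add: algebra_simps)+
  have i: "cis x * cis (- x) = 1" by (simp add: cis_mult)
  have "2 * complex_of_real (cos x) * W (Suc (Suc n)) (sin x) =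
    2 * \<i> * complex_of_real (sin x) * (2 * complex_of_real (cos x) * W (Suc n) (sin x)) + 2 * complex_of_real (cos x) * W n (sin x)"
    by (simp add: algebra_simps)
  also have "\<dots> = (cis x - cis (- x)) * chord_fun (Suc n) x + chord_fun n x"
    unfolding step sin_conv_cis ..
  also have "\<dots> = chord_fun (Suc (Suc n)) x"
    unfolding chord_fun_def e
    using sin_recurrence[OF i, of "cis (real (n + 1) * x)" "(-1) ^ n" "cis (- (real (n + 1) * x))"] by simp
  finally show ?case .
qed

lemma W_minus: "W n (- t) = (-1) ^ n * W n t"
  by (induction n rule: two_step_induct) (simp_all add: algebra_simps)

text \<open>The kernel sin((n+1) psi) / sin psi, kept as a sum because its frequencies n - 2l are
  those of the Zernike polynomials of degree n.\<close>

definition dirichlet :: "nat \<Rightarrow> real \<Rightarrow> complex" where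
  "dirichlet n \<psi> = (\<Sum>l\<le>n. cis (real_of_int (int n - 2 * int l) * \<psi>))"

text \<open>Multiplication by e^{i psi} - e^{-i psi} makes the sum telescope.\<close>

lemma dirichlet_sin:
  "2 * \<i> * complex_of_real (sin \<psi>) * dirichlet n \<psi> = cis (real (n + 1) * \<psi>) - cis (- (real (n + 1) * \<psi>))"
proof -
  have "2 * \<i> * complex_of_real (sin \<psi>) * dirichlet n \<psi> =
     (\<Sum>l\<le>n. cis ((real n - 2 * real l + 1) * \<psi>) - cis ((real n - 2 * real (Suc l) + 1) * \<psi>))"
    unfolding dirichlet_def sum_distrib_left sin_conv_cis
    by (intro sum.cong refl) (simp add: left_diff_distrib cis_mult algebra_simps)
  also have "\<dots> = cis ((real n - 2 * real 0 + 1) * \<psi>) - cis ((real n - 2 * real (Suc n) + 1) * \<psi>)"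
    by (rule sum_telescope)
  finally show ?thesis by (simp add: algebra_simps)
qed

lemma dirichlet_sin_0:
  assumes "cis \<psi> = complex_of_real e" "e = 1 \<or> e = -1"
  shows "dirichlet n \<psi> = of_nat (n + 1) * complex_of_real e ^ n"
proof -
  have "cis (real_of_int (int n - 2 * int l) * \<psi>) = complex_of_real e ^ n" for l
  proof -
    have "cis (real_of_int (int n - 2 * int l) * \<psi>) = cis (real n * \<psi>) * cnj (cis (real l * \<psi>)) ^ 2"
      by (simp add: cis_cnj cis_mult power2_eq_square algebra_simps)
    also have "\<dots> = complex_of_real e ^ n * cnj (complex_of_real e ^ l) ^ 2"
      unfolding Complex.DeMoivre[of \<psi>, symmetric] assms(1) ..
    also have "cnj (complex_of_real e ^ l) ^ 2 = 1"
      using assms(2) by (auto simp: power_mult[symmetric] power_mult_distrib)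
    finally show ?thesis by simp
  qed
  then show ?thesis by (simp add: dirichlet_def)
qed

text \<open>The antiderivative is \<open>V (Suc n)\<close> up to a constant. Its argument is sin(s +
  psi) at one end and sin(s - psi) at the other, and the difference of the two values separates into
  a function of psi times a function of s. The first factor is the Dirichlet kernel after division
  by sin psi.\<close>

lemma chord_integral_W:
  assumes s: "\<bar>s\<bar> \<le> pi / 2"
  shows "(LINT r:{0..2 * cos s}|lborel. W n (sin (\<psi> + s) - r * sin \<psi>)) =
     dirichlet n \<psi> * chord_fun n s / of_nat (n + 1)"
\<comment> \<open>When sin psi = 0 the integrand is constant along the chord, and the integral is
  its length times the value.\<close>
proof (cases "sin \<psi> = 0")
  case True
  have c: "cos s \<ge> 0" using s by (intro cos_ge_zero) linarith+
  define e where "e = cos \<psi>"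
  have e: "e = 1 \<or> e = -1"
    using True sin_cos_squared_add[of \<psi>] by (simp add: e_def power2_eq_1_iff)
  have ce: "cis \<psi> = complex_of_real e" using True by (simp add: e_def complex_eq_iff)
  have "(LINT r:{0..2 * cos s}|lborel. W n (sin (\<psi> + s) - r * sin \<psi>)) = 2 * complex_of_real (cos s) * W n (e * sin s)"
  proof -
    have "sin (\<psi> + s) - r * sin \<psi> = e * sin s" for r using True by (simp add: sin_add e_def)
    moreover have "(LINT r:{0..2 * cos s}|lborel. a) = 2 * complex_of_real (cos s) * a" for a :: complex
      using c by (simp add: set_lebesgue_integral_def scaleR_conv_of_real)
    ultimately show ?thesis by simp
  qed
  also have "\<dots> = complex_of_real e ^ n * chord_fun n s"
    using e by (auto simp: W_minus W_sin[of s n, symmetric])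
  finally show ?thesis
    by (simp add: dirichlet_sin_0[OF ce e] del: of_nat_Suc of_nat_add)
next
  case False
  have c: "cos s \<ge> 0" using s by (intro cos_ge_zero) linarith+
  let ?g = "\<lambda>r. sin (\<psi> + s) - r * sin \<psi>"
  define K where "K = - (2 * \<i> * complex_of_real (sin \<psi>) * of_nat (n + 1))"
  have K: "K \<noteq> 0" unfolding K_def using False by (simp del: of_nat_Suc of_nat_add)
  have "(LINT r:{0..2 * cos s}|lborel. W n (?g r)) = V (Suc n) (?g (2 * cos s)) / K - V (Suc n) (?g 0) / K"
    unfolding set_lebesgue_integral_def
  proof (rule integral_FTC_atLeastAtMost)
    show "0 \<le> 2 * cos s" using c by simp
    show "continuous_on {0..2 * cos s} (\<lambda>r. W n (?g r))" by (intro continuous_intros)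
    fix r
    have "((\<lambda>r. ?g r) has_vector_derivative (- sin \<psi>)) (at r within {0..2 * cos s})"
      by (auto intro!: derivative_eq_intros)
    from vector_diff_chain_within[OF this V_has_vector_derivative, of n]
    have "((\<lambda>r. V (Suc n) (?g r)) has_vector_derivative (- sin \<psi>) *\<^sub>R (2 * \<i> * of_nat (n + 1) * W n (?g r))) (at r within {0..2 * cos s})"
      by (simp only: o_def)
    then have d: "((\<lambda>r. V (Suc n) (?g r) / K) has_vector_derivative (- sin \<psi>) *\<^sub>R (2 * \<i> * of_nat (n + 1) * W n (?g r)) / K) (at r within {0..2 * cos s})"
      by (rule has_vector_derivative_divide)
    have e: "(- sin \<psi>) *\<^sub>R (2 * \<i> * of_nat (n + 1) * W n (?g r)) = K * W n (?g r)"
      by (simp add: K_def scaleR_conv_of_real)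
    show "((\<lambda>r. V (Suc n) (?g r) / K) has_vector_derivative W n (?g r)) (at r within {0..2 * cos s})"
      using d unfolding e nonzero_mult_div_cancel_left[OF K] .
  qed
  also have "?g (2 * cos s) = sin (s - \<psi>)"
    by (simp add: sin_add sin_diff)
  also have "?g 0 = sin (s + \<psi>)" by (simp add: add.commute)
  also have "V (Suc n) (sin (s - \<psi>)) / K - V (Suc n) (sin (s + \<psi>)) / K =
     - ((cis (real (n + 1) * \<psi>) - cis (- (real (n + 1) * \<psi>))) * chord_fun n s) / K"
  proof -
    have e: "cis (real (Suc n) * (s - \<psi>)) = cis (real (n + 1) * s) * cis (- (real (n + 1) * \<psi>))"
      "cis (- (real (Suc n) * (s - \<psi>))) = cis (- (real (n + 1) * s)) * cis (real (n + 1) * \<psi>)"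
      "cis (real (Suc n) * (s + \<psi>)) = cis (real (n + 1) * s) * cis (real (n + 1) * \<psi>)"
      "cis (- (real (Suc n) * (s + \<psi>))) = cis (- (real (n + 1) * s)) * cis (- (real (n + 1) * \<psi>))"
      unfolding cis_mult by (rule arg_cong[of _ _ cis], simp add: algebra_simps)+
    show ?thesis unfolding V_sin e diff_divide_distrib[symmetric]
      by (rule arg_cong[of _ _ "\<lambda>x. x / K"]) (simp add: chord_fun_def algebra_simps)
  qed
  also have "cis (real (n + 1) * \<psi>) - cis (- (real (n + 1) * \<psi>)) = - K * dirichlet n \<psi> / of_nat (n + 1)"
    unfolding dirichlet_sin[symmetric] K_def by (simp del: of_nat_Suc of_nat_add)
  also have "- (- K * dirichlet n \<psi> / of_nat (n + 1) * chord_fun n s) / K = dirichlet n \<psi> * chord_fun n s / of_nat (n + 1)"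
    using K by simp
  finally show ?thesis .
qed

lemma integral_cis_interval:
  assumes "m \<noteq> 0" "a \<le> b"
  shows "(LINT \<theta>:{a..b}|lborel. cis (real_of_int m * \<theta>)) =
    (cis (real_of_int m * b) - cis (real_of_int m * a)) / (\<i> * of_int m)"
proof -
  define K where "K = \<i> * of_int m"
  have K: "K \<noteq> 0" using assms by (simp add: K_def)
  have "(LINT \<theta>:{a..b}|lborel. cis (real_of_int m * \<theta>)) = cis (real_of_int m * b) / K - cis (real_of_int m * a) / K"
    unfolding set_lebesgue_integral_def
  proof (rule integral_FTC_atLeastAtMost[OF assms(2)])
    fix x
    have "((\<lambda>x. real_of_int m * x) has_real_derivative real_of_int m) (at x within {a..b})"
      by (auto intro!: derivative_eq_intros)
    then have "((\<lambda>x. cis (real_of_int m * x)) has_vector_derivative real_of_int m *\<^sub>R (\<i> * cis (real_of_int m * x))) (at x within {a..b})"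
      unfolding has_real_derivative_iff_has_vector_derivative
      by (intro vector_diff_chain_within[unfolded o_def, where g = cis])
         (auto simp: has_vector_derivative_def cis_conv_exp intro!: derivative_eq_intros)
    from has_vector_derivative_divide[OF this, of K]
    show "((\<lambda>x. cis (real_of_int m * x) / K) has_vector_derivative cis (real_of_int m * x)) (at x within {a..b})"
      using K by (simp add: K_def scaleR_conv_of_real)
  qed (auto intro!: continuous_intros)
  then show ?thesis by (simp add: K_def diff_divide_distrib)
qed

lemma integral_cis:
  "(LINT \<theta>:{0..2 * pi}|lborel. cis (real_of_int m * \<theta>)) = (if m = 0 then 2 * complex_of_real pi else 0)"
proof (cases "m = 0")
  case True
  have "(LINT r:{0..2 * pi}|lborel. 1) = 2 * complex_of_real pi"
    by (simp add: set_lebesgue_integral_def scaleR_conv_of_real)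
  then show ?thesis using True by simp
next
  case False
  have "cis (real_of_int m * (2 * pi)) = 1"
    using cis_multiple_2pi[of "real_of_int m"] by (simp add: mult.commute)
  then show ?thesis using False by (simp add: integral_cis_interval)
qed

lemma cis_set_integrable:
  assumes "continuous_on {a..b} f"
  shows "set_integrable lborel {a..b} (f :: real \<Rightarrow> complex)"
  by (rule borel_integrable_atLeastAtMost'[OF assms])

lemma set_integral_sum:
  fixes f :: "'i \<Rightarrow> 'a \<Rightarrow> complex"
  assumes "\<And>i. i \<in> I \<Longrightarrow> set_integrable M A (f i)"
  shows "(LINT x:A|M. \<Sum>i\<in>I. f i x) = (\<Sum>i\<in>I. LINT x:A|M. f i x)"
  using assms unfolding set_lebesgue_integral_def set_integrable_def scaleR_sum_right
  by (rule Bochner_Integration.integral_sum)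

lemma zernike_alt:
  "zernike n k z = (-1) ^ n / complex_of_real (2 * pi) *
     (LINT \<theta>:{0..2 * pi}|lborel. cis (real_of_int (int n - 2 * int k) * \<theta>) * W n (Im (cis \<theta> * cnj z)))"
proof -
  have "Im (cis \<theta> * cnj z) = cmod z * sin (\<theta> - Arg z)" for \<theta>
  proof -
    have "z = complex_of_real (cmod z) * cis (Arg z)"
      by (metis rcis_cmod_Arg rcis_def)
    then have "cis \<theta> * cnj z = cis \<theta> * cnj (complex_of_real (cmod z) * cis (Arg z))" by simp
    also have "\<dots> = complex_of_real (cmod z) * cis (\<theta> - Arg z)"
      by (simp add: cis_cnj cis_mult)
    finally show ?thesis by simp
  qed
  then show ?thesis unfolding zernike_def by simp
qed

section \<open>Spans of monomials and of Zernike polynomials\<close>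

definition monom2 :: "nat \<Rightarrow> nat \<Rightarrow> complex \<Rightarrow> complex" where
  "monom2 a b z = z ^ a * cnj z ^ b"

text \<open>Generated by adding one scaled generator at a time, so that closure properties become
  inductions; indices and coefficients are recovered in \<open>lspan_finite_sum\<close>.\<close>

inductive_set lspan :: "('a \<Rightarrow> complex) set \<Rightarrow> ('a \<Rightarrow> complex) set" for B where
  zero: "(\<lambda>_. 0) \<in> lspan B"
| step: "f \<in> lspan B \<Longrightarrow> b \<in> B \<Longrightarrow> (\<lambda>z. f z + c * b z) \<in> lspan B"

lemma lspan_scale_base: "b \<in> B \<Longrightarrow> (\<lambda>z. c * b z) \<in> lspan B"
  using lspan.step[OF lspan.zero, of b B c] by simp

lemma lspan_base: "b \<in> B \<Longrightarrow> b \<in> lspan B"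
  using lspan_scale_base[of b B 1] by simp

lemma lspan_add:
  assumes "f \<in> lspan B" "g \<in> lspan B"
  shows "(\<lambda>z. f z + g z) \<in> lspan B"
  using assms(2)
proof induction
  case zero
  then show ?case using assms(1) by simp
next
  case (step g b c)
  from lspan.step[OF step.IH step.hyps(2), of c] show ?case by (simp add: add.assoc)
qed

lemma lspan_scale:
  assumes "f \<in> lspan B"
  shows "(\<lambda>z. c * f z) \<in> lspan B"
  using assms
proof induction
  case zero
  then show ?case by (simp add: lspan.zero)
next
  case (step f b d)
  from lspan.step[OF step.IH step.hyps(2), of "c * d"] show ?case by (simp add: algebra_simps)
qed

lemma lspan_sum:
  assumes "\<And>i. i \<in> I \<Longrightarrow> f i \<in> lspan B"
  shows "(\<lambda>z. \<Sum>i\<in>I. f i z) \<in> lspan B"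
  using assms by (induction I rule: infinite_finite_induct) (auto intro: lspan_add lspan.zero)

lemma lspan_trans:
  assumes "f \<in> lspan B" "\<And>b. b \<in> B \<Longrightarrow> b \<in> lspan C"
  shows "f \<in> lspan C"
  using assms(1)
proof induction
  case zero
  then show ?case by (rule lspan.zero)
next
  case (step f b c)
  show ?case by (rule lspan_add[OF step.IH lspan_scale[OF assms(2)[OF step.hyps(2)]]])
qed

lemma lspan_mult:
  assumes "f \<in> lspan B" "g \<in> lspan B" and B: "\<And>a b. a \<in> B \<Longrightarrow> b \<in> B \<Longrightarrow> (\<lambda>z. a z * b z) \<in> B"
  shows "(\<lambda>z. f z * g z) \<in> lspan B"
  using assms(1)
proof induction
  case zero
  then show ?case by (simp add: lspan.zero)
next
  case (step f a c)
  have "(\<lambda>z. a z * g z) \<in> lspan B"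
    using assms(2)
  proof induction
    case zero
    then show ?case by (simp add: lspan.zero)
  next
    case (step g b d)
    from lspan.step[OF step.IH B[OF \<open>a \<in> B\<close> step.hyps(2)], of d] show ?case by (simp add: algebra_simps)
  qed
  from lspan_add[OF step.IH lspan_scale[OF this, of c]] show ?case by (simp add: algebra_simps)
qed

lemma lspan_finite_sum:
  assumes "f \<in> lspan (x ` J)"
  shows "\<exists>F c. finite F \<and> F \<subseteq> J \<and> f = (\<lambda>z. \<Sum>j\<in>F. c j * x j z)"
  using assms
proof induction
  case zero
  show ?case by (rule exI[of _ "{}"]) simp
next
  case (step f b d)
  then obtain F c j where F: "finite F" "F \<subseteq> J" "f = (\<lambda>z. \<Sum>j\<in>F. c j * x j z)" and j: "j \<in> J" "b = x j"
    by blast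
  \<comment> \<open>The new generator may already occur in \<open>F\<close>, in which case the
    coefficients are added.\<close>
  define c' where "c' = (\<lambda>i. (if i \<in> F then c i else 0) + (if i = j then d else 0))"
  have "f z + d * b z = (\<Sum>i\<in>insert j F. c' i * x i z)" for z
  proof -
    have "(\<Sum>i\<in>insert j F. c' i * x i z) = (\<Sum>i\<in>insert j F. (if i \<in> F then c i else 0) * x i z) + (\<Sum>i\<in>insert j F. (if i = j then d else 0) * x i z)"
      unfolding c'_def distrib_right sum.distrib ..
    also have "(\<Sum>i\<in>insert j F. (if i \<in> F then c i else 0) * x i z) = (\<Sum>i\<in>F. c i * x i z)"
      using F(1) by (intro sum.mono_neutral_cong_right) auto
    also have "(\<Sum>i\<in>insert j F. (if i = j then d else 0) * x i z) = d * x j z"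
      using F(1) by (subst sum.mono_neutral_cong_right[where S = "{j}" and h = "\<lambda>i. d * x i z"]) auto
    finally show ?thesis using F j by simp
  qed
  then have "(\<lambda>z. f z + d * b z) = (\<lambda>z. \<Sum>i\<in>insert j F. c' i * x i z)" by (rule ext)
  then show ?case using F(1,2) j(1)
    by (intro exI[of _ "insert j F"] exI[of _ c'] conjI) (simp_all only: finite_insert insert_subset simp_thms)
qed

text \<open>Following the recurrence, \<open>W n\<close> is monic in the variable 2it. The leading
  coefficient 1 is what later makes the Zernike family triangular with respect to the
  monomials.\<close>

lemma W_expansion: "\<exists>d. \<forall>t. W n t = (2 * \<i> * complex_of_real t) ^ n + (\<Sum>j<n. d j * (2 * \<i> * complex_of_real t) ^ j)"
proof (induction n rule: two_step_induct)
  case 1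
  show ?case by (rule exI[of _ "\<lambda>_. 0"]) simp
next
  case (step n)
  then obtain d e where
    d: "\<And>t. W n t = (2 * \<i> * complex_of_real t) ^ n + (\<Sum>j<n. d j * (2 * \<i> * complex_of_real t) ^ j)" and
    e: "\<And>t. W (Suc n) t = (2 * \<i> * complex_of_real t) ^ Suc n + (\<Sum>j<Suc n. e j * (2 * \<i> * complex_of_real t) ^ j)"
    by blast
  \<comment> \<open>\<open>d'\<close> includes the leading coefficient of \<open>W n\<close> at
    degree n, and \<open>e'\<close> shifts the coefficients of \<open>W (Suc n)\<close> by the
    factor 2it.\<close>
  define d' where "d' = (\<lambda>j. if j = n then 1 else if j < n then d j else 0)"
  define e' where "e' = (\<lambda>j. case j of 0 \<Rightarrow> 0 | Suc i \<Rightarrow> e i)"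
  show ?case
  proof (intro exI allI)
    fix t
    define u where "u = 2 * \<i> * complex_of_real t"
    have 1: "(\<Sum>j<Suc (Suc n). d' j * u ^ j) = W n t"
    proof -
      have "(\<Sum>j<Suc (Suc n). d' j * u ^ j) = (\<Sum>j<n. d' j * u ^ j) + u ^ n" by (simp add: d'_def)
      also have "(\<Sum>j<n. d' j * u ^ j) = (\<Sum>j<n. d j * u ^ j)" by (intro sum.cong) (auto simp: d'_def)
      finally show ?thesis by (simp add: d u_def)
    qed
    have 2: "u * (\<Sum>j<Suc n. e j * u ^ j) = (\<Sum>j<Suc (Suc n). e' j * u ^ j)"
      unfolding sum.lessThan_Suc_shift[of _ "Suc n"] sum_distrib_left by (simp add: e'_def mult_ac)
    have "W (Suc (Suc n)) t = u * W (Suc n) t + W n t" by (simp add: u_def)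
    also have "\<dots> = u ^ Suc (Suc n) + (u * (\<Sum>j<Suc n. e j * u ^ j) + W n t)"
      unfolding e u_def[symmetric] by (simp add: algebra_simps)
    also have "u * (\<Sum>j<Suc n. e j * u ^ j) + W n t = (\<Sum>j<Suc (Suc n). (e' j + d' j) * u ^ j)"
      unfolding 2 1[symmetric] distrib_right sum.distrib ..
    finally show "W (Suc (Suc n)) t = (2 * \<i> * complex_of_real t) ^ Suc (Suc n) + (\<Sum>j<Suc (Suc n). (e' j + d' j) * (2 * \<i> * complex_of_real t) ^ j)"
      unfolding u_def .
  qed
qed simp

definition moment :: "nat \<Rightarrow> int \<Rightarrow> complex \<Rightarrow> complex" where
  "moment j m z = (LINT \<theta>:{0..2 * pi}|lborel. cis (real_of_int m * \<theta>) * (2 * \<i> * complex_of_real (Im (cis \<theta> * cnj z))) ^ j)"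

text \<open>Twice i times the imaginary part is e^{i theta} conj(z) - e^{-i theta} z. After binomial
  expansion, integration over the circle keeps only the term of frequency zero, that is 2l = j -
  m.\<close>

lemma moment_eq:
  "moment j m z = (\<Sum>l\<le>j. of_nat (j choose l) * (-1) ^ (j - l) *
     (if m + 2 * int l - int j = 0 then 2 * complex_of_real pi else 0) * monom2 (j - l) l z)"
proof -
  have "cis (real_of_int m * \<theta>) * (2 * \<i> * complex_of_real (Im (cis \<theta> * cnj z))) ^ j =
     (\<Sum>l\<le>j. (of_nat (j choose l) * (-1) ^ (j - l) * monom2 (j - l) l z) * cis (real_of_int (m + 2 * int l - int j) * \<theta>))" for \<theta>
  proof -
    have "2 * \<i> * complex_of_real (Im (cis \<theta> * cnj z)) = cis \<theta> * cnj z + (- (cis (- \<theta>) * z))"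
      using complex_diff_cnj[of "cis \<theta> * cnj z"] by (simp add: cis_cnj mult.commute)
    then have "(2 * \<i> * complex_of_real (Im (cis \<theta> * cnj z))) ^ j =
      (\<Sum>l\<le>j. of_nat (j choose l) * (cis \<theta> * cnj z) ^ l * (- (cis (- \<theta>) * z)) ^ (j - l))"
      by (simp only: binomial_ring)
    also have "cis (real_of_int m * \<theta>) * \<dots> =
     (\<Sum>l\<le>j. (of_nat (j choose l) * (-1) ^ (j - l) * monom2 (j - l) l z) * cis (real_of_int (m + 2 * int l - int j) * \<theta>))"
      unfolding sum_distrib_left
    proof (intro sum.cong refl)
      fix l assume "l \<in> {..j}"
      then have "real_of_int m * \<theta> + (real l * \<theta> + real (j - l) * (- \<theta>)) = real_of_int (m + 2 * int l - int j) * \<theta>"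
        by (simp add: of_nat_diff algebra_simps)
      then have c: "cis (real_of_int (m + 2 * int l - int j) * \<theta>) = cis (real_of_int m * \<theta>) * (cis \<theta> ^ l * cis (- \<theta>) ^ (j - l))"
        by (simp only: Complex.DeMoivre cis_mult)
      have "(- (cis (- \<theta>) * z)) ^ (j - l) = (-1) ^ (j - l) * (cis (- \<theta>) ^ (j - l) * z ^ (j - l))"
        by (metis power_minus power_mult_distrib)
      then show "cis (real_of_int m * \<theta>) * (of_nat (j choose l) * (cis \<theta> * cnj z) ^ l * (- (cis (- \<theta>) * z)) ^ (j - l)) =
        (of_nat (j choose l) * (-1) ^ (j - l) * monom2 (j - l) l z) * cis (real_of_int (m + 2 * int l - int j) * \<theta>)"
        unfolding c monom2_def power_mult_distrib by (simp only: mult_ac)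
    qed
    finally show ?thesis .
  qed
  then have "moment j m z = (LINT \<theta>:{0..2 * pi}|lborel. \<Sum>l\<le>j. (of_nat (j choose l) * (-1) ^ (j - l) * monom2 (j - l) l z) * cis (real_of_int (m + 2 * int l - int j) * \<theta>))"
    unfolding moment_def by presburger
  also have "\<dots> = (\<Sum>l\<le>j. LINT \<theta>:{0..2 * pi}|lborel. (of_nat (j choose l) * (-1) ^ (j - l) * monom2 (j - l) l z) * cis (real_of_int (m + 2 * int l - int j) * \<theta>))"
    by (rule set_integral_sum) (auto intro!: cis_set_integrable continuous_intros)
  also have "\<dots> = (\<Sum>l\<le>j. of_nat (j choose l) * (-1) ^ (j - l) *
     (if m + 2 * int l - int j = 0 then 2 * complex_of_real pi else 0) * monom2 (j - l) l z)"
    unfolding set_integral_mult_right integral_cis by (simp only: mult_ac)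
  finally show ?thesis .
qed

definition monomials :: "nat \<Rightarrow> (complex \<Rightarrow> complex) set" where
  "monomials n = {monom2 a b | a b. a + b < n}"

lemma zernike_moments:
  obtains d where "\<And>k z. zernike n k z = (-1) ^ n / complex_of_real (2 * pi) *
     (moment n (int n - 2 * int k) z + (\<Sum>j<n. d j * moment j (int n - 2 * int k) z))"
proof -
  obtain d where d: "\<And>t. W n t = (2 * \<i> * complex_of_real t) ^ n + (\<Sum>j<n. d j * (2 * \<i> * complex_of_real t) ^ j)"
    using W_expansion by blast
  have si: "set_integrable lborel {0..2 * pi} (\<lambda>\<theta>. c * (cis (real_of_int m * \<theta>) * (2 * \<i> * complex_of_real (Im (cis \<theta> * cnj z))) ^ j))" for c m j z
    by (intro cis_set_integrable continuous_intros)
  show thesis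
  proof (rule that)
    fix k z
    let ?m = "int n - 2 * int k"
    let ?u = "\<lambda>\<theta>. 2 * \<i> * complex_of_real (Im (cis \<theta> * cnj z))"
    have "(LINT \<theta>:{0..2 * pi}|lborel. cis (real_of_int ?m * \<theta>) * W n (Im (cis \<theta> * cnj z))) =
       (LINT \<theta>:{0..2 * pi}|lborel. 1 * (cis (real_of_int ?m * \<theta>) * ?u \<theta> ^ n) + (\<Sum>j<n. d j * (cis (real_of_int ?m * \<theta>) * ?u \<theta> ^ j)))"
      unfolding d by (simp add: distrib_left sum_distrib_left mult_ac)
    also have "\<dots> = (LINT \<theta>:{0..2 * pi}|lborel. 1 * (cis (real_of_int ?m * \<theta>) * ?u \<theta> ^ n)) +
      (LINT \<theta>:{0..2 * pi}|lborel. \<Sum>j<n. d j * (cis (real_of_int ?m * \<theta>) * ?u \<theta> ^ j))"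
      by (intro set_integral_add(2) si cis_set_integrable continuous_intros)
    also have "(LINT \<theta>:{0..2 * pi}|lborel. \<Sum>j<n. d j * (cis (real_of_int ?m * \<theta>) * ?u \<theta> ^ j)) =
      (\<Sum>j<n. LINT \<theta>:{0..2 * pi}|lborel. d j * (cis (real_of_int ?m * \<theta>) * ?u \<theta> ^ j))"
      by (rule set_integral_sum) (rule si)
    finally show "zernike n k z = (-1) ^ n / complex_of_real (2 * pi) * (moment n ?m z + (\<Sum>j<n. d j * moment j ?m z))"
      unfolding zernike_alt moment_def set_integral_mult_right by simp
  qed
qed

lemma moment_lspan: "moment j m \<in> lspan (monomials (Suc j))"
proof -
  have "(\<lambda>z. \<Sum>l\<le>j. (of_nat (j choose l) * (-1) ^ (j - l) *
     (if m + 2 * int l - int j = 0 then 2 * complex_of_real pi else 0)) * monom2 (j - l) l z) \<in> lspan (monomials (Suc j))"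
    by (intro lspan_sum lspan_scale_base) (auto simp: monomials_def intro!: exI)
  then show ?thesis unfolding moment_eq[abs_def] .
qed

lemma monomials_mono: "m \<le> n \<Longrightarrow> monomials m \<subseteq> monomials n"
proof
  fix f assume "m \<le> n" "f \<in> monomials m"
  then obtain a b where "f = monom2 a b" "a + b < n" by (auto simp: monomials_def)
  then show "f \<in> monomials n" unfolding monomials_def by blast
qed

lemma lspan_mono: "f \<in> lspan B \<Longrightarrow> B \<subseteq> C \<Longrightarrow> f \<in> lspan C"
  by (erule lspan_trans) (auto intro: lspan_base)

text \<open>In the moment of order n with frequency n - 2k the surviving binomial term is l = k,
  with nonzero coefficient because k <= n. Moments of lower order contribute only lower
  degrees.\<close>

lemma zernike_leading:
  assumes k: "k \<le> n"
  obtains c q where "c \<noteq> 0" "q \<in> lspan (monomials n)" "\<And>z. zernike n k z = c * monom2 (n - k) k z + q z"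
proof -
  obtain d where d: "\<And>k z. zernike n k z = (-1) ^ n / complex_of_real (2 * pi) *
     (moment n (int n - 2 * int k) z + (\<Sum>j<n. d j * moment j (int n - 2 * int k) z))"
    by (rule zernike_moments) blast
  define a where "a = (-1) ^ n / complex_of_real (2 * pi)"
  define q where "q = (\<lambda>z. a * (\<Sum>j<n. d j * moment j (int n - 2 * int k) z))"
  have "moment n (int n - 2 * int k) z = of_nat (n choose k) * (-1) ^ (n - k) * (2 * complex_of_real pi) * monom2 (n - k) k z" for z
  proof -
    have "moment n (int n - 2 * int k) z = (\<Sum>l\<in>{k}. of_nat (n choose l) * (-1) ^ (n - l) * (2 * complex_of_real pi) * monom2 (n - l) l z)"
      unfolding moment_eq using k by (intro sum.mono_neutral_cong_right) auto
    then show ?thesis by simp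
  qed
  then have z: "zernike n k z = a * (of_nat (n choose k) * (-1) ^ (n - k) * (2 * complex_of_real pi)) * monom2 (n - k) k z + q z" for z
    unfolding d q_def a_def[symmetric] by (simp add: algebra_simps)
  show thesis
  proof (rule that[OF _ _ z])
    show "a * (of_nat (n choose k) * (-1) ^ (n - k) * (2 * complex_of_real pi)) \<noteq> 0"
      using k by (simp add: a_def)
    show "q \<in> lspan (monomials n)"
      unfolding q_def
    proof (intro lspan_scale lspan_sum)
      fix j assume "j \<in> {..<n}"
      then have "monomials (Suc j) \<subseteq> monomials n" by (intro monomials_mono) simp
      from lspan_mono[OF moment_lspan this] show "moment j (int n - 2 * int k) \<in> lspan (monomials n)" .
    qed
  qed
qed

lemma lspan_continuous:
  assumes "f \<in> lspan B" "\<And>b. b \<in> B \<Longrightarrow> continuous_on S b"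
  shows "continuous_on S f"
  using assms(1)
proof induction
  case (step f b c)
  show ?case by (intro continuous_on_add continuous_on_mult_left step.IH assms(2) step.hyps)
qed simp

lemma zernike_continuous:
  assumes "k \<le> n" shows "continuous_on S (zernike n k)"
proof -
  obtain c q where q: "q \<in> lspan (monomials n)" and z: "\<And>z. zernike n k z = c * monom2 (n - k) k z + q z"
    by (rule zernike_leading[OF assms]) blast
  have m: "continuous_on S (monom2 a b)" for a b
    unfolding monom2_def[abs_def] by (intro continuous_intros)
  have "continuous_on S q"
    by (rule lspan_continuous[OF q]) (auto simp: monomials_def intro: m)
  then show ?thesis unfolding z[abs_def] by (intro continuous_intros m)
qed

text \<open>The monomial of bidegree (a, b) leads the Zernike polynomial of degree a + b with index
  b. Triangularity is inverted by strong induction on the degree.\<close>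

lemma monom2_lspan_zernike: "monom2 a b \<in> lspan ((\<lambda>(n, k). zernike n k) ` index_set)"
proof (induction "a + b" arbitrary: a b rule: less_induct)
  case less
  obtain c q where c: "c \<noteq> 0" and q: "q \<in> lspan (monomials (a + b))" and z: "\<And>z. zernike (a + b) b z = c * monom2 (a + b - b) b z + q z"
    by (rule zernike_leading[of b "a + b"]) auto
  have "q \<in> lspan ((\<lambda>(n, k). zernike n k) ` index_set)"
    by (rule lspan_trans[OF q]) (auto simp: monomials_def intro: less)
  moreover have "zernike (a + b) b \<in> lspan ((\<lambda>(n, k). zernike n k) ` index_set)"
    by (rule lspan_base, rule image_eqI[of _ _ "(a + b, b)"]) (auto simp: index_set_def)
  ultimately have "(\<lambda>z. (1 / c) * (zernike (a + b) b z + (-1) * q z)) \<in> lspan ((\<lambda>(n, k). zernike n k) ` index_set)"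
    by (intro lspan_scale lspan_add)
  also have "(\<lambda>z. (1 / c) * (zernike (a + b) b z + (-1) * q z)) = monom2 a b"
    using c by (auto simp: z fun_eq_iff)
  finally show ?case .
qed

text \<open>Structural induction. A real-linear function is a combination of z and conj z, and
  products of monomials are monomials.\<close>

lemma real_polynomial_function_lspan:
  fixes f :: "complex \<Rightarrow> real"
  assumes "real_polynomial_function f"
  shows "(\<lambda>z. complex_of_real (f z)) \<in> lspan (range (\<lambda>(a, b). monom2 a b))"
  using assms
proof induction
  case (linear f)
  interpret f: bounded_linear f by fact
  have "(\<lambda>z. complex_of_real (f 1 / 2) * monom2 1 0 z + complex_of_real (f 1 / 2) * monom2 0 1 z
     + (complex_of_real (f \<i>) / (2 * \<i>) * monom2 1 0 z + (- complex_of_real (f \<i>) / (2 * \<i>)) * monom2 0 1 z))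
     \<in> lspan (range (\<lambda>(a, b). monom2 a b))"
    by (intro lspan_add lspan_scale_base) (auto simp: image_iff)
  also have "(\<lambda>z. complex_of_real (f 1 / 2) * monom2 1 0 z + complex_of_real (f 1 / 2) * monom2 0 1 z
     + (complex_of_real (f \<i>) / (2 * \<i>) * monom2 1 0 z + (- complex_of_real (f \<i>) / (2 * \<i>)) * monom2 0 1 z)) = (\<lambda>z. complex_of_real (f z))"
  proof
    fix z
    have "z = Re z *\<^sub>R 1 + Im z *\<^sub>R \<i>" by (simp add: complex_eq_iff)
    then have "f z = Re z * f 1 + Im z * f \<i>" by (metis f.add f.scaleR real_scaleR_def)
    then show "complex_of_real (f 1 / 2) * monom2 1 0 z + complex_of_real (f 1 / 2) * monom2 0 1 z
     + (complex_of_real (f \<i>) / (2 * \<i>) * monom2 1 0 z + (- complex_of_real (f \<i>) / (2 * \<i>)) * monom2 0 1 z) = complex_of_real (f z)"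
    proof -
      define F G X Y where "F = complex_of_real (f 1)" and "G = complex_of_real (f \<i>)"
        and "X = complex_of_real (Re z)" and "Y = complex_of_real (Im z)"
      have zz: "z = X + \<i> * Y" "cnj z = X - \<i> * Y"
        by (simp_all add: X_def Y_def complex_eq_iff)
      have "F / 2 * (X + \<i> * Y) + F / 2 * (X - \<i> * Y) + (G / (2 * \<i>) * (X + \<i> * Y) + (- G / (2 * \<i>)) * (X - \<i> * Y)) = X * F + Y * G"
        by (simp add: field_simps)
      also have "X * F + Y * G = complex_of_real (f z)"
        unfolding \<open>f z = _\<close> by (simp add: F_def G_def X_def Y_def)
      finally show ?thesis
        unfolding zz[symmetric] by (simp add: monom2_def F_def G_def)
    qed
  qed
  finally show ?case .
next
  case (const c)
  have "(\<lambda>z. complex_of_real c * monom2 0 0 z) \<in> lspan (range (\<lambda>(a, b). monom2 a b))"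
    by (intro lspan_scale_base) (auto simp: image_iff)
  then show ?case by (simp add: monom2_def[of 0 0])
next
  case (add f g)
  from lspan_add[OF add.IH] show ?case by simp
next
  case (mult f g)
  have "(\<lambda>z. complex_of_real (f z) * complex_of_real (g z)) \<in> lspan (range (\<lambda>(a, b). monom2 a b))"
  proof (rule lspan_mult[OF mult.IH])
    fix p q assume "p \<in> range (\<lambda>(a, b). monom2 a b)" "q \<in> range (\<lambda>(a, b). monom2 a b)"
    then obtain a b c d where "p = monom2 a b" "q = monom2 c d" by auto
    then have "(\<lambda>z. p z * q z) = monom2 (a + c) (b + d)"
      by (auto simp: monom2_def power_add fun_eq_iff)
    then show "(\<lambda>z. p z * q z) \<in> range (\<lambda>(a, b). monom2 a b)" by auto
  qed
  then show ?case by simp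
qed

lemma polynomial_function_lspan_zernike:
  fixes p :: "complex \<Rightarrow> complex"
  assumes "polynomial_function p"
  shows "p \<in> lspan ((\<lambda>(n, k). zernike n k) ` index_set)"
proof -
  have r: "real_polynomial_function (Re \<circ> p)" "real_polynomial_function (Im \<circ> p)"
    using assms bounded_linear_Re bounded_linear_Im unfolding polynomial_function_def by blast+
  have "(\<lambda>z. complex_of_real ((Re \<circ> p) z) + \<i> * complex_of_real ((Im \<circ> p) z)) \<in> lspan (range (\<lambda>(a, b). monom2 a b))"
    by (intro lspan_add lspan_scale real_polynomial_function_lspan r)
  also have "(\<lambda>z. complex_of_real ((Re \<circ> p) z) + \<i> * complex_of_real ((Im \<circ> p) z)) = p"
    by (simp add: complex_eq_iff fun_eq_iff)
  finally show ?thesis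
    by (rule lspan_trans) (auto intro: monom2_lspan_zernike)
qed

section \<open>Chord integrals and orthogonality of Zernike polynomials\<close>

lemma Im_chord: "Im (cis \<theta> * cnj (chord \<beta> s r)) = sin ((\<theta> - \<beta> - s) + s) - r * sin (\<theta> - \<beta> - s)"
proof -
  have "cis \<theta> * cnj (chord \<beta> s r) = cis (\<theta> - \<beta>) - complex_of_real r * cis (\<theta> - \<beta> - s)"
    by (simp add: chord_def cis_cnj right_diff_distrib cis_mult mult.assoc[symmetric] mult.commute algebra_simps)
  then show ?thesis by simp
qed

lemma chord_fun_continuous [continuous_intros]:
  assumes "continuous_on S f" shows "continuous_on S (\<lambda>x. chord_fun n (f x))"
  unfolding chord_fun_def by (intro continuous_intros assms)

lemma chord_continuous [continuous_intros]:
  assumes "continuous_on S f" "continuous_on S g" "continuous_on S h"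
  shows "continuous_on S (\<lambda>x. chord (f x) (g x) (h x))"
  unfolding chord_def by (intro continuous_intros assms)

text \<open>Orthogonality of exponentials keeps the single term l = n - k of the kernel. The range 0
  <= k <= n is exactly the set of frequencies that the kernel contains.\<close>

lemma integral_cis_dirichlet:
  assumes k: "k \<le> n"
  shows "(LINT \<theta>:{0..2 * pi}|lborel. cis (real_of_int (int n - 2 * int k) * \<theta>) * dirichlet n (\<theta> - \<phi>)) =
    2 * complex_of_real pi * cis (real_of_int (int n - 2 * int k) * \<phi>)"
proof -
  let ?m = "int n - 2 * int k"
  have "cis (real_of_int ?m * \<theta>) * dirichlet n (\<theta> - \<phi>) =
    (\<Sum>l\<le>n. cis (- (real_of_int (int n - 2 * int l) * \<phi>)) * cis (real_of_int (?m + (int n - 2 * int l)) * \<theta>))" for \<theta>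
    unfolding dirichlet_def sum_distrib_left cis_mult
    by (intro sum.cong refl arg_cong[of _ _ cis]) (simp add: algebra_simps)
  then have "(LINT \<theta>:{0..2 * pi}|lborel. cis (real_of_int ?m * \<theta>) * dirichlet n (\<theta> - \<phi>)) =
    (LINT \<theta>:{0..2 * pi}|lborel. \<Sum>l\<le>n. cis (- (real_of_int (int n - 2 * int l) * \<phi>)) * cis (real_of_int (?m + (int n - 2 * int l)) * \<theta>))"
    by presburger
  also have "\<dots> = (\<Sum>l\<le>n. LINT \<theta>:{0..2 * pi}|lborel. cis (- (real_of_int (int n - 2 * int l) * \<phi>)) * cis (real_of_int (?m + (int n - 2 * int l)) * \<theta>))"
    by (rule set_integral_sum) (intro cis_set_integrable continuous_intros)
  also have "\<dots> = (\<Sum>l\<le>n. cis (- (real_of_int (int n - 2 * int l) * \<phi>)) * (if ?m + (int n - 2 * int l) = 0 then 2 * complex_of_real pi else 0))"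
    unfolding set_integral_mult_right integral_cis ..
  also have "\<dots> = (\<Sum>l\<in>{n - k}. cis (real_of_int ?m * \<phi>) * (2 * complex_of_real pi))"
    using k by (intro sum.mono_neutral_cong_right) (auto simp: of_nat_diff algebra_simps)
  finally show ?thesis by (simp add: mult.commute)
qed

text \<open>Exchange the average over theta with the integral along the chord, apply the chord
  integral of \<open>W\<close> with psi = theta - (beta + s), and let the Dirichlet kernel reproduce
  the exponential at beta + s. The result has the shape of \<open>psi\<close> without its Jacobian
  factor.\<close>

lemma chord_integral_zernike:
  assumes s: "\<bar>s\<bar> \<le> pi / 2" and k: "k \<le> n"
  shows "(LINT r:{0..2 * cos s}|lborel. zernike n k (chord \<beta> s r)) =
    (-1) ^ n / of_nat (n + 1) * cis (real_of_int (int n - 2 * int k) * (\<beta> + s)) * chord_fun n s"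
proof -
  define m where "m = int n - 2 * int k"
  define c :: complex where "c = (-1) ^ n / complex_of_real (2 * pi)"
  define F where "F = (\<lambda>r \<theta>. cis (real_of_int m * \<theta>) * W n (sin ((\<theta> - \<beta> - s) + s) - r * sin (\<theta> - \<beta> - s)))"
  have F1: "continuous_on A (\<lambda>\<theta>. F r \<theta>)" and F2: "continuous_on A (\<lambda>r. F r \<theta>)" for A r \<theta>
    unfolding F_def by (intro continuous_intros)+
  have z: "zernike n k (chord \<beta> s r) = c * integral {0..2 * pi} (F r)" for r
    unfolding zernike_alt Im_chord c_def[symmetric] m_def[symmetric]
    using set_borel_integral_eq_integral(2)[OF cis_set_integrable[OF F1]] by (simp add: F_def)
  have "(LINT r:{0..2 * cos s}|lborel. zernike n k (chord \<beta> s r)) = integral {0..2 * cos s} (\<lambda>r. zernike n k (chord \<beta> s r))"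
    by (intro set_borel_integral_eq_integral(2) cis_set_integrable
        continuous_on_compose2[OF zernike_continuous[OF k, of UNIV]] continuous_intros subset_UNIV)
  also have "\<dots> = c * integral {0..2 * cos s} (\<lambda>r. integral {0..2 * pi} (F r))"
    unfolding z by simp
  also have "integral {0..2 * cos s} (\<lambda>r. integral {0..2 * pi} (F r)) = integral {0..2 * pi} (\<lambda>\<theta>. integral {0..2 * cos s} (\<lambda>r. F r \<theta>))"
  proof -
    have "continuous_on (cbox (0, 0) (2 * cos s, 2 * pi)) (\<lambda>(r, \<theta>). F r \<theta>)"
      unfolding F_def case_prod_unfold by (intro continuous_intros)
    from integral_swap_continuous[OF this] show ?thesis by simp
  qed
  also have "\<dots> = integral {0..2 * pi} (\<lambda>\<theta>. chord_fun n s / of_nat (n + 1) * (cis (real_of_int m * \<theta>) * dirichlet n (\<theta> - (\<beta> + s))))"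
  proof (rule Henstock_Kurzweil_Integration.integral_cong)
    fix \<theta>
    have "integral {0..2 * cos s} (\<lambda>r. F r \<theta>) = (LINT r:{0..2 * cos s}|lborel. F r \<theta>)"
      by (rule set_borel_integral_eq_integral(2)[symmetric]) (rule cis_set_integrable[OF F2])
    also have "\<dots> = cis (real_of_int m * \<theta>) * (dirichlet n (\<theta> - \<beta> - s) * chord_fun n s / of_nat (n + 1))"
      unfolding F_def set_integral_mult_right chord_integral_W[OF s] ..
    finally show "integral {0..2 * cos s} (\<lambda>r. F r \<theta>) = chord_fun n s / of_nat (n + 1) * (cis (real_of_int m * \<theta>) * dirichlet n (\<theta> - (\<beta> + s)))"
      by (simp add: diff_diff_eq mult_ac)
  qed
  also have "\<dots> = chord_fun n s / of_nat (n + 1) * integral {0..2 * pi} (\<lambda>\<theta>. cis (real_of_int m * \<theta>) * dirichlet n (\<theta> - (\<beta> + s)))"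
    by simp
  also have "integral {0..2 * pi} (\<lambda>\<theta>. cis (real_of_int m * \<theta>) * dirichlet n (\<theta> - (\<beta> + s))) =
     (LINT \<theta>:{0..2 * pi}|lborel. cis (real_of_int m * \<theta>) * dirichlet n (\<theta> - (\<beta> + s)))"
    unfolding dirichlet_def
    by (rule set_borel_integral_eq_integral(2)[symmetric]) (intro cis_set_integrable continuous_intros)
  also have "\<dots> = 2 * complex_of_real pi * cis (real_of_int m * (\<beta> + s))"
    unfolding m_def by (rule integral_cis_dirichlet[OF k])
  finally show ?thesis by (simp add: c_def m_def mult_ac)
qed

lemma half_circle_integral:
  "(LINT s:{- pi / 2..pi / 2}|lborel. cis (real_of_int m * s)) =
     complex_of_real (if m = 0 then pi else 2 * sin (real_of_int m * pi / 2) / real_of_int m)"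
proof (cases "m = 0")
  case True
  have "(LINT r:{- pi / 2..pi / 2}|lborel. 1) = complex_of_real pi"
    by (simp add: set_lebesgue_integral_def scaleR_conv_of_real)
  then show ?thesis using True by simp
next
  case False
  have "(LINT s:{- pi / 2..pi / 2}|lborel. cis (real_of_int m * s)) =
     (cis (real_of_int m * pi / 2) - cis (- (real_of_int m * pi / 2))) / (\<i> * of_int m)"
    using False by (simp add: integral_cis_interval)
  also have "\<dots> = 2 * \<i> * complex_of_real (sin (real_of_int m * pi / 2)) / (\<i> * of_int m)"
    unfolding sin_conv_cis ..
  finally show ?thesis using False by simp
qed

text \<open>Expanding gives the frequencies n - m and n + m + 2 with both signs. If n + m is even,
  nonzero even frequencies integrate to zero over the half circle. If it is odd, the integrals need
  not vanish, but their signs cancel in pairs.\<close>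

lemma chord_fun_orthogonal:
  "(LINT s:{- pi / 2..pi / 2}|lborel. chord_fun n s * cnj (chord_fun m s)) = (if n = m then 2 * complex_of_real pi else 0)"
proof -
  define E where "E = (\<lambda>c::int. LINT s:{- pi / 2..pi / 2}|lborel. cis (real_of_int c * s))"
  have E: "E c = complex_of_real (if c = 0 then pi else 2 * sin (real_of_int c * pi / 2) / real_of_int c)" for c
    unfolding E_def by (rule half_circle_integral)
  have Eminus: "E (- c) = E c" for c by (simp add: E)
  have Eeven: "E (2 * d) = 0" if "d \<noteq> 0" for d
    using that sin_int_times_real[of d] by (simp add: E mult.commute)
  let ?d = "int n - int m" and ?e = "int n + int m + 2"
  have "chord_fun n s * cnj (chord_fun m s) = (1 * cis (real_of_int ?d * s) + (-1) ^ m * cis (real_of_int ?e * s))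
      + ((-1) ^ n * cis (real_of_int (- ?e) * s) + (-1) ^ (n + m) * cis (real_of_int (- ?d) * s))" for s
  proof -
    have "chord_fun n s * cnj (chord_fun m s) =
      cis (real (n + 1) * s) * cis (- (real (m + 1) * s)) + (-1) ^ m * (cis (real (n + 1) * s) * cis (real (m + 1) * s))
      + ((-1) ^ n * (cis (- (real (n + 1) * s)) * cis (- (real (m + 1) * s))) + (-1) ^ (n + m) * (cis (- (real (n + 1) * s)) * cis (real (m + 1) * s)))"
      by (simp add: chord_fun_def cis_cnj power_add algebra_simps)
    moreover have "real (n + 1) * s + - (real (m + 1) * s) = real_of_int ?d * s"
      "real (n + 1) * s + real (m + 1) * s = real_of_int ?e * s"
      "- (real (n + 1) * s) + - (real (m + 1) * s) = real_of_int (- ?e) * s"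
      "- (real (n + 1) * s) + real (m + 1) * s = real_of_int (- ?d) * s"
      by (simp_all add: algebra_simps)
    ultimately show ?thesis by (simp only: cis_mult mult_1_left)
  qed
  then have "(LINT s:{- pi / 2..pi / 2}|lborel. chord_fun n s * cnj (chord_fun m s)) =
     (LINT s:{- pi / 2..pi / 2}|lborel. (1 * cis (real_of_int ?d * s) + (-1) ^ m * cis (real_of_int ?e * s))
      + ((-1) ^ n * cis (real_of_int (- ?e) * s) + (-1) ^ (n + m) * cis (real_of_int (- ?d) * s)))"
    by presburger
  also have "\<dots> = (1 * E ?d + (-1) ^ m * E ?e) + ((-1) ^ n * E (- ?e) + (-1) ^ (n + m) * E (- ?d))"
  proof -
    have i: "set_integrable lborel {- pi / 2..pi / 2} (\<lambda>s. c * cis (real_of_int d * s))" for c d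
      by (intro cis_set_integrable continuous_intros)
    have l: "(LINT s:{- pi / 2..pi / 2}|lborel. c * cis (real_of_int d * s)) = c * E d" for c d
      unfolding E_def by (rule set_integral_mult_right)
    show ?thesis
      unfolding l[symmetric]
      by (subst set_integral_add(2) | intro i set_integral_add(1))+ (rule refl)
  qed
  also have "\<dots> = (1 + (-1) ^ (n + m)) * E ?d + ((-1) ^ m + (-1) ^ n) * E ?e"
    unfolding Eminus by (simp add: algebra_simps)
  also have "\<dots> = (if n = m then 2 * complex_of_real pi else 0)"
  proof (cases "even (n + m)")
    case True
    then have "even ?d" "even ?e" by presburger+
    then obtain d e where de: "?d = 2 * d" "?e = 2 * e" by (meson evenE)
    have "e \<noteq> 0" using de by linarith
    then have "E ?e = 0" unfolding de by (rule Eeven)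
    moreover have "E ?d = (if n = m then complex_of_real pi else 0)"
    proof (cases "n = m")
      case True
      then show ?thesis by (simp add: E)
    next
      case False
      then have "d \<noteq> 0" using de by linarith
      then have "E ?d = 0" unfolding de by (rule Eeven)
      then show ?thesis using False by simp
    qed
    moreover have "(-1::complex) ^ (n + m) = 1" using True by simp
    ultimately show ?thesis by simp
  next
    case False
    then have "(-1::complex) ^ (n + m) = -1" "(-1::complex) ^ m + (-1) ^ n = 0" "n \<noteq> m"
      by (auto simp: minus_one_power_iff)
    then show ?thesis by simp
  qed
  finally show ?thesis .
qed

lemma zernike_measurable [measurable]: "k \<le> n \<Longrightarrow> zernike n k \<in> borel_measurable borel"
  by (intro borel_measurable_continuous_onI zernike_continuous)

lemma zernike_bounded:
  assumes "k \<le> n"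
  obtains B where "\<And>z. cmod z \<le> 1 \<Longrightarrow> cmod (zernike n k z) \<le> B"
proof -
  have "compact (zernike n k ` cball 0 1)"
    by (intro compact_continuous_image zernike_continuous assms) simp
  then have "bounded (zernike n k ` cball 0 1)" by (rule compact_imp_bounded)
  then obtain B where B: "\<forall>y\<in>zernike n k ` cball 0 1. cmod y \<le> B" by (auto simp: bounded_iff)
  show thesis by (rule that[of B]) (use B in simp)
qed

lemma W_bounded:
  obtains B where "\<And>t. \<bar>t\<bar> \<le> 1 \<Longrightarrow> cmod (W n t) \<le> B"
proof -
  have "compact (W n ` {-1..1})"
    by (intro compact_continuous_image W_continuous continuous_on_id) simp
  then have "bounded (W n ` {-1..1})" by (rule compact_imp_bounded)
  then obtain B where "\<forall>y\<in>W n ` {-1..1}. cmod y \<le> B" by (auto simp: bounded_iff)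
  then show thesis using that[of B] by (auto simp: abs_le_iff)
qed

text \<open>Sliced along its level lines, the ridge function leaves the inner integral, which
  becomes a chord integral of a Zernike polynomial. The slice density cos s supplies 2 cos s W_n(sin
  s) = \<open>chord_fun n s\<close>, and orthogonality of these functions decides.\<close>

lemma zernike_ridge_inner:
  assumes j: "j \<le> m"
  shows "(LINT z:cball 0 1|lborel. W n (Im (cis \<theta> * cnj z)) * cnj (zernike m j z)) =
    (if n = m then complex_of_real pi * ((-1) ^ m / of_nat (m + 1)) * cis (- (real_of_int (int m - 2 * int j) * \<theta>)) else 0)"
proof -
  let ?p = "int m - 2 * int j"
  let ?G = "\<lambda>z. W n (Im (cis \<theta> * cnj z)) * cnj (zernike m j z)"
  obtain B where B: "\<And>z. cmod z \<le> 1 \<Longrightarrow> cmod (zernike m j z) \<le> B" by (rule zernike_bounded[OF j]) blast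
  obtain B' where B': "\<And>t. \<bar>t\<bar> \<le> 1 \<Longrightarrow> cmod (W n t) \<le> B'" by (rule W_bounded[of n]) blast
  have Gc: "continuous_on UNIV ?G" by (intro continuous_intros zernike_continuous j)
  have "(LINT z:cball 0 1|lborel. ?G z) = (LINT s:{- pi / 2..pi / 2}|lborel. complex_of_real (cos s) *
       (LINT r:{0..2 * cos s}|lborel. ?G (cis \<theta> * (cis (- s) - complex_of_real r))))"
  proof (rule integral_chords)
    show "?G \<in> borel_measurable borel" by (rule borel_measurable_continuous_onI[OF Gc])
    show "cmod (?G z) \<le> B' * B" if z: "cmod z \<le> 1" for z
    proof -
      have "\<bar>Im (cis \<theta> * cnj z)\<bar> \<le> cmod (cis \<theta> * cnj z)" by (rule abs_Im_le_cmod)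
      also have "\<dots> \<le> 1" using z by (simp add: norm_mult)
      finally have "cmod (W n (Im (cis \<theta> * cnj z))) \<le> B'" by (rule B')
      then show ?thesis unfolding norm_mult complex_mod_cnj
        by (intro mult_mono B[OF z]) (auto intro: order_trans[OF norm_ge_zero])
    qed
  qed
  also have "\<dots> = (LINT s:{- pi / 2..pi / 2}|lborel. ((-1) ^ m / (2 * of_nat (m + 1)) * cis (- (real_of_int ?p * \<theta>))) * (chord_fun n s * cnj (chord_fun m s)))"
  proof (rule set_lebesgue_integral_cong)
    show "\<forall>s. s \<in> {- pi / 2..pi / 2} \<longrightarrow> complex_of_real (cos s) * (LINT r:{0..2 * cos s}|lborel. ?G (cis \<theta> * (cis (- s) - complex_of_real r)))
      = ((-1) ^ m / (2 * of_nat (m + 1)) * cis (- (real_of_int ?p * \<theta>))) * (chord_fun n s * cnj (chord_fun m s))"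
    proof (intro allI impI)
      fix s assume "s \<in> {- pi / 2..pi / 2}"
      then have s: "\<bar>s\<bar> \<le> pi / 2" by (auto simp: abs_le_iff)
      \<comment> \<open>Choosing the base angle theta - s makes the chords for varying s parallel,
        all in the direction -e^{i theta}.\<close>
      have ch: "cis \<theta> * (cis (- s) - complex_of_real r) = chord (\<theta> - s) s r" for r
        by (simp add: chord_def right_diff_distrib cis_mult mult.left_commute)
      have im: "Im (cis \<theta> * cnj (chord (\<theta> - s) s r)) = sin s" for r
        unfolding Im_chord by simp
      have "(LINT r:{0..2 * cos s}|lborel. ?G (cis \<theta> * (cis (- s) - complex_of_real r))) =
         W n (sin s) * (LINT r:{0..2 * cos s}|lborel. cnj (zernike m j (chord (\<theta> - s) s r)))"
        unfolding ch im by (rule set_integral_mult_right)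
      also have "(LINT r:{0..2 * cos s}|lborel. cnj (zernike m j (chord (\<theta> - s) s r))) = cnj (LINT r:{0..2 * cos s}|lborel. zernike m j (chord (\<theta> - s) s r))"
        unfolding set_lebesgue_integral_def Bochner_Integration.integral_cnj[symmetric] by simp
      also have "\<dots> = (-1) ^ m / of_nat (m + 1) * cis (- (real_of_int ?p * \<theta>)) * cnj (chord_fun m s)"
        unfolding chord_integral_zernike[OF s j] by (simp add: cis_cnj)
      finally have "complex_of_real (cos s) * (LINT r:{0..2 * cos s}|lborel. ?G (cis \<theta> * (cis (- s) - complex_of_real r))) =
        (2 * complex_of_real (cos s) * W n (sin s)) / 2 * ((-1) ^ m / of_nat (m + 1) * cis (- (real_of_int ?p * \<theta>)) * cnj (chord_fun m s))"
        by simp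
      then show "complex_of_real (cos s) * (LINT r:{0..2 * cos s}|lborel. ?G (cis \<theta> * (cis (- s) - complex_of_real r)))
      = ((-1) ^ m / (2 * of_nat (m + 1)) * cis (- (real_of_int ?p * \<theta>))) * (chord_fun n s * cnj (chord_fun m s))"
        unfolding W_sin by simp
    qed
  qed simp
  also have "\<dots> = ((-1) ^ m / (2 * of_nat (m + 1)) * cis (- (real_of_int ?p * \<theta>))) * (if n = m then 2 * complex_of_real pi else 0)"
    unfolding set_integral_mult_right chord_fun_orthogonal ..
  also have "\<dots> = (if n = m then complex_of_real pi * ((-1) ^ m / of_nat (m + 1)) * cis (- (real_of_int ?p * \<theta>)) else 0)"
    by (simp add: field_simps del: of_nat_Suc of_nat_add)
  finally show ?thesis .
qed

text \<open>Only the first factor is written as an average of ridge functions. After Fubini,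
  \<open>zernike_ridge_inner\<close> settles the degrees and leaves an exponential in theta, whose
  orthogonality settles k and j.\<close>

lemma zernike_orthogonal:
  assumes k: "k \<le> n" and j: "j \<le> m"
  shows "(LINT z:cball 0 1|lborel. zernike n k z * cnj (zernike m j z)) =
    (if n = m \<and> k = j then complex_of_real (pi / real (n + 1)) else 0)"
proof -
  have cb [measurable]: "cball (0::complex) 1 \<in> sets borel" by simp
  let ?p = "int n - 2 * int k" and ?q = "int m - 2 * int j"
  define c :: complex where "c = (-1) ^ n / complex_of_real (2 * pi)"
  define f where "f = (\<lambda>(z::complex, \<theta>::real). indicat_real (cball 0 1) z *\<^sub>R (indicat_real {0..2 * pi} \<theta> *\<^sub>R
     (cis (real_of_int ?p * \<theta>) * (W n (Im (cis \<theta> * cnj z)) * cnj (zernike m j z)))))"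
  obtain B where B: "\<And>z. cmod z \<le> 1 \<Longrightarrow> cmod (zernike m j z) \<le> B" by (rule zernike_bounded[OF j]) blast
  obtain B' where B': "\<And>t. \<bar>t\<bar> \<le> 1 \<Longrightarrow> cmod (W n t) \<le> B'" by (rule W_bounded[of n]) blast
  have mf: "f \<in> borel_measurable (lborel \<Otimes>\<^sub>M lborel)"
  proof -
    have g: "(\<lambda>p::complex \<times> real. cis (real_of_int ?p * snd p) * (W n (Im (cis (snd p) * cnj (fst p))) * cnj (zernike m j (fst p)))) \<in> borel_measurable borel"
      by (intro borel_measurable_continuous_onI continuous_intros continuous_on_compose2[OF zernike_continuous[OF j, of UNIV]] subset_UNIV)
    then have g': "(\<lambda>p::complex \<times> real. cis (real_of_int ?p * snd p) * (W n (Im (cis (snd p) * cnj (fst p))) * cnj (zernike m j (fst p)))) \<in> borel_measurable (lborel \<Otimes>\<^sub>M lborel)"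
      by (simp add: lborel_prod)
    show ?thesis unfolding f_def case_prod_unfold
      by (intro borel_measurable_scaleR g') measurable
  qed
  have int: "integrable (lborel \<Otimes>\<^sub>M lborel) f"
  proof (rule integrableI_bounded_set[where A = "cball 0 1 \<times> {0..2 * pi}" and B = "B' * B"])
    show "cball 0 1 \<times> {0..2 * pi} \<in> sets (lborel \<Otimes>\<^sub>M lborel)" by (intro pair_measureI) auto
    show "f \<in> borel_measurable (lborel \<Otimes>\<^sub>M lborel)" by (rule mf)
    have "emeasure (lborel \<Otimes>\<^sub>M lborel) (cball (0::complex) 1 \<times> {0..2 * pi}) = emeasure lborel (cball (0::complex) 1) * emeasure lborel {0..2 * pi}"
      by (rule lborel.emeasure_pair_measure_Times) auto
    also have "\<dots> < \<infinity>" using emeasure_bounded_finite[OF bounded_cball[of "0::complex" 1]] by (simp add: ennreal_mult_less_top)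
    finally show "emeasure (lborel \<Otimes>\<^sub>M lborel) (cball (0::complex) 1 \<times> {0..2 * pi}) < \<infinity>" .
    have "norm (f p) \<le> B' * B" if "p \<in> cball 0 1 \<times> {0..2 * pi}" for p
    proof -
      have z: "cmod (fst p) \<le> 1" using that by auto
      have "\<bar>Im (cis (snd p) * cnj (fst p))\<bar> \<le> cmod (cis (snd p) * cnj (fst p))" by (rule abs_Im_le_cmod)
      also have "\<dots> \<le> 1" using z by (simp add: norm_mult)
      finally have "cmod (W n (Im (cis (snd p) * cnj (fst p)))) \<le> B'" by (rule B')
      moreover have "norm (f p) = cmod (W n (Im (cis (snd p) * cnj (fst p)))) * cmod (zernike m j (fst p))"
        using that by (auto simp: f_def case_prod_unfold norm_mult indicator_def)
      ultimately show ?thesis using B[OF z]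
        by (auto intro!: mult_mono intro: order_trans[OF norm_ge_zero])
    qed
    then show "AE p in lborel \<Otimes>\<^sub>M lborel. p \<in> cball 0 1 \<times> {0..2 * pi} \<longrightarrow> norm (f p) \<le> B' * B" by blast
    have "f p = 0" if "p \<notin> cball 0 1 \<times> {0..2 * pi}" for p
      using that by (cases p) (auto simp: f_def indicator_def)
    then show "AE p in lborel \<Otimes>\<^sub>M lborel. p \<notin> cball 0 1 \<times> {0..2 * pi} \<longrightarrow> f p = 0" by blast
  qed
  have "(LINT z:cball 0 1|lborel. zernike n k z * cnj (zernike m j z)) = (\<integral>z. c * (\<integral>\<theta>. f (z, \<theta>) \<partial>lborel) \<partial>lborel)"
    unfolding set_lebesgue_integral_def
  proof (intro Bochner_Integration.integral_cong refl)
    fix z :: complex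
    have "(\<integral>\<theta>. f (z, \<theta>) \<partial>lborel) = (\<integral>\<theta>. (indicator (cball 0 1) z * cnj (zernike m j z)) * (indicat_real {0..2 * pi} \<theta> *\<^sub>R (cis (real_of_int ?p * \<theta>) * W n (Im (cis \<theta> * cnj z)))) \<partial>lborel)"
      by (intro Bochner_Integration.integral_cong refl) (auto simp: f_def indicator_def)
    also have "\<dots> = (indicator (cball 0 1) z * cnj (zernike m j z)) * (LINT \<theta>:{0..2 * pi}|lborel. cis (real_of_int ?p * \<theta>) * W n (Im (cis \<theta> * cnj z)))"
      unfolding set_lebesgue_integral_def by (rule integral_mult_right_zero)
    finally show "indicat_real (cball 0 1) z *\<^sub>R (zernike n k z * cnj (zernike m j z)) = c * (\<integral>\<theta>. f (z, \<theta>) \<partial>lborel)"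
      unfolding zernike_alt[of n k] c_def by (simp add: indicator_def)
  qed
  also have "\<dots> = c * (\<integral>z. (\<integral>\<theta>. f (z, \<theta>) \<partial>lborel) \<partial>lborel)" by (rule integral_mult_right_zero)
  also have "(\<integral>z. (\<integral>\<theta>. f (z, \<theta>) \<partial>lborel) \<partial>lborel) = (\<integral>\<theta>. (\<integral>z. f (z, \<theta>) \<partial>lborel) \<partial>lborel)"
    using lborel_pair.Fubini_integral[of "\<lambda>z \<theta>. f (z, \<theta>)"] int by simp
  also have "\<dots> = (LINT \<theta>:{0..2 * pi}|lborel. cis (real_of_int ?p * \<theta>) * (LINT z:cball 0 1|lborel. W n (Im (cis \<theta> * cnj z)) * cnj (zernike m j z)))"
    unfolding set_lebesgue_integral_def
  proof (intro Bochner_Integration.integral_cong refl)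
    fix \<theta> :: real
    have "(\<integral>z. f (z, \<theta>) \<partial>lborel) = (\<integral>z. (indicator {0..2 * pi} \<theta> * cis (real_of_int ?p * \<theta>)) * (indicat_real (cball 0 1) z *\<^sub>R (W n (Im (cis \<theta> * cnj z)) * cnj (zernike m j z))) \<partial>lborel)"
      by (intro Bochner_Integration.integral_cong refl) (auto simp: f_def indicator_def)
    also have "\<dots> = (indicator {0..2 * pi} \<theta> * cis (real_of_int ?p * \<theta>)) * (\<integral>z. indicat_real (cball 0 1) z *\<^sub>R (W n (Im (cis \<theta> * cnj z)) * cnj (zernike m j z)) \<partial>lborel)"
      by (rule integral_mult_right_zero)
    finally show "(\<integral>z. f (z, \<theta>) \<partial>lborel) = indicat_real {0..2 * pi} \<theta> *\<^sub>R (cis (real_of_int ?p * \<theta>) *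
       (\<integral>z. indicat_real (cball 0 1) z *\<^sub>R (W n (Im (cis \<theta> * cnj z)) * cnj (zernike m j z)) \<partial>lborel))"
      by (simp add: indicator_def)
  qed
  also have "\<dots> = (if n = m \<and> k = j then complex_of_real pi * ((-1) ^ m / of_nat (m + 1)) * (2 * complex_of_real pi) else 0)"
  proof (cases "n = m")
    case True
    have "(LINT \<theta>:{0..2 * pi}|lborel. cis (real_of_int ?p * \<theta>) * (complex_of_real pi * ((-1) ^ m / of_nat (m + 1)) * cis (- (real_of_int ?q * \<theta>))))
      = (LINT \<theta>:{0..2 * pi}|lborel. (complex_of_real pi * ((-1) ^ m / of_nat (m + 1))) * cis (real_of_int (?p - ?q) * \<theta>))"
    proof (rule set_lebesgue_integral_cong)
      have "cis (real_of_int (?p - ?q) * \<theta>) = cis (real_of_int ?p * \<theta>) * cis (- (real_of_int ?q * \<theta>))" for \<theta>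
        unfolding cis_mult by (rule arg_cong[of _ _ cis]) (simp add: algebra_simps)
      then show "\<forall>\<theta>. \<theta> \<in> {0..2 * pi} \<longrightarrow> cis (real_of_int ?p * \<theta>) * (complex_of_real pi * ((-1) ^ m / of_nat (m + 1)) * cis (- (real_of_int ?q * \<theta>)))
        = (complex_of_real pi * ((-1) ^ m / of_nat (m + 1))) * cis (real_of_int (?p - ?q) * \<theta>)"
        by (simp add: mult_ac)
    qed simp
    also have "\<dots> = (complex_of_real pi * ((-1) ^ m / of_nat (m + 1))) * (if ?p - ?q = 0 then 2 * complex_of_real pi else 0)"
      unfolding set_integral_mult_right integral_cis ..
    also have "?p - ?q = 0 \<longleftrightarrow> k = j" using True by auto
    finally show ?thesis
      unfolding zernike_ridge_inner[OF j] using True by (cases "k = j") (simp_all only: if_True if_False simp_thms mult_zero_right)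
  next
    case False
    then show ?thesis unfolding zernike_ridge_inner[OF j] by simp
  qed
  finally have fin: "(LINT z:cball 0 1|lborel. zernike n k z * cnj (zernike m j z)) =
    c * (if n = m \<and> k = j then complex_of_real pi * ((-1) ^ m / of_nat (m + 1)) * (2 * complex_of_real pi) else 0)" .
  \<comment> \<open>The two signs (-1)^m square to 1, and the average's 1/(2 pi) cancels the full
    circle, leaving pi/(m+1).\<close>
  have "e / (2 * p) * (p * (e / N) * (2 * p)) = (e * e) * p / N" if "p \<noteq> 0" for e p N :: complex
    using that by simp
  from this[of "complex_of_real pi" "(-1) ^ m" "of_nat (m + 1)"]
  have "(-1) ^ m / complex_of_real (2 * pi) * (complex_of_real pi * ((-1) ^ m / of_nat (m + 1)) * (2 * complex_of_real pi)) =
      complex_of_real (pi / real (m + 1))"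
    by (simp add: power_mult_distrib[symmetric])
  note factor = this
  show ?thesis
  proof (cases "n = m \<and> k = j")
    case True
    then have "n = m" by simp
    show ?thesis unfolding fin c_def using True factor unfolding \<open>n = m\<close> by (simp only: simp_thms if_True)
  next
    case False
    then show ?thesis unfolding fin by (simp only: False if_False mult_zero_right)
  qed
qed

section \<open>Density of polynomials in L2 of the disk\<close>

definition clip :: "real \<Rightarrow> complex \<Rightarrow> complex" where
  "clip m w = complex_of_real (m / max m (cmod w)) * w"

lemma clip_continuous: "m > 0 \<Longrightarrow> continuous_on UNIV (clip m)"
  unfolding clip_def[abs_def] by (intro continuous_intros) auto

lemma norm_clip_le:
  assumes "m > 0" shows "cmod (clip m w) \<le> m"
proof -
  have pos: "max m (cmod w) > 0" using assms by simp
  have "cmod (clip m w) = m / max m (cmod w) * cmod w"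
    unfolding clip_def norm_mult norm_of_real using assms by simp
  also have "\<dots> \<le> m / max m (cmod w) * max m (cmod w)"
    using assms by (intro mult_left_mono) auto
  also have "\<dots> = m" using pos by simp
  finally show ?thesis .
qed

lemma clip_id: "m > 0 \<Longrightarrow> cmod w \<le> m \<Longrightarrow> clip m w = w"
  by (simp add: clip_def max_def)

lemma norm_diff_clip_le:
  assumes "m > 0" shows "cmod (w - clip m w) \<le> cmod w"
proof -
  have f: "0 \<le> m / max m (cmod w)" "m / max m (cmod w) \<le> 1" using assms by (auto simp: divide_le_eq_1)
  have "w - clip m w = complex_of_real (1 - m / max m (cmod w)) * w" by (simp add: clip_def algebra_simps)
  then have "cmod (w - clip m w) = (1 - m / max m (cmod w)) * cmod w"
    using f by (simp only: norm_mult norm_of_real abs_of_nonneg)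
  also have "\<dots> \<le> 1 * cmod w" using f by (intro mult_right_mono) auto
  finally show ?thesis by simp
qed

lemma norm_add_sq_le: "(cmod (a + b))\<^sup>2 \<le> 2 * (cmod a)\<^sup>2 + 2 * (cmod b)\<^sup>2"
proof -
  have "(cmod (a + b))\<^sup>2 \<le> (cmod a + cmod b)\<^sup>2"
    by (intro power_mono norm_triangle_ineq) auto
  also have "\<dots> \<le> 2 * (cmod a)\<^sup>2 + 2 * (cmod b)\<^sup>2"
    using sum_squares_bound[of "cmod a" "cmod b"] by (simp add: power2_sum)
  finally show ?thesis .
qed

lemma nn_integral_norm_add_sq_le:
  assumes [measurable]: "f \<in> borel_measurable borel" "g \<in> borel_measurable borel" "S \<in> sets borel"
  shows "(\<integral>\<^sup>+z. ennreal ((cmod (f z + g z))\<^sup>2) * indicator S z \<partial>lborel) \<le>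
    2 * (\<integral>\<^sup>+z. ennreal ((cmod (f z))\<^sup>2) * indicator S z \<partial>lborel) + 2 * (\<integral>\<^sup>+z. ennreal ((cmod (g z))\<^sup>2) * indicator S z \<partial>lborel)"
proof -
  have "(\<integral>\<^sup>+z. ennreal ((cmod (f z + g z))\<^sup>2) * indicator S z \<partial>lborel) \<le>
    (\<integral>\<^sup>+z. 2 * (ennreal ((cmod (f z))\<^sup>2) * indicator S z) + 2 * (ennreal ((cmod (g z))\<^sup>2) * indicator S z) \<partial>lborel)"
  proof (intro nn_integral_mono)
    fix z
    have "ennreal ((cmod (f z + g z))\<^sup>2) \<le> ennreal (2 * (cmod (f z))\<^sup>2 + 2 * (cmod (g z))\<^sup>2)"
      by (intro ennreal_leI norm_add_sq_le)
    also have "\<dots> = 2 * ennreal ((cmod (f z))\<^sup>2) + 2 * ennreal ((cmod (g z))\<^sup>2)"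
      by (simp add: ennreal_mult)
    finally show "ennreal ((cmod (f z + g z))\<^sup>2) * indicator S z \<le> 2 * (ennreal ((cmod (f z))\<^sup>2) * indicator S z) + 2 * (ennreal ((cmod (g z))\<^sup>2) * indicator S z)"
      by (auto simp: indicator_def)
  qed
  also have "\<dots> = 2 * (\<integral>\<^sup>+z. ennreal ((cmod (f z))\<^sup>2) * indicator S z \<partial>lborel) + 2 * (\<integral>\<^sup>+z. ennreal ((cmod (g z))\<^sup>2) * indicator S z \<partial>lborel)"
    by (subst nn_integral_add) (auto simp: nn_integral_cmult)
  finally show ?thesis .
qed

lemma ennreal_double_add_less:
  assumes "a < ennreal (e / 4)" "b < ennreal (e / 4)"
  shows "2 * a + 2 * b < ennreal e"
proof -
  obtain r s where r: "a = ennreal r" "0 \<le> r" and s: "b = ennreal s" "0 \<le> s"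
    using assms by (cases a; cases b) auto
  have "r < e / 4" "s < e / 4" using assms r s by (simp_all add: ennreal_less_iff)
  then have less: "2 * r + 2 * s < e" by linarith
  have "2 * a + 2 * b = ennreal (2 * r) + ennreal (2 * s)"
    using r s by (simp add: ennreal_mult)
  also have "\<dots> = ennreal (2 * r + 2 * s)" using r s by (intro ennreal_plus[symmetric]) auto
  also have "\<dots> < ennreal e" using less r s by (simp add: ennreal_less_iff del: ennreal_plus)
  finally show ?thesis .
qed

text \<open>Truncate first: \<open>clip m\<close> retracts the plane continuously onto the disk of
  radius m, so clipping almost everywhere convergent continuous approximants keeps them continuous
  and bounded. Dominated convergence then applies both to the truncation and to the
  approximation.\<close>

lemma L2_disk_continuous_approx:
  fixes H :: "complex \<Rightarrow> complex"
  assumes H [measurable]: "H \<in> borel_measurable borel"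
    and fin: "(\<integral>\<^sup>+z. ennreal ((cmod (H z))\<^sup>2) * indicator (cball 0 1) z \<partial>lborel) < \<infinity>" and e: "e > 0"
  obtains g where "continuous_on UNIV g" "(\<integral>\<^sup>+z. ennreal ((cmod (H z - g z))\<^sup>2) * indicator (cball 0 1) z \<partial>lborel) < ennreal e"
proof -
  have cb [measurable]: "cball (0::complex) 1 \<in> sets borel" by simp
  let ?I = "\<lambda>f. \<integral>\<^sup>+z. ennreal ((cmod (f z))\<^sup>2) * indicator (cball 0 1) z \<partial>lborel"
  have clm: "(\<lambda>z. clip m (f z)) \<in> borel_measurable borel" if "m > 0" "f \<in> borel_measurable borel" for m f
    by (rule measurable_compose[OF that(2) borel_measurable_continuous_onI[OF clip_continuous[OF that(1)]]])
  have "(\<lambda>i. ?I (\<lambda>z. H z - clip (real (Suc i)) (H z))) \<longlonglongrightarrow> (\<integral>\<^sup>+z. 0 \<partial>(lborel :: complex measure))"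
  proof (rule nn_integral_dominated_convergence[where w = "\<lambda>z. ennreal ((cmod (H z))\<^sup>2) * indicator (cball 0 1) z"])
    show "(\<lambda>z. ennreal ((cmod (H z - clip (real (Suc i)) (H z)))\<^sup>2) * indicator (cball 0 1) z) \<in> borel_measurable lborel" for i
    proof -
      have [measurable]: "(\<lambda>z. clip (real (Suc i)) (H z)) \<in> borel_measurable borel" by (rule clm) (use H in auto)
      show ?thesis by measurable
    qed
    show "AE z in lborel. ennreal ((cmod (H z - clip (real (Suc i)) (H z)))\<^sup>2) * indicator (cball 0 1) z \<le> ennreal ((cmod (H z))\<^sup>2) * indicator (cball 0 1) z" for i
      by (intro AE_I2 mult_right_mono ennreal_leI power_mono norm_diff_clip_le) auto
    show "AE z in lborel. (\<lambda>i. ennreal ((cmod (H z - clip (real (Suc i)) (H z)))\<^sup>2) * indicator (cball 0 1) z) \<longlonglongrightarrow> 0"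
    proof (rule AE_I2)
      fix z :: complex
      obtain N where N: "cmod (H z) \<le> real N" using real_arch_simple by blast
      have "\<forall>\<^sub>F i in sequentially. ennreal ((cmod (H z - clip (real (Suc i)) (H z)))\<^sup>2) * indicator (cball 0 1) z = 0"
        using eventually_ge_at_top[of N]
      proof eventually_elim
        case (elim i)
        then have "cmod (H z) \<le> real (Suc i)" using N by linarith
        then show ?case by (simp add: clip_id)
      qed
      then show "(\<lambda>i. ennreal ((cmod (H z - clip (real (Suc i)) (H z)))\<^sup>2) * indicator (cball 0 1) z) \<longlonglongrightarrow> 0"
        by (rule tendsto_eventually)
    qed
  qed (use fin in auto)
  then have "(\<lambda>i. ?I (\<lambda>z. H z - clip (real (Suc i)) (H z))) \<longlonglongrightarrow> 0" by simp
  \<comment> \<open>Each error is allowed e/4, because |a + b|^2 <= 2 |a|^2 + 2 |b|^2 doubles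
    both.\<close>
  from order_tendstoD(2)[OF this, of "ennreal (e / 4)"] e
  obtain i where i: "?I (\<lambda>z. H z - clip (real (Suc i)) (H z)) < ennreal (e / 4)"
    by (auto simp: eventually_sequentially)
  define m where "m = real (Suc i)"
  have m: "m > 0" by (simp add: m_def)
  have "H \<in> borel_measurable lebesgue" using H by (simp add: measurable_completion)
  then have "H measurable_on UNIV" by (rule lebesgue_measurable_imp_measurable_on) simp
  then have "\<exists>N g. negligible N \<and> (\<forall>n. continuous_on UNIV (g n)) \<and> (\<forall>x. x \<notin> N \<longrightarrow> (\<lambda>n. g n x) \<longlonglongrightarrow> H x)"
    unfolding measurable_on_def by (simp only: UNIV_I if_True)
  then obtain N g where N: "negligible N" and gc: "\<And>n. continuous_on UNIV (g n)"
    and g: "\<And>x. x \<notin> N \<Longrightarrow> (\<lambda>n. g n x) \<longlonglongrightarrow> H x"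
    by (elim exE conjE) blast
  have gm: "g n \<in> borel_measurable borel" for n by (rule borel_measurable_continuous_onI[OF gc])
  have cm [measurable]: "(\<lambda>z. clip m (H z)) \<in> borel_measurable borel" "\<And>n. (\<lambda>z. clip m (g n z)) \<in> borel_measurable borel"
    by (intro clm m H gm)+
  have "(\<lambda>n. ?I (\<lambda>z. clip m (H z) - clip m (g n z))) \<longlonglongrightarrow> (\<integral>\<^sup>+z. 0 \<partial>(lborel :: complex measure))"
  proof (rule nn_integral_dominated_convergence[where w = "\<lambda>z. ennreal ((2 * m)\<^sup>2) * indicator (cball 0 1) z"])
    show "AE z in lborel. ennreal ((cmod (clip m (H z) - clip m (g n z)))\<^sup>2) * indicator (cball 0 1) z \<le> ennreal ((2 * m)\<^sup>2) * indicator (cball 0 1) z" for n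
    proof (intro AE_I2 mult_right_mono ennreal_leI power_mono)
      fix z
      have "cmod (clip m (H z) - clip m (g n z)) \<le> cmod (clip m (H z)) + cmod (clip m (g n z))" by (rule norm_triangle_ineq4)
      also have "\<dots> \<le> 2 * m" using norm_clip_le[OF m, of "H z"] norm_clip_le[OF m, of "g n z"] by simp
      finally show "cmod (clip m (H z) - clip m (g n z)) \<le> 2 * m" .
    qed auto
    show "(\<integral>\<^sup>+z. ennreal ((2 * m)\<^sup>2) * indicator (cball 0 1) z \<partial>(lborel :: complex measure)) < \<infinity>"
      using emeasure_bounded_finite[OF bounded_cball[of "0::complex" 1]]
      by (simp add: nn_integral_cmult ennreal_mult_less_top)
    have "AE z in lborel. z \<notin> N"
    proof -
      have "N \<in> null_sets lebesgue" using N by (simp add: negligible_iff_null_sets)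
      then have "AE z in lebesgue. z \<notin> N" by (rule AE_not_in)
      then show ?thesis by (simp add: AE_completion_iff)
    qed
    then show "AE z in lborel. (\<lambda>n. ennreal ((cmod (clip m (H z) - clip m (g n z)))\<^sup>2) * indicator (cball 0 1) z) \<longlonglongrightarrow> 0"
    proof eventually_elim
      case (elim z)
      have "isCont (clip m) (H z)" using clip_continuous[OF m] by (simp add: continuous_on_eq_continuous_at)
      from isCont_tendsto_compose[OF this g[OF elim]]
      have "(\<lambda>n. (cmod (clip m (H z) - clip m (g n z)))\<^sup>2) \<longlonglongrightarrow> (cmod (clip m (H z) - clip m (H z)))\<^sup>2"
        by (intro tendsto_intros)
      then have "(\<lambda>n. ennreal ((cmod (clip m (H z) - clip m (g n z)))\<^sup>2)) \<longlonglongrightarrow> ennreal 0"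
        by (intro tendsto_ennrealI) simp
      then show ?case by (cases "z \<in> cball 0 1") auto
    qed
  qed measurable
  then have "(\<lambda>n. ?I (\<lambda>z. clip m (H z) - clip m (g n z))) \<longlonglongrightarrow> 0" by simp
  from order_tendstoD(2)[OF this, of "ennreal (e / 4)"] e
  obtain n where n: "?I (\<lambda>z. clip m (H z) - clip m (g n z)) < ennreal (e / 4)"
    by (auto simp: eventually_sequentially)
  show thesis
  proof (rule that)
    show "continuous_on UNIV (\<lambda>z. clip m (g n z))"
      by (rule continuous_on_compose2[OF clip_continuous[OF m] gc]) auto
    have "?I (\<lambda>z. H z - clip m (g n z)) = ?I (\<lambda>z. (H z - clip m (H z)) + (clip m (H z) - clip m (g n z)))"
      by simp
    also have "\<dots> \<le> 2 * ?I (\<lambda>z. H z - clip m (H z)) + 2 * ?I (\<lambda>z. clip m (H z) - clip m (g n z))"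
      by (rule nn_integral_norm_add_sq_le) measurable
    also have "\<dots> < ennreal e"
      using i n unfolding m_def[symmetric] by (rule ennreal_double_add_less)
    finally show "?I (\<lambda>z. H z - clip m (g n z)) < ennreal e" .
  qed
qed

lemma L2_disk_polynomial_approx:
  fixes H :: "complex \<Rightarrow> complex"
  assumes H [measurable]: "H \<in> borel_measurable borel"
    and fin: "(\<integral>\<^sup>+z. ennreal ((cmod (H z))\<^sup>2) * indicator (cball 0 1) z \<partial>lborel) < \<infinity>" and e: "e > 0"
  obtains p where "polynomial_function p" "(\<integral>\<^sup>+z. ennreal ((cmod (H z - p z))\<^sup>2) * indicator (cball 0 1) z \<partial>lborel) < ennreal e"
proof -
  have cb [measurable]: "cball (0::complex) 1 \<in> sets borel" by simp
  let ?I = "\<lambda>f. \<integral>\<^sup>+z. ennreal ((cmod (f z))\<^sup>2) * indicator (cball 0 1) z \<partial>lborel"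
  obtain g where g: "continuous_on UNIV g" "?I (\<lambda>z. H z - g z) < ennreal (e / 4)"
    by (rule L2_disk_continuous_approx[OF H fin, of "e / 4"]) (use e in auto)
  \<comment> \<open>A uniform error d costs d^2 pi = e/8 on the disk of area pi, strictly below the
    allowed e/4.\<close>
  define d where "d = sqrt (e / (8 * pi))"
  have d: "d > 0" "d\<^sup>2 = e / (8 * pi)" using e by (auto simp: d_def)
  have "\<exists>p. polynomial_function p \<and> (\<forall>x \<in> cball 0 1. norm (g x - p x) < d)"
    by (rule Stone_Weierstrass_polynomial_function[OF compact_cball continuous_on_subset[OF g(1) subset_UNIV] d(1)])
  then obtain p where p: "polynomial_function p" "\<And>x. x \<in> cball 0 1 \<Longrightarrow> norm (g x - p x) < d" by blast
  have [measurable]: "g \<in> borel_measurable borel" by (rule borel_measurable_continuous_onI[OF g(1)])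
  have [measurable]: "p \<in> borel_measurable borel"
    by (rule borel_measurable_continuous_onI[OF continuous_on_polymonial_function[OF p(1)]])
  have "?I (\<lambda>z. g z - p z) \<le> (\<integral>\<^sup>+z. ennreal (d\<^sup>2) * indicator (cball 0 1) z \<partial>(lborel :: complex measure))"
    by (intro nn_integral_mono) (auto simp: indicator_def intro!: ennreal_leI power_mono less_imp_le[OF p(2)])
  also have "\<dots> = ennreal (d\<^sup>2) * ennreal pi"
    by (simp add: nn_integral_cmult emeasure_cball unit_ball_vol_2)
  also have "\<dots> = ennreal (e / 8)" using e by (simp add: ennreal_mult[symmetric] d)
  finally have gp: "?I (\<lambda>z. g z - p z) \<le> ennreal (e / 8)" .
  show thesis
  proof (rule that[OF p(1)])
    have "?I (\<lambda>z. H z - p z) = ?I (\<lambda>z. (H z - g z) + (g z - p z))" by simp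
    also have "\<dots> \<le> 2 * ?I (\<lambda>z. H z - g z) + 2 * ?I (\<lambda>z. g z - p z)"
      by (rule nn_integral_norm_add_sq_le) measurable
    also have "\<dots> < ennreal e"
      by (rule ennreal_double_add_less[OF g(2) le_less_trans[OF gp]]) (use e in \<open>simp add: ennreal_less_iff\<close>)
    finally show "?I (\<lambda>z. H z - p z) < ennreal e" .
  qed
qed

section \<open>The X-ray transform as a singular system\<close>

text \<open>Rays are preserved and the radial profile runs continuously from 0 to 1, so the
  intermediate value theorem finds the radius.\<close>

lemma proj_surj:
  assumes \<kappa>: "-1 < \<kappa>" "\<kappa> < 1" and z: "cmod z \<le> 1"
  obtains w where "cmod w \<le> 1" "proj \<kappa> w = z"
proof (cases "z = 0")
  case True
  show thesis by (rule that[of 0]) (use True in \<open>auto simp: proj_def\<close>)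
next
  case False
  define \<phi> where "\<phi> = (\<lambda>r::real. (1 - \<kappa>) / (1 - \<kappa> * r\<^sup>2) * r)"
  have p: "1 - \<kappa> * r\<^sup>2 \<noteq> 0" if "r \<in> {0..1}" for r
    using curvature_factor_pos(2)[OF \<kappa>, of "complex_of_real r"] that by simp
  have "continuous_on {0..1} \<phi>" unfolding \<phi>_def using p by (intro continuous_intros) auto
  moreover have "\<phi> 0 = 0" "\<phi> 1 = 1" using \<kappa> by (simp_all add: \<phi>_def)
  ultimately have "\<exists>r\<ge>0. r \<le> 1 \<and> \<phi> r = cmod z"
    using z by (intro IVT') auto
  then obtain r where r: "0 \<le> r" "r \<le> 1" "\<phi> r = cmod z" by blast
  show thesis
  proof (rule that[of "complex_of_real r * sgn z"])
    have n: "cmod (complex_of_real r * sgn z) = r" using r False by (simp add: norm_mult norm_sgn)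
    show "cmod (complex_of_real r * sgn z) \<le> 1" unfolding n by (rule r)
    have "proj \<kappa> (complex_of_real r * sgn z) = complex_of_real (\<phi> r) * sgn z"
      unfolding proj_def n \<phi>_def by simp
    then show "proj \<kappa> (complex_of_real r * sgn z) = z"
      using False by (simp add: r sgn_eq)
  qed
qed

lemma flatten_eq:
  assumes \<kappa>: "-1 < \<kappa>" "\<kappa> < 1" and z: "cmod z \<le> 1"
    and k: "\<And>z. cmod z \<le> 1 \<Longrightarrow> k z = complex_of_real (weight \<kappa> z) * K (proj \<kappa> z)"
  shows "flatten \<kappa> k z = K z"
proof -
  obtain w where w: "cmod w \<le> 1" "proj \<kappa> w = z" by (rule proj_surj[OF \<kappa> z])
  then show ?thesis
    using flatten_proj[OF \<kappa> w(1), of k] k[OF w(1)] weight_pos[OF \<kappa> w(1)] by simp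
qed

lemma flatten_factor:
  assumes \<kappa>: "-1 < \<kappa>" "\<kappa> < 1" and z: "cmod z \<le> 1"
  shows "h z = complex_of_real (weight \<kappa> z) * flatten \<kappa> h (proj \<kappa> z)"
  using flatten_proj[OF \<kappa> z, of h] weight_pos[OF \<kappa> z] by simp

lemma norm_chord_le_1:
  assumes r: "r \<in> {0..2 * cos s}"
  shows "cmod (chord \<beta> s r) \<le> 1"
proof -
  have "(cmod (chord \<beta> s r))\<^sup>2 = (1 - r * cos s)\<^sup>2 + (r * sin s)\<^sup>2"
    by (simp add: chord_def norm_mult cmod_power2)
  also have "\<dots> = 1 - r * (2 * cos s - r)"
    using sin_cos_squared_add[of s] by algebra
  also have "\<dots> \<le> 1" using r by simp
  finally show ?thesis by (simp add: abs_square_le_1)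
qed

section \<open>The normalised Zernike functions in the weighted space\<close>

lemma zernike_curv_eq:
  "zernike_curv \<kappa> n k z = complex_of_real (weight \<kappa> z) * (complex_of_real (sqrt ((1 - \<kappa>) / (1 + \<kappa>))) * zernike n k (proj \<kappa> z))"
  by (simp add: zernike_curv_def weight_def proj_def)

lemma zernike_disk_finite:
  assumes "k \<le> n"
  shows "(\<integral>\<^sup>+z. ennreal ((cmod (c * zernike n k z))\<^sup>2) * indicator (cball 0 1) z \<partial>lborel) < \<infinity>"
proof -
  obtain B where B: "\<And>z. cmod z \<le> 1 \<Longrightarrow> cmod (zernike n k z) \<le> B" by (rule zernike_bounded[OF assms]) blast
  have "(\<integral>\<^sup>+z. ennreal ((cmod (c * zernike n k z))\<^sup>2) * indicator (cball 0 1) z \<partial>lborel) \<le>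
    (\<integral>\<^sup>+z. ennreal ((cmod c * B)\<^sup>2) * indicator (cball 0 1) z \<partial>(lborel :: complex measure))"
    using B by (intro nn_integral_mono) (auto simp: indicator_def norm_mult intro!: ennreal_leI power_mono mult_left_mono)
  also have "\<dots> = ennreal ((cmod c * B)\<^sup>2) * emeasure lborel (cball (0::complex) 1)"
    by (rule nn_integral_cmult_indicator) simp
  also have "\<dots> < \<infinity>"
    using emeasure_bounded_finite[OF bounded_cball[of "0::complex" 1]]
    by (simp add: ennreal_mult_less_top)
  finally show ?thesis .
qed

lemma normalize_L2:
  assumes "f \<in> L2_space M" shows "L2_normalize M f \<in> L2_space M"
proof -
  have eq: "L2_normalize M f = (\<lambda>x. (1 / complex_of_real (L2_norm M f)) * f x)"
    by (simp add: L2_normalize_def fun_eq_iff)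
  show ?thesis unfolding eq by (rule L2_space_scale[OF assms])
qed

lemma normalize_inner:
  "L2_inner M (L2_normalize M f) (L2_normalize M g) = L2_inner M f g / complex_of_real (L2_norm M f * L2_norm M g)"
proof -
  have "L2_inner M (L2_normalize M f) (L2_normalize M g) = (\<integral>x. (f x * cnj (g x)) / complex_of_real (L2_norm M f * L2_norm M g) \<partial>M)"
    unfolding L2_inner_def L2_normalize_def by (simp add: mult_ac)
  then show ?thesis unfolding L2_inner_def by simp
qed

context
  fixes \<kappa> :: real
  assumes \<kappa>: "-1 < \<kappa>" "\<kappa> < 1"
begin

lemma zernike_curv_L2:
  assumes k: "k \<le> n"
  shows "zernike_curv \<kappa> n k \<in> L2_space (weighted_vol \<kappa>)"
proof -
  let ?K = "\<lambda>z. complex_of_real (sqrt ((1 - \<kappa>) / (1 + \<kappa>))) * zernike n k z"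
  have K: "?K \<in> borel_measurable borel" using k by measurable
  have m: "zernike_curv \<kappa> n k \<in> borel_measurable (weighted_vol \<kappa>)"
    by (rule weighted_vol_measurable_proj[OF \<kappa> K]) (rule zernike_curv_eq)
  show ?thesis
    unfolding L2_space_iff[OF m]
    by (subst nn_integral_weighted_vol_norm[OF \<kappa> K])
       (use zernike_disk_finite[OF k] in \<open>auto simp: zernike_curv_eq ennreal_mult_less_top\<close>)
qed

lemma zernike_curv_inner:
  assumes k: "k \<le> n" and j: "j \<le> m"
  shows "L2_inner (weighted_vol \<kappa>) (zernike_curv \<kappa> n k) (zernike_curv \<kappa> m j) =
    (if (n, k) = (m, j) then complex_of_real (pi / ((1 - \<kappa>\<^sup>2) * real (n + 1))) else 0)"
proof -
  let ?c = "complex_of_real (sqrt ((1 - \<kappa>) / (1 + \<kappa>)))"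
  have cc: "?c * ?c = complex_of_real ((1 - \<kappa>) / (1 + \<kappa>))"
    using \<kappa> by (simp only: of_real_mult[symmetric]) simp
  have "L2_inner (weighted_vol \<kappa>) (zernike_curv \<kappa> n k) (zernike_curv \<kappa> m j) =
    complex_of_real (1 / (1 - \<kappa>)\<^sup>2) * (LINT z:cball 0 1|lborel. (?c * zernike n k z) * cnj (?c * zernike m j z))"
    by (rule integral_weighted_vol_inner[OF \<kappa>]) (use k j in \<open>simp_all add: zernike_curv_eq\<close>)
  also have "(LINT z:cball 0 1|lborel. (?c * zernike n k z) * cnj (?c * zernike m j z)) =
     (LINT z:cball 0 1|lborel. (?c * ?c) * (zernike n k z * cnj (zernike m j z)))"
    by (simp add: mult_ac)
  also have "\<dots> = (?c * ?c) * (if n = m \<and> k = j then complex_of_real (pi / real (n + 1)) else 0)"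
    unfolding set_integral_mult_right zernike_orthogonal[OF k j] ..
  also have "complex_of_real (1 / (1 - \<kappa>)\<^sup>2) * \<dots> =
    (if n = m \<and> k = j then complex_of_real ((1 / (1 - \<kappa>)\<^sup>2) * ((1 - \<kappa>) / (1 + \<kappa>)) * (pi / real (n + 1))) else 0)"
    unfolding cc by (simp only: of_real_mult mult.assoc if_distrib[of "\<lambda>x. _ * x"] mult_zero_right)
  also have "(1 / (1 - \<kappa>)\<^sup>2) * ((1 - \<kappa>) / (1 + \<kappa>)) * (pi / real (n + 1)) = pi / ((1 - \<kappa>\<^sup>2) * real (n + 1))"
  proof -
    have "(1 / a\<^sup>2) * (a / b) * (pi / N) = pi / (a * b * N)" if "a \<noteq> 0" for a b N :: real
      using that by (simp add: power2_eq_square)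
    from this[of "1 - \<kappa>" "1 + \<kappa>" "real (n + 1)"] \<kappa>
    show ?thesis by (simp add: power2_eq_square algebra_simps)
  qed
  finally show ?thesis by simp
qed

text \<open>The square is the product of 1/(1-kappa)^2 from the change of variables,
  (1-kappa)/(1+kappa) from the prefactor of \<open>zernike_curv\<close>, and the Euclidean value
  pi/(n+1). It does not depend on k.\<close>

definition zernike_norm :: "nat \<Rightarrow> real" where
  "zernike_norm n = sqrt (pi / ((1 - \<kappa>\<^sup>2) * real (n + 1)))"

lemma one_minus_sq_pos: "1 - \<kappa>\<^sup>2 > 0"
  using \<kappa> by (simp add: abs_square_less_1)

lemma zernike_norm_pos: "zernike_norm n > 0"
  using one_minus_sq_pos by (simp add: zernike_norm_def)

lemma zernike_curv_norm:
  assumes k: "k \<le> n"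
  shows "L2_norm (weighted_vol \<kappa>) (zernike_curv \<kappa> n k) = zernike_norm n"
proof -
  have "complex_of_real ((L2_norm (weighted_vol \<kappa>) (zernike_curv \<kappa> n k))\<^sup>2) = complex_of_real (pi / ((1 - \<kappa>\<^sup>2) * real (n + 1)))"
    unfolding L2_inner_self[symmetric] zernike_curv_inner[OF k k] by simp
  then have "(L2_norm (weighted_vol \<kappa>) (zernike_curv \<kappa> n k))\<^sup>2 = pi / ((1 - \<kappa>\<^sup>2) * real (n + 1))"
    by (simp only: of_real_eq_iff)
  then show ?thesis unfolding zernike_norm_def by (metis L2_norm_nonneg real_sqrt_unique)
qed

lemma Z_hat_orthonormal: "L2_orthonormal (weighted_vol \<kappa>) index_set (Z_hat \<kappa>)"
  unfolding L2_orthonormal_def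
proof (intro conjI ballI)
  fix i assume "i \<in> index_set"
  then show "Z_hat \<kappa> i \<in> L2_space (weighted_vol \<kappa>)"
    by (cases i) (auto simp: Z_hat_def index_set_def intro!: normalize_L2 zernike_curv_L2)
next
  fix i i' assume i: "i \<in> index_set" "i' \<in> index_set"
  obtain n k m j where ij: "i = (n, k)" "i' = (m, j)" by (cases i, cases i')
  with i have k: "k \<le> n" "j \<le> m" by (auto simp: index_set_def)
  have "zernike_norm n * zernike_norm n = pi / ((1 - \<kappa>\<^sup>2) * real (n + 1))"
    using one_minus_sq_pos by (simp add: zernike_norm_def)
  note sq = this[symmetric]
  have val: "L2_inner (weighted_vol \<kappa>) (Z_hat \<kappa> i) (Z_hat \<kappa> i') =
     (if (n, k) = (m, j) then complex_of_real (pi / ((1 - \<kappa>\<^sup>2) * real (n + 1))) else 0) / complex_of_real (zernike_norm n * zernike_norm m)"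
    unfolding ij Z_hat_def case_prod_conv normalize_inner zernike_curv_inner[OF k] zernike_curv_norm[OF k(1)] zernike_curv_norm[OF k(2)] ..
  show "L2_inner (weighted_vol \<kappa>) (Z_hat \<kappa> i) (Z_hat \<kappa> i') = (if i = i' then 1 else 0)"
  proof (cases "i = i'")
    case True
    then have "m = n" "j = k" using ij by simp_all
    then show ?thesis using True unfolding val sq using zernike_norm_pos[of n] by simp
  next
    case False
    then have "(n, k) \<noteq> (m, j)" using ij by simp
    then show ?thesis unfolding val if_not_P[OF False] by (simp only: if_False simp_thms) simp
  qed
qed

lemma Z_hat_factor:
  assumes "k \<le> n"
  shows "Z_hat \<kappa> (n, k) z = complex_of_real (weight \<kappa> z) *
    (complex_of_real (sqrt ((1 - \<kappa>) / (1 + \<kappa>)) / zernike_norm n) * zernike n k (proj \<kappa> z))"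
  by (simp add: Z_hat_def L2_normalize_def zernike_curv_norm[OF assms] zernike_curv_eq)

text \<open>After flattening, the question is one of polynomial approximation on the Euclidean disk,
  and every polynomial is a finite combination of Zernike polynomials.\<close>

lemma Z_hat_dense: "L2_dense_span (weighted_vol \<kappa>) index_set (Z_hat \<kappa>)"
  unfolding L2_dense_span_def
proof (intro ballI allI impI)
  fix f and e :: real assume f: "f \<in> L2_space (weighted_vol \<kappa>)" and e: "e > 0"
  define H where "H = flatten \<kappa> f"
  have fm: "f \<in> borel_measurable (weighted_vol \<kappa>)" using f by (simp add: L2_space_def)
  have H [measurable]: "H \<in> borel_measurable borel"
    unfolding H_def by (rule flatten_measurable) (use fm in \<open>simp add: measurable_weighted_vol\<close>)
  have fH: "f z = complex_of_real (weight \<kappa> z) * H (proj \<kappa> z)" if "cmod z \<le> 1" for z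
    unfolding H_def by (rule flatten_factor[OF \<kappa> that])
  have "(\<integral>\<^sup>+z. ennreal ((cmod (f z))\<^sup>2) \<partial>weighted_vol \<kappa>) =
      ennreal (1 / (1 - \<kappa>)\<^sup>2) * (\<integral>\<^sup>+z. ennreal ((cmod (H z))\<^sup>2) * indicator (cball 0 1) z \<partial>lborel)"
    by (rule nn_integral_weighted_vol_norm[OF \<kappa> H fH])
  then have "ennreal (1 / (1 - \<kappa>)\<^sup>2) * (\<integral>\<^sup>+z. ennreal ((cmod (H z))\<^sup>2) * indicator (cball 0 1) z \<partial>lborel) < \<infinity>"
    using f unfolding L2_space_iff[OF fm] by simp
  then have fin: "(\<integral>\<^sup>+z. ennreal ((cmod (H z))\<^sup>2) * indicator (cball 0 1) z \<partial>lborel) < \<infinity>"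
    using \<kappa> by (auto simp: ennreal_mult_less_top)
  \<comment> \<open>Tolerance on the flat side; transport back divides it by (1-kappa)^2.\<close>
  have "(1 - \<kappa>)\<^sup>2 * e\<^sup>2 > 0" using \<kappa> e by simp
  then obtain p where p: "polynomial_function p"
    "(\<integral>\<^sup>+z. ennreal ((cmod (H z - p z))\<^sup>2) * indicator (cball 0 1) z \<partial>lborel) < ennreal ((1 - \<kappa>)\<^sup>2 * e\<^sup>2)"
    by (rule L2_disk_polynomial_approx[OF H fin])
  obtain F c where F: "finite F" "F \<subseteq> index_set" and pF: "p = (\<lambda>z. \<Sum>j\<in>F. c j * (case j of (n, k) \<Rightarrow> zernike n k) z)"
    using lspan_finite_sum[OF polynomial_function_lspan_zernike[OF p(1)]] by blast
  \<comment> \<open>Undoes the normalisation and the prefactor that separate \<open>Z_hat\<close>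
    from the flat Zernike polynomial.\<close>
  define d where "d = (\<lambda>(n, k). c (n, k) * complex_of_real (zernike_norm n / sqrt ((1 - \<kappa>) / (1 + \<kappa>))))"
  let ?g = "\<lambda>z. f z - (\<Sum>j\<in>F. d j * Z_hat \<kappa> j z)"
  have pm [measurable]: "p \<in> borel_measurable borel"
    by (rule borel_measurable_continuous_onI[OF continuous_on_polymonial_function[OF p(1)]])
  have g: "?g z = complex_of_real (weight \<kappa> z) * (H (proj \<kappa> z) - p (proj \<kappa> z))" if z: "cmod z \<le> 1" for z
  proof -
    have "(\<Sum>j\<in>F. d j * Z_hat \<kappa> j z) = complex_of_real (weight \<kappa> z) * p (proj \<kappa> z)"
      unfolding pF sum_distrib_left
    proof (intro sum.cong refl)
      fix j assume "j \<in> F"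
      then obtain n k where j: "j = (n, k)" "k \<le> n" using F by (auto simp: index_set_def)
      have "complex_of_real (zernike_norm n / sqrt ((1 - \<kappa>) / (1 + \<kappa>))) * complex_of_real (sqrt ((1 - \<kappa>) / (1 + \<kappa>)) / zernike_norm n) = 1"
        unfolding of_real_mult[symmetric] using zernike_norm_pos[of n] \<kappa> by simp
      then have "c (n, k) * complex_of_real (zernike_norm n / sqrt ((1 - \<kappa>) / (1 + \<kappa>))) * (W * (complex_of_real (sqrt ((1 - \<kappa>) / (1 + \<kappa>)) / zernike_norm n) * Z)) = W * (c (n, k) * Z)" for W Z
        by (metis (no_types, lifting) mult.assoc mult.left_commute mult_1_left)
      then show "d j * Z_hat \<kappa> j z = complex_of_real (weight \<kappa> z) * (c j * (case j of (n, k) \<Rightarrow> zernike n k) (proj \<kappa> z))"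
        unfolding j(1) Z_hat_factor[OF j(2)] d_def case_prod_conv by blast
    qed
    then show ?thesis by (simp add: fH[OF z] right_diff_distrib)
  qed
  have gL2: "?g \<in> L2_space (weighted_vol \<kappa>)"
    by (intro L2_space_diff f L2_space_lincomb) (use F Z_hat_orthonormal in \<open>auto simp: L2_orthonormal_def\<close>)
  have "(\<integral>\<^sup>+z. ennreal ((cmod (?g z))\<^sup>2) \<partial>weighted_vol \<kappa>) =
      ennreal (1 / (1 - \<kappa>)\<^sup>2) * (\<integral>\<^sup>+z. ennreal ((cmod (H z - p z))\<^sup>2) * indicator (cball 0 1) z \<partial>lborel)"
    by (rule nn_integral_weighted_vol_norm[OF \<kappa> _ g]) measurable
  also have "\<dots> < ennreal (1 / (1 - \<kappa>)\<^sup>2) * ennreal ((1 - \<kappa>)\<^sup>2 * e\<^sup>2)"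
    using p(2) \<kappa> by (intro ennreal_mult_strict_left_mono) auto
  also have "\<dots> = ennreal (e\<^sup>2)"
    using \<kappa> by (subst ennreal_mult[symmetric]) auto
  finally have "ennreal ((L2_norm (weighted_vol \<kappa>) ?g)\<^sup>2) < ennreal (e\<^sup>2)"
    unfolding L2_norm_nn[OF gL2] .
  then have "(L2_norm (weighted_vol \<kappa>) ?g)\<^sup>2 < e\<^sup>2" by (subst (asm) ennreal_less_iff) auto
  then have "L2_norm (weighted_vol \<kappa>) ?g < e" by (rule power2_less_imp_less) (use e in simp)
  then show "\<exists>F c. finite F \<and> F \<subseteq> index_set \<and> L2_norm (weighted_vol \<kappa>) (\<lambda>z. f z - (\<Sum>j\<in>F. c j * Z_hat \<kappa> j z)) < e"
    using F by (intro exI[of _ F] exI[of _ d] conjI)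
qed

end

section \<open>Measurability, boundedness and linearity of the transform\<close>

lemma norm_set_integral_sq_le:
  fixes f :: "real \<Rightarrow> complex"
  assumes f [measurable]: "f \<in> borel_measurable borel" and L: "0 \<le> L"
  shows "ennreal ((cmod (LINT r:{0..L}|lborel. f r))\<^sup>2) \<le> ennreal L * (\<integral>\<^sup>+r. ennreal ((cmod (f r))\<^sup>2) * indicator {0..L} r \<partial>lborel)"
proof (cases "set_integrable lborel {0..L} f")
  case True
  have "ennreal (cmod (LINT r:{0..L}|lborel. f r)) \<le> (\<integral>\<^sup>+r. ennreal (norm (indicat_real {0..L} r *\<^sub>R f r)) \<partial>lborel)"
    using True unfolding set_integrable_def set_lebesgue_integral_def by (rule integral_norm_bound_ennreal)
  also have "\<dots> = (\<integral>\<^sup>+r. (ennreal (cmod (f r)) * indicator {0..L} r) * indicator {0..L} r \<partial>lborel)"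
    by (intro nn_integral_cong) (auto simp: indicator_def)
  finally have "(ennreal (cmod (LINT r:{0..L}|lborel. f r)))\<^sup>2 \<le> (\<integral>\<^sup>+r. (ennreal (cmod (f r)) * indicator {0..L} r) * indicator {0..L} r \<partial>lborel)\<^sup>2"
    by (rule power_mono) simp
  also have "\<dots> \<le> (\<integral>\<^sup>+r. (ennreal (cmod (f r)) * indicator {0..L} r)\<^sup>2 \<partial>lborel) * (\<integral>\<^sup>+r. (indicator {0..L} r)\<^sup>2 \<partial>(lborel :: real measure))"
    by (rule Cauchy_Schwarz_nn_integral) measurable
  also have "(\<integral>\<^sup>+r. (ennreal (cmod (f r)) * indicator {0..L} r)\<^sup>2 \<partial>lborel) = (\<integral>\<^sup>+r. ennreal ((cmod (f r))\<^sup>2) * indicator {0..L} r \<partial>lborel)"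
    by (intro nn_integral_cong) (auto simp: indicator_def ennreal_power)
  also have "(\<integral>\<^sup>+r. (indicator {0..L} r)\<^sup>2 \<partial>(lborel :: real measure)) = (\<integral>\<^sup>+r. indicator {0..L} r \<partial>(lborel :: real measure))"
    by (intro nn_integral_cong) (auto simp: indicator_def)
  also have "\<dots> = ennreal L" using L by simp
  finally show ?thesis by (simp add: ennreal_power mult.commute)
next
  case False
  \<comment> \<open>A non-integrable function has Bochner integral 0, so the estimate holds
    trivially; boundedness can therefore be proved pointwise before integrability is known.\<close>
  then have "(LINT r:{0..L}|lborel. f r) = 0"
    unfolding set_lebesgue_integral_def set_integrable_def by (rule not_integrable_integral_eq)
  then show ?thesis by simp
qed

lemma set_integrable_square:
  fixes f :: "real \<Rightarrow> complex"
  assumes f [measurable]: "f \<in> borel_measurable borel" and L: "0 \<le> L"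
    and fin: "(\<integral>\<^sup>+r. ennreal ((cmod (f r))\<^sup>2) * indicator {0..L} r \<partial>lborel) < \<infinity>"
  shows "set_integrable lborel {0..L} f"
  unfolding set_integrable_def
proof (rule integrableI_bounded)
  show "(\<lambda>r. indicat_real {0..L} r *\<^sub>R f r) \<in> borel_measurable lborel" by measurable
  have "(\<integral>\<^sup>+r. ennreal (norm (indicat_real {0..L} r *\<^sub>R f r)) \<partial>lborel)\<^sup>2 = (\<integral>\<^sup>+r. (ennreal (cmod (f r)) * indicator {0..L} r) * indicator {0..L} r \<partial>lborel)\<^sup>2"
    by (intro arg_cong[of _ _ "\<lambda>x. x\<^sup>2"] nn_integral_cong) (auto simp: indicator_def)
  also have "\<dots> \<le> (\<integral>\<^sup>+r. (ennreal (cmod (f r)) * indicator {0..L} r)\<^sup>2 \<partial>lborel) * (\<integral>\<^sup>+r. (indicator {0..L} r)\<^sup>2 \<partial>(lborel :: real measure))"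
    by (rule Cauchy_Schwarz_nn_integral) measurable
  also have "(\<integral>\<^sup>+r. (ennreal (cmod (f r)) * indicator {0..L} r)\<^sup>2 \<partial>lborel) = (\<integral>\<^sup>+r. ennreal ((cmod (f r))\<^sup>2) * indicator {0..L} r \<partial>lborel)"
    by (intro nn_integral_cong) (auto simp: indicator_def ennreal_power)
  also have "(\<integral>\<^sup>+r. (indicator {0..L} r)\<^sup>2 \<partial>(lborel :: real measure)) = (\<integral>\<^sup>+r. indicator {0..L} r \<partial>(lborel :: real measure))"
    by (intro nn_integral_cong) (auto simp: indicator_def)
  also have "(\<integral>\<^sup>+r. ennreal ((cmod (f r))\<^sup>2) * indicator {0..L} r \<partial>lborel) * \<dots> < \<infinity>"
    using fin L by (simp add: ennreal_mult_less_top)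
  finally show "(\<integral>\<^sup>+r. ennreal (norm (indicat_real {0..L} r *\<^sub>R f r)) \<partial>lborel) < \<infinity>"
    by (simp add: power_less_top_ennreal)
qed

lemma chord_measurable [measurable (raw)]:
  assumes [measurable]: "f \<in> borel_measurable M" "g \<in> borel_measurable M" "h \<in> borel_measurable M"
  shows "(\<lambda>x. chord (f x) (g x) (h x)) \<in> borel_measurable M"
  unfolding chord_def by measurable

lemma mem_fan_domain: "p \<in> fan_domain \<Longrightarrow> \<bar>snd p\<bar> \<le> pi / 2"
  by (cases p) (auto simp: abs_le_iff)

context
  fixes \<kappa> :: real
  assumes \<kappa>: "-1 < \<kappa>" "\<kappa> < 1"
begin

definition weighted_xray :: "(complex \<Rightarrow> complex) \<Rightarrow> real \<times> real \<Rightarrow> complex" where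
  "weighted_xray h = I0 \<kappa> (\<lambda>z. complex_of_real (weight \<kappa> z) * h z)"

text \<open>Written with \<open>scat_ext\<close> and not \<open>scat\<close>, so that it is defined
  and Borel measurable on the whole parameter plane.\<close>

definition flat_xray :: "(complex \<Rightarrow> complex) \<Rightarrow> real \<times> real \<Rightarrow> complex" where
  "flat_xray H p = complex_of_real ((1 + \<kappa>) / ((1 - \<kappa>) * chord_factor \<kappa> (snd p))) *
      (LINT r:{0..2 * cos (scat_ext \<kappa> (snd p))}|lborel. H (chord (fst p) (scat_ext \<kappa> (snd p)) r))"

lemma scat_ext_measurable [measurable]: "scat_ext \<kappa> \<in> borel_measurable borel"
  by (intro borel_measurable_continuous_onI scat_ext_continuous[OF \<kappa>])

lemma weighted_xray_eq_flat_xray: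
  assumes h: "h \<in> borel_measurable (weighted_vol \<kappa>)" and p: "p \<in> fan_domain"
  shows "weighted_xray h p = flat_xray (flatten \<kappa> h) p"
proof -
  note \<alpha> = mem_fan_domain[OF p]
  have "weighted_xray h (fst p, snd p) = flat_xray (flatten \<kappa> h) p"
    unfolding weighted_xray_def flat_xray_def
    by (subst I0_flatten[OF \<kappa> \<alpha>]) (use h in \<open>simp_all add: measurable_weighted_vol scat_eq_scat_ext[OF \<kappa> \<alpha>]\<close>)
  then show ?thesis by simp
qed

lemma flat_xray_measurable:
  assumes [measurable]: "H \<in> borel_measurable borel"
  shows "flat_xray H \<in> borel_measurable borel"
proof -
  have [measurable]: "chord_factor \<kappa> \<in> borel_measurable borel"
    unfolding chord_factor_def[abs_def] by measurable
  have "(\<lambda>p. LINT r:{0..2 * cos (scat_ext \<kappa> (snd p))}|lborel. H (chord (fst p) (scat_ext \<kappa> (snd p)) r)) =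
    (\<lambda>p::real\<times>real. \<integral>r. (if 0 \<le> r \<and> r \<le> 2 * cos (scat_ext \<kappa> (snd p)) then H (chord (fst p) (scat_ext \<kappa> (snd p)) r) else 0) \<partial>lborel)"
    unfolding set_lebesgue_integral_def
    by (intro ext Bochner_Integration.integral_cong refl) (auto simp: indicator_def)
  also have "\<dots> \<in> borel_measurable (borel \<Otimes>\<^sub>M borel)"
  proof (rule lborel.borel_measurable_lebesgue_integral)
    show "case_prod (\<lambda>(p::real\<times>real) r. if 0 \<le> r \<and> r \<le> 2 * cos (scat_ext \<kappa> (snd p)) then H (chord (fst p) (scat_ext \<kappa> (snd p)) r) else 0) \<in> borel_measurable ((borel \<Otimes>\<^sub>M borel) \<Otimes>\<^sub>M lborel)"
      unfolding case_prod_unfold by measurable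
  qed
  finally have [measurable]: "(\<lambda>p. LINT r:{0..2 * cos (scat_ext \<kappa> (snd p))}|lborel. H (chord (fst p) (scat_ext \<kappa> (snd p)) r)) \<in> borel_measurable (borel \<Otimes>\<^sub>M borel)" .
  have "flat_xray H \<in> borel_measurable (borel \<Otimes>\<^sub>M borel)" unfolding flat_xray_def[abs_def] by measurable
  then show ?thesis by (simp only: borel_prod)
qed

lemma weighted_xray_measurable:
  assumes h: "h \<in> borel_measurable (weighted_vol \<kappa>)"
  shows "weighted_xray h \<in> borel_measurable (boundary_measure \<kappa>)"
proof -
  have "flatten \<kappa> h \<in> borel_measurable borel"
    by (rule flatten_measurable) (use h in \<open>simp add: measurable_weighted_vol\<close>)
  then have "flat_xray (flatten \<kappa> h) \<in> borel_measurable (boundary_measure \<kappa>)"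
    unfolding measurable_boundary_measure by (intro borel_measurable_restrict flat_xray_measurable)
  then show ?thesis
    by (rule measurable_cong[THEN iffD1, rotated]) (simp only: space_boundary_measure weighted_xray_eq_flat_xray[OF h])
qed

text \<open>The squared modulus along one chord with exactly the densities of the fan-beam formula:
  cos s through \<open>chord_weight\<close>, and the derivative of the scattering angle.\<close>

definition energy :: "(complex \<Rightarrow> complex) \<Rightarrow> real \<times> real \<Rightarrow> ennreal" where
  "energy H p = (\<integral>\<^sup>+r. ennreal ((cmod (H (chord (fst p) (scat_ext \<kappa> (snd p)) r)))\<^sup>2) * ennreal (chord_weight (scat_ext \<kappa> (snd p)) r) \<partial>lborel)
     * ennreal ((1 - \<kappa>\<^sup>2) / (chord_factor \<kappa> (snd p))\<^sup>2)"

lemma energy_measurable: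
  assumes [measurable]: "H \<in> borel_measurable borel"
  shows "energy H \<in> borel_measurable borel"
proof -
  have [measurable]: "chord_factor \<kappa> \<in> borel_measurable borel"
    unfolding chord_factor_def[abs_def] by measurable
  have "energy H \<in> borel_measurable (borel \<Otimes>\<^sub>M borel)" unfolding energy_def[abs_def] by measurable
  then show ?thesis by (simp only: borel_prod)
qed

text \<open>The derivative factor is absorbed by the substitution from alpha to the scattering
  angle; the fan-beam formula contributes 2 pi and the boundary measure 1/(1+kappa).\<close>

lemma energy_integral:
  assumes [measurable]: "H \<in> borel_measurable borel"
  shows "(\<integral>\<^sup>+p. energy H p \<partial>boundary_measure \<kappa>) =
    ennreal (2 * pi / (1 + \<kappa>)) * (\<integral>\<^sup>+z. ennreal ((cmod (H z))\<^sup>2) * indicator (cball 0 1) z \<partial>lborel)"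
proof -
  let ?F = "\<lambda>z. ennreal ((cmod (H z))\<^sup>2)"
  define G where "G = (\<lambda>\<beta> s. \<integral>\<^sup>+r. ?F (chord \<beta> s r) * ennreal (chord_weight s r) \<partial>lborel)"
  have Gm [measurable]: "G \<beta> \<in> borel_measurable borel" for \<beta>
    unfolding G_def by measurable
  have inner: "(\<integral>\<^sup>+\<alpha>. energy H (\<beta>, \<alpha>) * indicator {- pi / 2..pi / 2} \<alpha> \<partial>lborel) = (\<integral>\<^sup>+s. G \<beta> s \<partial>lborel)" for \<beta>
  proof -
    have "(\<integral>\<^sup>+\<alpha>. energy H (\<beta>, \<alpha>) * indicator {- pi / 2..pi / 2} \<alpha> \<partial>lborel) =
      (\<integral>\<^sup>+\<alpha>. G \<beta> (scat \<kappa> \<alpha>) * ennreal (scat_deriv \<kappa> \<alpha>) * indicator {- pi / 2..pi / 2} \<alpha> \<partial>lborel)"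
    proof (intro nn_integral_cong)
      fix \<alpha> :: real
      show "energy H (\<beta>, \<alpha>) * indicator {- pi / 2..pi / 2} \<alpha> = G \<beta> (scat \<kappa> \<alpha>) * ennreal (scat_deriv \<kappa> \<alpha>) * indicator {- pi / 2..pi / 2} \<alpha>"
      proof (cases "\<bar>\<alpha>\<bar> \<le> pi / 2")
        case True
        then show ?thesis by (simp add: energy_def G_def scat_eq_scat_ext[OF \<kappa>] scat_deriv_eq[OF \<kappa>])
      next
        case False
        then show ?thesis by (auto simp: indicator_def abs_le_iff)
      qed
    qed
    also have "\<dots> = (\<integral>\<^sup>+s. G \<beta> s * indicator {- pi / 2..pi / 2} s \<partial>lborel)"
      by (rule nn_integral_scat[OF \<kappa> Gm])
    also have "\<dots> = (\<integral>\<^sup>+s. G \<beta> s \<partial>lborel)"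
    proof (intro nn_integral_cong)
      fix s :: real
      show "G \<beta> s * indicator {- pi / 2..pi / 2} s = G \<beta> s"
      proof (cases "s \<in> {- pi / 2..pi / 2}")
        case False
        then have "G \<beta> s = 0" by (simp add: G_def chord_weight_def)
        then show ?thesis by simp
      qed simp
    qed
    finally show ?thesis .
  qed
  have "(\<integral>\<^sup>+p. energy H p \<partial>boundary_measure \<kappa>) = ennreal (1 / (1 + \<kappa>)) *
    (\<integral>\<^sup>+\<beta>. (\<integral>\<^sup>+\<alpha>. energy H (\<beta>, \<alpha>) * indicator {- pi / 2..pi / 2} \<alpha> \<partial>lborel) * indicator {0..<2 * pi} \<beta> \<partial>lborel)"
    by (rule nn_integral_boundary) (rule energy_measurable, measurable)
  also have "\<dots> = ennreal (1 / (1 + \<kappa>)) * (\<integral>\<^sup>+\<beta>. (\<integral>\<^sup>+s. G \<beta> s \<partial>lborel) * indicator {0..<2 * pi} \<beta> \<partial>lborel)"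
    unfolding inner ..
  also have "(\<integral>\<^sup>+\<beta>. (\<integral>\<^sup>+s. G \<beta> s \<partial>lborel) * indicator {0..<2 * pi} \<beta> \<partial>lborel) = ennreal (2 * pi) * (\<integral>\<^sup>+z. ?F z * indicator (cball 0 1) z \<partial>lborel)"
    unfolding G_def by (rule nn_integral_fan_beam) measurable
  also have "ennreal (1 / (1 + \<kappa>)) * \<dots> = ennreal (2 * pi / (1 + \<kappa>)) * (\<integral>\<^sup>+z. ?F z * indicator (cball 0 1) z \<partial>lborel)"
    using \<kappa> by (simp add: mult.assoc[symmetric] ennreal_mult[symmetric])
  finally show ?thesis .
qed

lemma scat_ext_cos_nonneg:
  assumes p: "p \<in> fan_domain"
  shows "cos (scat_ext \<kappa> (snd p)) \<ge> 0" "scat_ext \<kappa> (snd p) \<in> {- pi / 2..pi / 2}"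
proof -
  note \<alpha> = mem_fan_domain[OF p]
  have "\<bar>scat_ext \<kappa> (snd p)\<bar> \<le> pi / 2"
    using scat_trig(3)[OF \<kappa> \<alpha>] by (simp only: scat_eq_scat_ext[OF \<kappa> \<alpha>])
  then show "cos (scat_ext \<kappa> (snd p)) \<ge> 0" "scat_ext \<kappa> (snd p) \<in> {- pi / 2..pi / 2}"
    by (rule cos_nonneg_pi_half) (use \<open>\<bar>scat_ext \<kappa> (snd p)\<bar> \<le> pi / 2\<close> in \<open>auto simp: abs_le_iff\<close>)
qed

lemma energy_eq:
  assumes [measurable]: "H \<in> borel_measurable borel" and p: "p \<in> fan_domain"
  shows "energy H p = ennreal ((1 - \<kappa>\<^sup>2) / (chord_factor \<kappa> (snd p))\<^sup>2 * cos (scat_ext \<kappa> (snd p))) *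
     (\<integral>\<^sup>+r. ennreal ((cmod (H (chord (fst p) (scat_ext \<kappa> (snd p)) r)))\<^sup>2) * indicator {0..2 * cos (scat_ext \<kappa> (snd p))} r \<partial>lborel)"
proof -
  let ?s = "scat_ext \<kappa> (snd p)"
  note c = scat_ext_cos_nonneg[OF p]
  have "(\<integral>\<^sup>+r. ennreal ((cmod (H (chord (fst p) ?s r)))\<^sup>2) * ennreal (chord_weight ?s r) \<partial>lborel) =
    (\<integral>\<^sup>+r. ennreal (cos ?s) * (ennreal ((cmod (H (chord (fst p) ?s r)))\<^sup>2) * indicator {0..2 * cos ?s} r) \<partial>lborel)"
    by (intro nn_integral_cong) (use c in \<open>auto simp: chord_weight_def indicator_def mult.commute\<close>)
  also have "\<dots> = ennreal (cos ?s) * (\<integral>\<^sup>+r. ennreal ((cmod (H (chord (fst p) ?s r)))\<^sup>2) * indicator {0..2 * cos ?s} r \<partial>lborel)"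
    by (rule nn_integral_cmult) measurable
  finally have e: "(\<integral>\<^sup>+r. ennreal ((cmod (H (chord (fst p) ?s r)))\<^sup>2) * ennreal (chord_weight ?s r) \<partial>lborel) =
    ennreal (cos ?s) * (\<integral>\<^sup>+r. ennreal ((cmod (H (chord (fst p) ?s r)))\<^sup>2) * indicator {0..2 * cos ?s} r \<partial>lborel)" .
  have m: "ennreal ((1 - \<kappa>\<^sup>2) / (chord_factor \<kappa> (snd p))\<^sup>2 * cos ?s) = ennreal ((1 - \<kappa>\<^sup>2) / (chord_factor \<kappa> (snd p))\<^sup>2) * ennreal (cos ?s)"
    using c(1) scat_deriv_pos[OF \<kappa>, of "snd p"] by (intro ennreal_mult) auto
  show ?thesis unfolding energy_def e m by (simp only: mult_ac)
qed

text \<open>The chord length 2 cos s lost in Cauchy-Schwarz and the squared prefactor, proportional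
  to D^-2, are both already contained in \<open>energy\<close>. The constant is therefore uniform up
  to tangential directions.\<close>

lemma flat_xray_sq_le:
  assumes H [measurable]: "H \<in> borel_measurable borel" and p: "p \<in> fan_domain"
  shows "ennreal ((cmod (flat_xray H p))\<^sup>2) \<le> ennreal (2 * (1 + \<kappa>)\<^sup>2 / ((1 - \<kappa>)\<^sup>2 * (1 - \<kappa>\<^sup>2))) * energy H p"
proof -
  let ?s = "scat_ext \<kappa> (snd p)" and ?D = "chord_factor \<kappa> (snd p)"
  let ?S = "\<integral>\<^sup>+r. ennreal ((cmod (H (chord (fst p) ?s r)))\<^sup>2) * indicator {0..2 * cos ?s} r \<partial>lborel"
  note c = scat_ext_cos_nonneg[OF p] and D = chord_factor_pos[OF \<kappa>, of "snd p"] and q = one_minus_sq_pos[OF \<kappa>]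
  define a where "a = (1 + \<kappa>) / ((1 - \<kappa>) * ?D)"
  have "ennreal ((cmod (flat_xray H p))\<^sup>2) = ennreal (a\<^sup>2) * ennreal ((cmod (LINT r:{0..2 * cos ?s}|lborel. H (chord (fst p) ?s r)))\<^sup>2)"
    unfolding flat_xray_def a_def[symmetric] by (simp add: norm_mult power_mult_distrib ennreal_mult)
  also have "\<dots> \<le> ennreal (a\<^sup>2) * (ennreal (2 * cos ?s) * ?S)"
    using c by (intro mult_left_mono norm_set_integral_sq_le) (auto, measurable)
  also have "\<dots> = ennreal (2 * (1 + \<kappa>)\<^sup>2 / ((1 - \<kappa>)\<^sup>2 * (1 - \<kappa>\<^sup>2))) * (ennreal ((1 - \<kappa>\<^sup>2) / ?D\<^sup>2 * cos ?s) * ?S)"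
  proof -
    have "(x / (y * D))\<^sup>2 * (2 * c) = 2 * x\<^sup>2 / (y\<^sup>2 * q) * (q / D\<^sup>2 * c)" if "q > 0" for x y D c q :: real
      using that by (simp add: power_divide power_mult_distrib)
    from this[OF q, of "1 + \<kappa>" "1 - \<kappa>" ?D "cos ?s"]
    have "ennreal (a\<^sup>2) * ennreal (2 * cos ?s) = ennreal (2 * (1 + \<kappa>)\<^sup>2 / ((1 - \<kappa>)\<^sup>2 * (1 - \<kappa>\<^sup>2))) * ennreal ((1 - \<kappa>\<^sup>2) / ?D\<^sup>2 * cos ?s)"
      using c q by (simp add: a_def ennreal_mult[symmetric])
    then show ?thesis by (simp only: mult.assoc[symmetric])
  qed
  also have "ennreal ((1 - \<kappa>\<^sup>2) / ?D\<^sup>2 * cos ?s) * ?S = energy H p"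
    by (rule energy_eq[OF H p, symmetric])
  finally show ?thesis .
qed

lemma flatten_norm:
  assumes h: "h \<in> L2_space (weighted_vol \<kappa>)"
  shows "flatten \<kappa> h \<in> borel_measurable borel"
    "(\<integral>\<^sup>+z. ennreal ((cmod (flatten \<kappa> h z))\<^sup>2) * indicator (cball 0 1) z \<partial>lborel) = ennreal ((1 - \<kappa>)\<^sup>2 * (L2_norm (weighted_vol \<kappa>) h)\<^sup>2)"
proof -
  show m: "flatten \<kappa> h \<in> borel_measurable borel"
    by (rule flatten_measurable) (use h in \<open>simp add: L2_space_def measurable_weighted_vol\<close>)
  let ?I = "\<integral>\<^sup>+z. ennreal ((cmod (flatten \<kappa> h z))\<^sup>2) * indicator (cball 0 1) z \<partial>lborel"
  have "(\<integral>\<^sup>+z. ennreal ((cmod (h z))\<^sup>2) \<partial>weighted_vol \<kappa>) = ennreal (1 / (1 - \<kappa>)\<^sup>2) * ?I"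
    by (rule nn_integral_weighted_vol_norm[OF \<kappa> m flatten_factor[OF \<kappa>]])
  then have "ennreal ((L2_norm (weighted_vol \<kappa>) h)\<^sup>2) = ennreal (1 / (1 - \<kappa>)\<^sup>2) * ?I"
    unfolding L2_norm_nn[OF h] .
  then have "ennreal ((1 - \<kappa>)\<^sup>2) * ennreal ((L2_norm (weighted_vol \<kappa>) h)\<^sup>2) = (ennreal ((1 - \<kappa>)\<^sup>2) * ennreal (1 / (1 - \<kappa>)\<^sup>2)) * ?I"
    by (simp only: mult.assoc)
  also have "ennreal ((1 - \<kappa>)\<^sup>2) * ennreal (1 / (1 - \<kappa>)\<^sup>2) = 1"
    using \<kappa> by (subst ennreal_mult[symmetric]) auto
  finally show "?I = ennreal ((1 - \<kappa>)\<^sup>2 * (L2_norm (weighted_vol \<kappa>) h)\<^sup>2)"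
    by (simp add: ennreal_mult)
qed

lemma weighted_xray_norm_sq_le:
  assumes h: "h \<in> L2_space (weighted_vol \<kappa>)"
  shows "(\<integral>\<^sup>+p. ennreal ((cmod (weighted_xray h p))\<^sup>2) \<partial>boundary_measure \<kappa>) \<le>
     ennreal (2 * (1 + \<kappa>)\<^sup>2 / ((1 - \<kappa>)\<^sup>2 * (1 - \<kappa>\<^sup>2)) * (2 * pi / (1 + \<kappa>)) * (1 - \<kappa>)\<^sup>2 * (L2_norm (weighted_vol \<kappa>) h)\<^sup>2)"
proof -
  have hm: "h \<in> borel_measurable (weighted_vol \<kappa>)" using h by (simp add: L2_space_def)
  note H = flatten_norm[OF h] and q = one_minus_sq_pos[OF \<kappa>]
  let ?C = "2 * (1 + \<kappa>)\<^sup>2 / ((1 - \<kappa>)\<^sup>2 * (1 - \<kappa>\<^sup>2))"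
  have "(\<integral>\<^sup>+p. ennreal ((cmod (weighted_xray h p))\<^sup>2) \<partial>boundary_measure \<kappa>) \<le> (\<integral>\<^sup>+p. ennreal ?C * energy (flatten \<kappa> h) p \<partial>boundary_measure \<kappa>)"
  proof (intro nn_integral_mono)
    fix p assume "p \<in> space (boundary_measure \<kappa>)"
    then have p: "p \<in> fan_domain" by simp
    show "ennreal ((cmod (weighted_xray h p))\<^sup>2) \<le> ennreal ?C * energy (flatten \<kappa> h) p"
      unfolding weighted_xray_eq_flat_xray[OF hm p] by (rule flat_xray_sq_le[OF H(1) p])
  qed
  also have "\<dots> = ennreal ?C * (\<integral>\<^sup>+p. energy (flatten \<kappa> h) p \<partial>boundary_measure \<kappa>)"
  proof (rule nn_integral_cmult)
    show "energy (flatten \<kappa> h) \<in> borel_measurable (boundary_measure \<kappa>)"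
      unfolding measurable_boundary_measure by (rule borel_measurable_restrict[OF energy_measurable[OF H(1)]])
  qed
  also have "\<dots> = ennreal (?C * (2 * pi / (1 + \<kappa>)) * (1 - \<kappa>)\<^sup>2 * (L2_norm (weighted_vol \<kappa>) h)\<^sup>2)"
    unfolding energy_integral[OF H(1)] H(2) using \<kappa> q
    by (simp add: ennreal_mult[symmetric] mult_ac)
  finally show ?thesis .
qed

lemma weighted_xray_L2:
  assumes h: "h \<in> L2_space (weighted_vol \<kappa>)"
  shows "weighted_xray h \<in> L2_space (boundary_measure \<kappa>)"
proof -
  have m: "weighted_xray h \<in> borel_measurable (boundary_measure \<kappa>)"
    by (rule weighted_xray_measurable) (use h in \<open>simp add: L2_space_def\<close>)
  show ?thesis unfolding L2_space_iff[OF m] using weighted_xray_norm_sq_le[OF h] by (rule le_less_trans) simp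
qed

lemma weighted_xray_bounded:
  "\<exists>C. \<forall>h\<in>L2_space (weighted_vol \<kappa>). L2_norm (boundary_measure \<kappa>) (weighted_xray h) \<le> C * L2_norm (weighted_vol \<kappa>) h"
proof (intro exI ballI)
  fix h assume h: "h \<in> L2_space (weighted_vol \<kappa>)"
  let ?C = "2 * (1 + \<kappa>)\<^sup>2 / ((1 - \<kappa>)\<^sup>2 * (1 - \<kappa>\<^sup>2)) * (2 * pi / (1 + \<kappa>)) * (1 - \<kappa>)\<^sup>2"
  have C: "?C \<ge> 0" using \<kappa> one_minus_sq_pos[OF \<kappa>] by simp
  have "ennreal ((L2_norm (boundary_measure \<kappa>) (weighted_xray h))\<^sup>2) \<le> ennreal (?C * (L2_norm (weighted_vol \<kappa>) h)\<^sup>2)"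
    using weighted_xray_norm_sq_le[OF h] unfolding L2_norm_nn[OF weighted_xray_L2[OF h]] .
  then have "(L2_norm (boundary_measure \<kappa>) (weighted_xray h))\<^sup>2 \<le> ?C * (L2_norm (weighted_vol \<kappa>) h)\<^sup>2"
    using C by (subst (asm) ennreal_le_iff) auto
  also have "\<dots> = (sqrt ?C * L2_norm (weighted_vol \<kappa>) h)\<^sup>2"
    using C by (simp only: power_mult_distrib real_sqrt_pow2)
  finally show "L2_norm (boundary_measure \<kappa>) (weighted_xray h) \<le> sqrt ?C * L2_norm (weighted_vol \<kappa>) h"
    by (rule power2_le_imp_le) (use C in simp)
qed

text \<open>Total energy is finite, so almost every chord has finite energy, and a square-integrable
  function on a bounded interval is integrable. This is what additivity of the Bochner integral
  along chords requires.\<close>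

lemma chord_integrable_AE:
  assumes h: "h \<in> L2_space (weighted_vol \<kappa>)"
  shows "AE p in boundary_measure \<kappa>. set_integrable lborel {0..2 * cos (scat_ext \<kappa> (snd p))} (\<lambda>r. flatten \<kappa> h (chord (fst p) (scat_ext \<kappa> (snd p)) r))"
proof -
  note H = flatten_norm[OF h]
  note Hm [measurable] = H(1)
  have "(\<integral>\<^sup>+p. energy (flatten \<kappa> h) p \<partial>boundary_measure \<kappa>) \<noteq> \<infinity>"
    unfolding energy_integral[OF H(1)] H(2) by (simp add: ennreal_mult_eq_top_iff)
  moreover have "energy (flatten \<kappa> h) \<in> borel_measurable (boundary_measure \<kappa>)"
    unfolding measurable_boundary_measure by (rule borel_measurable_restrict[OF energy_measurable[OF H(1)]])
  ultimately have "AE p in boundary_measure \<kappa>. energy (flatten \<kappa> h) p \<noteq> \<infinity>"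
    by (intro nn_integral_PInf_AE)
  moreover have "AE p in boundary_measure \<kappa>. p \<in> fan_domain" by (rule AE_I2) simp
  ultimately show ?thesis
  proof eventually_elim
    case (elim p)
    let ?s = "scat_ext \<kappa> (snd p)"
    let ?f = "\<lambda>r. flatten \<kappa> h (chord (fst p) ?s r)"
    note c = scat_ext_cos_nonneg[OF elim(2)]
    have fm: "?f \<in> borel_measurable borel" by measurable
    have "(\<integral>\<^sup>+r. ennreal ((cmod (?f r))\<^sup>2) * indicator {0..2 * cos ?s} r \<partial>lborel) < \<infinity>"
    \<comment> \<open>For tangential directions the energy says nothing, but the chord is then a
      single point.\<close>
    proof (cases "cos ?s = 0")
      case True
      have "(\<integral>\<^sup>+r. ennreal ((cmod (?f r))\<^sup>2) * indicator {0..2 * cos ?s} r \<partial>lborel) = (\<integral>\<^sup>+r. 0 \<partial>(lborel :: real measure))"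
        by (intro nn_integral_cong_AE, use AE_lborel_singleton[of 0] in eventually_elim) (auto simp: True indicator_def)
      then show ?thesis by simp
    next
      case False
      then have "(1 - \<kappa>\<^sup>2) / (chord_factor \<kappa> (snd p))\<^sup>2 * cos ?s > 0"
        using c(1) by (intro mult_pos_pos scat_deriv_pos[OF \<kappa>]) auto
      then show ?thesis
        using elim(1) unfolding energy_eq[OF H(1) elim(2)] by (auto simp: ennreal_mult_eq_top_iff less_top)
    qed
    then show ?case
      by (intro set_integrable_square fm) (use c in auto)
  qed
qed

text \<open>\<open>flatten\<close> is linear pointwise; only splitting the chord integral needs the
  exceptional null sets of the two functions.\<close>

lemma weighted_xray_linear_AE:
  assumes f: "f \<in> L2_space (weighted_vol \<kappa>)" and g: "g \<in> L2_space (weighted_vol \<kappa>)"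
  shows "AE p in boundary_measure \<kappa>. weighted_xray (\<lambda>x. a * f x + b * g x) p = a * weighted_xray f p + b * weighted_xray g p"
proof -
  have fm: "f \<in> borel_measurable (weighted_vol \<kappa>)" and gm: "g \<in> borel_measurable (weighted_vol \<kappa>)"
    using f g by (simp_all add: L2_space_def)
  have hm: "(\<lambda>x. a * f x + b * g x) \<in> borel_measurable (weighted_vol \<kappa>)"
    using fm gm by measurable
  have fl: "flatten \<kappa> (\<lambda>x. a * f x + b * g x) z = a * flatten \<kappa> f z + b * flatten \<kappa> g z" for z
    by (simp add: flatten_def add_divide_distrib)
  have "AE p in boundary_measure \<kappa>. p \<in> fan_domain" by (rule AE_I2) simp
  with chord_integrable_AE[OF f] chord_integrable_AE[OF g] show ?thesis
  proof eventually_elim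
    case (elim p)
    show ?case
      unfolding weighted_xray_eq_flat_xray[OF hm elim(3)] weighted_xray_eq_flat_xray[OF fm elim(3)] weighted_xray_eq_flat_xray[OF gm elim(3)] flat_xray_def fl
      using elim(1,2) by (subst set_integral_add(2)) (auto simp: algebra_simps)
  qed
qed

lemma weighted_xray_bounded_operator: "L2_bounded_operator (weighted_vol \<kappa>) (boundary_measure \<kappa>) weighted_xray"
  unfolding L2_bounded_operator_def
  by (intro conjI ballI allI weighted_xray_L2 weighted_xray_linear_AE weighted_xray_bounded)

end

section \<open>The boundary functions and the singular relation\<close>

lemma emeasure_fan_domain_finite: "emeasure lborel fan_domain < \<infinity>"
proof -
  have "bounded fan_domain" by (intro bounded_Times) auto
  then show ?thesis by (rule emeasure_bounded_finite)
qed

lemma continuous_bounded_fan: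
  fixes f :: "real \<times> real \<Rightarrow> complex"
  assumes "continuous_on UNIV f"
  obtains B where "\<And>p. p \<in> fan_domain \<Longrightarrow> cmod (f p) \<le> B"
proof -
  have "compact (f ` ({0..2 * pi} \<times> {- pi / 2..pi / 2}))"
    by (intro compact_continuous_image continuous_on_subset[OF assms] compact_Times) auto
  then have "bounded (f ` ({0..2 * pi} \<times> {- pi / 2..pi / 2}))" by (rule compact_imp_bounded)
  then obtain B where B: "\<forall>y\<in>f ` ({0..2 * pi} \<times> {- pi / 2..pi / 2}). cmod y \<le> B" by (auto simp: bounded_iff)
  show thesis
  proof (rule that)
    fix p assume "p \<in> fan_domain"
    then have "p \<in> {0..2 * pi} \<times> {- pi / 2..pi / 2}" by auto
    then show "cmod (f p) \<le> B" using B by blast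
  qed
qed

lemma integral_boundary:
  fixes f :: "real \<times> real \<Rightarrow> complex"
  assumes \<kappa>: "-1 < \<kappa>" and f: "continuous_on UNIV f"
  shows "(\<integral>p. f p \<partial>boundary_measure \<kappa>) = complex_of_real (1 / (1 + \<kappa>)) *
     (LINT \<beta>:{0..<2 * pi}|lborel. LINT \<alpha>:{- pi / 2..pi / 2}|lborel. f (\<beta>, \<alpha>))"
proof -
  have fm: "f \<in> borel_measurable borel" by (rule borel_measurable_continuous_onI[OF f])
  obtain B where B: "\<And>p. p \<in> fan_domain \<Longrightarrow> cmod (f p) \<le> B" by (rule continuous_bounded_fan[OF f]) blast
  have fr: "f \<in> borel_measurable (restrict_space lborel fan_domain)"
    unfolding measurable_restrict_lborel by (rule borel_measurable_restrict[OF fm])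
  have dom: "fan_domain \<inter> space lborel \<in> sets lborel" using fan_domain_borel by simp
  have int: "integrable lborel (\<lambda>p. indicat_real fan_domain p *\<^sub>R f p)"
  proof (rule integrableI_bounded_set[where A = fan_domain and B = B])
    show "fan_domain \<in> sets lborel" using fan_domain_borel by simp
    show "(\<lambda>p. indicat_real fan_domain p *\<^sub>R f p) \<in> borel_measurable lborel"
      using fm fan_domain_borel by (intro borel_measurable_scaleR borel_measurable_indicator) auto
    show "emeasure lborel fan_domain < \<infinity>" by (rule emeasure_fan_domain_finite)
    show "AE p in lborel. p \<in> fan_domain \<longrightarrow> norm (indicat_real fan_domain p *\<^sub>R f p) \<le> B"
      using B by (intro AE_I2) (simp add: indicator_def)
    show "AE p in lborel. p \<notin> fan_domain \<longrightarrow> indicat_real fan_domain p *\<^sub>R f p = 0"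
      by (intro AE_I2) (simp add: indicator_def)
  qed
  then have int': "integrable (lborel \<Otimes>\<^sub>M lborel) (\<lambda>p. indicat_real fan_domain p *\<^sub>R f p)" by (simp add: lborel_prod)
  have "(\<integral>p. f p \<partial>boundary_measure \<kappa>) = (\<integral>p. (1 / (1 + \<kappa>)) *\<^sub>R f p \<partial>restrict_space lborel fan_domain)"
    unfolding boundary_measure_def using \<kappa> by (intro integral_density[OF fr]) auto
  also have "\<dots> = (\<integral>p. indicat_real fan_domain p *\<^sub>R ((1 / (1 + \<kappa>)) *\<^sub>R f p) \<partial>lborel)"
    by (rule integral_restrict_space[OF dom])
  also have "\<dots> = (\<integral>p. complex_of_real (1 / (1 + \<kappa>)) * (indicat_real fan_domain p *\<^sub>R f p) \<partial>lborel)"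
    by (intro Bochner_Integration.integral_cong refl) (simp add: scaleR_conv_of_real mult.left_commute)
  also have "\<dots> = complex_of_real (1 / (1 + \<kappa>)) * (\<integral>p. indicat_real fan_domain p *\<^sub>R f p \<partial>lborel)"
    by (rule integral_mult_right_zero)
  also have "(\<integral>p. indicat_real fan_domain p *\<^sub>R f p \<partial>lborel) = (\<integral>\<beta>. \<integral>\<alpha>. indicat_real fan_domain (\<beta>, \<alpha>) *\<^sub>R f (\<beta>, \<alpha>) \<partial>lborel \<partial>lborel)"
    using lborel_pair.integral_fst'[OF int'] by (simp add: lborel_prod)
  also have "\<dots> = (LINT \<beta>:{0..<2 * pi}|lborel. LINT \<alpha>:{- pi / 2..pi / 2}|lborel. f (\<beta>, \<alpha>))"
    unfolding set_lebesgue_integral_def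
  proof (intro Bochner_Integration.integral_cong refl)
    fix \<beta> :: real
    have "(\<integral>\<alpha>. indicat_real fan_domain (\<beta>, \<alpha>) *\<^sub>R f (\<beta>, \<alpha>) \<partial>lborel) =
      (\<integral>\<alpha>. complex_of_real (indicat_real {0..<2 * pi} \<beta>) * (indicat_real {- pi / 2..pi / 2} \<alpha> *\<^sub>R f (\<beta>, \<alpha>)) \<partial>lborel)"
      by (intro Bochner_Integration.integral_cong refl) (auto simp: indicator_def)
    also have "\<dots> = complex_of_real (indicat_real {0..<2 * pi} \<beta>) * (\<integral>\<alpha>. indicat_real {- pi / 2..pi / 2} \<alpha> *\<^sub>R f (\<beta>, \<alpha>) \<partial>lborel)"
      by (rule integral_mult_right_zero)
    finally show "(\<integral>\<alpha>. indicat_real fan_domain (\<beta>, \<alpha>) *\<^sub>R f (\<beta>, \<alpha>) \<partial>lborel) =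
      indicat_real {0..<2 * pi} \<beta> *\<^sub>R (\<integral>\<alpha>. indicat_real {- pi / 2..pi / 2} \<alpha> *\<^sub>R f (\<beta>, \<alpha>) \<partial>lborel)"
      by (simp add: scaleR_conv_of_real)
  qed
  finally show ?thesis .
qed

lemma integral_cis_halfopen:
  "(LINT \<beta>:{0..<2 * pi}|lborel. cis (real_of_int m * \<beta>)) = (if m = 0 then 2 * complex_of_real pi else 0)"
proof -
  have "(LINT \<beta>:{0..<2 * pi}|lborel. cis (real_of_int m * \<beta>)) = (LINT \<beta>:{0..2 * pi}|lborel. cis (real_of_int m * \<beta>))"
    unfolding set_lebesgue_integral_def
  proof (rule integral_cong_AE)
    have [measurable]: "(\<lambda>\<beta>. cis (real_of_int m * \<beta>)) \<in> borel_measurable borel" by measurable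
    show "(\<lambda>\<beta>. indicat_real {0..<2 * pi} \<beta> *\<^sub>R cis (real_of_int m * \<beta>)) \<in> borel_measurable lborel"
      "(\<lambda>\<beta>. indicat_real {0..2 * pi} \<beta> *\<^sub>R cis (real_of_int m * \<beta>)) \<in> borel_measurable lborel" by measurable
    show "AE \<beta> in lborel. indicat_real {0..<2 * pi} \<beta> *\<^sub>R cis (real_of_int m * \<beta>) = indicat_real {0..2 * pi} \<beta> *\<^sub>R cis (real_of_int m * \<beta>)"
      using AE_lborel_singleton[of "2 * pi"] by eventually_elim (auto simp: indicator_def)
  qed
  then show ?thesis by (simp only: integral_cis)
qed

context
  fixes \<kappa> :: real
  assumes \<kappa>: "-1 < \<kappa>" "\<kappa> < 1"
begin

text \<open>A globally continuous extension of \<open>psi\<close>, indexed by the frequency m = n -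
  2k.\<close>

definition psi_ext :: "nat \<Rightarrow> int \<Rightarrow> real \<times> real \<Rightarrow> complex" where
  "psi_ext n m p = (-1) ^ n / complex_of_real (4 * pi) * complex_of_real (sqrt ((1 - \<kappa>\<^sup>2) / (chord_factor \<kappa> (snd p))\<^sup>2))
     * cis (real_of_int m * (fst p + scat_ext \<kappa> (snd p))) * chord_fun n (scat_ext \<kappa> (snd p))"

lemma psi_eq_psi_ext:
  assumes p: "p \<in> fan_domain"
  shows "psi \<kappa> n k p = psi_ext n (int n - 2 * k) p"
  using mem_fan_domain[OF p]
  by (cases p) (simp add: psi_def psi_ext_def chord_fun_def scat_deriv_eq[OF \<kappa>] scat_eq_scat_ext[OF \<kappa>])

lemma psi_ext_continuous: "continuous_on UNIV (psi_ext n m)"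
proof -
  have 1: "continuous_on UNIV (\<lambda>p::real\<times>real. (1 - \<kappa>\<^sup>2) / (chord_factor \<kappa> (snd p))\<^sup>2)"
    by (rule continuous_on_compose2[OF scat_deriv_continuous[OF \<kappa>, of UNIV]]) (auto intro: continuous_intros)
  have 2: "continuous_on UNIV (\<lambda>p::real\<times>real. scat_ext \<kappa> (snd p))"
    by (rule continuous_on_compose2[OF scat_ext_continuous[OF \<kappa>, of UNIV]]) (auto intro: continuous_intros)
  show ?thesis unfolding psi_ext_def[abs_def]
    by (intro continuous_intros continuous_on_real_sqrt 1 2)
qed

lemma psi_L2: "psi \<kappa> n k \<in> L2_space (boundary_measure \<kappa>)"
proof -
  let ?P = "psi_ext n (int n - 2 * k)"
  have Pm: "?P \<in> borel_measurable borel" by (rule borel_measurable_continuous_onI[OF psi_ext_continuous])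
  then have "?P \<in> borel_measurable (boundary_measure \<kappa>)"
    unfolding measurable_boundary_measure by (rule borel_measurable_restrict)
  then have m: "psi \<kappa> n k \<in> borel_measurable (boundary_measure \<kappa>)"
    by (rule measurable_cong[THEN iffD1, rotated]) (simp only: space_boundary_measure psi_eq_psi_ext)
  obtain B where B: "\<And>p. p \<in> fan_domain \<Longrightarrow> cmod (?P p) \<le> B" by (rule continuous_bounded_fan[OF psi_ext_continuous]) blast
  have "(\<integral>\<^sup>+p. ennreal ((cmod (psi \<kappa> n k p))\<^sup>2) \<partial>boundary_measure \<kappa>) \<le> (\<integral>\<^sup>+p. ennreal (B\<^sup>2) \<partial>boundary_measure \<kappa>)"
    using B by (intro nn_integral_mono ennreal_leI power_mono) (simp_all only: space_boundary_measure psi_eq_psi_ext norm_ge_zero)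
  also have "\<dots> = ennreal (B\<^sup>2) * emeasure (boundary_measure \<kappa>) fan_domain" by simp
  also have "emeasure (boundary_measure \<kappa>) fan_domain = (\<integral>\<^sup>+p. 1 \<partial>boundary_measure \<kappa>)" by simp
  also have "\<dots> = ennreal (1 / (1 + \<kappa>)) *
    (\<integral>\<^sup>+\<beta>. (\<integral>\<^sup>+\<alpha>. 1 * indicator {- pi / 2..pi / 2} \<alpha> \<partial>(lborel :: real measure)) * indicator {0..<2 * pi} \<beta> \<partial>lborel)"
    by (rule nn_integral_boundary) simp
  also have "\<dots> = ennreal (1 / (1 + \<kappa>)) * (ennreal pi * ennreal (2 * pi))"
    by (simp add: nn_integral_cmult)
  also have "ennreal (B\<^sup>2) * \<dots> < \<infinity>" by (simp add: ennreal_mult_less_top)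
  finally show ?thesis unfolding L2_space_iff[OF m] .
qed

text \<open>The product splits: integration in beta forces equal frequencies, and the factor
  sqrt(scat') of each function combines into the Jacobian of the substitution s = scat, leaving the
  orthogonality of \<open>chord_fun\<close>. The constant is (2 pi)^2 / (16 pi^2 (1+kappa)).\<close>

lemma psi_inner:
  "L2_inner (boundary_measure \<kappa>) (psi \<kappa> n (int k)) (psi \<kappa> m (int j)) =
     (if (n, k) = (m, j) then complex_of_real (1 / (4 * (1 + \<kappa>))) else 0)"
proof -
  let ?p = "int n - 2 * int k" and ?q = "int m - 2 * int j"
  let ?s = "scat_ext \<kappa>" and ?d = "\<lambda>\<alpha>. (1 - \<kappa>\<^sup>2) / (chord_factor \<kappa> \<alpha>)\<^sup>2"
  define C :: complex where "C = (-1) ^ (n + m) / complex_of_real (16 * pi\<^sup>2)"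
  define b where "b = (\<lambda>s. cis (real_of_int (?p - ?q) * s) * (chord_fun n s * cnj (chord_fun m s)))"
  have bc: "continuous_on A b" for A unfolding b_def by (intro continuous_intros)
  have prod: "psi_ext n ?p (\<beta>, \<alpha>) * cnj (psi_ext m ?q (\<beta>, \<alpha>)) = (C * cis (real_of_int (?p - ?q) * \<beta>)) * (complex_of_real (?d \<alpha>) * b (?s \<alpha>))" for \<beta> \<alpha>
  proof -
    have sq: "complex_of_real (sqrt (?d \<alpha>)) * complex_of_real (sqrt (?d \<alpha>)) = complex_of_real (?d \<alpha>)"
      using scat_deriv_pos[OF \<kappa>, of \<alpha>] by (simp only: of_real_mult[symmetric] real_sqrt_mult_self abs_of_pos)
    have cc: "cis (real_of_int ?p * (\<beta> + ?s \<alpha>)) * cis (- (real_of_int ?q * (\<beta> + ?s \<alpha>))) = cis (real_of_int (?p - ?q) * \<beta>) * cis (real_of_int (?p - ?q) * ?s \<alpha>)"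
      unfolding cis_mult by (rule arg_cong[of _ _ cis]) (simp add: algebra_simps)
    have C: "(-1) ^ n / complex_of_real (4 * pi) * ((-1) ^ m / complex_of_real (4 * pi)) = C"
      by (simp add: C_def power_add power2_eq_square)
    have "psi_ext n ?p (\<beta>, \<alpha>) * cnj (psi_ext m ?q (\<beta>, \<alpha>)) =
       ((-1) ^ n / complex_of_real (4 * pi) * ((-1) ^ m / complex_of_real (4 * pi))) *
       (complex_of_real (sqrt (?d \<alpha>)) * complex_of_real (sqrt (?d \<alpha>))) *
       (cis (real_of_int ?p * (\<beta> + ?s \<alpha>)) * cis (- (real_of_int ?q * (\<beta> + ?s \<alpha>)))) * (chord_fun n (?s \<alpha>) * cnj (chord_fun m (?s \<alpha>)))"
      unfolding psi_ext_def fst_conv snd_conv complex_cnj_mult complex_cnj_divide complex_cnj_power complex_cnj_complex_of_real cis_cnj complex_cnj_minus complex_cnj_one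
      by (simp only: mult_ac)
    then show ?thesis unfolding sq cc C b_def by (simp only: mult_ac)
  qed
  have cont: "continuous_on UNIV (\<lambda>p. psi_ext n ?p p * cnj (psi_ext m ?q p))"
    by (intro continuous_intros psi_ext_continuous)
  have "L2_inner (boundary_measure \<kappa>) (psi \<kappa> n (int k)) (psi \<kappa> m (int j)) =
     (\<integral>p. psi_ext n ?p p * cnj (psi_ext m ?q p) \<partial>boundary_measure \<kappa>)"
    unfolding L2_inner_def
    by (intro Bochner_Integration.integral_cong refl) (simp only: space_boundary_measure psi_eq_psi_ext)
  also have "\<dots> = complex_of_real (1 / (1 + \<kappa>)) *
     (LINT \<beta>:{0..<2 * pi}|lborel. LINT \<alpha>:{- pi / 2..pi / 2}|lborel. (C * cis (real_of_int (?p - ?q) * \<beta>)) * (complex_of_real (?d \<alpha>) * b (?s \<alpha>)))"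
    unfolding integral_boundary[OF \<kappa>(1) cont] prod ..
  also have "(LINT \<beta>:{0..<2 * pi}|lborel. LINT \<alpha>:{- pi / 2..pi / 2}|lborel. (C * cis (real_of_int (?p - ?q) * \<beta>)) * (complex_of_real (?d \<alpha>) * b (?s \<alpha>)))
     = (LINT \<beta>:{0..<2 * pi}|lborel. (C * (LINT \<alpha>:{- pi / 2..pi / 2}|lborel. complex_of_real (?d \<alpha>) * b (?s \<alpha>))) * cis (real_of_int (?p - ?q) * \<beta>))"
  proof (rule set_lebesgue_integral_cong)
    show "\<forall>\<beta>. \<beta> \<in> {0..<2 * pi} \<longrightarrow> (LINT \<alpha>:{- pi / 2..pi / 2}|lborel. (C * cis (real_of_int (?p - ?q) * \<beta>)) * (complex_of_real (?d \<alpha>) * b (?s \<alpha>)))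
      = (C * (LINT \<alpha>:{- pi / 2..pi / 2}|lborel. complex_of_real (?d \<alpha>) * b (?s \<alpha>))) * cis (real_of_int (?p - ?q) * \<beta>)"
      unfolding set_integral_mult_right by (intro allI impI) (simp only: mult_ac)
  qed simp
  also have "\<dots> = (C * (LINT \<alpha>:{- pi / 2..pi / 2}|lborel. complex_of_real (?d \<alpha>) * b (?s \<alpha>))) * (if ?p - ?q = 0 then 2 * complex_of_real pi else 0)"
    unfolding set_integral_mult_right integral_cis_halfopen ..
  also have "(LINT \<alpha>:{- pi / 2..pi / 2}|lborel. complex_of_real (?d \<alpha>) * b (?s \<alpha>)) = (LINT s:{?s (- pi / 2)..?s (pi / 2)}|lborel. b s)"
    using scat_deriv_pos[OF \<kappa>]
    by (intro set_integral_substitution[symmetric] borel_measurable_continuous_onI bc DERIV_scat_ext[OF \<kappa>] scat_deriv_continuous[OF \<kappa>])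
       (auto simp: less_imp_le)
  also have "\<dots> = (LINT s:{- pi / 2..pi / 2}|lborel. b s)" by simp
  finally have inner: "L2_inner (boundary_measure \<kappa>) (psi \<kappa> n (int k)) (psi \<kappa> m (int j)) =
     complex_of_real (1 / (1 + \<kappa>)) * ((C * (LINT s:{- pi / 2..pi / 2}|lborel. b s)) * (if ?p - ?q = 0 then 2 * complex_of_real pi else 0))" .
  show ?thesis
  proof (cases "?p - ?q = 0")
    case True
    then have "b = (\<lambda>s. chord_fun n s * cnj (chord_fun m s))" unfolding b_def True by simp
    then have bi: "(LINT s:{- pi / 2..pi / 2}|lborel. b s) = (if n = m then 2 * complex_of_real pi else 0)"
      by (simp only: chord_fun_orthogonal)
    show ?thesis
    proof (cases "n = m")
      case nm: True
      then have "(n, k) = (m, j)" using True by auto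
      moreover have "C = complex_of_real (1 / (16 * pi\<^sup>2))" unfolding C_def nm by simp
      moreover have "(1 / (1 + \<kappa>)) * ((1 / (16 * pi\<^sup>2) * (2 * pi)) * (2 * pi)) = 1 / (4 * (1 + \<kappa>))"
        using \<kappa> by (simp add: power2_eq_square)
      then have "complex_of_real (1 / (1 + \<kappa>)) * ((complex_of_real (1 / (16 * pi\<^sup>2)) * (2 * complex_of_real pi)) * (2 * complex_of_real pi)) = complex_of_real (1 / (4 * (1 + \<kappa>)))"
        by (metis of_real_mult of_real_numeral)
      ultimately show ?thesis unfolding inner bi using True nm by (simp only: if_True simp_thms)
    next
      case False
      then show ?thesis unfolding inner bi by simp
    qed
  next
    case False
    then have "(n, k) \<noteq> (m, j)" by auto
    then show ?thesis unfolding inner if_not_P[OF False] by (simp only: if_False mult_zero_right)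
  qed
qed

lemma psi_norm: "L2_norm (boundary_measure \<kappa>) (psi \<kappa> n (int k)) = 1 / (2 * sqrt (1 + \<kappa>))"
proof -
  have "complex_of_real ((L2_norm (boundary_measure \<kappa>) (psi \<kappa> n (int k)))\<^sup>2) = complex_of_real (1 / (4 * (1 + \<kappa>)))"
    unfolding L2_inner_self[symmetric] psi_inner by simp
  then have "(L2_norm (boundary_measure \<kappa>) (psi \<kappa> n (int k)))\<^sup>2 = (1 / (2 * sqrt (1 + \<kappa>)))\<^sup>2"
    using \<kappa> by (simp only: of_real_eq_iff) (simp add: power_divide power_mult_distrib)
  then show ?thesis
    by (rule power2_eq_imp_eq) (use \<kappa> in auto)
qed

lemma psi_hat_orthonormal: "L2_orthonormal (boundary_measure \<kappa>) index_set (psi_hat \<kappa>)"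
  unfolding L2_orthonormal_def
proof (intro conjI ballI)
  fix i assume "i \<in> index_set"
  show "psi_hat \<kappa> i \<in> L2_space (boundary_measure \<kappa>)"
    by (cases i) (auto simp: psi_hat_def intro!: normalize_L2 psi_L2)
next
  fix i i' assume "i \<in> index_set" "i' \<in> index_set"
  obtain n k m j where ij: "i = (n, k)" "i' = (m, j)" by (cases i, cases i')
  have sq: "1 / (2 * sqrt (1 + \<kappa>)) * (1 / (2 * sqrt (1 + \<kappa>))) = 1 / (4 * (1 + \<kappa>))"
    using \<kappa> by simp
  have val: "L2_inner (boundary_measure \<kappa>) (psi_hat \<kappa> i) (psi_hat \<kappa> i') =
     (if (n, k) = (m, j) then complex_of_real (1 / (4 * (1 + \<kappa>))) else 0) / complex_of_real (1 / (4 * (1 + \<kappa>)))"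
    unfolding ij psi_hat_def case_prod_conv normalize_inner psi_inner psi_norm sq ..
  have nz: "complex_of_real (1 / (4 * (1 + \<kappa>))) \<noteq> 0"
    using \<kappa> by (simp only: of_real_eq_0_iff) simp
  show "L2_inner (boundary_measure \<kappa>) (psi_hat \<kappa> i) (psi_hat \<kappa> i') = (if i = i' then 1 else 0)"
    unfolding val using nz ij by (cases "(n, k) = (m, j)") (simp_all only: if_True if_False divide_self div_0 simp_thms prod.inject)
qed

text \<open>On the left, the factors of the flat transform, of the normalised Zernike function and
  of its chord integral; on the right, the singular value, the reciprocal norm of \<open>psi\<close>
  and the prefactor of \<open>psi\<close>. The dependence on the chord factor cancels because the
  square root of the scattering derivative is also proportional to 1/D.\<close>

lemma sing_val_constant:
  assumes D: "D > 0"
  shows "(1 + \<kappa>) / ((1 - \<kappa>) * D) * (sqrt ((1 - \<kappa>) / (1 + \<kappa>)) / zernike_norm \<kappa> n) / real (n + 1) =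
    sing_val \<kappa> (n, k) * (2 * sqrt (1 + \<kappa>)) * (1 / (4 * pi) * sqrt ((1 - \<kappa>\<^sup>2) / D\<^sup>2))"
proof -
  \<comment> \<open>With the square roots as independent quantities the identity becomes
    rational.\<close>
  define u v w t where "u = sqrt (1 - \<kappa>)" and "v = sqrt (1 + \<kappa>)" and "w = sqrt (real n + 1)" and "t = sqrt pi"
  have pos: "u > 0" "v > 0" "w > 0" "t > 0" using \<kappa> by (auto simp: u_def v_def w_def t_def)
  have sq: "1 - \<kappa> = u\<^sup>2" "1 + \<kappa> = v\<^sup>2" "real n + 1 = w\<^sup>2" "pi = t\<^sup>2"
    using \<kappa> by (simp_all add: u_def v_def w_def t_def)
  have q: "1 - \<kappa>\<^sup>2 = u\<^sup>2 * v\<^sup>2" unfolding sq[symmetric] by (simp add: power2_eq_square algebra_simps)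
  have s1: "sqrt ((1 - \<kappa>) / (1 + \<kappa>)) = u / v" by (simp add: real_sqrt_divide u_def v_def)
  have s2: "zernike_norm \<kappa> n = t / (u * v * w)"
  proof -
    have "pi / ((1 - \<kappa>\<^sup>2) * real (n + 1)) = (t / (u * v * w))\<^sup>2"
      unfolding q by (simp add: power_divide power_mult_distrib sq(3)[symmetric] sq(4)[symmetric] add.commute)
    then show ?thesis unfolding zernike_norm_def[OF \<kappa>] using pos by simp
  qed
  have s3: "sqrt ((1 - \<kappa>\<^sup>2) / D\<^sup>2) = u * v / D"
    unfolding q using pos D by (simp add: real_sqrt_divide real_sqrt_mult)
  have s4: "sing_val \<kappa> (n, k) = 1 / u * (2 * t / w)"
    by (simp add: sing_val_def u_def w_def t_def)
  have main: "v\<^sup>2 / (u\<^sup>2 * D) * (u / v / (t / (u * v * w))) / w\<^sup>2 = 1 / u * (2 * t / w) * (2 * v) * (1 / (4 * t\<^sup>2) * (u * v / D))"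
    using pos D by (simp add: power2_eq_square field_simps)
  have w': "real (n + 1) = w\<^sup>2" using sq(3) by simp
  show ?thesis unfolding s1 s2 s3 s4 v_def[symmetric] using main by (simp only: sq(1,2,4) w')
qed

text \<open>\<open>Z_hat\<close> flattens to a multiple of the Zernike polynomial on the closed
  disk, and chords stay there. The relation holds at every boundary point, since the functions are
  continuous.\<close>

lemma weighted_xray_Z_hat:
  assumes j: "j \<in> index_set" and p: "p \<in> fan_domain"
  shows "weighted_xray \<kappa> (Z_hat \<kappa> j) p = complex_of_real (sing_val \<kappa> j) * psi_hat \<kappa> j p"
proof -
  obtain n k where nk: "j = (n, k)" "k \<le> n" using j by (auto simp: index_set_def)
  let ?s = "scat_ext \<kappa> (snd p)" and ?m = "int n - 2 * int k" and ?D = "chord_factor \<kappa> (snd p)"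
  let ?c = "sqrt ((1 - \<kappa>) / (1 + \<kappa>)) / zernike_norm \<kappa> n"
  let ?K = "\<lambda>z. complex_of_real ?c * zernike n k z"
  have s: "\<bar>?s\<bar> \<le> pi / 2" using scat_ext_cos_nonneg(2)[OF \<kappa> p] by (auto simp: abs_le_iff)
  have zm: "Z_hat \<kappa> j \<in> borel_measurable (weighted_vol \<kappa>)"
    using Z_hat_orthonormal[OF \<kappa>] j by (simp add: L2_orthonormal_def L2_space_def)
  have fl: "flatten \<kappa> (Z_hat \<kappa> j) z = ?K z" if "cmod z \<le> 1" for z
    by (rule flatten_eq[OF \<kappa> that]) (simp only: nk(1) Z_hat_factor[OF \<kappa> nk(2)])
  have "(LINT r:{0..2 * cos ?s}|lborel. flatten \<kappa> (Z_hat \<kappa> j) (chord (fst p) ?s r)) = (LINT r:{0..2 * cos ?s}|lborel. ?K (chord (fst p) ?s r))"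
    by (rule set_lebesgue_integral_cong) (simp, intro allI impI fl norm_chord_le_1)
  also have "\<dots> = complex_of_real ?c * ((-1) ^ n / of_nat (n + 1) * cis (real_of_int ?m * (fst p + ?s)) * chord_fun n ?s)"
    unfolding set_integral_mult_right chord_integral_zernike[OF s nk(2)] ..
  finally have "weighted_xray \<kappa> (Z_hat \<kappa> j) p = complex_of_real ((1 + \<kappa>) / ((1 - \<kappa>) * ?D)) *
      (complex_of_real ?c * ((-1) ^ n / of_nat (n + 1) * cis (real_of_int ?m * (fst p + ?s)) * chord_fun n ?s))"
    unfolding weighted_xray_eq_flat_xray[OF \<kappa> zm p] flat_xray_def[OF \<kappa>] by (simp only:)
  also have "\<dots> = complex_of_real ((1 + \<kappa>) / ((1 - \<kappa>) * ?D) * ?c / real (n + 1)) * ((-1) ^ n * cis (real_of_int ?m * (fst p + ?s)) * chord_fun n ?s)"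
    by (simp only: of_real_mult of_real_divide of_real_of_nat_eq times_divide_eq_left times_divide_eq_right mult_ac)
  also have "\<dots> = complex_of_real (sing_val \<kappa> j) * (psi_ext n ?m p / complex_of_real (1 / (2 * sqrt (1 + \<kappa>))))"
    unfolding nk(1) sing_val_constant[OF chord_factor_pos[OF \<kappa>], of "snd p" n k] psi_ext_def
    by (simp add: mult_ac)
  also have "psi_ext n ?m p / complex_of_real (1 / (2 * sqrt (1 + \<kappa>))) = psi_hat \<kappa> j p"
    unfolding nk(1) psi_hat_def case_prod_conv L2_normalize_def psi_norm psi_eq_psi_ext[OF p] ..
  finally show ?thesis .
qed

lemma xray_singular_system:
  "singular_system (weighted_vol \<kappa>) (boundary_measure \<kappa>) (weighted_xray \<kappa>) index_set (Z_hat \<kappa>) (psi_hat \<kappa>) (sing_val \<kappa>)"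
proof
  show "L2_bounded_operator (weighted_vol \<kappa>) (boundary_measure \<kappa>) (weighted_xray \<kappa>)" by (rule weighted_xray_bounded_operator[OF \<kappa>])
  show "L2_orthonormal (weighted_vol \<kappa>) index_set (Z_hat \<kappa>)" by (rule Z_hat_orthonormal[OF \<kappa>])
  show "L2_dense_span (weighted_vol \<kappa>) index_set (Z_hat \<kappa>)" by (rule Z_hat_dense[OF \<kappa>])
  show "L2_orthonormal (boundary_measure \<kappa>) index_set (psi_hat \<kappa>)" by (rule psi_hat_orthonormal)
  show "sing_val \<kappa> j > 0" for j using \<kappa> by (cases j) (simp add: sing_val_def)
  show "AE p in boundary_measure \<kappa>. weighted_xray \<kappa> (Z_hat \<kappa> j) p = complex_of_real (sing_val \<kappa> j) * psi_hat \<kappa> j p" if "j \<in> index_set" for j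
    by (rule AE_I2) (simp only: space_boundary_measure weighted_xray_Z_hat[OF that])
qed

text \<open>The factorisation of \<open>f\<close> is known only on the closed disk, but the geodesic
  never leaves it before the exit time.\<close>

lemma I0_eq_weighted_xray:
  assumes f: "\<And>z. cmod z \<le> 1 \<Longrightarrow> f z = complex_of_real (weight \<kappa> z) * h z" and p: "p \<in> fan_domain"
  shows "I0 \<kappa> f p = weighted_xray \<kappa> h p"
proof -
  note \<alpha> = mem_fan_domain[OF p]
  obtain \<tau> Y where "0 \<le> \<tau>" "Y 0 = 0" "Y \<tau> = 2 * cos (snd p) / (1 - \<kappa>)"
    "\<And>t. t \<in> {0..\<tau>} \<Longrightarrow> (Y has_real_derivative 1 + \<kappa> * (Y t)\<^sup>2) (at t)"
    and nn: "\<And>t. t \<in> {0..\<tau>} \<Longrightarrow> 0 \<le> Y t" and le: "\<And>t. t \<in> {0..\<tau>} \<Longrightarrow> Y t \<le> 2 * cos (snd p) / (1 - \<kappa>)"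
    and pos: "\<And>t. t \<in> {0..\<tau>} \<Longrightarrow> 1 + \<kappa> * (Y t)\<^sup>2 > 0"
    and x: "\<And>f. xray \<kappa> f (fan_beam \<kappa> (fst p, snd p)) = (LINT t:{0..\<tau>}|lborel. f (moebius \<kappa> (fst p) (snd p) (Y t)))"
    by (rule xray_moebius[OF \<kappa> \<alpha>, where \<beta> = "fst p"]) blast
  have "cmod (moebius \<kappa> (fst p) (snd p) (Y t)) \<le> 1" if "t \<in> {0..\<tau>}" for t
    using norm_moebius_le_1_iff[OF \<kappa> cos_nonneg_pi_half[OF \<alpha>] nn[OF that] pos[OF that]] le[OF that] by simp
  then have "(LINT t:{0..\<tau>}|lborel. f (moebius \<kappa> (fst p) (snd p) (Y t))) =
     (LINT t:{0..\<tau>}|lborel. complex_of_real (weight \<kappa> (moebius \<kappa> (fst p) (snd p) (Y t))) * h (moebius \<kappa> (fst p) (snd p) (Y t)))"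
    by (intro set_lebesgue_integral_cong) (auto intro!: f)
  then show ?thesis
    unfolding weighted_xray_def[OF \<kappa>] I0_def using x[of f] x[of "\<lambda>z. complex_of_real (weight \<kappa> z) * h z"] by simp
qed

text \<open>The weight contained in \<open>f\<close> is moved into the measure; this is why
  coefficients taken with the unweighted volume are Fourier coefficients of \<open>h\<close> in the
  weighted space.\<close>

lemma coefficient_eq:
  assumes f: "\<And>z. cmod z \<le> 1 \<Longrightarrow> f z = complex_of_real (weight \<kappa> z) * h z"
    and h: "h \<in> L2_space (weighted_vol \<kappa>)" and j: "j \<in> index_set"
  shows "coefficient \<kappa> f j = L2_inner (weighted_vol \<kappa>) h (Z_hat \<kappa> j)"
proof -
  have m: "h \<in> borel_measurable (vol \<kappa>)" "Z_hat \<kappa> j \<in> borel_measurable (vol \<kappa>)"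
    using h Z_hat_orthonormal[OF \<kappa>] j
    by (simp_all add: L2_orthonormal_def L2_space_def measurable_vol measurable_weighted_vol)
  have w: "weight \<kappa> \<in> borel_measurable (vol \<kappa>)"
    unfolding measurable_vol by (rule borel_measurable_restrict) measurable
  have "L2_inner (weighted_vol \<kappa>) h (Z_hat \<kappa> j) = (\<integral>z. weight \<kappa> z *\<^sub>R (h z * cnj (Z_hat \<kappa> j z)) \<partial>vol \<kappa>)"
    unfolding L2_inner_def weighted_vol_def
  proof (rule integral_density)
    show "(\<lambda>z. h z * cnj (Z_hat \<kappa> j z)) \<in> borel_measurable (vol \<kappa>)"
      by (intro borel_measurable_times borel_measurable_cnj m)
    show "AE z in vol \<kappa>. 0 \<le> weight \<kappa> z"
      by (rule AE_I2) (use weight_pos[OF \<kappa>] in \<open>auto simp: less_imp_le\<close>)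
  qed (rule w)
  also have "\<dots> = coefficient \<kappa> f j"
    unfolding coefficient_def L2_inner_def
    by (intro Bochner_Integration.integral_cong refl) (simp add: f scaleR_conv_of_real)
  finally show ?thesis ..
qed

lemma AE_weighted_vol: "(AE z in weighted_vol \<kappa>. P z) \<longleftrightarrow> (AE z in vol \<kappa>. P z)"
proof -
  have w: "(\<lambda>z. ennreal (weight \<kappa> z)) \<in> borel_measurable (vol \<kappa>)"
    unfolding measurable_vol by (rule borel_measurable_restrict) measurable
  have wpos: "AE z in vol \<kappa>. 0 < ennreal (weight \<kappa> z)"
    by (rule AE_I2) (use weight_pos[OF \<kappa>] in auto)
  have "(AE z in weighted_vol \<kappa>. P z) \<longleftrightarrow> (AE z in vol \<kappa>. 0 < ennreal (weight \<kappa> z) \<longrightarrow> P z)"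
    unfolding weighted_vol_def by (rule AE_density[OF w])
  also have "\<dots> \<longleftrightarrow> (AE z in vol \<kappa>. P z)"
    using wpos by (auto elim: eventually_mono eventually_elim2)
  finally show ?thesis .
qed

end

theorem theorem2:
  fixes \<kappa> :: real
  assumes "-1 < \<kappa>" and "\<kappa> < 1"
  shows "(\<forall>f\<in>weighted_L2 \<kappa>.
            has_expansion \<kappa> f (coefficient \<kappa> f)
          \<and> (\<forall>c. has_expansion \<kappa> f c \<longrightarrow> (\<forall>j\<in>index_set. c j = coefficient \<kappa> f j))
          \<and> (\<lambda>j. (cmod (coefficient \<kappa> f j))\<^sup>2) summable_on index_set
          \<and> L2_has_sum (boundary_measure \<kappa>)
              (\<lambda>j p. complex_of_real (sing_val \<kappa> j) * coefficient \<kappa> f j * psi_hat \<kappa> j p)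
              index_set (I0 \<kappa> f))
       \<and> singular_value_decomposition (weighted_vol \<kappa>) (boundary_measure \<kappa>)
           (\<lambda>h. I0 \<kappa> (\<lambda>z. complex_of_real (weight \<kappa> z) * h z))
           index_set (Z_hat \<kappa>) (psi_hat \<kappa>) (sing_val \<kappa>)"
proof -
  note \<kappa> = assms
  interpret singular_system "weighted_vol \<kappa>" "boundary_measure \<kappa>" "weighted_xray \<kappa>" index_set "Z_hat \<kappa>" "psi_hat \<kappa>" "sing_val \<kappa>"
    by (rule xray_singular_system[OF \<kappa>])
  have weighted_xray: "weighted_xray \<kappa> = (\<lambda>h. I0 \<kappa> (\<lambda>z. complex_of_real (weight \<kappa> z) * h z))"
    by (rule ext) (rule weighted_xray_def[OF \<kappa>])
  show ?thesis
  proof (intro conjI ballI allI impI)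
    show "singular_value_decomposition (weighted_vol \<kappa>) (boundary_measure \<kappa>)
           (\<lambda>h. I0 \<kappa> (\<lambda>z. complex_of_real (weight \<kappa> z) * h z)) index_set (Z_hat \<kappa>) (psi_hat \<kappa>) (sing_val \<kappa>)"
      using svd unfolding weighted_xray .
  next
    fix f assume "f \<in> weighted_L2 \<kappa>"
    then obtain h where h: "h \<in> L2_space (weighted_vol \<kappa>)" and fh': "\<forall>z\<in>cball 0 1. f z = complex_of_real (weight \<kappa> z) * h z"
      unfolding weighted_L2_def by blast
    have fh: "f z = complex_of_real (weight \<kappa> z) * h z" if "cmod z \<le> 1" for z using fh' that by simp
    have co: "coefficient \<kappa> f j = L2_inner (weighted_vol \<kappa>) h (Z_hat \<kappa> j)" if "j \<in> index_set" for j
      by (rule coefficient_eq[OF \<kappa> fh h that])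
    \<comment> \<open>The coefficient formula \<open>co\<close> is available only on
      \<open>index_set\<close>, while the series mention functions of all indices.\<close>
    have sum_cong: "L2_has_sum M u index_set g" if "L2_has_sum M v index_set g" "\<And>j. j \<in> index_set \<Longrightarrow> u j = v j"
      for M :: "'z measure" and u v g
    proof -
      have "(\<Sum>j\<in>F. u j x) = (\<Sum>j\<in>F. v j x)" if "F \<subseteq> index_set" for F x
        using that \<open>\<And>j. j \<in> index_set \<Longrightarrow> u j = v j\<close> by (intro sum.cong) auto
      then have "\<forall>\<^sub>F F in finite_subsets_at_top index_set. L2_norm M (\<lambda>x. g x - (\<Sum>j\<in>F. v j x)) = L2_norm M (\<lambda>x. g x - (\<Sum>j\<in>F. u j x))"
        by (intro eventually_finite_subsets_at_top_weakI) simp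
      then show ?thesis
        using that unfolding L2_has_sum_def by (auto intro: Lim_transform_eventually)
    qed
    show "has_expansion \<kappa> f (coefficient \<kappa> f)"
      unfolding has_expansion_def
    proof (intro exI conjI)
      show "L2_has_sum (weighted_vol \<kappa>) (\<lambda>j z. coefficient \<kappa> f j * Z_hat \<kappa> j z) index_set h"
        by (rule sum_cong[OF orthonormal_expansion[OF on_x dense_x h]]) (simp only: co)
      show "AE z in vol \<kappa>. f z = complex_of_real (weight \<kappa> z) * h z"
        by (rule AE_I2) (use fh in simp)
    qed
    show "(\<lambda>j. (cmod (coefficient \<kappa> f j))\<^sup>2) summable_on index_set"
      using bessel_summable[OF on_x h] by (rule summable_on_cong[THEN iffD1, rotated]) (simp only: co)
    show "c j = coefficient \<kappa> f j" if c: "has_expansion \<kappa> f c" and j: "j \<in> index_set" for c j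
    proof -
      obtain g where g: "L2_has_sum (weighted_vol \<kappa>) (\<lambda>j z. c j * Z_hat \<kappa> j z) index_set g"
        and fg: "AE z in vol \<kappa>. f z = complex_of_real (weight \<kappa> z) * g z"
        using c unfolding has_expansion_def by blast
      have gL2: "g \<in> L2_space (weighted_vol \<kappa>)" using g by (simp add: L2_has_sum_def)
      \<comment> \<open>Dividing by the positive weight shows that any expansion of \<open>f\<close>
        represents the same \<open>h\<close>, so uniqueness reduces to that of Fourier
        coefficients.\<close>
      have "AE z in vol \<kappa>. cmod z \<le> 1" by (rule AE_I2) simp
      with fg have "AE z in vol \<kappa>. g z = h z"
      proof eventually_elim
        case (elim z)
        then show ?case using fh[OF elim(2)] weight_pos[OF \<kappa> elim(2)] by simp
      qed
      then have "AE z in weighted_vol \<kappa>. g z = h z" unfolding AE_weighted_vol[OF \<kappa>] .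
      then have "L2_inner (weighted_vol \<kappa>) g (Z_hat \<kappa> j) = L2_inner (weighted_vol \<kappa>) h (Z_hat \<kappa> j)"
        using gL2 h on_x j by (intro L2_inner_cong_AE) (simp_all add: L2_space_def L2_orthonormal_def)
      then show ?thesis
        using L2_has_sum_coeff_unique[OF on_x g j] co[OF j] by simp
    qed
    show "L2_has_sum (boundary_measure \<kappa>) (\<lambda>j p. complex_of_real (sing_val \<kappa> j) * coefficient \<kappa> f j * psi_hat \<kappa> j p) index_set (I0 \<kappa> f)"
    proof -
      have base: "L2_has_sum (boundary_measure \<kappa>) (\<lambda>j p. complex_of_real (sing_val \<kappa> j) * coefficient \<kappa> f j * psi_hat \<kappa> j p) index_set (weighted_xray \<kappa> h)"
        by (rule sum_cong[OF image_expansion[OF h]]) (simp only: co)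
      \<comment> \<open>Agreement is known only on the space of the boundary measure, so membership
        and norms are transferred there.\<close>
      have eq: "I0 \<kappa> f p = weighted_xray \<kappa> h p" if "p \<in> space (boundary_measure \<kappa>)" for p
        by (rule I0_eq_weighted_xray[OF \<kappa> fh]) (use that in simp_all)
      have mem: "I0 \<kappa> f \<in> L2_space (boundary_measure \<kappa>) \<longleftrightarrow> weighted_xray \<kappa> h \<in> L2_space (boundary_measure \<kappa>)"
      proof -
        have "I0 \<kappa> f \<in> borel_measurable (boundary_measure \<kappa>) \<longleftrightarrow> weighted_xray \<kappa> h \<in> borel_measurable (boundary_measure \<kappa>)"
          by (rule measurable_cong[OF eq])
        moreover have "integrable (boundary_measure \<kappa>) (\<lambda>p. (cmod (I0 \<kappa> f p))\<^sup>2) \<longleftrightarrow> integrable (boundary_measure \<kappa>) (\<lambda>p. (cmod (weighted_xray \<kappa> h p))\<^sup>2)"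
          by (rule Bochner_Integration.integrable_cong) (simp_all only: eq)
        ultimately show ?thesis unfolding L2_space_def by simp
      qed
      have nrm: "L2_norm (boundary_measure \<kappa>) (\<lambda>p. I0 \<kappa> f p - S p) = L2_norm (boundary_measure \<kappa>) (\<lambda>p. weighted_xray \<kappa> h p - S p)" for S
        unfolding L2_norm_def
        by (intro arg_cong[of _ _ sqrt] Bochner_Integration.integral_cong refl) (simp only: eq)
      show ?thesis unfolding L2_has_sum_def nrm mem using base[unfolded L2_has_sum_def] .
    qed
  qed
qed

end
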